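(* Let $(y,h,x)$ be a basis of $\mathfrak{sl}_2=\mathfrak{sl}_2(\mathbb{C})$ with $[h,y]=-2y$, $[h,x]=2x$, $[x,y]=h$. The Lie algebra $L(\mathfrak{sl}_2,\mathrm{f.d.})$ is isomorphic, as a Lie algebra (the gradings being disregarded), to $$L\Bigl(\mathbb{C}h,\ \operatorname{ad}\oplus\rho_{\mathfrak{h}}^{-},\ \mathbb{C}x\oplus\bigoplus_{i,j\in\mathbb{N}\cup\{0\}}\mathbb{C}e_{i,j}^-,\ \mathbb{C}y\oplus\bigoplus_{i,j\in\mathbb{N}\cup\{0\}}\mathbb{C}e_{i,j}^+,\ K_{\mathfrak{sl}_2}|_{\mathbb{C}h}\Bigr),$$ where the pairing between $\mathbb{C}x\oplus\bigoplus_{i,j}\mathbb{C}e_{i,j}^-$ and $\mathbb{C}y\oplus\bigoplus_{i,j}\mathbb{C}e_{i,j}^+$ is defined by $\langle x,e_{i,j}^+\rangle=\langle e_{i,j}^-,y\rangle=0$, $\langle x,y\rangle=4$, $\langle e_{i,j}^-,e_{k,l}^+\rangle=4\delta_{(i,j),(k,l)}$ for all $i,j,k,l\in\mathbb{N}\cup\{0\}$.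
   Context: Everything is over $\mathbb{C}$. A graded Lie algebra is $\bigoplus_{n\in\mathbb{Z}}V_n$ with $[V_n,V_m]\subset V_{n+m}$, assumed generated by its local part $V_{-1}\oplus V_0\oplus V_1$. It is minimal if for every graded Lie algebra $\bigoplus_n V_n'$, every isomorphism of local parts $V'_{-1}\oplus V'_0\oplus V'_1\to V_{-1}\oplus V_0\oplus V_1$ extends to an epimorphism $\bigoplus_n V'_n\to\bigoplus_n V_n$. Let $\mathfrak{g}$ be a Lie algebra with a non-degenerate invariant bilinear form $B$, $\rho:\mathfrak{g}\otimes V\to V$ a representation, and $(\varrho,\mathcal{V})$ a $\mathfrak{g}$-submodule of $\operatorname{Hom}(V,\mathbb{C})$. The pentad $(\mathfrak{g},\rho,V,\mathcal{V},B)$ is standard if the canonical pairing restricted to $V\times\mathcal{V}$ is non-degenerate and there is a linear map $\Phi_\rho:V\otimes\mathcal{V}\to\mathfrak{g}$ with $B(a,\Phi_\rho(v\otimes\phi))=\langle\rho(a\otimes v),\phi\rangle=-\langle v,\varrho(a\otimes\phi)\rangle$ for all $a\in\mathfrak{g},v\in V,\phi\in\mathcal{V}$. The associated Lie algebra $L(\mathfrak{g},\rho,V,\mathcal{V},B)=\bigoplus_n V_n$ is the (unique) minimal graded Lie algebra with $V_0=\mathfrak{g}$, $V_1=V$, $V_{-1}=\mathcal{V}$ (as $\mathfrak{g}$-modules) and $[v,\phi]=\Phi_\rho(v\otimes\phi)$ for $v\in V_1,\phi\in V_{-1}$. For $n\ge 0$ let $(n\Lambda_1,V(n+1))$ be the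 $(n+1)$-dimensional irreducible representation of $\mathfrak{sl}_2$. Let $(\rho_{\mathrm{f.d.}},U_{\mathrm{f.d.}})$ be the direct sum over all $n\ge 0$ of countably infinitely many copies of $n\Lambda_1$. Since each $n\Lambda_1$ is self-dual, $U_{\mathrm{f.d.}}$ is regarded as a submodule of $\operatorname{Hom}(U_{\mathrm{f.d.}},\mathbb{C})$ via the pairing $U_{\mathrm{f.d.}}\times U_{\mathrm{f.d.}}\to\mathbb{C}$ which is a non-degenerate invariant pairing on each irreducible copy and for which distinct copies are orthogonal. With $K_{\mathfrak{sl}_2}$ the Killing form, $(\mathfrak{sl}_2,\rho_{\mathrm{f.d.}},U_{\mathrm{f.d.}},U_{\mathrm{f.d.}},K_{\mathfrak{sl}_2})$ is a standard pentad, and $L(\mathfrak{sl}_2,\mathrm{f.d.})$ denotes the associated Lie algebra. The symbols $e_{i,j}^{\pm}$ ($i,j\in\mathbb{N}\cup\{0\}$) are formal basis vectors. With $\mathfrak{h}=\mathbb{C}h$, the representations $\rho_{\mathfrak{h}}^{\pm}$ of $\mathfrak{h}$ on $\bigoplus_{i,j}\mathbb{C}e_{i,j}^{\pm}$ are $\rho_{\mathfrak{h}}^{+}(h\otimes e_{i,j}^+)=ie_{i,j}^+$ and $\rho_{\mathfrak{h}}^{-}(h\otimes e_{i,j}^-)=-ie_{i,j}^-$; $h$ acts on $\mathbb{C}x$ and $\mathbb{C}y$ by the adjoint action in $\mathfrak{sl}_2$. Through the pairing in the claim, $\mathbb{C}y\oplus\bigoplus_{i,j}\mathbb{C}e_{i,j}^+$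 is regarded as a submodule of the dual of $\mathbb{C}x\oplus\bigoplus_{i,j}\mathbb{C}e_{i,j}^-$, and the displayed pentad is standard. *)

theory Defs
  imports "HOL-Analysis.Determinants" "HOL-Algebra.Algebraic_Closure_Type"
begin

no_notation fps_nth (infixl \<open>$\<close> 75)

text \<open>
  Vector spaces over the complex numbers are HOL-Algebra modules over \<open>CC\<close>; the fields \<open>mult\<close> and
  \<open>one\<close> of the module record play no role.
\<close>

abbreviation CC :: "complex ring" where
  "CC \<equiv> ring_of_type_algebra"

abbreviation vector_space_CC :: "(complex, 'a, 'm) module_scheme \<Rightarrow> bool" where
  "vector_space_CC V \<equiv> Module.module CC V"

definition scalar_space :: "(complex, complex) module" where
  "scalar_space =
     \<lparr>carrier = UNIV, mult = (*), one = 1, zero = 0, add = (+), module.smult = (*)\<rparr>"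

definition linear_maps ::
    "(complex, 'a, 'm) module_scheme \<Rightarrow> (complex, 'b, 'n) module_scheme \<Rightarrow> ('a \<Rightarrow> 'b) set" where
  "linear_maps V W = {f \<in> carrier V \<rightarrow> carrier W.
     (\<forall>u\<in>carrier V. \<forall>v\<in>carrier V. f (u \<oplus>\<^bsub>V\<^esub> v) = f u \<oplus>\<^bsub>W\<^esub> f v) \<and>
     (\<forall>c. \<forall>v\<in>carrier V. f (c \<odot>\<^bsub>V\<^esub> v) = c \<odot>\<^bsub>W\<^esub> f v)}"

definition linear_isos ::
    "(complex, 'a, 'm) module_scheme \<Rightarrow> (complex, 'b, 'n) module_scheme \<Rightarrow> ('a \<Rightarrow> 'b) set" where
  "linear_isos V W = {f \<in> linear_maps V W. bij_betw f (carrier V) (carrier W)}"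

definition bilinear_maps ::
    "(complex, 'a, 'm) module_scheme \<Rightarrow> (complex, 'b, 'n) module_scheme \<Rightarrow>
     (complex, 'c, 'k) module_scheme \<Rightarrow> ('a \<Rightarrow> 'b \<Rightarrow> 'c) set" where
  "bilinear_maps V W Z = {f.
     (\<forall>v\<in>carrier V. f v \<in> linear_maps W Z) \<and>
     (\<forall>w\<in>carrier W. (\<lambda>v. f v w) \<in> linear_maps V Z)}"

definition nondegenerate ::
    "(complex, 'a, 'm) module_scheme \<Rightarrow> (complex, 'b, 'n) module_scheme \<Rightarrow>
     ('a \<Rightarrow> 'b \<Rightarrow> complex) \<Rightarrow> bool" where
  "nondegenerate V W p \<longleftrightarrow>
     (\<forall>v\<in>carrier V. (\<forall>w\<in>carrier W. p v w = 0) \<longrightarrow> v = \<zero>\<^bsub>V\<^esub>) \<and>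
     (\<forall>w\<in>carrier W. (\<forall>v\<in>carrier V. p v w = 0) \<longrightarrow> w = \<zero>\<^bsub>W\<^esub>)"

definition is_direct_sum ::
    "(complex, 'a, 'm) module_scheme \<Rightarrow> ('i \<Rightarrow> 'a set) \<Rightarrow> bool" where
  "is_direct_sum V F \<longleftrightarrow>
     (\<forall>i. submodule (F i) CC V) \<and>
     (\<forall>v\<in>carrier V. \<exists>!f. (\<forall>i. f i \<in> F i) \<and> finite {i. f i \<noteq> \<zero>\<^bsub>V\<^esub>} \<and>
        v = (\<Oplus>\<^bsub>V\<^esub>i\<in>{i. f i \<noteq> \<zero>\<^bsub>V\<^esub>}. f i))"

definition is_basis ::
    "(complex, 'a, 'm) module_scheme \<Rightarrow> nat \<Rightarrow> (nat \<Rightarrow> 'a) \<Rightarrow> bool" where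
  "is_basis V n b \<longleftrightarrow>
     (\<forall>i<n. b i \<in> carrier V) \<and>
     (\<forall>v\<in>carrier V. \<exists>!c. c \<in> {..<n} \<rightarrow>\<^sub>E UNIV \<and> v = (\<Oplus>\<^bsub>V\<^esub>i\<in>{..<n}. c i \<odot>\<^bsub>V\<^esub> b i))"

definition has_dimension :: "(complex, 'a, 'm) module_scheme \<Rightarrow> nat \<Rightarrow> bool" where
  "has_dimension V n \<longleftrightarrow> (\<exists>b. is_basis V n b)"

definition endo_trace :: "(complex, 'a, 'm) module_scheme \<Rightarrow> ('a \<Rightarrow> 'a) \<Rightarrow> complex" where
  "endo_trace V f = (THE t. \<exists>n b M. is_basis V n b \<and>
     (\<forall>j<n. f (b j) = (\<Oplus>\<^bsub>V\<^esub>i\<in>{..<n}. M i j \<odot>\<^bsub>V\<^esub> b i)) \<and> t = (\<Sum>i<n. M i i))"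

definition direct_sum_space ::
    "(complex, 'a, 'm) module_scheme \<Rightarrow> (complex, 'b, 'n) module_scheme \<Rightarrow>
     (complex, 'a \<times> 'b) module" where
  "direct_sum_space V W =
     \<lparr>carrier = carrier V \<times> carrier W, mult = undefined, one = undefined,
      zero = (\<zero>\<^bsub>V\<^esub>, \<zero>\<^bsub>W\<^esub>),
      add = (\<lambda>(v, w) (v', w'). (v \<oplus>\<^bsub>V\<^esub> v', w \<oplus>\<^bsub>W\<^esub> w')),
      module.smult = (\<lambda>c (v, w). (c \<odot>\<^bsub>V\<^esub> v, c \<odot>\<^bsub>W\<^esub> w))\<rparr>"

definition direct_sum_action ::
    "('g \<Rightarrow> 'a \<Rightarrow> 'a) \<Rightarrow> ('g \<Rightarrow> 'b \<Rightarrow> 'b) \<Rightarrow> 'g \<Rightarrow> 'a \<times> 'b \<Rightarrow> 'a \<times> 'b" where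
  "direct_sum_action \<rho> \<sigma> a = (\<lambda>(v, w). (\<rho> a v, \<sigma> a w))"

text \<open>The space with formal basis vectors \<open>e_{i,j}\<close>, realised as finitely supported functions.\<close>

definition formal_space :: "(complex, nat \<times> nat \<Rightarrow> complex) module" where
  "formal_space =
     \<lparr>carrier = {f. finite {p. f p \<noteq> 0}}, mult = undefined, one = undefined,
      zero = (\<lambda>p. 0), add = (\<lambda>f g p. f p + g p), module.smult = (\<lambda>c f p. c * f p)\<rparr>"

definition formal_vec :: "nat \<Rightarrow> nat \<Rightarrow> nat \<times> nat \<Rightarrow> complex" where
  "formal_vec i j = (\<lambda>p. if p = (i, j) then 1 else 0)"


record 'a lie = "(complex, 'a) module" +
  bracket :: "'a \<Rightarrow> 'a \<Rightarrow> 'a"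

locale lie_algebra = Module.module CC L for L :: "'a lie" (structure) +
  assumes bracket_bilinear: "bracket L \<in> bilinear_maps L L L"
    and bracket_alternating: "a \<in> carrier L \<Longrightarrow> bracket L a a = \<zero>"
    and jacobi: "\<lbrakk>a \<in> carrier L; b \<in> carrier L; c \<in> carrier L\<rbrakk> \<Longrightarrow>
      bracket L a (bracket L b c) \<oplus> bracket L b (bracket L c a) \<oplus> bracket L c (bracket L a b) = \<zero>"

definition lie_subalgebra :: "'a set \<Rightarrow> 'a lie \<Rightarrow> bool" where
  "lie_subalgebra S L \<longleftrightarrow> submodule S CC L \<and> (\<forall>a\<in>S. \<forall>b\<in>S. bracket L a b \<in> S)"

definition lie_homs :: "'a lie \<Rightarrow> 'b lie \<Rightarrow> ('a \<Rightarrow> 'b) set" where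
  "lie_homs L M = {f \<in> linear_maps L M.
     \<forall>a\<in>carrier L. \<forall>b\<in>carrier L. f (bracket L a b) = bracket M (f a) (f b)}"

definition lie_epis :: "'a lie \<Rightarrow> 'b lie \<Rightarrow> ('a \<Rightarrow> 'b) set" where
  "lie_epis L M = {f \<in> lie_homs L M. f ` carrier L = carrier M}"

definition lie_isomorphic :: "'a lie \<Rightarrow> 'b lie \<Rightarrow> bool" where
  "lie_isomorphic L M \<longleftrightarrow> (\<exists>f\<in>lie_homs L M. bij_betw f (carrier L) (carrier M))"

definition killing_form :: "'a lie \<Rightarrow> 'a \<Rightarrow> 'a \<Rightarrow> complex" where
  "killing_form L a b = endo_trace L (\<lambda>z. bracket L a (bracket L b z))"

definition invariant_form :: "'a lie \<Rightarrow> ('a \<Rightarrow> 'a \<Rightarrow> complex) \<Rightarrow> bool" where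
  "invariant_form L B \<longleftrightarrow>
     (\<forall>a\<in>carrier L. \<forall>b\<in>carrier L. \<forall>c\<in>carrier L. B (bracket L a b) c = B a (bracket L b c))"

definition lie_representation ::
    "'g lie \<Rightarrow> (complex, 'v, 'm) module_scheme \<Rightarrow> ('g \<Rightarrow> 'v \<Rightarrow> 'v) \<Rightarrow> bool" where
  "lie_representation g V \<rho> \<longleftrightarrow>
     vector_space_CC V \<and> \<rho> \<in> bilinear_maps g V V \<and>
     (\<forall>a\<in>carrier g. \<forall>b\<in>carrier g. \<forall>v\<in>carrier V.
        \<rho> (bracket g a b) v = \<rho> a (\<rho> b v) \<ominus>\<^bsub>V\<^esub> \<rho> b (\<rho> a v))"

definition lie_submodule ::
    "'g lie \<Rightarrow> (complex, 'v, 'm) module_scheme \<Rightarrow> ('g \<Rightarrow> 'v \<Rightarrow> 'v) \<Rightarrow> 'v set \<Rightarrow> bool" where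
  "lie_submodule g V \<rho> W \<longleftrightarrow>
     submodule W CC V \<and> (\<forall>a\<in>carrier g. \<forall>w\<in>W. \<rho> a w \<in> W)"

definition irreducible_representation ::
    "'g lie \<Rightarrow> (complex, 'v, 'm) module_scheme \<Rightarrow> ('g \<Rightarrow> 'v \<Rightarrow> 'v) \<Rightarrow> bool" where
  "irreducible_representation g V \<rho> \<longleftrightarrow>
     lie_representation g V \<rho> \<and> carrier V \<noteq> {\<zero>\<^bsub>V\<^esub>} \<and>
     (\<forall>W. lie_submodule g V \<rho> W \<longrightarrow> W = {\<zero>\<^bsub>V\<^esub>} \<or> W = carrier V)"

text \<open>\<open>Hom(V, \<complex>)\<close>, with functionals made extensional on the carrier of \<open>V\<close>.\<close>

definition dual_space ::
    "(complex, 'v, 'm) module_scheme \<Rightarrow> (complex, 'v \<Rightarrow> complex) module" where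
  "dual_space V =
     \<lparr>carrier = linear_maps V scalar_space \<inter> extensional (carrier V),
      mult = undefined, one = undefined,
      zero = (\<lambda>v\<in>carrier V. 0),
      add = (\<lambda>\<phi> \<psi>. \<lambda>v\<in>carrier V. \<phi> v + \<psi> v),
      module.smult = (\<lambda>c \<phi>. \<lambda>v\<in>carrier V. c * \<phi> v)\<rparr>"

definition dual_action ::
    "(complex, 'v, 'm) module_scheme \<Rightarrow> ('g \<Rightarrow> 'v \<Rightarrow> 'v) \<Rightarrow> 'g \<Rightarrow> ('v \<Rightarrow> complex) \<Rightarrow> 'v \<Rightarrow> complex" where
  "dual_action V \<rho> a \<phi> = (\<lambda>v\<in>carrier V. - \<phi> (\<rho> a v))"

text \<open>The image of \<open>W\<close> in \<open>Hom(V, \<complex>)\<close> under a pairing \<open>p\<close> of \<open>V\<close> with \<open>W\<close>.\<close>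

definition dual_image ::
    "(complex, 'v, 'm) module_scheme \<Rightarrow> (complex, 'w, 'n) module_scheme \<Rightarrow>
     ('v \<Rightarrow> 'w \<Rightarrow> complex) \<Rightarrow> ('v \<Rightarrow> complex) set" where
  "dual_image V W p = (\<lambda>w. \<lambda>v\<in>carrier V. p v w) ` carrier W"


definition local_part :: "'a lie \<Rightarrow> (int \<Rightarrow> 'a set) \<Rightarrow> 'a set" where
  "local_part L G = {a \<oplus>\<^bsub>L\<^esub> b \<oplus>\<^bsub>L\<^esub> c | a b c. a \<in> G (-1) \<and> b \<in> G 0 \<and> c \<in> G 1}"

definition graded_lie_algebra :: "'a lie \<Rightarrow> (int \<Rightarrow> 'a set) \<Rightarrow> bool" where
  "graded_lie_algebra L G \<longleftrightarrow>
     lie_algebra L \<and> is_direct_sum L G \<and>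
     (\<forall>n m. \<forall>a\<in>G n. \<forall>b\<in>G m. bracket L a b \<in> G (n + m)) \<and>
     (\<forall>S. lie_subalgebra S L \<and> local_part L G \<subseteq> S \<longrightarrow> S = carrier L)"

definition local_isos ::
    "'a lie \<Rightarrow> (int \<Rightarrow> 'a set) \<Rightarrow> 'b lie \<Rightarrow> (int \<Rightarrow> 'b set) \<Rightarrow> ('a \<Rightarrow> 'b) set" where
  "local_isos L G M H = {f.
     f \<in> linear_isos (L\<lparr>carrier := local_part L G\<rparr>) (M\<lparr>carrier := local_part M H\<rparr>) \<and>
     (\<forall>i\<in>{-1, 0, 1}. f ` G i = H i) \<and>
     (\<forall>i\<in>{-1, 0, 1}. \<forall>j\<in>{-1, 0, 1}. i + j \<in> {-1, 0, 1} \<longrightarrow>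
        (\<forall>a\<in>G i. \<forall>b\<in>G j. f (bracket L a b) = bracket M (f a) (f b)))}"

text \<open>
  The test algebra \<open>L'\<close> may have any operations on any subset of the type \<open>'a\<close>. This is no
  restriction: as \<open>L'\<close> is generated by a copy of the local part of \<open>L\<close>, which is zero or has at
  least the cardinality of the continuum, its cardinality is at most that of the local part of \<open>L\<close>,
  so that \<open>L'\<close> is isomorphic to a Lie algebra carried by a subset of \<open>'a\<close>.
\<close>

definition minimal_graded_lie_algebra :: "'a lie \<Rightarrow> (int \<Rightarrow> 'a set) \<Rightarrow> bool" where
  "minimal_graded_lie_algebra L G \<longleftrightarrow>
     graded_lie_algebra L G \<and>
     (\<forall>(L' :: 'a lie) G' f. graded_lie_algebra L' G' \<and> f \<in> local_isos L' G' L G \<longrightarrow>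
        (\<exists>F\<in>lie_epis L' L. \<forall>a\<in>local_part L' G'. F a = f a))"


text \<open>\<open>\<Phi>\<close> as a bilinear map instead of a linear map on the tensor product.\<close>

definition is_Phi ::
    "'g lie \<Rightarrow> ('g \<Rightarrow> 'v \<Rightarrow> 'v) \<Rightarrow> (complex, 'v) module \<Rightarrow> ('v \<Rightarrow> complex) set \<Rightarrow>
     ('g \<Rightarrow> 'g \<Rightarrow> complex) \<Rightarrow> ('v \<Rightarrow> ('v \<Rightarrow> complex) \<Rightarrow> 'g) \<Rightarrow> bool" where
  "is_Phi g \<rho> V \<V> B \<Phi> \<longleftrightarrow>
     \<Phi> \<in> bilinear_maps V ((dual_space V)\<lparr>carrier := \<V>\<rparr>) g \<and>
     (\<forall>a\<in>carrier g. \<forall>v\<in>carrier V. \<forall>\<phi>\<in>\<V>.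
        B a (\<Phi> v \<phi>) = \<phi> (\<rho> a v) \<and> \<phi> (\<rho> a v) = - dual_action V \<rho> a \<phi> v)"

definition standard_pentad ::
    "'g lie \<Rightarrow> ('g \<Rightarrow> 'v \<Rightarrow> 'v) \<Rightarrow> (complex, 'v) module \<Rightarrow> ('v \<Rightarrow> complex) set \<Rightarrow>
     ('g \<Rightarrow> 'g \<Rightarrow> complex) \<Rightarrow> bool" where
  "standard_pentad g \<rho> V \<V> B \<longleftrightarrow>
     lie_algebra g \<and>
     B \<in> bilinear_maps g g scalar_space \<and> invariant_form g B \<and> nondegenerate g g B \<and>
     lie_representation g V \<rho> \<and>
     lie_submodule g (dual_space V) (dual_action V \<rho>) \<V> \<and>
     nondegenerate V ((dual_space V)\<lparr>carrier := \<V>\<rparr>) (\<lambda>v \<phi>. \<phi> v) \<and>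
     (\<exists>\<Phi>. is_Phi g \<rho> V \<V> B \<Phi>)"

text \<open>
  The algebra \<open>L(g, \<rho>, V, \<V>, B)\<close> is determined up to isomorphism only, and is therefore
  described by a predicate; the maps \<open>\<iota>0\<close>, \<open>\<iota>1\<close>, \<open>\<iota>m\<close> are the identifications of \<open>g\<close>, \<open>V\<close>, \<open>\<V>\<close> with
  the components of degree \<open>0\<close>, \<open>1\<close>, \<open>-1\<close>.
\<close>

definition associated_lie_algebra ::
    "'g lie \<Rightarrow> ('g \<Rightarrow> 'v \<Rightarrow> 'v) \<Rightarrow> (complex, 'v) module \<Rightarrow> ('v \<Rightarrow> complex) set \<Rightarrow>
     ('g \<Rightarrow> 'g \<Rightarrow> complex) \<Rightarrow> 'a lie \<Rightarrow> (int \<Rightarrow> 'a set) \<Rightarrow> bool" where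
  "associated_lie_algebra g \<rho> V \<V> B L G \<longleftrightarrow>
     minimal_graded_lie_algebra L G \<and>
     (\<exists>\<Phi> \<iota>0 \<iota>1 \<iota>m. is_Phi g \<rho> V \<V> B \<Phi> \<and>
        \<iota>0 \<in> linear_isos g (L\<lparr>carrier := G 0\<rparr>) \<and>
        \<iota>1 \<in> linear_isos V (L\<lparr>carrier := G 1\<rparr>) \<and>
        \<iota>m \<in> linear_isos ((dual_space V)\<lparr>carrier := \<V>\<rparr>) (L\<lparr>carrier := G (-1)\<rparr>) \<and>
        (\<forall>a\<in>carrier g. \<forall>b\<in>carrier g. bracket L (\<iota>0 a) (\<iota>0 b) = \<iota>0 (bracket g a b)) \<and>
        (\<forall>a\<in>carrier g. \<forall>v\<in>carrier V. bracket L (\<iota>0 a) (\<iota>1 v) = \<iota>1 (\<rho> a v)) \<and>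
        (\<forall>a\<in>carrier g. \<forall>\<phi>\<in>\<V>. bracket L (\<iota>0 a) (\<iota>m \<phi>) = \<iota>m (dual_action V \<rho> a \<phi>)) \<and>
        (\<forall>v\<in>carrier V. \<forall>\<phi>\<in>\<V>. bracket L (\<iota>1 v) (\<iota>m \<phi>) = \<iota>0 (\<Phi> v \<phi>)))"


definition sl2 :: "(complex^2^2) lie" where
  "sl2 = \<lparr>carrier = {A. trace A = 0}, mult = (**), one = mat 1, zero = 0, add = (+),
     module.smult = (\<lambda>c A. \<chi> i j. c * A $ i $ j), bracket = (\<lambda>A B. A ** B - B ** A)\<rparr>"

definition sl2_line :: "complex^2^2 \<Rightarrow> (complex^2^2) lie" where
  "sl2_line a = sl2\<lparr>carrier := range (\<lambda>c. c \<odot>\<^bsub>sl2\<^esub> a)\<rparr>"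

text \<open>
  \<open>U\<close> is the direct sum of submodules \<open>C (n, j)\<close>, \<open>n, j \<in> \<nat>\<close>, where \<open>C (n, j)\<close> is the
  \<open>j\<close>-th copy of the irreducible representation of dimension \<open>n + 1\<close>.
\<close>

definition fd_sum ::
    "(complex, 'u) module \<Rightarrow> (complex^2^2 \<Rightarrow> 'u \<Rightarrow> 'u) \<Rightarrow> (nat \<times> nat \<Rightarrow> 'u set) \<Rightarrow> bool" where
  "fd_sum U \<rho> C \<longleftrightarrow>
     lie_representation sl2 U \<rho> \<and> is_direct_sum U C \<and>
     (\<forall>n j. irreducible_representation sl2 (U\<lparr>carrier := C (n, j)\<rparr>) \<rho> \<and>
        has_dimension (U\<lparr>carrier := C (n, j)\<rparr>) (n + 1))"

definition fd_pairing ::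
    "(complex, 'u) module \<Rightarrow> (complex^2^2 \<Rightarrow> 'u \<Rightarrow> 'u) \<Rightarrow> (nat \<times> nat \<Rightarrow> 'u set) \<Rightarrow>
     ('u \<Rightarrow> 'u \<Rightarrow> complex) \<Rightarrow> bool" where
  "fd_pairing U \<rho> C p \<longleftrightarrow>
     p \<in> bilinear_maps U U scalar_space \<and>
     (\<forall>k. \<forall>a\<in>carrier sl2. \<forall>u\<in>C k. \<forall>w\<in>C k. p (\<rho> a u) w = - p u (\<rho> a w)) \<and>
     (\<forall>k. nondegenerate (U\<lparr>carrier := C k\<rparr>) (U\<lparr>carrier := C k\<rparr>) p) \<and>
     (\<forall>k l. k \<noteq> l \<longrightarrow> (\<forall>u\<in>C k. \<forall>w\<in>C l. p u w = 0))"

text \<open>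
  \<open>rho_minus h\<close> and \<open>rho_plus h\<close> are the actions of \<open>\<complex>h\<close> with \<open>h e_{i,j} = -i e_{i,j}\<close> and
  \<open>h e_{i,j} = i e_{i,j}\<close>.
\<close>

definition line_coord :: "complex^2^2 \<Rightarrow> complex^2^2 \<Rightarrow> complex" where
  "line_coord h a = (THE c. a = c \<odot>\<^bsub>sl2\<^esub> h)"

definition rho_minus ::
    "complex^2^2 \<Rightarrow> complex^2^2 \<Rightarrow> (nat \<times> nat \<Rightarrow> complex) \<Rightarrow> nat \<times> nat \<Rightarrow> complex" where
  "rho_minus h a f = (\<lambda>(i, j). line_coord h a * (- of_nat i * f (i, j)))"

definition rho_plus ::
    "complex^2^2 \<Rightarrow> complex^2^2 \<Rightarrow> (nat \<times> nat \<Rightarrow> complex) \<Rightarrow> nat \<times> nat \<Rightarrow> complex" where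
  "rho_plus h a f = (\<lambda>(i, j). line_coord h a * (of_nat i * f (i, j)))"

text \<open>\<open>line_formal_space x\<close> is \<open>\<complex>x \<oplus> \<Oplus>\<^sub>i\<^sub>,\<^sub>j \<complex>e_{i,j}\<close>, used for \<open>(x, e\<^sup>-)\<close> as well as for \<open>(y, e\<^sup>+)\<close>.\<close>

definition line_formal_space ::
    "complex^2^2 \<Rightarrow> (complex, (complex^2^2) \<times> (nat \<times> nat \<Rightarrow> complex)) module" where
  "line_formal_space a = direct_sum_space (sl2_line a) formal_space"

end

theory Submission
  imports Defs
begin

text \<open>
  A minimal graded Lie algebra has no nonzero graded ideal that meets its local part trivially, and
  every automorphism of its local part extends to it. Let \<open>S\<close> be the subalgebra of \<open>L\<^sub>1 \<times> L\<^sub>2\<close>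
  generated by the pairs \<open>(h, h)\<close>, \<open>(x, x)\<close>, \<open>(y, y)\<close>, \<open>(v, e\<^sup>-)\<close>, \<open>(w, e\<^sup>+)\<close>, where \<open>v\<close> runs through
  lowest weight vectors of the irreducible summands of \<open>U\<close> in degree \<open>1\<close>, and \<open>w\<close> through highest
  weight vectors of the summands of the dual in degree \<open>-1\<close>. Both projections of \<open>S\<close> are onto. Their
  kernels define ideals of \<open>L\<^sub>2\<close> and \<open>L\<^sub>1\<close>, which are graded because each of the two gradings is,
  on the other algebra, the eigenspace decomposition of an extended local automorphism. They meet
  the local parts trivially, hence vanish, and \<open>S\<close> is the graph of an isomorphism.
\<close>

section \<open>Complex vector spaces\<close>

text \<open>Minimality only gives maps between algebras with isomorphic local parts, while
  \<open>x\<close> and \<open>y\<close> have degree 0 on one side and degrees 1 and -1 on the other.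
  So no homomorphism between \<open>L\<^sub>1\<close> and \<open>L\<^sub>2\<close> is available in
  advance, and it is obtained through its graph. For the same reason gradedness is tested with
  automorphisms instead of degree derivations: they take the value \<open>2 ^ n\<close> in degree
  \<open>n\<close>, and different powers of 2 differ. The generators have to reproduce
  \<open>q\<close>: \<open>x\<close> kills highest and \<open>y\<close> kills lowest weight vectors,
  which mirrors the two zero conditions on \<open>q\<close>. The constant 4 is the Killing form of
  \<open>x\<close> and \<open>y\<close>; as \<open>h\<close> has Killing norm 8, the second pentad
  then gives \<open>h\<close> as the bracket of \<open>x\<close> and \<open>y\<close>. The delicate
  local case is a vector \<open>u\<close> of \<open>U\<close> with vanishing image: bracketing with
  the dual shows that \<open>sl2\<close> kills \<open>u\<close>, so \<open>u\<close> lies in the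
  trivial summands, where lowest weight vectors exhaust it and injectivity can be read off in
  \<open>L\<^sub>2\<close>.\<close>

lemma CC_simps [simp]:
  "carrier CC = UNIV" "a \<oplus>\<^bsub>CC\<^esub> b = a + b" "a \<otimes>\<^bsub>CC\<^esub> b = a * b" "\<zero>\<^bsub>CC\<^esub> = 0" "\<one>\<^bsub>CC\<^esub> = 1"
  by (simp_all add: ring_of_type_algebra_def)

lemma cring_CC: "cring CC"
  by (rule cring_from_type_algebra)

text \<open>As the scalars form a whole type, the carrier conditions on scalars in the library rules
  disappear; the restatements below are in a form fit for rewriting.\<close>

locale complex_space = Module.module CC V for V :: "(complex, 'a, 'm) module_scheme" (structure)
begin

lemma smult_in [simp, intro]: "v \<in> carrier V \<Longrightarrow> c \<odot> v \<in> carrier V"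
  using smult_closed by simp

lemma smult_add_left: "v \<in> carrier V \<Longrightarrow> (a + b) \<odot> v = a \<odot> v \<oplus> b \<odot> v"
  using smult_l_distr[of a b v] by simp

lemma smult_add_right:
  "u \<in> carrier V \<Longrightarrow> v \<in> carrier V \<Longrightarrow> a \<odot> (u \<oplus> v) = a \<odot> u \<oplus> a \<odot> v"
  using smult_r_distr[of a u v] by simp

lemma smult_smult [simp]: "v \<in> carrier V \<Longrightarrow> a \<odot> (b \<odot> v) = (a * b) \<odot> v"
  using smult_assoc1[of a b v] by simp

lemma smult_1 [simp]: "v \<in> carrier V \<Longrightarrow> 1 \<odot> v = v"
  using smult_one[of v] by simp

lemma smult_0_left [simp]: "v \<in> carrier V \<Longrightarrow> 0 \<odot> v = \<zero>"
  using smult_l_null[of v] by simp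

lemma smult_0_right [simp]: "a \<odot> \<zero> = \<zero>"
  using smult_r_null[of a] by simp

lemma add_in [simp, intro]: "u \<in> carrier V \<Longrightarrow> v \<in> carrier V \<Longrightarrow> u \<oplus> v \<in> carrier V"
  by (rule M.a_closed)

lemma uminus_eq_smult: "v \<in> carrier V \<Longrightarrow> \<ominus> v = (-1) \<odot> v"
proof -
  assume v: "v \<in> carrier V"
  have "(-1) \<odot> v \<oplus> v = \<zero>"
    using smult_add_left[of v "-1" 1] v by simp
  then show ?thesis using M.minus_equality[of "(-1) \<odot> v" v] v by simp
qed

lemma minus_eq_smult: "v \<in> carrier V \<Longrightarrow> u \<ominus> v = u \<oplus> (-1) \<odot> v"
  by (simp add: a_minus_def uminus_eq_smult)

lemma smult_eq_zero_iff: "v \<in> carrier V \<Longrightarrow> c \<odot> v = \<zero> \<longleftrightarrow> c = 0 \<or> v = \<zero>"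
  by (metis smult_smult smult_1 smult_0_left smult_0_right left_inverse)

lemma add_eq_zero_iff:
  "u \<in> carrier V \<Longrightarrow> v \<in> carrier V \<Longrightarrow> u \<oplus> v = \<zero> \<longleftrightarrow> u = (-1) \<odot> v"
  by (metis M.minus_equality M.r_neg M.a_comm M.minus_minus smult_in uminus_eq_smult)

lemma eq_iff_diff_zero:
  assumes "u \<in> carrier V" "v \<in> carrier V"
  shows "u = v \<longleftrightarrow> u \<oplus> (-1) \<odot> v = \<zero>"
  using add_eq_zero_iff[of u "(-1) \<odot> v"] assms by auto

lemma smult_collect [simp]:
  "v \<in> carrier V \<Longrightarrow> a \<odot> v \<oplus> b \<odot> v = (a + b) \<odot> v"
  "v \<in> carrier V \<Longrightarrow> v \<oplus> b \<odot> v = (1 + b) \<odot> v"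
  "v \<in> carrier V \<Longrightarrow> a \<odot> v \<oplus> v = (a + 1) \<odot> v"
  by (simp_all add: smult_add_left)

lemma submodule_CI:
  assumes "H \<subseteq> carrier V" "\<zero> \<in> H"
    "\<And>a b. a \<in> H \<Longrightarrow> b \<in> H \<Longrightarrow> a \<oplus> b \<in> H" "\<And>c a. a \<in> H \<Longrightarrow> c \<odot> a \<in> H"
  shows "submodule H CC V"
proof (rule submoduleI)
  show "\<ominus> a \<in> H" if "a \<in> H" for a
    using assms(4)[OF that, of "-1"] uminus_eq_smult[of a] assms(1) that by auto
qed (use assms in auto)

lemma submodule_CD:
  assumes "submodule H CC V"
  shows "\<And>a. a \<in> H \<Longrightarrow> a \<in> carrier V" "\<zero> \<in> H"
    "\<And>a b. a \<in> H \<Longrightarrow> b \<in> H \<Longrightarrow> a \<oplus> b \<in> H" "\<And>c a. a \<in> H \<Longrightarrow> c \<odot> a \<in> H"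
proof -
  show 1: "\<And>c a. a \<in> H \<Longrightarrow> c \<odot> a \<in> H" using submoduleE(4)[OF assms] by simp
  show 2: "\<And>a. a \<in> H \<Longrightarrow> a \<in> carrier V" using submoduleE(1)[OF assms] by auto
  obtain a where "a \<in> H" using submoduleE(2)[OF assms] by auto
  then show "\<zero> \<in> H" using 1[of a 0] 2[of a] by simp
  show "\<And>a b. a \<in> H \<Longrightarrow> b \<in> H \<Longrightarrow> a \<oplus> b \<in> H" using submoduleE(5)[OF assms] by simp
qed

lemma finsum_in_submodule:
  assumes "submodule H CC V" "\<And>i. i \<in> A \<Longrightarrow> f i \<in> H"
  shows "(\<Oplus>i\<in>A. f i) \<in> H"
proof (cases "finite A")
  case True
  then show ?thesis using assms(2)
  proof (induction A)
    case empty
    then show ?case using submodule_CD(2)[OF assms(1)] by simp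
  next
    case (insert i A)
    then show ?case using submodule_CD[OF assms(1)]
      by (subst M.finsum_insert) (auto simp: Pi_def)
  qed
next
  case False
  then show ?thesis using submodule_CD(2)[OF assms(1)] by (simp add: M.finsum_infinite)
qed

lemma finsum_superset:
  assumes "finite B" "A \<subseteq> B" "\<And>i. i \<in> B - A \<Longrightarrow> f i = \<zero>" "\<And>i. i \<in> A \<Longrightarrow> f i \<in> carrier V"
  shows "(\<Oplus>i\<in>A. f i) = (\<Oplus>i\<in>B. f i)"
proof (rule M.add.finprod_mono_neutral_cong_left)
  show "f \<in> B \<rightarrow> carrier V"
    using assms(3,4) by (metis DiffI M.zero_closed Pi_I)
qed (use assms in auto)

lemma complex_space_submodule:
  assumes "submodule H CC V" shows "complex_space (V\<lparr>carrier := H\<rparr>)"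
  unfolding complex_space_def
  using submodule.submodule_is_module[OF assms] module_axioms by simp

end

lemma complex_spaceI: "Module.module CC V \<Longrightarrow> complex_space V"
  by (simp add: complex_space_def)

lemma complex_space_intro:
  fixes V (structure)
  assumes "\<And>u v. u \<in> carrier V \<Longrightarrow> v \<in> carrier V \<Longrightarrow> u \<oplus> v \<in> carrier V"
    "\<zero> \<in> carrier V"
    "\<And>u v w. u \<in> carrier V \<Longrightarrow> v \<in> carrier V \<Longrightarrow> w \<in> carrier V \<Longrightarrow> (u \<oplus> v) \<oplus> w = u \<oplus> (v \<oplus> w)"
    "\<And>u v. u \<in> carrier V \<Longrightarrow> v \<in> carrier V \<Longrightarrow> u \<oplus> v = v \<oplus> u"
    "\<And>v. v \<in> carrier V \<Longrightarrow> \<zero> \<oplus> v = v"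
    "\<And>c v. v \<in> carrier V \<Longrightarrow> c \<odot> v \<in> carrier V"
    "\<And>v. v \<in> carrier V \<Longrightarrow> (-1) \<odot> v \<oplus> v = \<zero>"
    "\<And>a b v. v \<in> carrier V \<Longrightarrow> (a + b) \<odot> v = a \<odot> v \<oplus> b \<odot> v"
    "\<And>a u v. u \<in> carrier V \<Longrightarrow> v \<in> carrier V \<Longrightarrow> a \<odot> (u \<oplus> v) = a \<odot> u \<oplus> a \<odot> v"
    "\<And>a b v. v \<in> carrier V \<Longrightarrow> (a * b) \<odot> v = a \<odot> (b \<odot> v)"
    "\<And>v. v \<in> carrier V \<Longrightarrow> 1 \<odot> v = v"
  shows "complex_space V"
proof (rule complex_spaceI, rule moduleI)
  show "abelian_group V"
  proof (rule abelian_groupI)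
    show "\<exists>y\<in>carrier V. y \<oplus> v = \<zero>" if "v \<in> carrier V" for v
      using assms(6,7) that by blast
  qed (use assms in auto)
qed (use assms cring_CC in auto)

lemma complex_space_scalar: "complex_space scalar_space"
  by (rule complex_space_intro) (auto simp: scalar_space_def algebra_simps)

lemma scalar_space_simps [simp]:
  "carrier scalar_space = UNIV" "a \<oplus>\<^bsub>scalar_space\<^esub> b = a + b"
  "a \<odot>\<^bsub>scalar_space\<^esub> b = a * b" "\<zero>\<^bsub>scalar_space\<^esub> = 0"
  by (simp_all add: scalar_space_def)

lemma linear_mapsI:
  assumes "\<And>v. v \<in> carrier V \<Longrightarrow> f v \<in> carrier W"
    "\<And>u v. u \<in> carrier V \<Longrightarrow> v \<in> carrier V \<Longrightarrow> f (u \<oplus>\<^bsub>V\<^esub> v) = f u \<oplus>\<^bsub>W\<^esub> f v"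
    "\<And>c v. v \<in> carrier V \<Longrightarrow> f (c \<odot>\<^bsub>V\<^esub> v) = c \<odot>\<^bsub>W\<^esub> f v"
  shows "f \<in> linear_maps V W"
  using assms by (auto simp: linear_maps_def)

lemma linear_mapsD:
  assumes "f \<in> linear_maps V W"
  shows "\<And>v. v \<in> carrier V \<Longrightarrow> f v \<in> carrier W"
    "\<And>u v. u \<in> carrier V \<Longrightarrow> v \<in> carrier V \<Longrightarrow> f (u \<oplus>\<^bsub>V\<^esub> v) = f u \<oplus>\<^bsub>W\<^esub> f v"
    "\<And>c v. v \<in> carrier V \<Longrightarrow> f (c \<odot>\<^bsub>V\<^esub> v) = c \<odot>\<^bsub>W\<^esub> f v"
  using assms by (auto simp: linear_maps_def)

lemma linear_maps_zero:
  assumes "complex_space V" "complex_space W" "f \<in> linear_maps V W"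
  shows "f \<zero>\<^bsub>V\<^esub> = \<zero>\<^bsub>W\<^esub>"
proof -
  interpret V: complex_space V by fact
  interpret W: complex_space W by fact
  show ?thesis
    using linear_mapsD(3)[OF assms(3), of "\<zero>\<^bsub>V\<^esub>" 0] linear_mapsD(1)[OF assms(3), of "\<zero>\<^bsub>V\<^esub>"] by simp
qed

lemma linear_maps_comp:
  assumes "f \<in> linear_maps V W" "g \<in> linear_maps W Z"
  shows "(\<lambda>v. g (f v)) \<in> linear_maps V Z"
  using linear_mapsD[OF assms(1)] linear_mapsD[OF assms(2)] by (intro linear_mapsI) auto

lemma linear_maps_smult:
  assumes "complex_space W" "f \<in> linear_maps V W"
  shows "(\<lambda>v. c \<odot>\<^bsub>W\<^esub> f v) \<in> linear_maps V W"
proof -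
  interpret W: complex_space W by fact
  show ?thesis using linear_mapsD[OF assms(2)]
    by (intro linear_mapsI) (auto simp: W.smult_add_right mult.commute)
qed

lemma linear_maps_add:
  assumes "complex_space W" "f \<in> linear_maps V W" "g \<in> linear_maps V W"
  shows "(\<lambda>v. f v \<oplus>\<^bsub>W\<^esub> g v) \<in> linear_maps V W"
proof -
  interpret W: complex_space W by fact
  show ?thesis using linear_mapsD[OF assms(2)] linear_mapsD[OF assms(3)]
    by (intro linear_mapsI) (auto simp: W.smult_add_right W.M.a_ac)
qed

lemma linear_maps_finsum:
  assumes "complex_space V" "complex_space W" "f \<in> linear_maps V W"
    "finite A" "\<And>i. i \<in> A \<Longrightarrow> g i \<in> carrier V"
  shows "f (\<Oplus>\<^bsub>V\<^esub>i\<in>A. g i) = (\<Oplus>\<^bsub>W\<^esub>i\<in>A. f (g i))"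
proof -
  interpret V: complex_space V by fact
  interpret W: complex_space W by fact
  show ?thesis using assms(4,5)
  proof (induction A)
    case empty
    then show ?case using linear_maps_zero[OF assms(1-3)] by simp
  next
    case (insert i A)
    then show ?case using linear_mapsD[OF assms(3)]
      by (subst V.M.finsum_insert W.M.finsum_insert; (auto simp: Pi_def)?)+
  qed
qed

lemma finsum_scalar_space: "finite A \<Longrightarrow> (\<Oplus>\<^bsub>scalar_space\<^esub>i\<in>A. f i) = (\<Sum>i\<in>A. f i)"
proof (induction A rule: finite_induct)
  interpret complex_space scalar_space by (rule complex_space_scalar)
  case empty show ?case by simp
next
  interpret complex_space scalar_space by (rule complex_space_scalar)
  case (insert x F) then show ?case by (subst M.finsum_insert) auto
qed

lemma functional_finsum:
  assumes "complex_space V" "f \<in> linear_maps V scalar_space"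
    "finite A" "\<And>i. i \<in> A \<Longrightarrow> g i \<in> carrier V"
  shows "f (\<Oplus>\<^bsub>V\<^esub>i\<in>A. g i) = (\<Sum>i\<in>A. f (g i))"
  using linear_maps_finsum[OF assms(1) complex_space_scalar assms(2-4)] finsum_scalar_space[OF assms(3)]
  by simp

lemma submodule_equalizer:
  assumes "complex_space V" "complex_space W" "f \<in> linear_maps V W" "g \<in> linear_maps V W"
  shows "submodule {v \<in> carrier V. f v = g v} CC V"
proof -
  interpret V: complex_space V by fact
  show ?thesis
    using linear_mapsD[OF assms(3)] linear_mapsD[OF assms(4)]
      linear_maps_zero[OF assms(1-3)] linear_maps_zero[OF assms(1,2,4)]
    by (intro V.submodule_CI) auto
qed

lemma submodule_vimage:
  assumes "complex_space V" "complex_space W" "f \<in> linear_maps V W" "submodule H CC W"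
  shows "submodule {v \<in> carrier V. f v \<in> H} CC V"
proof -
  interpret V: complex_space V by fact
  interpret W: complex_space W by fact
  show ?thesis
    using linear_mapsD[OF assms(3)] linear_maps_zero[OF assms(1-3)] W.submodule_CD[OF assms(4)]
    by (intro V.submodule_CI) auto
qed

lemma submodule_image:
  assumes "complex_space V" "complex_space W" "f \<in> linear_maps V W"
  shows "submodule (f ` carrier V) CC W"
proof -
  interpret V: complex_space V by fact
  interpret W: complex_space W by fact
  note f = linear_mapsD[OF assms(3)]
  show ?thesis
  proof (rule W.submodule_CI)
    show "\<zero>\<^bsub>W\<^esub> \<in> f ` carrier V"
      using linear_maps_zero[OF assms] V.M.zero_closed by (metis image_eqI)
    show "a \<oplus>\<^bsub>W\<^esub> b \<in> f ` carrier V" if "a \<in> f ` carrier V" "b \<in> f ` carrier V" for a b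
      using that by (auto simp: f(2)[symmetric])
    show "c \<odot>\<^bsub>W\<^esub> a \<in> f ` carrier V" if "a \<in> f ` carrier V" for a c
      using that by (auto simp: f(3)[symmetric])
  qed (use f in auto)
qed

lemma bilinear_mapsD:
  assumes "f \<in> bilinear_maps V W Z"
  shows "\<And>v. v \<in> carrier V \<Longrightarrow> f v \<in> linear_maps W Z"
    "\<And>w. w \<in> carrier W \<Longrightarrow> (\<lambda>v. f v w) \<in> linear_maps V Z"
  using assms by (auto simp: bilinear_maps_def)

lemma linear_isosD:
  assumes "f \<in> linear_isos V W"
  shows "f \<in> linear_maps V W" "inj_on f (carrier V)" "f ` carrier V = carrier W"
  using assms by (auto simp: linear_isos_def bij_betw_def)


section \<open>Direct sum decompositions\<close>

text \<open>The projections are part of the data, so that the same facts apply to components chosen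
  by uniqueness, to explicit weight projections and to the projections of a quotient. That the
  summands exhaust \<open>V\<close> is stated through submodules because linear identities are later
  checked on summands.\<close>

locale decomposition = complex_space V for V :: "(complex, 'a, 'm) module_scheme" (structure) +
  fixes F :: "'i \<Rightarrow> 'a set" and pr :: "'i \<Rightarrow> 'a \<Rightarrow> 'a"
  assumes summand: "submodule (F i) CC V"
    and pr_linear: "pr i \<in> linear_maps V V"
    and pr_in: "v \<in> carrier V \<Longrightarrow> pr i v \<in> F i"
    and pr_same: "v \<in> F i \<Longrightarrow> pr i v = v"
    and pr_other: "v \<in> F i \<Longrightarrow> i \<noteq> j \<Longrightarrow> pr j v = \<zero>"
    and pr_finite: "v \<in> carrier V \<Longrightarrow> finite {i. pr i v \<noteq> \<zero>}"
    and span: "submodule Z CC V \<Longrightarrow> (\<And>i. F i \<subseteq> Z) \<Longrightarrow> carrier V \<subseteq> Z"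
begin

lemma summand_in: "v \<in> F i \<Longrightarrow> v \<in> carrier V"
  using submodule_CD(1)[OF summand] .

lemma pr_carrier [simp]: "v \<in> carrier V \<Longrightarrow> pr i v \<in> carrier V"
  using pr_in summand_in by blast

lemma pr_add: "u \<in> carrier V \<Longrightarrow> v \<in> carrier V \<Longrightarrow> pr i (u \<oplus> v) = pr i u \<oplus> pr i v"
  using linear_mapsD(2)[OF pr_linear] .

lemma pr_smult: "v \<in> carrier V \<Longrightarrow> pr i (c \<odot> v) = c \<odot> pr i v"
  using linear_mapsD(3)[OF pr_linear] .

lemma pr_zero [simp]: "pr i \<zero> = \<zero>"
  using pr_same[of \<zero> i] submodule_CD(2)[OF summand[of i]] by auto

lemma pr_eq: "v \<in> F i \<Longrightarrow> pr j v = (if i = j then v else \<zero>)"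
  using pr_same pr_other by auto

text \<open>A vector has finitely many nonzero components, so the images of its components have a
  finite sum. The maps \<open>g i\<close> live on all of \<open>V\<close>, which avoids restricted
  carriers; only their values on \<open>F i\<close> enter.\<close>

lemma linear_extension:
  fixes g :: "'i \<Rightarrow> 'a \<Rightarrow> 'b" and W :: "(complex, 'b, 'n) module_scheme"
  assumes W: "complex_space W" and g: "\<And>i. g i \<in> linear_maps V W"
  obtains \<sigma> where "\<sigma> \<in> linear_maps V W" "\<And>i v. v \<in> F i \<Longrightarrow> \<sigma> v = g i v"
proof
  interpret W: complex_space W by fact
  note gn [simp] = linear_mapsD[OF g] and g0 [simp] = linear_maps_zero[OF complex_space_axioms W g]
  define \<sigma> where "\<sigma> v = (\<Oplus>\<^bsub>W\<^esub>i\<in>{i. pr i v \<noteq> \<zero>}. g i (pr i v))" for v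
  \<comment> \<open>Enlarging the index set adds only zeros; this brings two vectors and their sum
    to one common finite index set.\<close>
  have ext: "\<sigma> v = (\<Oplus>\<^bsub>W\<^esub>i\<in>A. g i (pr i v))"
    if "v \<in> carrier V" "finite A" "{i. pr i v \<noteq> \<zero>} \<subseteq> A" for v A
    unfolding \<sigma>_def by (rule W.finsum_superset) (use that in auto)
  show "\<sigma> \<in> linear_maps V W"
  proof (rule linear_mapsI)
    show "\<sigma> v \<in> carrier W" if "v \<in> carrier V" for v
      unfolding \<sigma>_def using that by (intro W.M.finsum_closed) auto
    show "\<sigma> (u \<oplus> v) = \<sigma> u \<oplus>\<^bsub>W\<^esub> \<sigma> v" if uv: "u \<in> carrier V" "v \<in> carrier V" for u v
    proof -
      let ?A = "{i. pr i u \<noteq> \<zero>} \<union> {i. pr i v \<noteq> \<zero>}"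
      have fin: "finite ?A" using pr_finite uv by auto
      have "\<sigma> (u \<oplus> v) = (\<Oplus>\<^bsub>W\<^esub>i\<in>?A. g i (pr i (u \<oplus> v)))"
        by (rule ext) (use uv fin pr_add in auto)
      also have "\<dots> = (\<Oplus>\<^bsub>W\<^esub>i\<in>?A. g i (pr i u) \<oplus>\<^bsub>W\<^esub> g i (pr i v))"
        using uv by (intro W.M.finsum_cong') (auto simp: pr_add)
      also have "\<dots> = (\<Oplus>\<^bsub>W\<^esub>i\<in>?A. g i (pr i u)) \<oplus>\<^bsub>W\<^esub> (\<Oplus>\<^bsub>W\<^esub>i\<in>?A. g i (pr i v))"
        using uv by (intro W.M.finsum_addf) auto
      also have "\<dots> = \<sigma> u \<oplus>\<^bsub>W\<^esub> \<sigma> v"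
        using ext[of u ?A] ext[of v ?A] uv fin by auto
      finally show ?thesis .
    qed
    show "\<sigma> (c \<odot> v) = c \<odot>\<^bsub>W\<^esub> \<sigma> v" if v: "v \<in> carrier V" for c v
    proof -
      let ?A = "{i. pr i v \<noteq> \<zero>}"
      have "\<sigma> (c \<odot> v) = (\<Oplus>\<^bsub>W\<^esub>i\<in>?A. g i (pr i (c \<odot> v)))"
        by (rule ext) (use v pr_finite pr_smult in auto)
      also have "\<dots> = (\<Oplus>\<^bsub>W\<^esub>i\<in>?A. c \<odot>\<^bsub>W\<^esub> g i (pr i v))"
        using v by (intro W.M.finsum_cong') (auto simp: pr_smult)
      also have "\<dots> = c \<odot>\<^bsub>W\<^esub> \<sigma> v"
        unfolding \<sigma>_def using v pr_finite[of v]
        by (subst W.finsum_smult_ldistr) auto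
      finally show ?thesis .
    qed
  qed
  show "\<sigma> v = g i v" if "v \<in> F i" for i v
  proof -
    have "\<sigma> v = (\<Oplus>\<^bsub>W\<^esub>j\<in>{i}. g j (pr j v))"
      by (rule ext) (use that summand_in pr_eq in \<open>auto split: if_splits\<close>)
    then show ?thesis using that summand_in by (simp add: pr_same)
  qed
qed

lemma diagonal_operator:
  fixes l :: "'i \<Rightarrow> complex"
  obtains \<sigma> where "\<sigma> \<in> linear_maps V V" "\<And>i v. v \<in> F i \<Longrightarrow> \<sigma> v = l i \<odot> v"
proof (rule linear_extension[OF complex_space_axioms, of "\<lambda>i v. l i \<odot> v"])
  show "(\<lambda>v. l i \<odot> v) \<in> linear_maps V V" for i
    by (rule linear_mapsI) (auto simp: smult_add_right mult.commute)
qed (rule that)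

lemma linear_maps_eqI:
  assumes "complex_space W" "f \<in> linear_maps V W" "g \<in> linear_maps V W"
    "\<And>i v. v \<in> F i \<Longrightarrow> f v = g v" "v \<in> carrier V"
  shows "f v = g v"
  using span[OF submodule_equalizer[OF complex_space_axioms assms(1-3)]] assms(4,5) summand_in
  by blast

text \<open>The vectors that are the sum of their components form a submodule, and it contains every
  summand.\<close>

lemma finsum_pr:
  assumes "v \<in> carrier V" "finite A" "{i. pr i v \<noteq> \<zero>} \<subseteq> A"
  shows "(\<Oplus>i\<in>A. pr i v) = v"
proof -
  let ?Z = "{v \<in> carrier V. (\<Oplus>i\<in>{i. pr i v \<noteq> \<zero>}. pr i v) = v}"
  have ext: "(\<Oplus>i\<in>{i. pr i v \<noteq> \<zero>}. pr i v) = (\<Oplus>i\<in>A. pr i v)"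
    if "v \<in> carrier V" "finite A" "{i. pr i v \<noteq> \<zero>} \<subseteq> A" for v A
    by (rule finsum_superset) (use that in auto)
  have sub: "submodule ?Z CC V"
  proof (rule submodule_CI)
    fix a b assume ab: "a \<in> ?Z" "b \<in> ?Z"
    let ?A = "{i. pr i a \<noteq> \<zero>} \<union> {i. pr i b \<noteq> \<zero>}"
    have fin: "finite ?A" using pr_finite ab by auto
    have "(\<Oplus>i\<in>{i. pr i (a \<oplus> b) \<noteq> \<zero>}. pr i (a \<oplus> b)) = (\<Oplus>i\<in>?A. pr i (a \<oplus> b))"
      by (rule ext) (use ab fin pr_add in auto)
    also have "\<dots> = (\<Oplus>i\<in>?A. pr i a \<oplus> pr i b)"
      using ab by (intro M.finsum_cong') (auto simp: pr_add)
    also have "\<dots> = (\<Oplus>i\<in>?A. pr i a) \<oplus> (\<Oplus>i\<in>?A. pr i b)"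
      using ab by (intro M.finsum_addf) auto
    also have "\<dots> = a \<oplus> b"
      using ext[of a ?A] ext[of b ?A] ab fin by auto
    finally show "a \<oplus> b \<in> ?Z" using ab by auto
  next
    fix c a assume a: "a \<in> ?Z"
    let ?A = "{i. pr i a \<noteq> \<zero>}"
    have "(\<Oplus>i\<in>{i. pr i (c \<odot> a) \<noteq> \<zero>}. pr i (c \<odot> a)) = (\<Oplus>i\<in>?A. pr i (c \<odot> a))"
      by (rule ext) (use a pr_finite pr_smult in auto)
    also have "\<dots> = (\<Oplus>i\<in>?A. c \<odot> pr i a)"
      using a by (intro M.finsum_cong') (auto simp: pr_smult)
    also have "\<dots> = c \<odot> (\<Oplus>i\<in>?A. pr i a)"
      using a pr_finite[of a] by (subst finsum_smult_ldistr) auto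
    finally show "c \<odot> a \<in> ?Z" using a by auto
  qed auto
  have "F i \<subseteq> ?Z" for i
  proof
    fix v assume v: "v \<in> F i"
    have "(\<Oplus>j\<in>{j. pr j v \<noteq> \<zero>}. pr j v) = (\<Oplus>j\<in>{i}. pr j v)"
      by (rule ext) (use v summand_in pr_eq in \<open>auto split: if_splits\<close>)
    then show "v \<in> ?Z" using v summand_in by (simp add: pr_same)
  qed
  then have "carrier V \<subseteq> ?Z" using span[OF sub] by blast
  then show ?thesis using ext[OF assms] assms(1) by auto
qed

lemma in_submodule_if_pr_in:
  assumes "submodule Z CC V" "v \<in> carrier V" "\<And>i. pr i v \<in> Z"
  shows "v \<in> Z"
  using finsum_in_submodule[OF assms(1), of "{i. pr i v \<noteq> \<zero>}" "\<lambda>i. pr i v"] assms(3)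
    finsum_pr[OF assms(2) pr_finite[OF assms(2)]] by simp

lemma eq_zero_if_pr_zero:
  assumes "v \<in> carrier V" "\<And>i. pr i v = \<zero>"
  shows "v = \<zero>"
proof -
  have "submodule {\<zero>} CC V" by (rule submodule_CI) auto
  then show ?thesis using in_submodule_if_pr_in[of "{\<zero>}" v] assms by auto
qed

lemma pr_finsum:
  assumes A: "finite A" and c: "\<And>n. c n \<in> F n" "\<And>n. n \<notin> A \<Longrightarrow> c n = \<zero>"
  shows "pr m (\<Oplus>n\<in>A. c n) = c m"
proof -
  have cV: "c n \<in> carrier V" for n using c(1) summand_in by blast
  have "pr m (\<Oplus>n\<in>A. c n) = (\<Oplus>n\<in>A. pr m (c n))"
    using A cV by (intro linear_maps_finsum[OF complex_space_axioms complex_space_axioms pr_linear]) auto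
  \<comment> \<open>\<open>m\<close> may lie outside \<open>A\<close>, so the index set is enlarged
    by \<open>m\<close> before it is cut down to \<open>m\<close> alone.\<close>
  also have "\<dots> = (\<Oplus>n\<in>insert m A. pr m (c n))"
    by (rule finsum_superset) (use A cV c(2) in auto)
  also have "\<dots> = (\<Oplus>n\<in>{m}. pr m (c n))"
    by (rule finsum_superset[symmetric]) (use A cV pr_eq[OF c(1)] in auto)
  also have "\<dots> = c m" using cV pr_same[OF c(1)] by simp
  finally show ?thesis .
qed

lemma is_direct_sum: "is_direct_sum V F"
  unfolding is_direct_sum_def
proof (intro conjI allI ballI summand)
  fix v assume v: "v \<in> carrier V"
  show "\<exists>!f. (\<forall>i. f i \<in> F i) \<and> finite {i. f i \<noteq> \<zero>} \<and> v = (\<Oplus>i\<in>{i. f i \<noteq> \<zero>}. f i)"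
  proof (rule ex1I)
    show "(\<forall>i. pr i v \<in> F i) \<and> finite {i. pr i v \<noteq> \<zero>} \<and> v = (\<Oplus>i\<in>{i. pr i v \<noteq> \<zero>}. pr i v)"
      using v pr_in pr_finite finsum_pr[OF v pr_finite[OF v]] by simp
    fix f assume f: "(\<forall>i. f i \<in> F i) \<and> finite {i. f i \<noteq> \<zero>} \<and> v = (\<Oplus>i\<in>{i. f i \<noteq> \<zero>}. f i)"
    have "pr j v = f j" for j
    proof -
      have "pr j v = pr j (\<Oplus>i\<in>{i. f i \<noteq> \<zero>}. f i)" using f by simp
      also have "\<dots> = f j" by (rule pr_finsum) (use f in auto)
      finally show ?thesis .
    qed
    then show "f = (\<lambda>i. pr i v)" by auto
  qed
qed

end

definition component :: "(complex, 'a, 'm) module_scheme \<Rightarrow> ('i \<Rightarrow> 'a set) \<Rightarrow> 'i \<Rightarrow> 'a \<Rightarrow> 'a" where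
  "component V F i v = (THE f. (\<forall>i. f i \<in> F i) \<and> finite {i. f i \<noteq> \<zero>\<^bsub>V\<^esub>} \<and>
        v = (\<Oplus>\<^bsub>V\<^esub>i\<in>{i. f i \<noteq> \<zero>\<^bsub>V\<^esub>}. f i)) i"

text \<open>The converse of \<open>is_direct_sum\<close>. Uniqueness of the component family makes
  it linear: adding or scaling families gives a family for the sum or the multiple.\<close>

lemma decomposition_component:
  fixes V :: "(complex, 'a, 'm) module_scheme" and F :: "'i \<Rightarrow> 'a set"
  assumes "complex_space V" and ds: "is_direct_sum V F"
  shows "decomposition V F (component V F)"
proof -
  interpret complex_space V by fact
  define Q where "Q v f \<longleftrightarrow> (\<forall>i. f i \<in> F i) \<and> finite {i. f i \<noteq> \<zero>\<^bsub>V\<^esub>} \<and>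
        v = (\<Oplus>\<^bsub>V\<^esub>i\<in>{i. f i \<noteq> \<zero>\<^bsub>V\<^esub>}. f i)" for v and f :: "'i \<Rightarrow> 'a"
  have sub: "submodule (F i) CC V" for i using ds by (auto simp: is_direct_sum_def)
  note subD = submodule_CD[OF sub]
  have ex1: "\<exists>!f. Q v f" if "v \<in> carrier V" for v
    using ds that by (auto simp: is_direct_sum_def Q_def)
  have comp: "component V F i v = (THE f. Q v f) i" for i v
    by (simp add: component_def Q_def)
  have Qc: "Q v (\<lambda>i. component V F i v)" if "v \<in> carrier V" for v
    unfolding comp using theI'[OF ex1[OF that]] .
  have Qu: "component V F i v = f i" if "v \<in> carrier V" "Q v f" for v f i
    unfolding comp using ex1[OF that(1)] that(2) by (metis (mono_tags, lifting) the1_equality)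
  \<comment> \<open>\<open>Q\<close> sums over the exact support, which changes under addition;
    \<open>QI\<close> and \<open>QD\<close> allow any finite set that contains it.\<close>
  have QI: "Q v f" if f: "\<And>i. f i \<in> F i" and A: "finite A" "{i. f i \<noteq> \<zero>\<^bsub>V\<^esub>} \<subseteq> A"
    and v: "v = (\<Oplus>\<^bsub>V\<^esub>i\<in>A. f i)" for v f A
  proof -
    have "(\<Oplus>\<^bsub>V\<^esub>i\<in>{i. f i \<noteq> \<zero>\<^bsub>V\<^esub>}. f i) = (\<Oplus>\<^bsub>V\<^esub>i\<in>A. f i)"
      by (rule finsum_superset) (use f A subD(1) in auto)
    then show ?thesis unfolding Q_def using f A v by (auto intro: finite_subset)
  qed
  have QD: "v = (\<Oplus>\<^bsub>V\<^esub>i\<in>A. f i)" if "Q v f" "finite A" "{i. f i \<noteq> \<zero>\<^bsub>V\<^esub>} \<subseteq> A" for v f A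
  proof -
    have "(\<Oplus>\<^bsub>V\<^esub>i\<in>{i. f i \<noteq> \<zero>\<^bsub>V\<^esub>}. f i) = (\<Oplus>\<^bsub>V\<^esub>i\<in>A. f i)"
      by (rule finsum_superset) (use that subD(1) in \<open>auto simp: Q_def\<close>)
    then show ?thesis using that(1) by (auto simp: Q_def)
  qed
  have single: "component V F j v = (if i = j then v else \<zero>\<^bsub>V\<^esub>)" if v: "v \<in> F i" for i j v
  proof (rule Qu)
    show "Q v (\<lambda>j. if i = j then v else \<zero>\<^bsub>V\<^esub>)"
      by (rule QI[of _ "{i}"]) (use v subD in auto)
  qed (use v subD in auto)
  show ?thesis
  proof (intro decomposition.intro decomposition_axioms.intro complex_space_axioms)
    show "submodule (F i) CC V" for i by (rule sub)
    show in_F: "component V F i v \<in> F i" if "v \<in> carrier V" for i v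
      using Qc[OF that] by (simp add: Q_def)
    show "component V F i v = v" if "v \<in> F i" for i v using single[OF that] by simp
    show "component V F j v = \<zero>\<^bsub>V\<^esub>" if "v \<in> F i" "i \<noteq> j" for i j v using single[OF that(1)] that(2) by simp
    show fin: "finite {i. component V F i v \<noteq> \<zero>\<^bsub>V\<^esub>}" if "v \<in> carrier V" for v
      using Qc[OF that] by (simp add: Q_def)
    show "carrier V \<subseteq> Z" if "submodule Z CC V" "\<And>i. F i \<subseteq> Z" for Z
    proof
      fix v assume v: "v \<in> carrier V"
      have "(\<Oplus>\<^bsub>V\<^esub>i\<in>{i. component V F i v \<noteq> \<zero>\<^bsub>V\<^esub>}. component V F i v) \<in> Z"
        using that(2) in_F[OF v] by (intro finsum_in_submodule[OF that(1)]) auto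
      then show "v \<in> Z" using Qc[OF v] by (simp add: Q_def)
    qed
    show "component V F i \<in> linear_maps V V" for i
    proof (rule linear_mapsI)
      show "component V F i v \<in> carrier V" if "v \<in> carrier V" for v
        using in_F[OF that] subD(1) by blast
      fix u v assume uv: "u \<in> carrier V" "v \<in> carrier V"
      show "component V F i (u \<oplus>\<^bsub>V\<^esub> v) = component V F i u \<oplus>\<^bsub>V\<^esub> component V F i v"
      proof (rule Qu)
        let ?A = "{i. component V F i u \<noteq> \<zero>\<^bsub>V\<^esub>} \<union> {i. component V F i v \<noteq> \<zero>\<^bsub>V\<^esub>}"
        have fA: "finite ?A" using fin uv by auto
        have car: "component V F i u \<in> carrier V" "component V F i v \<in> carrier V" for i
          using in_F uv subD(1) by blast+
        show "Q (u \<oplus>\<^bsub>V\<^esub> v) (\<lambda>i. component V F i u \<oplus>\<^bsub>V\<^esub> component V F i v)"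
        proof (rule QI[OF _ fA])
          have "(\<Oplus>\<^bsub>V\<^esub>i\<in>?A. component V F i u \<oplus>\<^bsub>V\<^esub> component V F i v) =
             (\<Oplus>\<^bsub>V\<^esub>i\<in>?A. component V F i u) \<oplus>\<^bsub>V\<^esub> (\<Oplus>\<^bsub>V\<^esub>i\<in>?A. component V F i v)"
            using car by (intro M.finsum_addf) auto
          then show "u \<oplus>\<^bsub>V\<^esub> v = (\<Oplus>\<^bsub>V\<^esub>i\<in>?A. component V F i u \<oplus>\<^bsub>V\<^esub> component V F i v)"
            using QD[OF Qc[OF uv(1)] fA] QD[OF Qc[OF uv(2)] fA] by auto
        qed (use in_F uv subD in auto)
      qed (use uv in auto)
    next
      fix c v assume v: "v \<in> carrier V"
      show "component V F i (c \<odot>\<^bsub>V\<^esub> v) = c \<odot>\<^bsub>V\<^esub> component V F i v"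
      proof (rule Qu)
        let ?A = "{i. component V F i v \<noteq> \<zero>\<^bsub>V\<^esub>}"
        have car: "component V F i v \<in> carrier V" for i using in_F v subD(1) by blast
        show "Q (c \<odot>\<^bsub>V\<^esub> v) (\<lambda>i. c \<odot>\<^bsub>V\<^esub> component V F i v)"
        proof (rule QI[OF _ fin[OF v]])
          show "c \<odot>\<^bsub>V\<^esub> v = (\<Oplus>\<^bsub>V\<^esub>i\<in>?A. c \<odot>\<^bsub>V\<^esub> component V F i v)"
            using QD[OF Qc[OF v] fin[OF v]] fin[OF v] car
            by (subst finsum_smult_ldistr[symmetric]) auto
        qed (use in_F v subD in auto)
      qed (use v in auto)
    qed
  qed
qed

text \<open>Applying \<open>f - l k\<close> removes the term of \<open>k\<close> and scales every
  other term by a nonzero factor, so induction on the index set works. Besides bases, it serves to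
  show that kernels are graded.\<close>

lemma eigenvectors_independent:
  fixes l :: "'i \<Rightarrow> complex"
  assumes "complex_space V" "f \<in> linear_maps V V" "finite A" "inj_on l A"
    "\<And>i. i \<in> A \<Longrightarrow> v i \<in> carrier V" "\<And>i. i \<in> A \<Longrightarrow> f (v i) = l i \<odot>\<^bsub>V\<^esub> v i"
    "(\<Oplus>\<^bsub>V\<^esub>i\<in>A. v i) = \<zero>\<^bsub>V\<^esub>" "i \<in> A"
  shows "v i = \<zero>\<^bsub>V\<^esub>"
proof -
  interpret complex_space V by fact
  have "\<forall>i\<in>A. v i = \<zero>\<^bsub>V\<^esub>"
    using assms(3-7)
  proof (induction A arbitrary: v)
    case empty then show ?case by simp
  next
    case (insert k A)
    let ?w = "\<lambda>i. (l i - l k) \<odot>\<^bsub>V\<^esub> v i"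
    have vA: "v \<in> A \<rightarrow> carrier V" and vk: "v k \<in> carrier V" using insert by auto
    have sum0: "v k \<oplus>\<^bsub>V\<^esub> (\<Oplus>\<^bsub>V\<^esub>i\<in>A. v i) = \<zero>\<^bsub>V\<^esub>"
      using insert.prems(4) insert.hyps vA vk by simp
    have s_in: "(\<Oplus>\<^bsub>V\<^esub>i\<in>A. v i) \<in> carrier V" using vA by simp
    have "(\<Oplus>\<^bsub>V\<^esub>i\<in>A. ?w i) = (\<Oplus>\<^bsub>V\<^esub>i\<in>A. f (v i) \<oplus>\<^bsub>V\<^esub> (- l k) \<odot>\<^bsub>V\<^esub> v i)"
      using insert.prems by (intro M.finsum_cong') (auto simp: linear_mapsD(1)[OF assms(2)])
    also have "\<dots> = (\<Oplus>\<^bsub>V\<^esub>i\<in>A. f (v i)) \<oplus>\<^bsub>V\<^esub> (\<Oplus>\<^bsub>V\<^esub>i\<in>A. (- l k) \<odot>\<^bsub>V\<^esub> v i)"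
      using insert.prems by (intro M.finsum_addf) (auto simp: linear_mapsD(1)[OF assms(2)])
    also have "(\<Oplus>\<^bsub>V\<^esub>i\<in>A. (- l k) \<odot>\<^bsub>V\<^esub> v i) = (- l k) \<odot>\<^bsub>V\<^esub> (\<Oplus>\<^bsub>V\<^esub>i\<in>A. v i)"
      using insert vA by (subst finsum_smult_ldistr) auto
    also have "(\<Oplus>\<^bsub>V\<^esub>i\<in>A. f (v i)) = f (\<Oplus>\<^bsub>V\<^esub>i\<in>A. v i)"
      using insert by (intro linear_maps_finsum[OF assms(1,1,2), symmetric]) auto
    \<comment> \<open>The rest of the sum is the negative of \<open>v k\<close>, itself an
      eigenvector for \<open>l k\<close>, so \<open>f - l k\<close> annihilates it.\<close>
    also have "(\<Oplus>\<^bsub>V\<^esub>i\<in>A. v i) = (-1) \<odot>\<^bsub>V\<^esub> v k"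
      using sum0 add_eq_zero_iff[OF s_in vk] vk s_in by (simp add: M.a_comm)
    also have "f ((-1) \<odot>\<^bsub>V\<^esub> v k) \<oplus>\<^bsub>V\<^esub> (- l k) \<odot>\<^bsub>V\<^esub> ((-1) \<odot>\<^bsub>V\<^esub> v k) = \<zero>\<^bsub>V\<^esub>"
      using linear_mapsD(3)[OF assms(2) vk, of "-1"] insert.prems(3)[of k] vk by simp
    finally have "(\<Oplus>\<^bsub>V\<^esub>i\<in>A. ?w i) = \<zero>\<^bsub>V\<^esub>" .
    then have "\<forall>i\<in>A. ?w i = \<zero>\<^bsub>V\<^esub>"
      using insert.prems insert.hyps
      by (intro insert.IH) (auto simp: linear_mapsD(3)[OF assms(2)] mult.commute inj_on_def)
    then have vz: "v i = \<zero>\<^bsub>V\<^esub>" if "i \<in> A" for i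
      using that insert.prems(1,2) insert.hyps(2) smult_eq_zero_iff[of "v i" "l i - l k"]
      by (auto simp: inj_on_def)
    then have "(\<Oplus>\<^bsub>V\<^esub>i\<in>A. v i) = \<zero>\<^bsub>V\<^esub>"
      by (intro M.add.finprod_one_eqI) auto
    then have "v k = \<zero>\<^bsub>V\<^esub>" using sum0 vk by simp
    then show ?case using vz by auto
  qed
  then show ?thesis using assms(8) by auto
qed

section \<open>Bases, traces and eigenvectors\<close>

text \<open>Gaussian elimination: one equation eliminates one unknown, and induction runs over the
  equations.\<close>

lemma homogeneous_system_solution:
  fixes M :: "'i \<Rightarrow> 'j \<Rightarrow> complex"
  assumes "finite E" "finite J" "card E < card J"
  shows "\<exists>c. (\<exists>j\<in>J. c j \<noteq> 0) \<and> (\<forall>i\<in>E. (\<Sum>j\<in>J. M i j * c j) = 0)"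
  using assms
proof (induction E arbitrary: J M)
  case empty
  then obtain j where "j \<in> J" by fastforce
  then show ?case by (intro exI[of _ "\<lambda>_. 1"]) auto
next
  case (insert e E)
  show ?case
  proof (cases "\<forall>j\<in>J. M e j = 0")
    case True
    obtain c where c: "\<exists>j\<in>J. c j \<noteq> 0" "\<forall>i\<in>E. (\<Sum>j\<in>J. M i j * c j) = 0"
      using insert.IH[of J M] insert.hyps insert.prems by auto
    have "(\<Sum>j\<in>J. M e j * c j) = 0" using True by simp
    then show ?thesis using c by auto
  next
    case False
    then obtain k where k: "k \<in> J" "M e k \<noteq> 0" by auto
    \<comment> \<open>Row \<open>i\<close> after clearing its entry in column \<open>k\<close> with
      the help of row \<open>e\<close>.\<close>
    define M' where "M' i j = M i j - M i k * M e j / M e k" for i j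
    have "card E < card (J - {k})" using insert.hyps insert.prems k by simp
    then obtain c where c: "\<exists>j\<in>J - {k}. c j \<noteq> 0" "\<forall>i\<in>E. (\<Sum>j\<in>J - {k}. M' i j * c j) = 0"
      using insert.IH[of "J - {k}" M'] insert.prems by auto
    \<comment> \<open>The value at \<open>k\<close> is the one that solves equation \<open>e\<close>
      for the given other unknowns.\<close>
    define d where "d = c(k := - (\<Sum>j\<in>J - {k}. M e j * c j) / M e k)"
    have split: "(\<Sum>j\<in>J. M i j * d j) = M i k * d k + (\<Sum>j\<in>J - {k}. M i j * c j)" for i
      using insert.prems k by (subst sum.remove[of J k]) (auto simp: d_def intro!: sum.cong)
    have 1: "(\<Sum>j\<in>J. M e j * d j) = 0" unfolding split using k by (simp add: d_def)
    have "(\<Sum>j\<in>J. M i j * d j) = 0" if "i \<in> E" for i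
    proof -
      have "(\<Sum>j\<in>J - {k}. M' i j * c j) =
        (\<Sum>j\<in>J - {k}. M i j * c j) - M i k / M e k * (\<Sum>j\<in>J - {k}. M e j * c j)"
        unfolding sum_distrib_left sum_subtractf[symmetric]
        by (rule sum.cong) (auto simp: M'_def algebra_simps)
      then show ?thesis unfolding split using c that k by (simp add: d_def)
    qed
    then show ?thesis using c 1 by (intro exI[of _ d]) (auto simp: d_def)
  qed
qed

lemma basis_coordinates:
  assumes "complex_space V" "is_basis V n b"
  obtains \<xi> where "\<And>i. \<xi> i \<in> linear_maps V scalar_space"
    "\<And>v. v \<in> carrier V \<Longrightarrow> v = (\<Oplus>\<^bsub>V\<^esub>i\<in>{..<n}. \<xi> i v \<odot>\<^bsub>V\<^esub> b i)"
    "\<And>i j. i < n \<Longrightarrow> j < n \<Longrightarrow> \<xi> i (b j) = (if i = j then 1 else 0)"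
proof -
  interpret complex_space V by fact
  define Q where "Q v c \<longleftrightarrow> c \<in> {..<n} \<rightarrow>\<^sub>E UNIV \<and> v = (\<Oplus>\<^bsub>V\<^esub>i\<in>{..<n}. c i \<odot>\<^bsub>V\<^esub> b i)" for v c
  have b: "b i \<in> carrier V" if "i < n" for i using assms(2) that by (auto simp: is_basis_def)
  have ex1: "\<exists>!c. Q v c" if "v \<in> carrier V" for v
    using assms(2) that unfolding is_basis_def Q_def by blast
  \<comment> \<open>From \<open>n\<close> on, the unique coefficient function is
    \<open>undefined\<close>, which would spoil linearity; the zero functional takes its
    place.\<close>
  define \<xi> where "\<xi> i v = (if i < n then (THE c. Q v c) i else 0)" for i v
  have Qc: "Q v (THE c. Q v c)" if "v \<in> carrier V" for v
    using theI'[OF ex1[OF that]] .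
  have rep: "v = (\<Oplus>\<^bsub>V\<^esub>i\<in>{..<n}. \<xi> i v \<odot>\<^bsub>V\<^esub> b i)" if "v \<in> carrier V" for v
  proof -
    have "(\<Oplus>\<^bsub>V\<^esub>i\<in>{..<n}. \<xi> i v \<odot>\<^bsub>V\<^esub> b i) = (\<Oplus>\<^bsub>V\<^esub>i\<in>{..<n}. (THE c. Q v c) i \<odot>\<^bsub>V\<^esub> b i)"
      using b by (intro M.finsum_cong') (auto simp: \<xi>_def)
    then show ?thesis using Qc[OF that] by (simp add: Q_def)
  qed
  have uniq: "\<xi> i v = c i" if v: "v \<in> carrier V" and c: "v = (\<Oplus>\<^bsub>V\<^esub>i\<in>{..<n}. c i \<odot>\<^bsub>V\<^esub> b i)" and i: "i < n" for v c i
  proof -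
    have "(\<Oplus>\<^bsub>V\<^esub>i\<in>{..<n}. restrict c {..<n} i \<odot>\<^bsub>V\<^esub> b i) = (\<Oplus>\<^bsub>V\<^esub>i\<in>{..<n}. c i \<odot>\<^bsub>V\<^esub> b i)"
      using b by (intro M.finsum_cong') auto
    then have "Q v (restrict c {..<n})" using c by (auto simp: Q_def)
    then have "(THE c. Q v c) = restrict c {..<n}" using ex1[OF v] Qc[OF v] by blast
    then show ?thesis using i by (simp add: \<xi>_def)
  qed
  show ?thesis
  proof
    show "v = (\<Oplus>\<^bsub>V\<^esub>i\<in>{..<n}. \<xi> i v \<odot>\<^bsub>V\<^esub> b i)" if "v \<in> carrier V" for v by (rule rep[OF that])
    show "\<xi> i (b j) = (if i = j then 1 else 0)" if "i < n" "j < n" for i j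
    proof (rule uniq[of "b j" "\<lambda>i. if i = j then 1 else 0" i, OF b[OF that(2)] _ that(1)])
      have "(\<Oplus>\<^bsub>V\<^esub>i\<in>{j}. (if i = j then 1 else 0) \<odot>\<^bsub>V\<^esub> b i) =
         (\<Oplus>\<^bsub>V\<^esub>i\<in>{..<n}. (if i = j then 1 else 0) \<odot>\<^bsub>V\<^esub> b i)"
        by (rule finsum_superset) (use that b in auto)
      then show "b j = (\<Oplus>\<^bsub>V\<^esub>i\<in>{..<n}. (if i = j then 1 else 0) \<odot>\<^bsub>V\<^esub> b i)"
        using b that by simp
    qed
    show "\<xi> i \<in> linear_maps V scalar_space" for i
    proof (cases "i < n")
      case True
      show ?thesis
      proof (rule linear_mapsI)
        fix u v assume uv: "u \<in> carrier V" "v \<in> carrier V"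
        have "u \<oplus>\<^bsub>V\<^esub> v = (\<Oplus>\<^bsub>V\<^esub>i\<in>{..<n}. \<xi> i u \<odot>\<^bsub>V\<^esub> b i) \<oplus>\<^bsub>V\<^esub> (\<Oplus>\<^bsub>V\<^esub>i\<in>{..<n}. \<xi> i v \<odot>\<^bsub>V\<^esub> b i)"
          by (simp only: rep[OF uv(1), symmetric] rep[OF uv(2), symmetric])
        also have "\<dots> = (\<Oplus>\<^bsub>V\<^esub>i\<in>{..<n}. \<xi> i u \<odot>\<^bsub>V\<^esub> b i \<oplus>\<^bsub>V\<^esub> \<xi> i v \<odot>\<^bsub>V\<^esub> b i)"
          using b by (intro M.finsum_addf[symmetric]) auto
        also have "\<dots> = (\<Oplus>\<^bsub>V\<^esub>i\<in>{..<n}. (\<xi> i u + \<xi> i v) \<odot>\<^bsub>V\<^esub> b i)"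
          using b by (intro M.finsum_cong') auto
        finally have "u \<oplus>\<^bsub>V\<^esub> v = (\<Oplus>\<^bsub>V\<^esub>i\<in>{..<n}. (\<xi> i u + \<xi> i v) \<odot>\<^bsub>V\<^esub> b i)" .
        from uniq[OF _ this True] show "\<xi> i (u \<oplus>\<^bsub>V\<^esub> v) = \<xi> i u \<oplus>\<^bsub>scalar_space\<^esub> \<xi> i v"
          using uv by simp
      next
        fix c v assume v: "v \<in> carrier V"
        have "c \<odot>\<^bsub>V\<^esub> v = c \<odot>\<^bsub>V\<^esub> (\<Oplus>\<^bsub>V\<^esub>i\<in>{..<n}. \<xi> i v \<odot>\<^bsub>V\<^esub> b i)"
          by (simp only: rep[OF v, symmetric])
        also have "\<dots> = (\<Oplus>\<^bsub>V\<^esub>i\<in>{..<n}. c \<odot>\<^bsub>V\<^esub> (\<xi> i v \<odot>\<^bsub>V\<^esub> b i))"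
          using b by (subst finsum_smult_ldistr) auto
        also have "\<dots> = (\<Oplus>\<^bsub>V\<^esub>i\<in>{..<n}. (c * \<xi> i v) \<odot>\<^bsub>V\<^esub> b i)"
          using b by (intro M.finsum_cong') auto
        finally have "c \<odot>\<^bsub>V\<^esub> v = (\<Oplus>\<^bsub>V\<^esub>i\<in>{..<n}. (c * \<xi> i v) \<odot>\<^bsub>V\<^esub> b i)" .
        from uniq[OF _ this True] show "\<xi> i (c \<odot>\<^bsub>V\<^esub> v) = c \<odot>\<^bsub>scalar_space\<^esub> \<xi> i v"
          using v by simp
      qed auto
    next
      case False
      then show ?thesis by (intro linear_mapsI) (auto simp: \<xi>_def)
    qed
  qed
qed

text \<open>The coordinates of the \<open>m\<close> vectors give \<open>n\<close> homogeneous
  equations in \<open>m > n\<close> unknowns.\<close>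

lemma is_basis_nontrivial_relation:
  assumes "complex_space V" "is_basis V n b" "n < m" "\<And>j. j < m \<Longrightarrow> w j \<in> carrier V"
  obtains c where "\<exists>j<m. c j \<noteq> 0" "(\<Oplus>\<^bsub>V\<^esub>j\<in>{..<m}. c j \<odot>\<^bsub>V\<^esub> w j) = \<zero>\<^bsub>V\<^esub>"
proof -
  interpret complex_space V by fact
  obtain \<xi> where xi: "\<And>i. \<xi> i \<in> linear_maps V scalar_space"
    "\<And>v. v \<in> carrier V \<Longrightarrow> v = (\<Oplus>\<^bsub>V\<^esub>i\<in>{..<n}. \<xi> i v \<odot>\<^bsub>V\<^esub> b i)"
    using basis_coordinates[OF assms(1,2)] by metis
  obtain c where c: "\<exists>j\<in>{..<m}. c j \<noteq> 0" "\<forall>i\<in>{..<n}. (\<Sum>j<m. \<xi> i (w j) * c j) = 0"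
    using homogeneous_system_solution[of "{..<n}" "{..<m}" "\<lambda>i j. \<xi> i (w j)"] assms(3) by auto
  let ?s = "\<Oplus>\<^bsub>V\<^esub>j\<in>{..<m}. c j \<odot>\<^bsub>V\<^esub> w j"
  have s_in: "?s \<in> carrier V" using assms(4) by (intro M.finsum_closed) auto
  have b: "b i \<in> carrier V" if "i < n" for i using assms(2) that by (auto simp: is_basis_def)
  have "\<xi> i ?s = 0" if "i < n" for i
  proof -
    have "\<xi> i ?s = (\<Sum>j<m. \<xi> i (c j \<odot>\<^bsub>V\<^esub> w j))"
      using assms(4) by (intro functional_finsum[OF assms(1) xi(1)]) auto
    also have "\<dots> = (\<Sum>j<m. \<xi> i (w j) * c j)"
      using assms(4) by (intro sum.cong) (auto simp: linear_mapsD(3)[OF xi(1)])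
    finally show ?thesis using c that by simp
  qed
  then have "(\<Oplus>\<^bsub>V\<^esub>i\<in>{..<n}. \<xi> i ?s \<odot>\<^bsub>V\<^esub> b i) = \<zero>\<^bsub>V\<^esub>"
    using b by (intro M.add.finprod_one_eqI) auto
  then have "?s = \<zero>\<^bsub>V\<^esub>" using xi(2)[OF s_in] by (rule trans[rotated])
  then show ?thesis using that c(1) by blast
qed

lemma is_basis_independent:
  assumes "complex_space V" "is_basis V n b" "(\<Oplus>\<^bsub>V\<^esub>j\<in>{..<n}. c j \<odot>\<^bsub>V\<^esub> b j) = \<zero>\<^bsub>V\<^esub>" "i < n"
  shows "c i = 0"
proof -
  interpret complex_space V by fact
  obtain \<xi> where xi: "\<And>i. \<xi> i \<in> linear_maps V scalar_space"
    "\<And>i j. i < n \<Longrightarrow> j < n \<Longrightarrow> \<xi> i (b j) = (if i = j then 1 else 0)"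
    using basis_coordinates[OF assms(1,2)] by metis
  have b: "b i \<in> carrier V" if "i < n" for i using assms(2) that by (auto simp: is_basis_def)
  have "0 = \<xi> i (\<Oplus>\<^bsub>V\<^esub>j\<in>{..<n}. c j \<odot>\<^bsub>V\<^esub> b j)"
    using assms(3) linear_maps_zero[OF assms(1) complex_space_scalar xi(1)] by simp
  also have "\<dots> = (\<Sum>j<n. \<xi> i (c j \<odot>\<^bsub>V\<^esub> b j))"
    using b by (intro functional_finsum[OF assms(1) xi(1)]) auto
  also have "\<dots> = (\<Sum>j<n. if i = j then c j else 0)"
    using b assms(4) by (intro sum.cong) (auto simp: linear_mapsD(3)[OF xi(1)] xi(2))
  finally show ?thesis using assms(4) by simp
qed

lemma is_basis_card_le:
  assumes "complex_space V" "is_basis V n b" "is_basis V m b'"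
  shows "m \<le> n"
proof (rule ccontr)
  assume "\<not> m \<le> n"
  then obtain c where "\<exists>j<m. c j \<noteq> 0" "(\<Oplus>\<^bsub>V\<^esub>j\<in>{..<m}. c j \<odot>\<^bsub>V\<^esub> b' j) = \<zero>\<^bsub>V\<^esub>"
    using is_basis_nontrivial_relation[OF assms(1,2), of m b'] assms(3) by (auto simp: is_basis_def)
  then show False using is_basis_independent[OF assms(1,3)] by blast
qed

text \<open>\<open>endo_trace\<close> selects a number by quantifying over all bases, so it can be
  evaluated only once independence of the basis is shown.\<close>

lemma endo_trace_eq:
  assumes "complex_space V" "is_basis V n b" "f \<in> linear_maps V V"
    "\<And>i. \<xi> i \<in> linear_maps V scalar_space"
    "\<And>v. v \<in> carrier V \<Longrightarrow> v = (\<Oplus>\<^bsub>V\<^esub>i\<in>{..<n}. \<xi> i v \<odot>\<^bsub>V\<^esub> b i)"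
    "\<And>i j. i < n \<Longrightarrow> j < n \<Longrightarrow> \<xi> i (b j) = (if i = j then 1 else 0)"
  shows "endo_trace V f = (\<Sum>i<n. \<xi> i (f (b i)))"
  unfolding endo_trace_def
proof (rule the_equality)
  interpret complex_space V by fact
  note f = linear_mapsD[OF assms(3)]
  have b: "b i \<in> carrier V" if "i < n" for i using assms(2) that by (auto simp: is_basis_def)
  show "\<exists>k d M. is_basis V k d \<and> (\<forall>j<k. f (d j) = (\<Oplus>\<^bsub>V\<^esub>i\<in>{..<k}. M i j \<odot>\<^bsub>V\<^esub> d i)) \<and>
    (\<Sum>i<n. \<xi> i (f (b i))) = (\<Sum>i<k. M i i)" (is "\<exists>k d M. ?R k d M")
  proof -
    have "?R n b (\<lambda>i j. \<xi> i (f (b j)))"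
      using assms(2) assms(5)[OF f(1)[OF b]] by blast
    then show ?thesis by (intro exI[of _ n] exI[of _ b] exI[of _ "\<lambda>i j. \<xi> i (f (b j))"])
  qed
  fix t assume "\<exists>n b M. is_basis V n b \<and> (\<forall>j<n. f (b j) = (\<Oplus>\<^bsub>V\<^esub>i\<in>{..<n}. M i j \<odot>\<^bsub>V\<^esub> b i)) \<and>
    t = (\<Sum>i<n. M i i)"
  then obtain m c M where m: "is_basis V m c" "t = (\<Sum>i<m. M i i)"
    and M': "\<And>j. j < m \<Longrightarrow> f (c j) = (\<Oplus>\<^bsub>V\<^esub>i\<in>{..<m}. M i j \<odot>\<^bsub>V\<^esub> c i)" by blast
  obtain \<eta> where eta: "\<And>i. \<eta> i \<in> linear_maps V scalar_space"
    "\<And>v. v \<in> carrier V \<Longrightarrow> v = (\<Oplus>\<^bsub>V\<^esub>i\<in>{..<m}. \<eta> i v \<odot>\<^bsub>V\<^esub> c i)"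
    "\<And>i j. i < m \<Longrightarrow> j < m \<Longrightarrow> \<eta> i (c j) = (if i = j then 1 else 0)"
    by (rule basis_coordinates[OF assms(1) m(1)]) (rule that)
  have c: "c i \<in> carrier V" if "i < m" for i using m(1) that by (auto simp: is_basis_def)
  \<comment> \<open>Used with \<open>f\<close> and with the identity in place of \<open>g\<close>:
    both traces turn into the same double sum over the two bases.\<close>
  have expand: "\<phi> (g v) = (\<Sum>j<k. \<zeta> j v * \<phi> (g (d j)))"
    if "\<phi> \<in> linear_maps V scalar_space" "g \<in> linear_maps V V" "v \<in> carrier V"
      "\<And>j. j < k \<Longrightarrow> d j \<in> carrier V" "v = (\<Oplus>\<^bsub>V\<^esub>i\<in>{..<k}. \<zeta> i v \<odot>\<^bsub>V\<^esub> d i)"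
    for \<phi> g v k and d :: "nat \<Rightarrow> 'a" and \<zeta>
  proof -
    have l: "(\<lambda>v. \<phi> (g v)) \<in> linear_maps V scalar_space" by (rule linear_maps_comp[OF that(2,1)])
    have "\<phi> (g v) = \<phi> (g (\<Oplus>\<^bsub>V\<^esub>i\<in>{..<k}. \<zeta> i v \<odot>\<^bsub>V\<^esub> d i))"
      by (rule arg_cong[OF that(5), of "\<lambda>v. \<phi> (g v)"])
    also have "\<dots> = (\<Sum>j<k. \<phi> (g (\<zeta> j v \<odot>\<^bsub>V\<^esub> d j)))"
      using that(4) by (intro functional_finsum[OF assms(1) l]) auto
    also have "\<dots> = (\<Sum>j<k. \<zeta> j v * \<phi> (g (d j)))"
      using that(4) by (intro sum.cong) (auto simp: linear_mapsD(3)[OF l])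
    finally show ?thesis .
  qed
  have id: "(\<lambda>v. v) \<in> linear_maps V V" by (auto intro: linear_mapsI)
  have Mii: "M j j = \<eta> j (f (c j))" if "j < m" for j
  proof -
    have "\<eta> j (f (c j)) = (\<Sum>i<m. \<eta> j (M i j \<odot>\<^bsub>V\<^esub> c i))"
      unfolding M'[OF that] using c by (intro functional_finsum[OF assms(1) eta(1)]) auto
    also have "\<dots> = (\<Sum>i<m. if j = i then M i j else 0)"
      using c that by (intro sum.cong) (auto simp: linear_mapsD(3)[OF eta(1)] eta(3))
    finally show ?thesis using that by simp
  qed
  have "t = (\<Sum>j<m. \<eta> j (f (c j)))" using m(2) Mii by simp
  also have "\<dots> = (\<Sum>j<m. \<Sum>i<n. \<xi> i (c j) * \<eta> j (f (b i)))"
    using c b by (intro sum.cong refl expand[OF eta(1) assms(3) _ _ assms(5)]) auto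
  also have "\<dots> = (\<Sum>i<n. \<Sum>j<m. \<eta> j (f (b i)) * \<xi> i (c j))"
    by (subst sum.swap) (simp add: mult.commute)
  also have "\<dots> = (\<Sum>i<n. \<xi> i (f (b i)))"
    using f(1) b c by (intro sum.cong refl expand[OF assms(4) id _ _ eta(2), symmetric]) auto
  finally show "t = (\<Sum>i<n. \<xi> i (f (b i)))" .
qed

section \<open>Finite spans, bases and eigenvectors\<close>

definition finite_span :: "(complex, 'a, 'm) module_scheme \<Rightarrow> nat \<Rightarrow> (nat \<Rightarrow> 'a) \<Rightarrow> 'a set" where
  "finite_span V n w = {\<Oplus>\<^bsub>V\<^esub>i\<in>{..<n}. c i \<odot>\<^bsub>V\<^esub> w i | c. True}"

lemma finite_spanI: "v = (\<Oplus>\<^bsub>V\<^esub>i\<in>{..<n}. c i \<odot>\<^bsub>V\<^esub> w i) \<Longrightarrow> v \<in> finite_span V n w"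
  by (auto simp: finite_span_def)

context complex_space
begin

lemma finite_span_submodule:
  assumes w: "\<And>i. i < n \<Longrightarrow> w i \<in> carrier V"
  shows "submodule (finite_span V n w) CC V"
proof (rule submodule_CI)
  show "finite_span V n w \<subseteq> carrier V"
    using w by (auto simp: finite_span_def intro!: M.finsum_closed)
  have "(\<Oplus>i\<in>{..<n}. 0 \<odot> w i) = \<zero>" using w by (intro M.add.finprod_one_eqI) auto
  then show "\<zero> \<in> finite_span V n w" by (rule finite_spanI[OF sym])
  fix a b assume "a \<in> finite_span V n w" "b \<in> finite_span V n w"
  then obtain c d where ab: "a = (\<Oplus>i\<in>{..<n}. c i \<odot> w i)" "b = (\<Oplus>i\<in>{..<n}. d i \<odot> w i)"
    by (auto simp: finite_span_def)
  have "a \<oplus> b = (\<Oplus>i\<in>{..<n}. c i \<odot> w i \<oplus> d i \<odot> w i)"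
    unfolding ab using w by (intro M.finsum_addf[symmetric]) auto
  also have "\<dots> = (\<Oplus>i\<in>{..<n}. (c i + d i) \<odot> w i)"
    using w by (intro M.finsum_cong') auto
  finally show "a \<oplus> b \<in> finite_span V n w" by (auto simp: finite_span_def)
next
  fix k a assume "a \<in> finite_span V n w"
  then obtain c where a: "a = (\<Oplus>i\<in>{..<n}. c i \<odot> w i)" by (auto simp: finite_span_def)
  have "k \<odot> a = (\<Oplus>i\<in>{..<n}. k \<odot> (c i \<odot> w i))"
    unfolding a using w by (subst finsum_smult_ldistr) auto
  also have "\<dots> = (\<Oplus>i\<in>{..<n}. (k * c i) \<odot> w i)"
    using w by (intro M.finsum_cong') auto
  finally show "k \<odot> a \<in> finite_span V n w" by (auto simp: finite_span_def)
qed

lemma finite_span_base: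
  assumes w: "\<And>i. i < n \<Longrightarrow> w i \<in> carrier V" and j: "j < n"
  shows "w j \<in> finite_span V n w"
proof -
  have "(\<Oplus>i\<in>{j}. (if i = j then 1 else 0) \<odot> w i) = (\<Oplus>i\<in>{..<n}. (if i = j then 1 else 0) \<odot> w i)"
    by (rule finsum_superset) (use assms in auto)
  then have "w j = (\<Oplus>i\<in>{..<n}. (if i = j then 1 else 0) \<odot> w i)" using assms by simp
  then show ?thesis by (rule finite_spanI)
qed

lemma finite_span_least:
  assumes "submodule Z CC V" "\<And>i. i < n \<Longrightarrow> w i \<in> Z"
  shows "finite_span V n w \<subseteq> Z"
  using submodule_CD[OF assms(1)] assms(2)
  by (auto simp: finite_span_def intro!: finsum_in_submodule[OF assms(1)])

lemma finite_span_invariant: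
  assumes w: "\<And>i. i < n \<Longrightarrow> w i \<in> carrier V" and f: "f \<in> linear_maps V V"
    and fw: "\<And>i. i < n \<Longrightarrow> f (w i) \<in> finite_span V n w" and v: "v \<in> finite_span V n w"
  shows "f v \<in> finite_span V n w"
proof -
  have "submodule {v \<in> carrier V. f v \<in> finite_span V n w} CC V"
    by (rule submodule_vimage[OF complex_space_axioms complex_space_axioms f finite_span_submodule[OF w]])
  from finite_span_least[OF this, of n w] show ?thesis using v w fw by auto
qed

lemma is_basisI:
  assumes w: "\<And>i. i < n \<Longrightarrow> w i \<in> carrier V" and sp: "finite_span V n w = carrier V"
    and ind: "\<And>c i. (\<Oplus>i\<in>{..<n}. c i \<odot> w i) = \<zero> \<Longrightarrow> i < n \<Longrightarrow> c i = 0"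
  shows "is_basis V n w"
  unfolding is_basis_def
proof (intro conjI ballI allI impI)
  fix v assume "v \<in> carrier V"
  then obtain c where c: "v = (\<Oplus>i\<in>{..<n}. c i \<odot> w i)" using sp by (auto simp: finite_span_def)
  show "\<exists>!c. c \<in> {..<n} \<rightarrow>\<^sub>E UNIV \<and> v = (\<Oplus>i\<in>{..<n}. c i \<odot> w i)"
  proof (rule ex1I)
    have "(\<Oplus>i\<in>{..<n}. restrict c {..<n} i \<odot> w i) = (\<Oplus>i\<in>{..<n}. c i \<odot> w i)"
      using w by (intro M.finsum_cong') auto
    then show "restrict c {..<n} \<in> {..<n} \<rightarrow>\<^sub>E UNIV \<and> v = (\<Oplus>i\<in>{..<n}. restrict c {..<n} i \<odot> w i)"
      using c by auto
    fix d assume d: "d \<in> {..<n} \<rightarrow>\<^sub>E UNIV \<and> v = (\<Oplus>i\<in>{..<n}. d i \<odot> w i)"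
    have "(\<Oplus>i\<in>{..<n}. (d i - c i) \<odot> w i) = (\<Oplus>i\<in>{..<n}. d i \<odot> w i \<oplus> (-1) \<odot> (c i \<odot> w i))"
      using w by (intro M.finsum_cong') auto
    also have "\<dots> = (\<Oplus>i\<in>{..<n}. d i \<odot> w i) \<oplus> (\<Oplus>i\<in>{..<n}. (-1) \<odot> (c i \<odot> w i))"
      using w by (intro M.finsum_addf) auto
    also have "(\<Oplus>i\<in>{..<n}. (-1) \<odot> (c i \<odot> w i)) = (-1) \<odot> (\<Oplus>i\<in>{..<n}. c i \<odot> w i)"
      using w by (subst finsum_smult_ldistr) auto
    also have "(\<Oplus>i\<in>{..<n}. d i \<odot> w i) \<oplus> (-1) \<odot> (\<Oplus>i\<in>{..<n}. c i \<odot> w i) = \<zero>"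
      using d c \<open>v \<in> carrier V\<close> by auto
    finally have "d i = c i" if "i < n" for i using ind[of "\<lambda>i. d i - c i" i] that by simp
    then show "d = restrict c {..<n}" using d by (auto simp: fun_eq_iff PiE_def extensional_def)
  qed
qed (use w in auto)

text \<open>The polynomial \<open>q\<close> in \<open>f\<close> annihilates \<open>v\<close>.
  Splitting off a root \<open>l\<close> leaves a factor \<open>r\<close>: either \<open>r\<close> in
  \<open>f\<close> sends \<open>v\<close> to an eigenvector for \<open>l\<close>, or
  \<open>r\<close> annihilates \<open>v\<close> and has smaller degree.\<close>

lemma poly_eigenvector:
  assumes f: "f \<in> linear_maps V V" and "q \<noteq> 0" "Polynomial.degree q \<le> m" "v \<in> carrier V" "v \<noteq> \<zero>"
    "(\<Oplus>i\<in>{..m}. Polynomial.coeff q i \<odot> (f ^^ i) v) = \<zero>"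
  shows "\<exists>w l. w \<in> carrier V \<and> w \<noteq> \<zero> \<and> f w = l \<odot> w"
  using assms(2-)
proof (induction m arbitrary: q)
  case 0
  then have "Polynomial.coeff q 0 \<odot> v = \<zero>" by simp
  moreover have "Polynomial.coeff q 0 \<noteq> 0" using 0 by (metis degree_eq_zeroE le_zero_eq pCons_0_0 coeff_pCons_0)
  ultimately show ?case using 0 smult_eq_zero_iff by blast
next
  case (Suc m)
  have fi: "(f ^^ i) v \<in> carrier V" for i
    by (induction i) (use Suc.prems linear_mapsD(1)[OF f] in auto)
  show ?case
  proof (cases "Polynomial.degree q \<le> m")
    case True
    then have "Polynomial.coeff q (Suc m) = 0" by (simp add: coeff_eq_0)
    then have "(\<Oplus>i\<in>{..m}. Polynomial.coeff q i \<odot> (f ^^ i) v) = \<zero>"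
      using Suc.prems(5) fi linear_mapsD(1)[OF f] by (simp add: Pi_def del: funpow.simps)
    then show ?thesis using Suc True by blast
  next
    case False
    then have "\<not> constant (poly q)" by (simp add: constant_degree)
    then obtain l where "poly q l = 0" using fundamental_theorem_of_algebra by blast
    then obtain r where r: "q = [:- l, 1:] * r" using poly_eq_0_iff_dvd by (metis dvdE)
    have r0: "r \<noteq> 0" using r Suc.prems by auto
    then have dr: "Polynomial.degree r \<le> m"
      using r Suc.prems(2) by (simp add: degree_mult_eq del: mult_pCons_left)
    let ?w = "\<Oplus>i\<in>{..m}. Polynomial.coeff r i \<odot> (f ^^ i) v"
    have w_in: "?w \<in> carrier V" using fi by (intro M.finsum_closed) auto
    have q: "Polynomial.coeff q i = Polynomial.coeff (pCons 0 r) i + (- l) * Polynomial.coeff r i" for i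
      using r by simp
    \<comment> \<open>The coefficients of \<open>[:- l, 1:] * r\<close> are those of
      \<open>r\<close> shifted by one minus \<open>l\<close> times those of \<open>r\<close>; the
      shifted part sums to \<open>f ?w\<close>.\<close>
    have "\<zero> = (\<Oplus>i\<in>{..Suc m}. Polynomial.coeff (pCons 0 r) i \<odot> (f ^^ i) v \<oplus> (- l) \<odot> (Polynomial.coeff r i \<odot> (f ^^ i) v))"
      unfolding Suc.prems(5)[symmetric] using fi
      by (intro M.finsum_cong') (auto simp: q simp del: funpow.simps)
    also have "\<dots> = (\<Oplus>i\<in>{..Suc m}. Polynomial.coeff (pCons 0 r) i \<odot> (f ^^ i) v) \<oplus>
        (\<Oplus>i\<in>{..Suc m}. (- l) \<odot> (Polynomial.coeff r i \<odot> (f ^^ i) v))"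
      using fi by (intro M.finsum_addf) (auto simp del: funpow.simps)
    also have "(\<Oplus>i\<in>{..Suc m}. Polynomial.coeff (pCons 0 r) i \<odot> (f ^^ i) v) =
       (\<Oplus>i\<in>{..m}. Polynomial.coeff r i \<odot> (f ^^ Suc i) v)"
      using fi Suc.prems by (subst M.finsum_Suc2) (auto simp: Pi_def simp del: funpow.simps intro!: M.finsum_closed)
    also have "\<dots> = (\<Oplus>i\<in>{..m}. f (Polynomial.coeff r i \<odot> (f ^^ i) v))"
      using fi linear_mapsD[OF f] by (intro M.finsum_cong') auto
    also have "\<dots> = f ?w"
      using fi by (intro linear_maps_finsum[OF complex_space_axioms complex_space_axioms f, symmetric]) auto
    also have "(\<Oplus>i\<in>{..Suc m}. (- l) \<odot> (Polynomial.coeff r i \<odot> (f ^^ i) v)) =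
        (\<Oplus>i\<in>{..m}. (- l) \<odot> (Polynomial.coeff r i \<odot> (f ^^ i) v))"
    proof (rule finsum_superset[symmetric])
      show "(- l) \<odot> (Polynomial.coeff r i \<odot> (f ^^ i) v) = \<zero>" if "i \<in> {..Suc m} - {..m}" for i
        using that dr fi[of i] by (simp add: coeff_eq_0)
    qed (use fi in auto)
    also have "\<dots> = (- l) \<odot> ?w"
      using fi by (subst finsum_smult_ldistr) auto
    finally have "f ?w \<oplus> (- l) \<odot> ?w = \<zero>" by simp
    then have fw: "f ?w = l \<odot> ?w"
      using add_eq_zero_iff[of "f ?w" "(- l) \<odot> ?w"] w_in linear_mapsD(1)[OF f w_in] by simp
    show ?thesis
    proof (cases "?w = \<zero>")
      case True
      then show ?thesis using Suc.IH[OF r0 dr] Suc.prems by blast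
    qed (use fw w_in in blast)
  qed
qed

text \<open>In dimension \<open>n\<close> the \<open>n + 1\<close> vectors \<open>v\<close>,
  \<open>f v\<close>, ... are dependent, and a relation is a nonzero polynomial in \<open>f\<close>
  that annihilates \<open>v\<close>.\<close>

lemma eigenvector_exists:
  assumes f: "f \<in> linear_maps V V" and b: "is_basis V n b" and v: "v \<in> carrier V" "v \<noteq> \<zero>"
  shows "\<exists>w l. w \<in> carrier V \<and> w \<noteq> \<zero> \<and> f w = l \<odot> w"
proof -
  have fi: "(f ^^ i) v \<in> carrier V" for i
    by (induction i) (use v linear_mapsD(1)[OF f] in auto)
  obtain c where c: "\<exists>j<Suc n. c j \<noteq> 0" "(\<Oplus>j\<in>{..<Suc n}. c j \<odot> (f ^^ j) v) = \<zero>"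
    using is_basis_nontrivial_relation[OF complex_space_axioms b lessI, of "\<lambda>j. (f ^^ j) v"] fi by blast
  define q where "q = Poly (map c [0..<Suc n])"
  have cq: "Polynomial.coeff q i = (if i < Suc n then c i else 0)" for i
    by (simp add: q_def coeff_Poly_eq nth_default_def del: upt_Suc)
  show ?thesis
  proof (rule poly_eigenvector[OF f])
    show "q \<noteq> 0" using c(1) cq by (metis coeff_0)
    show "Polynomial.degree q \<le> n" by (rule degree_le) (simp add: cq)
    have "(\<Oplus>i\<in>{..n}. Polynomial.coeff q i \<odot> (f ^^ i) v) = (\<Oplus>j\<in>{..<Suc n}. c j \<odot> (f ^^ j) v)"
      using fi by (intro M.finsum_cong') (auto simp: cq)
    then show "(\<Oplus>i\<in>{..n}. Polynomial.coeff q i \<odot> (f ^^ i) v) = \<zero>" using c by simp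
  qed (use v in auto)
qed

text \<open>Nonzero eigenvectors for distinct eigenvalues are independent, and a finite basis allows
  only finitely many of them. This is what terminates weight strings.\<close>

lemma eigenvector_sequence_vanishes:
  assumes f: "f \<in> linear_maps V V" and b: "is_basis V n b" and w: "\<And>i. w i \<in> carrier V"
    and fw: "\<And>i. f (w i) = l i \<odot> w i" and l: "inj l"
  shows "\<exists>i::nat. w i = \<zero>"
proof (rule ccontr)
  assume nz: "\<nexists>i. w i = \<zero>"
  obtain c where c: "\<exists>j<Suc n. c j \<noteq> 0" "(\<Oplus>j\<in>{..<Suc n}. c j \<odot> w j) = \<zero>"
    using is_basis_nontrivial_relation[OF complex_space_axioms b lessI, of w] w by blast
  then obtain j where j: "j < Suc n" "c j \<noteq> 0" by blast
  have "c j \<odot> w j = \<zero>"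
    by (rule eigenvectors_independent[OF complex_space_axioms f, where A = "{..<Suc n}" and l = l])
      (use l w fw c j linear_mapsD(3)[OF f] in \<open>auto simp: inj_on_def mult.commute\<close>)
  then show False using j w nz smult_eq_zero_iff by blast
qed

end

section \<open>Irreducible representations of \<open>sl2\<close>\<close>

lemma (in complex_space) add_smult_cancel:
  assumes w: "w \<in> carrier V" and u: "u \<in> carrier V" and eq: "w \<oplus> a \<odot> u = b \<odot> u"
  shows "w = (b - a) \<odot> u"
proof -
  have "w = (w \<oplus> a \<odot> u) \<oplus> (- a) \<odot> u" using w u by (simp add: M.a_assoc)
  also have "\<dots> = (b - a) \<odot> u" unfolding eq using u by simp
  finally show ?thesis .
qed

text \<open>\<open>A\<close>, \<open>B\<close>, \<open>D\<close> stand for \<open>x\<close>,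
  \<open>y\<close>, \<open>h\<close>. Lowering an eigenvector of \<open>D\<close> ends in a vector
  killed by \<open>B\<close>; raising that one ends as well, and the coefficient at the end of the
  string must vanish, which determines the weight. The string spans an invariant subspace, hence
  everything, and counting dimensions gives its length.\<close>

lemma (in complex_space) sl2_irreducible_weight_basis:
  assumes A: "A \<in> linear_maps V V" and B: "B \<in> linear_maps V V" and D: "D \<in> linear_maps V V"
    and AB: "\<And>v. v \<in> carrier V \<Longrightarrow> A (B v) = B (A v) \<oplus> D v"
    and DA: "\<And>v. v \<in> carrier V \<Longrightarrow> D (A v) = A (D v) \<oplus> 2 \<odot> A v"
    and DB: "\<And>v. v \<in> carrier V \<Longrightarrow> D (B v) = B (D v) \<oplus> (-2) \<odot> B v"
    and irr: "\<And>W. submodule W CC V \<Longrightarrow> (\<forall>w\<in>W. A w \<in> W \<and> B w \<in> W \<and> D w \<in> W) \<Longrightarrow>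
      W = {\<zero>} \<or> W = carrier V"
    and nontriv: "carrier V \<noteq> {\<zero>}" and basis: "is_basis V (Suc n) b"
  obtains e where "e \<in> carrier V" "e \<noteq> \<zero>" "B e = \<zero>" "(A ^^ Suc n) e = \<zero>"
    "is_basis V (Suc n) (\<lambda>i. (A ^^ i) e)"
    "\<And>i. D ((A ^^ i) e) = (2 * of_nat i - of_nat n) \<odot> (A ^^ i) e"
    "\<And>i. B ((A ^^ Suc i) e) = (of_nat (Suc i) * (of_nat n - of_nat i)) \<odot> (A ^^ i) e"
proof -
  note An = linear_mapsD[OF A] and Bn = linear_mapsD[OF B] and Dn = linear_mapsD[OF D]
  obtain v0 where "v0 \<in> carrier V" "v0 \<noteq> \<zero>" using nontriv by auto
  then obtain v l where v: "v \<in> carrier V" "v \<noteq> \<zero>" "D v = l \<odot> v"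
    using eigenvector_exists[OF D basis] by blast
  have Bv: "(B ^^ i) v \<in> carrier V" for i by (induction i) (use v Bn in auto)
  have DBv: "D ((B ^^ i) v) = (l - 2 * of_nat i) \<odot> (B ^^ i) v" for i
  proof (induction i)
    case 0 then show ?case using v by simp
  next
    case (Suc i)
    then show ?case using DB[OF Bv[of i]] Bn Bv[of i] by (simp add: algebra_simps)
  qed
  have "inj (\<lambda>i. l - 2 * of_nat i :: complex)" by (auto simp: inj_def)
  then have ex: "\<exists>i. (B ^^ i) v = \<zero>"
    by (rule eigenvector_sequence_vanishes[OF D basis, of "\<lambda>i. (B ^^ i) v" "\<lambda>i. l - 2 * of_nat i", OF Bv DBv])
  define k where "k = (LEAST i. (B ^^ i) v = \<zero>)"
  have k: "(B ^^ k) v = \<zero>" unfolding k_def using LeastI_ex[OF ex] .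
  then obtain k' where k': "k = Suc k'" using v by (cases k) auto
  define e where "e = (B ^^ k') v"
  have e: "e \<in> carrier V" "e \<noteq> \<zero>" "B e = \<zero>"
    using Bv not_less_Least[of k' "\<lambda>i. (B ^^ i) v = \<zero>"] k k' unfolding e_def k_def[symmetric] by auto
  define \<mu> where "\<mu> = l - 2 * of_nat k'"
  have De: "D e = \<mu> \<odot> e" using DBv[of k'] by (simp add: e_def \<mu>_def)
  have Ae: "(A ^^ i) e \<in> carrier V" for i by (induction i) (use e An in auto)
  have DAe: "D ((A ^^ i) e) = (\<mu> + 2 * of_nat i) \<odot> (A ^^ i) e" for i
  proof (induction i)
    case 0 then show ?case using De by simp
  next
    case (Suc i)
    then show ?case using DA[OF Ae[of i]] An Ae[of i] by (simp add: algebra_simps)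
  qed
  \<comment> \<open>Moving \<open>B\<close> past each \<open>A\<close> by
    \<open>A B = B A + D\<close> contributes a weight; the partial sums of the weights
    \<open>\<mu>\<close>, \<open>\<mu> + 2\<close>, ... give the product.\<close>
  have BAe: "B ((A ^^ Suc i) e) = (- of_nat (Suc i) * (\<mu> + of_nat i)) \<odot> (A ^^ i) e" for i
  proof (induction i)
    case 0
    have "B (A e) \<oplus> \<mu> \<odot> e = \<zero>"
      using AB[OF e(1)] e(3) De linear_maps_zero[OF complex_space_axioms complex_space_axioms A] by simp
    then show ?case using add_eq_zero_iff[of "B (A e)" "\<mu> \<odot> e"] e(1) An(1) Bn(1) by simp
  next
    case (Suc i)
    let ?u = "(A ^^ Suc i) e"
    have u: "?u \<in> carrier V" using Ae .
    have "B (A ?u) \<oplus> D ?u = A (B ?u)" using AB[OF u] by simp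
    also have "\<dots> = (- of_nat (Suc i) * (\<mu> + of_nat i)) \<odot> ?u"
      using Suc An Ae[of i] by simp
    finally have "B (A ?u) \<oplus> (\<mu> + 2 * of_nat (Suc i)) \<odot> ?u = (- of_nat (Suc i) * (\<mu> + of_nat i)) \<odot> ?u"
      using DAe[of "Suc i"] by simp
    then have "B (A ?u) = (- of_nat (Suc i) * (\<mu> + of_nat i) - (\<mu> + 2 * of_nat (Suc i))) \<odot> ?u"
      by (rule add_smult_cancel[OF Bn(1)[OF An(1)[OF u]] u])
    moreover have "(- of_nat (Suc i) * (\<mu> + of_nat i) - (\<mu> + 2 * of_nat (Suc i))) =
       - of_nat (Suc (Suc i)) * (\<mu> + of_nat (Suc i))" by (simp add: algebra_simps)
    ultimately show ?case by simp
  qed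
  have "inj (\<lambda>i. \<mu> + 2 * of_nat i :: complex)" by (auto simp: inj_def)
  then have ex2: "\<exists>i. (A ^^ i) e = \<zero>"
    by (rule eigenvector_sequence_vanishes[OF D basis, of "\<lambda>i. (A ^^ i) e" "\<lambda>i. \<mu> + 2 * of_nat i", OF Ae DAe])
  define N' where "N' = (LEAST i. (A ^^ i) e = \<zero>)"
  have N': "(A ^^ N') e = \<zero>" unfolding N'_def using LeastI_ex[OF ex2] .
  then obtain N where N: "N' = Suc N" using e by (cases N') auto
  have nz: "(A ^^ i) e \<noteq> \<zero>" if "i < Suc N" for i
    using not_less_Least[of i "\<lambda>i. (A ^^ i) e = \<zero>"] that N unfolding N'_def by auto
  have z: "(A ^^ Suc N) e = \<zero>" using N' N by simp
  \<comment> \<open>\<open>B\<close> applied to the first vanishing vector of the string is a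
    multiple of the last nonzero one; its factor is therefore 0, so \<open>\<mu>\<close> is
    \<open>- N\<close>.\<close>
  have "(- of_nat (Suc N) * (\<mu> + of_nat N)) \<odot> (A ^^ N) e = \<zero>"
    using BAe[of N] z linear_maps_zero[OF complex_space_axioms complex_space_axioms B] by simp
  then have "- of_nat (Suc N) * (\<mu> + of_nat N) = 0"
    using smult_eq_zero_iff[OF Ae] nz[of N] by blast
  then have mu: "\<mu> = - of_nat N"
    by (metis add_eq_0_iff add.inverse_inverse mult_eq_0_iff neg_equal_0_iff_equal of_nat_neq_0)
  let ?w = "\<lambda>i. (A ^^ i) e" and ?W = "finite_span V (Suc N) (\<lambda>i. (A ^^ i) e)"
  have W: "submodule ?W CC V" by (rule finite_span_submodule) (rule Ae)
  note WD = submodule_CD[OF W]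
  have wW: "?w i \<in> ?W" if "i < Suc N" for i by (rule finite_span_base[OF Ae that])
  have AW: "A (?w i) \<in> ?W" if "i < Suc N" for i
  proof (cases "i = N")
    case True then show ?thesis using z WD(2) by simp
  next
    case False then show ?thesis using wW[of "Suc i"] that by simp
  qed
  have DW: "D (?w i) \<in> ?W" if "i < Suc N" for i using DAe WD(4) wW[OF that] by simp
  have BW: "B (?w i) \<in> ?W" if "i < Suc N" for i
  proof (cases i)
    case 0 then show ?thesis using e(3) WD(2) by simp
  next
    case (Suc j) then show ?thesis using BAe[of j] WD(4)[OF wW[of j]] that by simp
  qed
  have "\<forall>w\<in>?W. A w \<in> ?W \<and> B w \<in> ?W \<and> D w \<in> ?W"
    using finite_span_invariant[OF Ae A AW] finite_span_invariant[OF Ae B BW]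
      finite_span_invariant[OF Ae D DW] by blast
  then have WV: "?W = carrier V" using irr[OF W] wW[of 0] e by auto
  have bas: "is_basis V (Suc N) ?w"
  proof (rule is_basisI[OF Ae WV])
    fix c i assume c: "(\<Oplus>i\<in>{..<Suc N}. c i \<odot> (A ^^ i) e) = \<zero>" and i: "i < Suc N"
    have "c i \<odot> ?w i = \<zero>"
    proof (rule eigenvectors_independent[OF complex_space_axioms D, where A = "{..<Suc N}" and l = "\<lambda>i. \<mu> + 2 * of_nat i"])
      show "D (c j \<odot> ?w j) = (\<mu> + 2 * of_nat j) \<odot> (c j \<odot> ?w j)" for j
        using Dn(3) DAe Ae by (simp add: mult.commute)
    qed (use c i Ae in \<open>auto simp: inj_on_def\<close>)
    then show "c i = 0" using smult_eq_zero_iff[OF Ae] nz[OF i] by blast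
  qed
  have Nn: "N = n"
    using is_basis_card_le[OF complex_space_axioms basis bas]
      is_basis_card_le[OF complex_space_axioms bas basis] by simp
  show ?thesis
  proof (rule that[of e])
    show "D ((A ^^ i) e) = (2 * of_nat i - of_nat n) \<odot> (A ^^ i) e" for i
      using DAe[of i] mu Nn by (simp add: algebra_simps)
    show "B ((A ^^ Suc i) e) = (of_nat (Suc i) * (of_nat n - of_nat i)) \<odot> (A ^^ i) e" for i
    proof -
      have "- of_nat (Suc i) * (\<mu> + of_nat i) = of_nat (Suc i) * (of_nat n - of_nat i :: complex)"
        using mu Nn by (simp add: algebra_simps)
      then show ?thesis using BAe[of i] by simp
    qed
  qed (use e z bas Nn in auto)
qed

text \<open>The line through a common zero of the three operators is invariant. This identifies the
  trivial summands.\<close>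

lemma (in complex_space) irreducible_line:
  assumes A: "A \<in> linear_maps V V" and B: "B \<in> linear_maps V V" and D: "D \<in> linear_maps V V"
    and irr: "\<And>W. submodule W CC V \<Longrightarrow> (\<forall>w\<in>W. A w \<in> W \<and> B w \<in> W \<and> D w \<in> W) \<Longrightarrow>
      W = {\<zero>} \<or> W = carrier V"
    and v: "v \<in> carrier V" "v \<noteq> \<zero>" "A v = \<zero>" "B v = \<zero>" "D v = \<zero>" and w: "w \<in> carrier V"
  obtains c where "w = c \<odot> v"
proof -
  let ?W = "range (\<lambda>c. c \<odot> v)"
  have "submodule ?W CC V"
  proof (rule submodule_CI)
    show "\<zero> \<in> ?W" using v by (intro image_eqI[of _ _ 0]) auto
    show "a \<oplus> b \<in> ?W" if "a \<in> ?W" "b \<in> ?W" for a b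
      using that v by (auto simp: smult_add_left[symmetric])
  qed (use v in auto)
  moreover have "\<forall>w\<in>?W. A w \<in> ?W \<and> B w \<in> ?W \<and> D w \<in> ?W"
    using v linear_mapsD(3)[OF A] linear_mapsD(3)[OF B] linear_mapsD(3)[OF D]
    by (auto intro!: image_eqI[of _ _ 0])
  ultimately have "?W = {\<zero>} \<or> ?W = carrier V" by (rule irr)
  moreover have "v \<in> ?W" using v by (intro image_eqI[of _ _ 1]) auto
  ultimately show ?thesis using v w that by auto
qed

section \<open>Lie algebras and \<open>sl2\<close>\<close>

sublocale lie_algebra \<subseteq> complex_space L
  by (simp add: complex_space_def module_axioms)

context lie_algebra
begin

lemma bracket_in [simp, intro]: "a \<in> carrier L \<Longrightarrow> b \<in> carrier L \<Longrightarrow> bracket L a b \<in> carrier L"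
  using linear_mapsD(1)[OF bilinear_mapsD(1)[OF bracket_bilinear]] .

lemma ad_linear: "a \<in> carrier L \<Longrightarrow> bracket L a \<in> linear_maps L L"
  using bilinear_mapsD(1)[OF bracket_bilinear] .

lemma ad_right_linear: "b \<in> carrier L \<Longrightarrow> (\<lambda>a. bracket L a b) \<in> linear_maps L L"
  using bilinear_mapsD(2)[OF bracket_bilinear] .

lemmas bracket_add_right = linear_mapsD(2)[OF ad_linear]
  and bracket_smult_right = linear_mapsD(3)[OF ad_linear]
  and bracket_add_left = linear_mapsD(2)[OF ad_right_linear]
  and bracket_smult_left = linear_mapsD(3)[OF ad_right_linear]

lemma bracket_zero_right [simp]: "a \<in> carrier L \<Longrightarrow> bracket L a \<zero> = \<zero>"
  using linear_maps_zero[OF complex_space_axioms complex_space_axioms ad_linear] .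

lemma bracket_zero_left [simp]: "a \<in> carrier L \<Longrightarrow> bracket L \<zero> a = \<zero>"
  using linear_maps_zero[OF complex_space_axioms complex_space_axioms ad_right_linear] .

lemma bracket_swap:
  assumes "a \<in> carrier L" "b \<in> carrier L"
  shows "bracket L a b = (-1) \<odot> bracket L b a"
proof -
  have "bracket L (a \<oplus> b) (a \<oplus> b) = \<zero>" using assms by (intro bracket_alternating) auto
  then have "bracket L b a \<oplus> bracket L a b = \<zero>"
    using assms bracket_alternating[OF assms(1)] bracket_alternating[OF assms(2)]
    by (simp add: bracket_add_left bracket_add_right)
  then show ?thesis using add_eq_zero_iff[of "bracket L a b" "bracket L b a"] assms by (simp add: M.a_comm)
qed

lemma jacobi_derivation:
  assumes "a \<in> carrier L" "b \<in> carrier L" "c \<in> carrier L"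
  shows "bracket L a (bracket L b c) = bracket L (bracket L a b) c \<oplus> bracket L b (bracket L a c)"
proof -
  let ?p = "bracket L a (bracket L b c)" and ?q = "bracket L b (bracket L a c)"
    and ?r = "bracket L (bracket L a b) c"
  have "bracket L b (bracket L c a) = (-1) \<odot> ?q"
    using bracket_swap[of c a] assms by (simp add: bracket_smult_right)
  moreover have "bracket L c (bracket L a b) = (-1) \<odot> ?r"
    using bracket_swap[of c "bracket L a b"] assms by simp
  ultimately have "?p \<oplus> ((-1) \<odot> ?q \<oplus> (-1) \<odot> ?r) = \<zero>"
    using jacobi[OF assms] assms by (simp add: M.a_assoc)
  then have "?p = (-1) \<odot> ((-1) \<odot> ?q \<oplus> (-1) \<odot> ?r)"
    using add_eq_zero_iff[of ?p "(-1) \<odot> ?q \<oplus> (-1) \<odot> ?r"] assms by simp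
  then show ?thesis using assms by (simp add: smult_add_right M.a_comm)
qed

end

lemma sl2_simps [simp]:
  "a \<oplus>\<^bsub>sl2\<^esub> b = a + b" "\<zero>\<^bsub>sl2\<^esub> = 0" "(c \<odot>\<^bsub>sl2\<^esub> a) $ i $ j = c * a $ i $ j"
  by (simp_all add: sl2_def)

lemma carrier_sl2: "carrier sl2 = {A. A $ 1 $ 1 + A $ 2 $ 2 = 0}"
  by (simp add: sl2_def trace_def sum_2)

lemma bracket_sl2: "bracket sl2 a b $ i $ j = (\<Sum>k\<in>UNIV. a $ i $ k * b $ k $ j) - (\<Sum>k\<in>UNIV. b $ i $ k * a $ k $ j)"
  by (simp add: sl2_def matrix_matrix_mult_def)

interpretation sl2: lie_algebra sl2
proof (intro lie_algebra.intro lie_algebra_axioms.intro)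
  have "c * a + c * b = 0" if "a + b = 0" for a b c :: complex
    using that by (metis distrib_left mult_zero_right)
  then have "c \<odot>\<^bsub>sl2\<^esub> v \<in> carrier sl2" if "v \<in> carrier sl2" for c v
    using that by (simp add: carrier_sl2)
  then have "complex_space sl2"
    by (intro complex_space_intro) (simp, auto simp: carrier_sl2 vec_eq_iff forall_2 algebra_simps)
  then show "vector_space_CC sl2" by (simp add: complex_space_def)
  have "bracket sl2 a b \<in> carrier sl2" for a b
    by (simp add: carrier_sl2 bracket_sl2 sum_2 algebra_simps)
  then show "bracket sl2 \<in> bilinear_maps sl2 sl2 sl2"
    unfolding bilinear_maps_def
    by (auto intro!: linear_mapsI simp: bracket_sl2 sum_2 vec_eq_iff forall_2 algebra_simps)
  show "bracket sl2 a a = \<zero>\<^bsub>sl2\<^esub>" for a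
    by (simp add: vec_eq_iff bracket_sl2)
  show "bracket sl2 a (bracket sl2 b c) \<oplus>\<^bsub>sl2\<^esub> bracket sl2 b (bracket sl2 c a) \<oplus>\<^bsub>sl2\<^esub>
      bracket sl2 c (bracket sl2 a b) = \<zero>\<^bsub>sl2\<^esub>" for a b c
    by (simp add: vec_eq_iff bracket_sl2 sum_2 forall_2 algebra_simps)
qed

text \<open>The triple is any basis with these relations, not the standard matrices, so computations
  go through its coordinate functionals. Their index order is that of the list \<open>y\<close>,
  \<open>h\<close>, \<open>x\<close>.\<close>

locale sl2_basis =
  fixes y h x :: "complex^2^2"
  assumes basis: "is_basis sl2 3 (\<lambda>i. [y, h, x] ! i)"
    and hy: "bracket sl2 h y = (-2) \<odot>\<^bsub>sl2\<^esub> y"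
    and hx: "bracket sl2 h x = 2 \<odot>\<^bsub>sl2\<^esub> x"
    and xy: "bracket sl2 x y = h"
begin

definition coord :: "nat \<Rightarrow> complex^2^2 \<Rightarrow> complex" where
  "coord = (SOME \<xi>. (\<forall>i. \<xi> i \<in> linear_maps sl2 scalar_space) \<and>
    (\<forall>v\<in>carrier sl2. v = (\<Oplus>\<^bsub>sl2\<^esub>i\<in>{..<3}. \<xi> i v \<odot>\<^bsub>sl2\<^esub> [y, h, x] ! i)) \<and>
    (\<forall>i<3. \<forall>j<3. \<xi> i ([y, h, x] ! j) = (if i = j then 1 else 0)))"

definition "cy = coord 0"
definition "ch = coord 1"
definition "cx = coord 2"

lemma coord:
  "coord i \<in> linear_maps sl2 scalar_space"
  "v \<in> carrier sl2 \<Longrightarrow> v = (\<Oplus>\<^bsub>sl2\<^esub>i\<in>{..<3}. coord i v \<odot>\<^bsub>sl2\<^esub> [y, h, x] ! i)"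
  "i < 3 \<Longrightarrow> j < 3 \<Longrightarrow> coord i ([y, h, x] ! j) = (if i = j then 1 else 0)"
proof -
  obtain \<xi> where "\<And>i. \<xi> i \<in> linear_maps sl2 scalar_space"
    "\<And>v. v \<in> carrier sl2 \<Longrightarrow> v = (\<Oplus>\<^bsub>sl2\<^esub>i\<in>{..<3}. \<xi> i v \<odot>\<^bsub>sl2\<^esub> [y, h, x] ! i)"
    "\<And>i j. i < 3 \<Longrightarrow> j < 3 \<Longrightarrow> \<xi> i ([y, h, x] ! j) = (if i = j then 1 else 0)"
    by (rule basis_coordinates[OF sl2.complex_space_axioms basis]) (rule that)
  then have "\<exists>\<xi>. (\<forall>i. \<xi> i \<in> linear_maps sl2 scalar_space) \<and>
    (\<forall>v\<in>carrier sl2. v = (\<Oplus>\<^bsub>sl2\<^esub>i\<in>{..<3}. \<xi> i v \<odot>\<^bsub>sl2\<^esub> [y, h, x] ! i)) \<and>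
    (\<forall>i<3. \<forall>j<3. \<xi> i ([y, h, x] ! j) = (if i = j then 1 else 0))" by blast
  note this[THEN someI_ex, folded coord_def]
  then show "coord i \<in> linear_maps sl2 scalar_space"
    "v \<in> carrier sl2 \<Longrightarrow> v = (\<Oplus>\<^bsub>sl2\<^esub>i\<in>{..<3}. coord i v \<odot>\<^bsub>sl2\<^esub> [y, h, x] ! i)"
    "i < 3 \<Longrightarrow> j < 3 \<Longrightarrow> coord i ([y, h, x] ! j) = (if i = j then 1 else 0)"
    by blast+
qed

lemma yhx_in [simp]: "y \<in> carrier sl2" "h \<in> carrier sl2" "x \<in> carrier sl2"
proof -
  have "[y, h, x] ! i \<in> carrier sl2" if "i < 3" for i using basis that by (auto simp: is_basis_def)
  from this[of 0] this[of 1] this[of 2]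
  show "y \<in> carrier sl2" "h \<in> carrier sl2" "x \<in> carrier sl2" by simp_all
qed

lemma coord_basis [simp]:
  "cy y = 1" "cy h = 0" "cy x = 0" "ch y = 0" "ch h = 1" "ch x = 0" "cx y = 0" "cx h = 0" "cx x = 1"
  using coord(3)[of 0 0] coord(3)[of 0 1] coord(3)[of 0 2] coord(3)[of 1 0] coord(3)[of 1 1]
    coord(3)[of 1 2] coord(3)[of 2 0] coord(3)[of 2 1] coord(3)[of 2 2]
  by (simp_all add: cy_def ch_def cx_def)

lemma coord_linear:
  "cy \<in> linear_maps sl2 scalar_space" "ch \<in> linear_maps sl2 scalar_space" "cx \<in> linear_maps sl2 scalar_space"
  using coord(1) by (simp_all add: cy_def ch_def cx_def)

lemma coord_add:
  assumes "a \<in> carrier sl2" "b \<in> carrier sl2"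
  shows "cy (a + b) = cy a + cy b" "ch (a + b) = ch a + ch b" "cx (a + b) = cx a + cx b"
  using coord_linear[THEN linear_mapsD(2), of a b] assms by simp_all

lemma coord_smult:
  assumes "a \<in> carrier sl2"
  shows "cy (c \<odot>\<^bsub>sl2\<^esub> a) = c * cy a" "ch (c \<odot>\<^bsub>sl2\<^esub> a) = c * ch a" "cx (c \<odot>\<^bsub>sl2\<^esub> a) = c * cx a"
  using coord_linear[THEN linear_mapsD(3), of a c] assms by simp_all

lemma expand:
  assumes "a \<in> carrier sl2"
  shows "a = cy a \<odot>\<^bsub>sl2\<^esub> y + (ch a \<odot>\<^bsub>sl2\<^esub> h + cx a \<odot>\<^bsub>sl2\<^esub> x)"
proof -
  have "{..<3} = {0, 1, 2::nat}" by auto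
  then have "(\<Oplus>\<^bsub>sl2\<^esub>i\<in>{..<3}. coord i a \<odot>\<^bsub>sl2\<^esub> [y, h, x] ! i) =
     cy a \<odot>\<^bsub>sl2\<^esub> y + (ch a \<odot>\<^bsub>sl2\<^esub> h + cx a \<odot>\<^bsub>sl2\<^esub> x)"
    by (simp add: Pi_def cy_def ch_def cx_def)
  then show ?thesis by (rule trans[OF coord(2)[OF assms]])
qed

lemma sl2_eqI:
  assumes "a \<in> carrier sl2" "b \<in> carrier sl2" "cy a = cy b" "ch a = ch b" "cx a = cx b"
  shows "a = b"
proof -
  have "a = cy a \<odot>\<^bsub>sl2\<^esub> y + (ch a \<odot>\<^bsub>sl2\<^esub> h + cx a \<odot>\<^bsub>sl2\<^esub> x)" by (rule expand[OF assms(1)])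
  also have "\<dots> = cy b \<odot>\<^bsub>sl2\<^esub> y + (ch b \<odot>\<^bsub>sl2\<^esub> h + cx b \<odot>\<^bsub>sl2\<^esub> x)" by (simp only: assms(3-))
  also have "\<dots> = b" by (rule expand[OF assms(2), symmetric])
  finally show ?thesis .
qed

lemma brackets_basis:
  "bracket sl2 h y = (-2) \<odot>\<^bsub>sl2\<^esub> y" "bracket sl2 y h = 2 \<odot>\<^bsub>sl2\<^esub> y"
  "bracket sl2 h x = 2 \<odot>\<^bsub>sl2\<^esub> x" "bracket sl2 x h = (-2) \<odot>\<^bsub>sl2\<^esub> x"
  "bracket sl2 x y = h" "bracket sl2 y x = (-1) \<odot>\<^bsub>sl2\<^esub> h"
  "bracket sl2 x x = 0" "bracket sl2 y y = 0" "bracket sl2 h h = 0"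
  using hy hx xy sl2.bracket_swap[of y h] sl2.bracket_swap[of x h] sl2.bracket_swap[of y x]
    sl2.bracket_alternating[of x] sl2.bracket_alternating[of y] sl2.bracket_alternating[of h] by simp_all

lemma coord_bracket:
  assumes a: "a \<in> carrier sl2" and b: "b \<in> carrier sl2"
  shows "cy (bracket sl2 a b) = 2 * (cy a * ch b - ch a * cy b)"
    "ch (bracket sl2 a b) = cx a * cy b - cy a * cx b"
    "cx (bracket sl2 a b) = 2 * (ch a * cx b - cx a * ch b)"
proof -
  \<comment> \<open>The bilinear expansion is done once for an arbitrary functional; the three
    coordinates are instances.\<close>
  have gen: "\<phi> (bracket sl2 a b) =
    cy a * ch b * \<phi> (2 \<odot>\<^bsub>sl2\<^esub> y) + cy a * cx b * \<phi> ((-1) \<odot>\<^bsub>sl2\<^esub> h) +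
    ch a * cy b * \<phi> ((-2) \<odot>\<^bsub>sl2\<^esub> y) + ch a * cx b * \<phi> (2 \<odot>\<^bsub>sl2\<^esub> x) +
    cx a * cy b * \<phi> h + cx a * ch b * \<phi> ((-2) \<odot>\<^bsub>sl2\<^esub> x)"
    if phi: "\<phi> \<in> linear_maps sl2 scalar_space" for \<phi>
  proof -
    have c0: "\<phi> 0 = 0"
      using linear_maps_zero[OF sl2.complex_space_axioms complex_space_scalar phi] by simp
    let ?f = "\<lambda>a b. \<phi> (bracket sl2 a b)"
    have l: "?f (u + u') w = ?f u w + ?f u' w" "?f w (u + u') = ?f w u + ?f w u'"
      if "u \<in> carrier sl2" "u' \<in> carrier sl2" "w \<in> carrier sl2" for u u' w
      using that sl2.bracket_add_left[of w u u'] sl2.bracket_add_right[of w u u']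
        linear_mapsD(2)[OF phi, of "bracket sl2 u w" "bracket sl2 u' w"]
        linear_mapsD(2)[OF phi, of "bracket sl2 w u" "bracket sl2 w u'"] by simp_all
    have l2: "?f (c \<odot>\<^bsub>sl2\<^esub> u) w = c * ?f u w" "?f w (c \<odot>\<^bsub>sl2\<^esub> u) = c * ?f w u"
      if "u \<in> carrier sl2" "w \<in> carrier sl2" for u w c
      using that sl2.bracket_smult_left[of w u c] sl2.bracket_smult_right[of w u c]
        linear_mapsD(3)[OF phi] by simp_all
    have cl: "u + u' \<in> carrier sl2" if "u \<in> carrier sl2" "u' \<in> carrier sl2" for u u'
      using sl2.add_in[OF that] by simp
    have "?f a b = ?f (cy a \<odot>\<^bsub>sl2\<^esub> y + (ch a \<odot>\<^bsub>sl2\<^esub> h + cx a \<odot>\<^bsub>sl2\<^esub> x))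
       (cy b \<odot>\<^bsub>sl2\<^esub> y + (ch b \<odot>\<^bsub>sl2\<^esub> h + cx b \<odot>\<^bsub>sl2\<^esub> x))"
      by (rule arg_cong2[OF expand[OF a] expand[OF b]])
    also have "\<dots> = cy a * ch b * ?f y h + cy a * cx b * ?f y x + ch a * cy b * ?f h y +
       ch a * cx b * ?f h x + cx a * cy b * ?f x y + cx a * ch b * ?f x h"
      by (simp add: l l2 cl brackets_basis(7-9) c0 algebra_simps)
    finally show ?thesis by (simp only: brackets_basis)
  qed
  show "cy (bracket sl2 a b) = 2 * (cy a * ch b - ch a * cy b)"
    "ch (bracket sl2 a b) = cx a * cy b - cy a * cx b"
    "cx (bracket sl2 a b) = 2 * (ch a * cx b - cx a * ch b)"
    unfolding coord_linear[THEN gen] by (simp_all add: coord_smult)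
qed

text \<open>The trace of the composed adjoint maps, read off in the basis. The values 8 on
  \<open>h\<close>, \<open>h\<close> and 4 on \<open>x\<close>, \<open>y\<close> are the constants
  behind the factor 4 in \<open>q\<close>.\<close>

lemma killing_form_sl2:
  assumes a: "a \<in> carrier sl2" and b: "b \<in> carrier sl2"
  shows "killing_form sl2 a b = 8 * ch a * ch b + 4 * (cy a * cx b + cx a * cy b)"
proof -
  have f: "(\<lambda>z. bracket sl2 a (bracket sl2 b z)) \<in> linear_maps sl2 sl2"
    by (rule linear_maps_comp[OF sl2.ad_linear[OF b] sl2.ad_linear[OF a]])
  have "killing_form sl2 a b = (\<Sum>i<3. coord i (bracket sl2 a (bracket sl2 b ([y, h, x] ! i))))"
    unfolding killing_form_def
    by (rule endo_trace_eq[OF sl2.complex_space_axioms basis f coord(1)]) (erule coord(2), erule coord(3))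
  also have "\<dots> = cy (bracket sl2 a (bracket sl2 b y)) + ch (bracket sl2 a (bracket sl2 b h)) +
      cx (bracket sl2 a (bracket sl2 b x))"
    by (simp add: eval_nat_numeral cy_def ch_def cx_def)
  also have "\<dots> = 8 * ch a * ch b + 4 * (cy a * cx b + cx a * cy b)"
    using a b by (simp add: coord_bracket algebra_simps)
  finally show ?thesis .
qed

end

section \<open>Formal spaces\<close>

lemma direct_sum_space_simps [simp]:
  "carrier (direct_sum_space V W) = carrier V \<times> carrier W"
  "\<zero>\<^bsub>direct_sum_space V W\<^esub> = (\<zero>\<^bsub>V\<^esub>, \<zero>\<^bsub>W\<^esub>)"
  "(v, w) \<oplus>\<^bsub>direct_sum_space V W\<^esub> (v', w') = (v \<oplus>\<^bsub>V\<^esub> v', w \<oplus>\<^bsub>W\<^esub> w')"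
  "c \<odot>\<^bsub>direct_sum_space V W\<^esub> (v, w) = (c \<odot>\<^bsub>V\<^esub> v, c \<odot>\<^bsub>W\<^esub> w)"
  by (simp_all add: direct_sum_space_def)

lemma complex_space_direct_sum:
  assumes "complex_space V" "complex_space W"
  shows "complex_space (direct_sum_space V W)"
proof -
  interpret V: complex_space V by fact
  interpret W: complex_space W by fact
  show ?thesis
    by (rule complex_space_intro)
      (auto simp: V.M.a_ac W.M.a_ac V.smult_add_left W.smult_add_left V.smult_add_right W.smult_add_right
        simp del: V.smult_collect W.smult_collect, simp_all)
qed

lemma formal_space_simps [simp]:
  "f \<in> carrier formal_space \<longleftrightarrow> finite {p. f p \<noteq> 0}"
  "\<zero>\<^bsub>formal_space\<^esub> = (\<lambda>p. 0)"
  "f \<oplus>\<^bsub>formal_space\<^esub> g = (\<lambda>p. f p + g p)"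
  "c \<odot>\<^bsub>formal_space\<^esub> f = (\<lambda>p. c * f p)"
  by (simp_all add: formal_space_def)

interpretation formal_space: complex_space formal_space
proof (rule complex_space_intro, goal_cases)
  case (1 u v)
  then have "finite ({p. u p \<noteq> 0} \<union> {p. v p \<noteq> 0})" by simp
  then show ?case by (simp, elim rev_finite_subset) auto
next
  case (6 c v)
  then show ?case by (cases "c = 0") auto
qed (auto simp: fun_eq_iff algebra_simps)

lemma formal_vec_in: "finite {p. formal_vec i j p \<noteq> 0}"
  by (rule finite_subset[of _ "{(i, j)}"]) (auto simp: formal_vec_def)

text \<open>Induction on the size of the support, removing one basis vector at a time.\<close>

lemma formal_space_span:
  assumes Z: "submodule Z CC formal_space" and vec: "\<And>i j. formal_vec i j \<in> Z"
    and f: "f \<in> carrier formal_space"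
  shows "f \<in> Z"
  using f
proof (induction "card {p. f p \<noteq> 0}" arbitrary: f)
  case 0
  then have "f = \<zero>\<^bsub>formal_space\<^esub>" by (auto simp: fun_eq_iff)
  then show ?case using formal_space.submodule_CD(2)[OF Z] by simp
next
  case (Suc n)
  then have "{p. f p \<noteq> 0} \<noteq> {}" by (metis card.empty nat.distinct(1))
  then obtain i j where ij: "f (i, j) \<noteq> 0" by auto
  let ?g = "f((i, j) := 0)"
  have supp: "{p. ?g p \<noteq> 0} = {p. f p \<noteq> 0} - {(i, j)}" by auto
  have "card {p. ?g p \<noteq> 0} = n" "finite {p. ?g p \<noteq> 0}"
    using Suc.hyps(2) Suc.prems ij unfolding supp by auto
  then have "?g \<in> Z" using Suc.hyps(1)[of ?g] by simp
  moreover have "f = ?g \<oplus>\<^bsub>formal_space\<^esub> f (i, j) \<odot>\<^bsub>formal_space\<^esub> formal_vec i j"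
    by (auto simp: fun_eq_iff formal_vec_def)
  ultimately show ?case using formal_space.submodule_CD(3,4)[OF Z] vec by metis
qed

text \<open>Presents the formal space as a sum of lines, so that \<open>linear_extension\<close>
  becomes available for it.\<close>

lemma decomposition_formal_space:
  "decomposition formal_space (\<lambda>(i, j). range (\<lambda>c. c \<odot>\<^bsub>formal_space\<^esub> formal_vec i j))
     (\<lambda>(i, j) f. f (i, j) \<odot>\<^bsub>formal_space\<^esub> formal_vec i j)"
proof (intro decomposition.intro decomposition_axioms.intro formal_space.complex_space_axioms, goal_cases)
  case (1 k)
  obtain i j where k: "k = (i, j)" by force
  have fin: "finite {p. c * formal_vec i j p \<noteq> 0}" for c
    by (rule finite_subset[OF _ formal_vec_in[of i j]]) auto
  show ?case unfolding k prod.case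
  proof (rule formal_space.submodule_CI)
    show "\<zero>\<^bsub>formal_space\<^esub> \<in> range (\<lambda>c. c \<odot>\<^bsub>formal_space\<^esub> formal_vec i j)"
      by (rule image_eqI[of _ _ 0]) auto
    show "a \<oplus>\<^bsub>formal_space\<^esub> b \<in> range (\<lambda>c. c \<odot>\<^bsub>formal_space\<^esub> formal_vec i j)"
      if "a \<in> range (\<lambda>c. c \<odot>\<^bsub>formal_space\<^esub> formal_vec i j)" "b \<in> range (\<lambda>c. c \<odot>\<^bsub>formal_space\<^esub> formal_vec i j)" for a b
    proof -
      obtain c d where "a = c \<odot>\<^bsub>formal_space\<^esub> formal_vec i j" "b = d \<odot>\<^bsub>formal_space\<^esub> formal_vec i j"
        using \<open>a \<in> _\<close> \<open>b \<in> _\<close> by blast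
      then show ?thesis by (intro image_eqI[of _ _ "c + d"]) (auto simp: algebra_simps)
    qed
    show "c \<odot>\<^bsub>formal_space\<^esub> a \<in> range (\<lambda>c. c \<odot>\<^bsub>formal_space\<^esub> formal_vec i j)"
      if "a \<in> range (\<lambda>c. c \<odot>\<^bsub>formal_space\<^esub> formal_vec i j)" for a c
    proof -
      obtain d where "a = d \<odot>\<^bsub>formal_space\<^esub> formal_vec i j" using \<open>a \<in> _\<close> by blast
      then show ?thesis by (intro image_eqI[of _ _ "c * d"]) (auto simp: algebra_simps)
    qed
  qed (use fin in auto)
next
  case (2 k)
  have fin: "finite {p. c * formal_vec i j p \<noteq> 0}" for c i j
    by (rule finite_subset[OF _ formal_vec_in[of i j]]) auto
  show ?case by (cases k, rule linear_mapsI) (use fin in \<open>auto simp: algebra_simps\<close>)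
next
  case (6 v)
  then have "finite {p. v p \<noteq> 0}" by simp
  then show ?case by (rule finite_subset[rotated]) auto
next
  case (7 Z)
  have "formal_vec i j \<in> Z" for i j
  proof -
    have "formal_vec i j \<in> range (\<lambda>c. c \<odot>\<^bsub>formal_space\<^esub> formal_vec i j)"
      by (rule image_eqI[of _ _ 1]) auto
    then show ?thesis using 7(2)[of "(i, j)"] by auto
  qed
  then show ?case using formal_space_span[OF 7(1)] by blast
qed (auto simp: fun_eq_iff formal_vec_def split: if_splits)

lemma formal_space_linear_map:
  fixes u :: "nat \<times> nat \<Rightarrow> 'b" and W :: "(complex, 'b, 'n) module_scheme"
  assumes "complex_space W" "\<And>k. u k \<in> carrier W"
  obtains E where "E \<in> linear_maps formal_space W" "\<And>i j. E (formal_vec i j) = u (i, j)"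
proof -
  interpret W: complex_space W by fact
  interpret D: decomposition formal_space "\<lambda>(i, j). range (\<lambda>c. c \<odot>\<^bsub>formal_space\<^esub> formal_vec i j)"
    "\<lambda>(i, j) f. f (i, j) \<odot>\<^bsub>formal_space\<^esub> formal_vec i j"
    by (rule decomposition_formal_space)
  \<comment> \<open>Reading off the coordinate at \<open>k\<close> is linear on the whole space and
    agrees with the wanted map on the line of \<open>k\<close>.\<close>
  have "(\<lambda>f. f k \<odot>\<^bsub>W\<^esub> u k) \<in> linear_maps formal_space W" for k
    using assms(2) by (intro linear_mapsI) (simp_all add: mult.commute)
  then obtain E where E: "E \<in> linear_maps formal_space W"
    "\<And>k f. f \<in> (\<lambda>(i, j). range (\<lambda>c. c \<odot>\<^bsub>formal_space\<^esub> formal_vec i j)) k \<Longrightarrow> E f = f k \<odot>\<^bsub>W\<^esub> u k"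
    using D.linear_extension[OF assms(1), of "\<lambda>k f. f k \<odot>\<^bsub>W\<^esub> u k"] by blast
  have "E (formal_vec i j) = u (i, j)" for i j
  proof -
    have "formal_vec i j \<in> range (\<lambda>c. c \<odot>\<^bsub>formal_space\<^esub> formal_vec i j)"
      by (rule image_eqI[of _ _ 1]) auto
    then have "E (formal_vec i j) = formal_vec i j (i, j) \<odot>\<^bsub>W\<^esub> u (i, j)"
      using E(2)[of "formal_vec i j" "(i, j)"] by simp
    then show ?thesis using assms(2) by (simp add: formal_vec_def)
  qed
  then show ?thesis using E(1) that by blast
qed

lemma formal_space_linear_eqI:
  assumes "complex_space W" "f \<in> linear_maps formal_space W" "g \<in> linear_maps formal_space W"
    "\<And>i j. f (formal_vec i j) = g (formal_vec i j)" "v \<in> carrier formal_space"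
  shows "f v = g v"
  using formal_space_span[OF submodule_equalizer[OF formal_space.complex_space_axioms assms(1-3)], of v]
    assms(4,5) formal_vec_in by auto

lemma sl2_line_submodule:
  assumes "a \<in> carrier sl2"
  shows "submodule (range (\<lambda>c. c \<odot>\<^bsub>sl2\<^esub> a)) CC sl2"
proof (rule sl2.submodule_CI)
  show "\<zero>\<^bsub>sl2\<^esub> \<in> range (\<lambda>c. c \<odot>\<^bsub>sl2\<^esub> a)"
    by (rule image_eqI[of _ _ 0]) (use assms sl2.smult_0_left in auto)
  fix u v assume "u \<in> range (\<lambda>c. c \<odot>\<^bsub>sl2\<^esub> a)" "v \<in> range (\<lambda>c. c \<odot>\<^bsub>sl2\<^esub> a)"
  then show "u \<oplus>\<^bsub>sl2\<^esub> v \<in> range (\<lambda>c. c \<odot>\<^bsub>sl2\<^esub> a)"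
    using assms by (auto simp: sl2.smult_add_left[symmetric] simp del: sl2_simps)
qed (use assms in auto)

lemma complex_space_sl2_line: "a \<in> carrier sl2 \<Longrightarrow> complex_space (sl2_line a)"
  unfolding sl2_line_def by (rule sl2.complex_space_submodule[OF sl2_line_submodule])

lemma sl2_line_simps [simp]:
  "carrier (sl2_line a) = range (\<lambda>c. c \<odot>\<^bsub>sl2\<^esub> a)" "u \<oplus>\<^bsub>sl2_line a\<^esub> v = u + v"
  "c \<odot>\<^bsub>sl2_line a\<^esub> u = c \<odot>\<^bsub>sl2\<^esub> u" "\<zero>\<^bsub>sl2_line a\<^esub> = 0" "bracket (sl2_line a) = bracket sl2"
  by (simp_all add: sl2_line_def sl2_def)

lemma complex_space_line_formal: "a \<in> carrier sl2 \<Longrightarrow> complex_space (line_formal_space a)"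
  unfolding line_formal_space_def
  by (rule complex_space_direct_sum[OF complex_space_sl2_line formal_space.complex_space_axioms])

lemma line_formal_space_simps [simp]:
  "(u, f) \<in> carrier (line_formal_space a) \<longleftrightarrow> u \<in> range (\<lambda>c. c \<odot>\<^bsub>sl2\<^esub> a) \<and> finite {p. f p \<noteq> 0}"
  "\<zero>\<^bsub>line_formal_space a\<^esub> = (0, \<lambda>p. 0)"
  "(u, f) \<oplus>\<^bsub>line_formal_space a\<^esub> (u', f') = (u + u', \<lambda>p. f p + f' p)"
  "c \<odot>\<^bsub>line_formal_space a\<^esub> (u, f) = (c \<odot>\<^bsub>sl2\<^esub> u, \<lambda>p. c * f p)"
  by (simp_all add: line_formal_space_def)

lemma zero_in_line [simp]: "a \<in> carrier sl2 \<Longrightarrow> 0 \<in> range (\<lambda>c. c \<odot>\<^bsub>sl2\<^esub> a)"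
  by (rule image_eqI[of _ _ 0]) (use sl2.smult_0_left in auto)

lemma self_in_line [simp]: "a \<in> carrier sl2 \<Longrightarrow> a \<in> range (\<lambda>c. c \<odot>\<^bsub>sl2\<^esub> a)"
  by (rule image_eqI[of _ _ 1]) (use sl2.smult_1 in auto)

lemma line_formal_basis_in:
  "a \<in> carrier sl2 \<Longrightarrow> (a, \<lambda>p. 0) \<in> carrier (line_formal_space a)"
  "a \<in> carrier sl2 \<Longrightarrow> (0, formal_vec i j) \<in> carrier (line_formal_space a)"
  by (auto simp: formal_vec_in)

lemma line_formal_linear_eqI:
  assumes "a \<in> carrier sl2" "complex_space W" "f \<in> linear_maps (line_formal_space a) W"
    "g \<in> linear_maps (line_formal_space a) W"
    "f (a, \<lambda>p. 0) = g (a, \<lambda>p. 0)" "\<And>i j. f (0, formal_vec i j) = g (0, formal_vec i j)"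
    "v \<in> carrier (line_formal_space a)"
  shows "f v = g v"
proof -
  note f = linear_mapsD[OF assms(3)] and g = linear_mapsD[OF assms(4)]
  have lin: "(\<lambda>\<phi>. k (0, \<phi>)) \<in> linear_maps formal_space W" if k: "k \<in> linear_maps (line_formal_space a) W" for k
  proof (rule linear_mapsI)
    fix u v assume "u \<in> carrier formal_space" "v \<in> carrier formal_space"
    then show "k (0, u \<oplus>\<^bsub>formal_space\<^esub> v) = k (0, u) \<oplus>\<^bsub>W\<^esub> k (0, v)"
      using linear_mapsD(2)[OF k, of "(0, u)" "(0, v)"] assms(1) by simp
  next
    fix c u assume "u \<in> carrier formal_space"
    moreover have "c \<odot>\<^bsub>sl2\<^esub> 0 = 0" using sl2.smult_0_right[of c] by simp
    ultimately show "k (0, c \<odot>\<^bsub>formal_space\<^esub> u) = c \<odot>\<^bsub>W\<^esub> k (0, u)"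
      using linear_mapsD(3)[OF k, of "(0, u)" c] assms(1) by simp
  qed (use linear_mapsD(1)[OF k] assms(1) in auto)
  obtain c \<phi> where v: "v = (c \<odot>\<^bsub>sl2\<^esub> a, \<phi>)" "\<phi> \<in> carrier formal_space"
    using assms(7) by (cases v) auto
  have v': "v = (c \<odot>\<^bsub>line_formal_space a\<^esub> (a, \<lambda>p. 0)) \<oplus>\<^bsub>line_formal_space a\<^esub> (0, \<phi>)"
    using v by simp
  have in1: "(a, \<lambda>p. 0) \<in> carrier (line_formal_space a)" "(0, \<phi>) \<in> carrier (line_formal_space a)"
    using assms(1) v by auto
  have in2: "c \<odot>\<^bsub>line_formal_space a\<^esub> (a, \<lambda>p. 0) \<in> carrier (line_formal_space a)"
    using in1(1) complex_space.smult_in[OF complex_space_line_formal[OF assms(1)]] by blast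
  have "f (0, \<phi>) = g (0, \<phi>)"
    by (rule formal_space_linear_eqI[OF assms(2) lin[OF assms(3)] lin[OF assms(4)] _ v(2)]) (rule assms(6))
  then show ?thesis
    unfolding v' f(2)[OF in2 in1(2)] g(2)[OF in2 in1(2)] f(3)[OF in1(1)] g(3)[OF in1(1)] using assms(5) by simp
qed


section \<open>Minimal graded Lie algebras\<close>

text \<open>The projections stay a parameter: an algebra given by its grading uses
  \<open>component\<close>, a quotient uses the projections it inherits.\<close>

locale graded_lie = lie_algebra L + decomposition L G pr
  for L :: "'a lie" (structure) and G :: "int \<Rightarrow> 'a set" and pr +
  assumes bracket_graded: "a \<in> G n \<Longrightarrow> b \<in> G m \<Longrightarrow> bracket L a b \<in> G (n + m)"
    and generated: "lie_subalgebra S L \<Longrightarrow> local_part L G \<subseteq> S \<Longrightarrow> S = carrier L"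

lemma graded_lieI:
  assumes "graded_lie_algebra L G"
  shows "graded_lie L G (component L G)"
proof -
  interpret lie_algebra L using assms by (simp add: graded_lie_algebra_def)
  interpret decomposition L G "component L G"
    using assms by (intro decomposition_component complex_space_axioms) (simp add: graded_lie_algebra_def)
  show ?thesis
    by (intro graded_lie.intro graded_lie_axioms.intro lie_algebra_axioms decomposition_axioms)
      (use assms in \<open>simp_all add: graded_lie_algebra_def\<close>)
qed

context graded_lie
begin

lemma graded_lie_algebra: "graded_lie_algebra L G"
  unfolding graded_lie_algebra_def
  using lie_algebra_axioms is_direct_sum bracket_graded generated by blast

lemma G_zero: "\<zero> \<in> G n"
  using submodule_CD(2)[OF summand] .

lemma local_part_base: "i \<in> {-1, 0, 1} \<Longrightarrow> a \<in> G i \<Longrightarrow> a \<in> local_part L G"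
proof -
  assume "i \<in> {-1, 0, 1}" and a: "a \<in> G i"
  then consider "i = -1" | "i = 0" | "i = 1" by blast
  then show ?thesis
  proof cases
    case 1
    then have "a = a \<oplus> \<zero> \<oplus> \<zero>" using a summand_in by simp
    then show ?thesis using a 1 G_zero unfolding local_part_def by blast
  next
    case 2
    then have "a = \<zero> \<oplus> a \<oplus> \<zero>" using a summand_in by simp
    then show ?thesis using a 2 G_zero unfolding local_part_def by blast
  next
    case 3
    then have "a = \<zero> \<oplus> \<zero> \<oplus> a" using a summand_in by simp
    then show ?thesis using a 3 G_zero unfolding local_part_def by blast
  qed
qed

lemma local_partE:
  assumes "v \<in> local_part L G"
  obtains a b c where "v = a \<oplus> b \<oplus> c" "a \<in> G (-1)" "b \<in> G 0" "c \<in> G 1"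
  using assms unfolding local_part_def by blast

lemma local_part_submodule: "submodule (local_part L G) CC L"
proof (rule submodule_CI)
  note [simp] = summand_in
  show "local_part L G \<subseteq> carrier L" by (auto elim!: local_partE)
  show "\<zero> \<in> local_part L G" using local_part_base[of 0 \<zero>] G_zero by simp
  show "u \<oplus> v \<in> local_part L G" if u: "u \<in> local_part L G" and v: "v \<in> local_part L G" for u v
  proof -
    obtain a b c where u: "u = a \<oplus> b \<oplus> c" "a \<in> G (-1)" "b \<in> G 0" "c \<in> G 1" using u by (rule local_partE)
    obtain a' b' c' where v: "v = a' \<oplus> b' \<oplus> c'" "a' \<in> G (-1)" "b' \<in> G 0" "c' \<in> G 1" using v by (rule local_partE)
    have in_L: "a \<in> carrier L" "b \<in> carrier L" "c \<in> carrier L" "a' \<in> carrier L" "b' \<in> carrier L" "c' \<in> carrier L"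
      using u v summand_in by blast+
    have "u \<oplus> v = (a \<oplus> a') \<oplus> (b \<oplus> b') \<oplus> (c \<oplus> c')"
      using in_L by (simp add: u(1) v(1) M.a_ac)
    moreover have "a \<oplus> a' \<in> G (-1)" "b \<oplus> b' \<in> G 0" "c \<oplus> c' \<in> G 1"
      using u v submodule_CD(3)[OF summand] by auto
    ultimately show ?thesis unfolding local_part_def by blast
  qed
  show "k \<odot> u \<in> local_part L G" if u: "u \<in> local_part L G" for u k
  proof -
    obtain a b c where u: "u = a \<oplus> b \<oplus> c" "a \<in> G (-1)" "b \<in> G 0" "c \<in> G 1" using u by (rule local_partE)
    have in_L: "a \<in> carrier L" "b \<in> carrier L" "c \<in> carrier L" using u summand_in by blast+
    have "k \<odot> u = k \<odot> a \<oplus> k \<odot> b \<oplus> k \<odot> c"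
      using in_L by (simp add: u(1) smult_add_right)
    moreover have "k \<odot> a \<in> G (-1)" "k \<odot> b \<in> G 0" "k \<odot> c \<in> G 1"
      using u submodule_CD(4)[OF summand] by auto
    ultimately show ?thesis unfolding local_part_def by blast
  qed
qed

lemma generated_by_components:
  assumes S: "lie_subalgebra S L" and "G (-1) \<subseteq> S" "G 0 \<subseteq> S" "G 1 \<subseteq> S"
  shows "S = carrier L"
proof (rule generated[OF S])
  have sub: "submodule S CC L" using S by (simp add: lie_subalgebra_def)
  show "local_part L G \<subseteq> S"
    using assms(2-) by (auto elim!: local_partE intro!: submodule_CD(3)[OF sub])
qed

text \<open>Two homomorphisms agree on a subalgebra, and the local part generates.\<close>

lemma lie_homs_eqI:
  assumes "lie_algebra M" "f \<in> lie_homs L M" "g \<in> lie_homs L M"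
    "\<And>i a. i \<in> {-1, 0, 1} \<Longrightarrow> a \<in> G i \<Longrightarrow> f a = g a" "a \<in> carrier L"
  shows "f a = g a"
proof -
  interpret M: lie_algebra M by fact
  let ?S = "{a \<in> carrier L. f a = g a}"
  have "lie_subalgebra ?S L"
    unfolding lie_subalgebra_def
    using submodule_equalizer[OF complex_space_axioms M.complex_space_axioms, of f g] assms(2,3)
    by (auto simp: lie_homs_def)
  then have "?S = carrier L"
    by (rule generated_by_components) (use assms(4) summand_in in auto)
  then show ?thesis using assms(5) by blast
qed

text \<open>The elements with all components in the sets \<open>Q\<close> form a subalgebra that
  contains the local part, hence fill \<open>L\<close>. Properties that multiply along degrees, such
  as having the eigenvalue \<open>2 powi n\<close>, are proved this way.\<close>

lemma graded_induct:
  assumes Q: "\<And>n. submodule (Q n) CC L" "\<And>n. Q n \<subseteq> G n"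
    and br: "\<And>n m a b. a \<in> Q n \<Longrightarrow> b \<in> Q m \<Longrightarrow> bracket L a b \<in> Q (n + m)"
    and base: "\<And>n. n \<in> {-1, 0, 1} \<Longrightarrow> G n \<subseteq> Q n" and a: "a \<in> G n"
  shows "a \<in> Q n"
proof -
  let ?Z = "{a \<in> carrier L. \<forall>n. pr n a \<in> Q n}"
  note QD = submodule_CD[OF Q(1)]
  have Zsub: "submodule ?Z CC L"
    by (rule submodule_CI) (auto simp: pr_add pr_smult QD)
  have QZ: "Q n \<subseteq> ?Z" for n
    using Q(2)[of n] summand_in pr_eq QD(2) by (fastforce split: if_splits)
  have "bracket L a b \<in> ?Z" if "a \<in> ?Z" "b \<in> ?Z" for a b
  proof -
    \<comment> \<open>Bilinearity is used one side at a time: at first the left factor is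
      homogeneous, afterwards it is split into its components.\<close>
    have 1: "bracket L z b \<in> ?Z" if z: "z \<in> Q i" for z i
    proof -
      have zL: "z \<in> carrier L" using z QD(1) by blast
      have "b \<in> {w \<in> carrier L. bracket L z w \<in> ?Z}"
      proof (rule in_submodule_if_pr_in)
        show "submodule {w \<in> carrier L. bracket L z w \<in> ?Z} CC L"
          by (rule submodule_vimage[OF complex_space_axioms complex_space_axioms ad_linear[OF zL] Zsub])
        show "pr j b \<in> {w \<in> carrier L. bracket L z w \<in> ?Z}" for j
          using br[OF z, of "pr j b" j] \<open>b \<in> ?Z\<close> QZ by auto
      qed (use \<open>b \<in> ?Z\<close> in auto)
      then show ?thesis by blast
    qed
    have bL: "b \<in> carrier L" using \<open>b \<in> ?Z\<close> by blast
    have "a \<in> {w \<in> carrier L. bracket L w b \<in> ?Z}"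
    proof (rule in_submodule_if_pr_in)
      show "submodule {w \<in> carrier L. bracket L w b \<in> ?Z} CC L"
        by (rule submodule_vimage[OF complex_space_axioms complex_space_axioms ad_right_linear[OF bL] Zsub])
      show "pr j a \<in> {w \<in> carrier L. bracket L w b \<in> ?Z}" for j
        using 1[of "pr j a" j] \<open>a \<in> ?Z\<close> by auto
    qed (use \<open>a \<in> ?Z\<close> in auto)
    then show ?thesis by blast
  qed
  then have "lie_subalgebra ?Z L" using Zsub unfolding lie_subalgebra_def by blast
  then have "?Z = carrier L"
    by (rule generated_by_components) (use base QZ in blast)+
  then have "pr n a \<in> Q n" using a summand_in by blast
  then show ?thesis using pr_same[OF a] by simp
qed

end

section \<open>Images of Lie algebras and quotients by graded ideals\<close>

lemma complex_space_image:
  assumes "complex_space V" "carrier W = f ` carrier V" "\<zero>\<^bsub>W\<^esub> = f \<zero>\<^bsub>V\<^esub>"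
    "\<And>u v. u \<in> carrier V \<Longrightarrow> v \<in> carrier V \<Longrightarrow> f u \<oplus>\<^bsub>W\<^esub> f v = f (u \<oplus>\<^bsub>V\<^esub> v)"
    "\<And>c v. v \<in> carrier V \<Longrightarrow> c \<odot>\<^bsub>W\<^esub> f v = f (c \<odot>\<^bsub>V\<^esub> v)"
  shows "complex_space W"
proof -
  interpret V: complex_space V by fact
  show ?thesis
  proof (rule complex_space_intro)
    fix u v w a b
    assume u: "u \<in> carrier W"
    then obtain u' where u': "u = f u'" "u' \<in> carrier V" using assms(2) by auto
    show "\<zero>\<^bsub>W\<^esub> \<oplus>\<^bsub>W\<^esub> u = u" using u' assms(3,4) by simp
    show "a \<odot>\<^bsub>W\<^esub> u \<in> carrier W" using u' assms(2,5) by simp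
    show "(-1) \<odot>\<^bsub>W\<^esub> u \<oplus>\<^bsub>W\<^esub> u = \<zero>\<^bsub>W\<^esub>" using u' assms(3-5) by simp
    show "(a + b) \<odot>\<^bsub>W\<^esub> u = a \<odot>\<^bsub>W\<^esub> u \<oplus>\<^bsub>W\<^esub> b \<odot>\<^bsub>W\<^esub> u" using u' assms(4,5) by simp
    show "(a * b) \<odot>\<^bsub>W\<^esub> u = a \<odot>\<^bsub>W\<^esub> (b \<odot>\<^bsub>W\<^esub> u)" using u' assms(5) by simp
    show "1 \<odot>\<^bsub>W\<^esub> u = u" using u' assms(5) by simp
    assume v: "v \<in> carrier W"
    then obtain v' where v': "v = f v'" "v' \<in> carrier V" using assms(2) by auto
    show "u \<oplus>\<^bsub>W\<^esub> v \<in> carrier W" using u' v' assms(2,4) by simp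
    show "u \<oplus>\<^bsub>W\<^esub> v = v \<oplus>\<^bsub>W\<^esub> u" using u' v' assms(4) by (simp add: V.M.a_comm)
    show "a \<odot>\<^bsub>W\<^esub> (u \<oplus>\<^bsub>W\<^esub> v) = a \<odot>\<^bsub>W\<^esub> u \<oplus>\<^bsub>W\<^esub> a \<odot>\<^bsub>W\<^esub> v"
      using u' v' assms(4,5) by (simp add: V.smult_add_right)
    assume w: "w \<in> carrier W"
    then obtain w' where w': "w = f w'" "w' \<in> carrier V" using assms(2) by auto
    show "u \<oplus>\<^bsub>W\<^esub> v \<oplus>\<^bsub>W\<^esub> w = u \<oplus>\<^bsub>W\<^esub> (v \<oplus>\<^bsub>W\<^esub> w)"
      using u' v' w' assms(4) by (simp add: V.M.a_assoc)
  next
    show "\<zero>\<^bsub>W\<^esub> \<in> carrier W" using assms(2,3) by simp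
  qed
qed

text \<open>\<open>f\<close> may identify elements, so quotients are covered: every identity in
  \<open>M\<close> is the image of one in \<open>L\<close>.\<close>

lemma lie_algebra_image:
  assumes "lie_algebra L" "carrier M = f ` carrier L" "\<zero>\<^bsub>M\<^esub> = f \<zero>\<^bsub>L\<^esub>"
    "\<And>u v. u \<in> carrier L \<Longrightarrow> v \<in> carrier L \<Longrightarrow> f u \<oplus>\<^bsub>M\<^esub> f v = f (u \<oplus>\<^bsub>L\<^esub> v)"
    "\<And>c v. v \<in> carrier L \<Longrightarrow> c \<odot>\<^bsub>M\<^esub> f v = f (c \<odot>\<^bsub>L\<^esub> v)"
    "\<And>u v. u \<in> carrier L \<Longrightarrow> v \<in> carrier L \<Longrightarrow> bracket M (f u) (f v) = f (bracket L u v)"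
  shows "lie_algebra M"
proof (intro lie_algebra.intro lie_algebra_axioms.intro)
  interpret L: lie_algebra L by fact
  show "vector_space_CC M"
    using complex_space_image[OF L.complex_space_axioms assms(2-5)] by (simp add: complex_space_def)
  show "bracket M \<in> bilinear_maps M M M"
    unfolding bilinear_maps_def
  proof (intro CollectI conjI ballI linear_mapsI)
    fix a b c k assume "a \<in> carrier M" "b \<in> carrier M"
    then obtain a' b' where ab: "a = f a'" "b = f b'" "a' \<in> carrier L" "b' \<in> carrier L"
      using assms(2) by auto
    show "bracket M a b \<in> carrier M" "bracket M a b \<in> carrier M" using ab assms(2,6) by simp_all
    show "bracket M a (k \<odot>\<^bsub>M\<^esub> b) = k \<odot>\<^bsub>M\<^esub> bracket M a b"
      using ab assms(5,6) by (simp add: L.bracket_smult_right)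
    show "bracket M (k \<odot>\<^bsub>M\<^esub> b) a = k \<odot>\<^bsub>M\<^esub> bracket M b a"
      using ab assms(5,6) by (simp add: L.bracket_smult_left)
    assume "c \<in> carrier M"
    then obtain c' where c: "c = f c'" "c' \<in> carrier L" using assms(2) by auto
    show "bracket M a (b \<oplus>\<^bsub>M\<^esub> c) = bracket M a b \<oplus>\<^bsub>M\<^esub> bracket M a c"
      using ab c assms(4,6) by (simp add: L.bracket_add_right)
    show "bracket M (b \<oplus>\<^bsub>M\<^esub> c) a = bracket M b a \<oplus>\<^bsub>M\<^esub> bracket M c a"
      using ab c assms(4,6) by (simp add: L.bracket_add_left)
  qed
  fix a assume "a \<in> carrier M"
  then obtain a' where a: "a = f a'" "a' \<in> carrier L" using assms(2) by auto
  show "bracket M a a = \<zero>\<^bsub>M\<^esub>" using a assms(3,6) L.bracket_alternating by simp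
  fix b c assume "b \<in> carrier M" "c \<in> carrier M"
  then obtain b' c' where bc: "b = f b'" "c = f c'" "b' \<in> carrier L" "c' \<in> carrier L"
    using assms(2) by auto
  show "bracket M a (bracket M b c) \<oplus>\<^bsub>M\<^esub> bracket M b (bracket M c a) \<oplus>\<^bsub>M\<^esub> bracket M c (bracket M a b) = \<zero>\<^bsub>M\<^esub>"
    using a bc assms(3,4,6) L.jacobi by simp
qed

text \<open>These identities turn membership of a difference in a submodule into a congruence:
  transitivity, sums, multiples and symmetry, in this order.\<close>

lemma (in complex_space) diff_identities:
  assumes [simp]: "a \<in> carrier V" "b \<in> carrier V" "c \<in> carrier V" "d \<in> carrier V"
  shows "(a \<oplus> (-1) \<odot> b) \<oplus> (b \<oplus> (-1) \<odot> c) = a \<oplus> (-1) \<odot> c"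
    "(a \<oplus> (-1) \<odot> b) \<oplus> (c \<oplus> (-1) \<odot> d) = (a \<oplus> c) \<oplus> (-1) \<odot> (b \<oplus> d)"
    "k \<odot> (a \<oplus> (-1) \<odot> b) = k \<odot> a \<oplus> (-1) \<odot> (k \<odot> b)"
    "(-1) \<odot> (a \<oplus> (-1) \<odot> b) = b \<oplus> (-1) \<odot> a"
proof -
  have "(a \<oplus> (-1) \<odot> b) \<oplus> (b \<oplus> (-1) \<odot> c) = a \<oplus> ((-1) \<odot> b \<oplus> b) \<oplus> (-1) \<odot> c"
    by (simp add: M.a_assoc del: smult_collect)
  then show "(a \<oplus> (-1) \<odot> b) \<oplus> (b \<oplus> (-1) \<odot> c) = a \<oplus> (-1) \<odot> c" by simp
qed (simp_all add: smult_add_right M.a_ac)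

text \<open>
  The quotient of \<open>L\<close> by \<open>I\<close> is carried by a system of representatives \<open>r\<close>, because minimality
  only provides test algebras on subsets of the type of \<open>L\<close>.
\<close>

lemma minimal_graded_ideal_trivial:
  fixes L :: "'a lie"
  assumes min: "minimal_graded_lie_algebra L G"
    and I: "submodule I CC L"
    and ideal: "\<And>a b. a \<in> carrier L \<Longrightarrow> b \<in> I \<Longrightarrow> bracket L a b \<in> I"
    and graded: "\<And>n b. b \<in> I \<Longrightarrow> component L G n b \<in> I"
    and loc: "\<And>n b. n \<in> {-1, 0, 1} \<Longrightarrow> b \<in> I \<Longrightarrow> b \<in> G n \<Longrightarrow> b = \<zero>\<^bsub>L\<^esub>"
  shows "I = {\<zero>\<^bsub>L\<^esub>}"
proof -
  have gr: "graded_lie_algebra L G" using min by (simp add: minimal_graded_lie_algebra_def)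
  interpret graded_lie L G "component L G" by (rule graded_lieI[OF gr])
  note ID = submodule_CD[OF I]
  let ?pr = "component L G"
  define df where "df a b = a \<oplus>\<^bsub>L\<^esub> (-1) \<odot>\<^bsub>L\<^esub> b" for a b
  have df_trans: "df a c \<in> I" if "df a b \<in> I" "df b c \<in> I" "a \<in> carrier L" "b \<in> carrier L" "c \<in> carrier L" for a b c
    using ID(3)[OF that(1,2)] diff_identities(1)[of a b c] that by (simp add: df_def)
  have df_sym: "df b a \<in> I" if "df a b \<in> I" "a \<in> carrier L" "b \<in> carrier L" for a b
    using ID(4)[OF that(1), of "-1"] diff_identities(4)[of a b] that by (simp add: df_def)
  have df_add: "df (a \<oplus>\<^bsub>L\<^esub> c) (b \<oplus>\<^bsub>L\<^esub> d) \<in> I"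
    if "df a b \<in> I" "df c d \<in> I" "a \<in> carrier L" "b \<in> carrier L" "c \<in> carrier L" "d \<in> carrier L" for a b c d
    using ID(3)[OF that(1,2)] diff_identities(2)[of a b c d] that by (simp add: df_def)
  have df_smult: "df (k \<odot>\<^bsub>L\<^esub> a) (k \<odot>\<^bsub>L\<^esub> b) \<in> I" if "df a b \<in> I" "a \<in> carrier L" "b \<in> carrier L" for a b k
    using ID(4)[OF that(1), of k] diff_identities(3)[of a b _ _ k] that by (simp add: df_def)
  have df_bracket: "df (bracket L a c) (bracket L b d) \<in> I"
    if "df a b \<in> I" "df c d \<in> I" and [simp]: "a \<in> carrier L" "b \<in> carrier L" "c \<in> carrier L" "d \<in> carrier L" for a b c d
  proof (rule df_trans)
    have "df (bracket L c a) (bracket L c b) = bracket L c (df a b)"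
      by (simp add: df_def bracket_add_right bracket_smult_right)
    then have "df (bracket L c a) (bracket L c b) \<in> I" using ideal[OF _ that(1), of c] by simp
    then have "df ((-1) \<odot>\<^bsub>L\<^esub> bracket L c a) ((-1) \<odot>\<^bsub>L\<^esub> bracket L c b) \<in> I" by (intro df_smult) auto
    then show "df (bracket L a c) (bracket L b c) \<in> I"
      using bracket_swap[of a c] bracket_swap[of b c] by simp
    have "df (bracket L b c) (bracket L b d) = bracket L b (df c d)"
      by (simp add: df_def bracket_add_right bracket_smult_right)
    then show "df (bracket L b c) (bracket L b d) \<in> I" using ideal[OF _ that(2), of b] by simp
  qed auto
  have df_pr: "df (?pr n a) (?pr n b) \<in> I" if "df a b \<in> I" "a \<in> carrier L" "b \<in> carrier L" for a b n
    using graded[OF that(1), of n] that by (simp add: df_def pr_add pr_smult)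
  have df_refl: "df a a \<in> I" if "a \<in> carrier L" for a using that ID(2) by (simp add: df_def)

  \<comment> \<open>The choice depends only on the class of \<open>a\<close>, since congruent
    elements define the same predicate; so \<open>r\<close> takes equal values exactly on congruent
    elements.\<close>
  define r where "r a = (SOME b. b \<in> carrier L \<and> df b a \<in> I)" for a
  have r: "r a \<in> carrier L" "df (r a) a \<in> I" if "a \<in> carrier L" for a
    using someI[of "\<lambda>b. b \<in> carrier L \<and> df b a \<in> I" a] df_refl that by (auto simp: r_def)
  have r_eq: "r a = r b" if "df a b \<in> I" "a \<in> carrier L" "b \<in> carrier L" for a b
  proof -
    have "(\<lambda>c. c \<in> carrier L \<and> df c a \<in> I) = (\<lambda>c. c \<in> carrier L \<and> df c b \<in> I)"
      using df_trans df_sym that by (intro ext) blast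
    then show ?thesis by (simp add: r_def)
  qed
  have r_eqD: "df a b \<in> I" if "r a = r b" "a \<in> carrier L" "b \<in> carrier L" for a b
    using df_trans[OF df_sym[OF r(2)[OF that(2)]]] r(2)[OF that(3)] r(1) that by (metis df_trans df_sym)
  note r_add = r_eq[OF df_add[OF r(2) r(2)]] and r_smult = r_eq[OF df_smult[OF r(2)]]
    and r_bracket = r_eq[OF df_bracket[OF r(2) r(2)]] and r_pr = r_eq[OF df_pr[OF r(2)]]

  \<comment> \<open>The quotient operations: compute in \<open>L\<close>, then return to the
    representative.\<close>
  define L' where "L' = L\<lparr>carrier := r ` carrier L, zero := r \<zero>\<^bsub>L\<^esub>, add := (\<lambda>a b. r (a \<oplus>\<^bsub>L\<^esub> b)),
    module.smult := (\<lambda>c a. r (c \<odot>\<^bsub>L\<^esub> a)), bracket := (\<lambda>a b. r (bracket L a b))\<rparr>"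
  have L'_simps: "carrier L' = r ` carrier L" "\<zero>\<^bsub>L'\<^esub> = r \<zero>\<^bsub>L\<^esub>" "a \<oplus>\<^bsub>L'\<^esub> b = r (a \<oplus>\<^bsub>L\<^esub> b)"
    "c \<odot>\<^bsub>L'\<^esub> a = r (c \<odot>\<^bsub>L\<^esub> a)" "bracket L' a b = r (bracket L a b)" for a b c
    by (simp_all add: L'_def)
  have Ladd: "r a \<oplus>\<^bsub>L'\<^esub> r b = r (a \<oplus>\<^bsub>L\<^esub> b)" if "a \<in> carrier L" "b \<in> carrier L" for a b
    using r_add[of a b] r(1) that by (simp add: L'_simps)
  have Lsmult: "c \<odot>\<^bsub>L'\<^esub> r a = r (c \<odot>\<^bsub>L\<^esub> a)" if "a \<in> carrier L" for a c
    using r_smult[of a c] r(1) that by (simp add: L'_simps)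
  have Lbracket: "bracket L' (r a) (r b) = r (bracket L a b)" if "a \<in> carrier L" "b \<in> carrier L" for a b
    using r_bracket[of a b] r(1) that by (simp add: L'_simps)
  have "lie_algebra L'"
    by (rule lie_algebra_image[OF lie_algebra_axioms, of _ r]) (use Ladd Lsmult Lbracket L'_simps in auto)
  then interpret L': lie_algebra L' .
  have r_lin: "r \<in> linear_maps L L'"
    by (rule linear_mapsI) (use Ladd Lsmult L'_simps in auto)
  define G' where "G' n = r ` G n" for n
  \<comment> \<open>The projections of \<open>L\<close> respect the congruence because
    \<open>I\<close> is graded; followed by \<open>r\<close> they act on representatives.\<close>
  have "decomposition L' G' (\<lambda>n a. r (?pr n a))"
  proof (intro decomposition.intro decomposition_axioms.intro L'.complex_space_axioms)
    show "submodule (G' n) CC L'" for n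
    proof (rule L'.submodule_CI)
      show "G' n \<subseteq> carrier L'" using summand_in by (auto simp: G'_def L'_simps)
      show "\<zero>\<^bsub>L'\<^esub> \<in> G' n" using G_zero by (auto simp: G'_def L'_simps)
      show "a \<oplus>\<^bsub>L'\<^esub> b \<in> G' n" if "a \<in> G' n" "b \<in> G' n" for a b
        using that submodule_CD(3)[OF summand] summand_in by (auto simp: G'_def Ladd)
      show "c \<odot>\<^bsub>L'\<^esub> a \<in> G' n" if "a \<in> G' n" for a c
        using that submodule_CD(4)[OF summand] summand_in by (auto simp: G'_def Lsmult)
    qed
    show "(\<lambda>a. r (?pr n a)) \<in> linear_maps L' L'" for n
    proof (rule linear_mapsI)
      fix u v c assume "u \<in> carrier L'"
      then obtain u' where u: "u = r u'" "u' \<in> carrier L" by (auto simp: L'_simps)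
      show "r (?pr n u) \<in> carrier L'" using u r(1) by (auto simp: L'_simps)
      show "r (?pr n (c \<odot>\<^bsub>L'\<^esub> u)) = c \<odot>\<^bsub>L'\<^esub> r (?pr n u)"
        using u r(1) by (simp add: Lsmult r_pr pr_smult)
      assume "v \<in> carrier L'"
      then obtain v' where v: "v = r v'" "v' \<in> carrier L" by (auto simp: L'_simps)
      show "r (?pr n (u \<oplus>\<^bsub>L'\<^esub> v)) = r (?pr n u) \<oplus>\<^bsub>L'\<^esub> r (?pr n v)"
        using u v r(1) by (simp add: Ladd r_pr pr_add)
    qed
    show "r (?pr n v) \<in> G' n" if v: "v \<in> carrier L'" for n v
    proof -
      have "v \<in> carrier L" using v r(1) by (auto simp: L'_simps)
      then show ?thesis using pr_in by (simp add: G'_def)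
    qed
    show "r (?pr n v) = v" if v: "v \<in> G' n" for n v
    proof -
      obtain v' where "v = r v'" "v' \<in> G n" using v by (auto simp: G'_def)
      then show ?thesis using r_pr[of v' n] r(1)[of v'] summand_in pr_same by simp
    qed
    show "r (?pr m v) = \<zero>\<^bsub>L'\<^esub>" if v: "v \<in> G' n" and nm: "n \<noteq> m" for n m v
    proof -
      obtain v' where "v = r v'" "v' \<in> G n" using v by (auto simp: G'_def)
      then show ?thesis using r_pr[of v' m] r(1)[of v'] summand_in pr_other nm by (simp add: L'_simps)
    qed
    show "finite {n. r (?pr n v) \<noteq> \<zero>\<^bsub>L'\<^esub>}" if v: "v \<in> carrier L'" for v
    proof (rule finite_subset)
      show "{n. r (?pr n v) \<noteq> \<zero>\<^bsub>L'\<^esub>} \<subseteq> {n. ?pr n v \<noteq> \<zero>\<^bsub>L\<^esub>}" by (auto simp: L'_simps)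
      show "finite {n. ?pr n v \<noteq> \<zero>\<^bsub>L\<^esub>}" using v r(1) by (intro pr_finite) (auto simp: L'_simps)
    qed
    show "carrier L' \<subseteq> Z" if Z: "submodule Z CC L'" "\<And>n. G' n \<subseteq> Z" for Z
    proof -
      have "carrier L \<subseteq> {v \<in> carrier L. r v \<in> Z}"
        by (rule span[OF submodule_vimage[OF complex_space_axioms L'.complex_space_axioms r_lin Z(1)]])
          (use Z(2) summand_in in \<open>auto simp: G'_def\<close>)
      then show ?thesis by (auto simp: L'_simps)
    qed
  qed
  then interpret D': decomposition L' G' "\<lambda>n a. r (?pr n a)" .
  have locL': "local_part L' G' = r ` local_part L G"
  proof -
    have "a \<oplus>\<^bsub>L'\<^esub> b \<oplus>\<^bsub>L'\<^esub> c \<in> r ` local_part L G" if abc: "a \<in> G' (-1)" "b \<in> G' 0" "c \<in> G' 1" for a b c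
    proof -
      obtain a' b' c' where x: "a = r a'" "b = r b'" "c = r c'" "a' \<in> G (-1)" "b' \<in> G 0" "c' \<in> G 1"
        using abc by (auto simp: G'_def)
      then have "a \<oplus>\<^bsub>L'\<^esub> b \<oplus>\<^bsub>L'\<^esub> c = r (a' \<oplus>\<^bsub>L\<^esub> b' \<oplus>\<^bsub>L\<^esub> c')" using Ladd summand_in by simp
      moreover have "a' \<oplus>\<^bsub>L\<^esub> b' \<oplus>\<^bsub>L\<^esub> c' \<in> local_part L G" using x unfolding local_part_def by blast
      ultimately show ?thesis by simp
    qed
    moreover have "r (a \<oplus>\<^bsub>L\<^esub> b \<oplus>\<^bsub>L\<^esub> c) \<in> local_part L' G'" if abc: "a \<in> G (-1)" "b \<in> G 0" "c \<in> G 1" for a b c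
    proof -
      have "r (a \<oplus>\<^bsub>L\<^esub> b \<oplus>\<^bsub>L\<^esub> c) = r a \<oplus>\<^bsub>L'\<^esub> r b \<oplus>\<^bsub>L'\<^esub> r c" using abc Ladd summand_in by simp
      then show ?thesis using abc unfolding local_part_def G'_def by blast
    qed
    ultimately show ?thesis unfolding local_part_def[of L'] by (auto elim!: local_partE)
  qed
  have "graded_lie L' G' (\<lambda>n a. r (?pr n a))"
  proof (intro graded_lie.intro graded_lie_axioms.intro D'.decomposition_axioms L'.lie_algebra_axioms)
    show "bracket L' a b \<in> G' (n + m)" if "a \<in> G' n" "b \<in> G' m" for a b n m
      using that bracket_graded summand_in by (auto simp: G'_def Lbracket)
    show "S = carrier L'" if S: "lie_subalgebra S L'" "local_part L' G' \<subseteq> S" for S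
    proof -
      have Ssub: "submodule S CC L'" using S by (simp add: lie_subalgebra_def)
      have "lie_subalgebra {v \<in> carrier L. r v \<in> S} L"
        unfolding lie_subalgebra_def
      proof (intro conjI ballI)
        show "submodule {v \<in> carrier L. r v \<in> S} CC L"
          by (rule submodule_vimage[OF complex_space_axioms L'.complex_space_axioms r_lin Ssub])
        fix a b assume ab: "a \<in> {v \<in> carrier L. r v \<in> S}" "b \<in> {v \<in> carrier L. r v \<in> S}"
        then have "bracket L' (r a) (r b) \<in> S" using S(1) by (auto simp: lie_subalgebra_def)
        then show "bracket L a b \<in> {v \<in> carrier L. r v \<in> S}" using ab Lbracket by simp
      qed
      moreover have "local_part L G \<subseteq> {v \<in> carrier L. r v \<in> S}"
        using S(2) locL' submodule_CD(1)[OF local_part_submodule] by auto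
      ultimately have "{v \<in> carrier L. r v \<in> S} = carrier L" by (rule generated)
      then show ?thesis using L'.submodule_CD(1)[OF Ssub] by (auto simp: L'_simps)
    qed
  qed
  then interpret GL': graded_lie L' G' "\<lambda>n a. r (?pr n a)" .

  \<comment> \<open>Each component of an element of \<open>I\<close> lies in \<open>I\<close>, and
    those in degrees -1, 0, 1 vanish by \<open>loc\<close>. Hence \<open>r\<close> is injective on
    the local part.\<close>
  have loc_zero: "v = \<zero>\<^bsub>L\<^esub>" if v: "v \<in> local_part L G" "v \<in> I" for v
  proof -
    obtain a b c where abc: "v = a \<oplus>\<^bsub>L\<^esub> b \<oplus>\<^bsub>L\<^esub> c" "a \<in> G (-1)" "b \<in> G 0" "c \<in> G 1"
      using v(1) by (rule local_partE)
    have vL: "v \<in> carrier L" using v ID(1) by blast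
    have in_L: "a \<in> carrier L" "b \<in> carrier L" "c \<in> carrier L" using abc summand_in by blast+
    have pv: "?pr n v = ?pr n a \<oplus>\<^bsub>L\<^esub> ?pr n b \<oplus>\<^bsub>L\<^esub> ?pr n c" for n
      using in_L by (simp add: abc(1) pr_add)
    have "?pr n v = \<zero>\<^bsub>L\<^esub>" for n
    proof (cases "n \<in> {-1, 0, 1}")
      case True
      then show ?thesis using loc[OF True graded[OF v(2)]] pr_in[OF vL] by blast
    next
      case False
      then show ?thesis using pv[of n] pr_eq[OF abc(2), of n] pr_eq[OF abc(3), of n] pr_eq[OF abc(4), of n] by auto
    qed
    then show ?thesis by (rule eq_zero_if_pr_zero[OF vL])
  qed
  note locD = submodule_CD[OF local_part_submodule]
  have r_inj: "inj_on r (local_part L G)"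
  proof (rule inj_onI)
    fix a b assume ab: "a \<in> local_part L G" "b \<in> local_part L G" "r a = r b"
    then have "df a b \<in> I" using r_eqD locD(1) by blast
    moreover have "df a b \<in> local_part L G" using ab locD(3,4) by (simp add: df_def)
    ultimately have "df a b = \<zero>\<^bsub>L\<^esub>" using loc_zero by blast
    then show "a = b" using eq_iff_diff_zero[of a b] ab locD(1) by (simp add: df_def)
  qed
  \<comment> \<open>The isomorphism runs from the local part of the quotient back to that of
    \<open>L\<close>, the direction in which minimality extends it.\<close>
  define f where "f = inv_into (local_part L G) r"
  have fr: "f (r a) = a" if "a \<in> local_part L G" for a
    unfolding f_def using r_inj that by simp
  have Gloc: "a \<in> local_part L G" if "a \<in> G i" "i \<in> {-1, 0, 1}" for a i
    using local_part_base that by blast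
  have "f \<in> local_isos L' G' L G"
    unfolding local_isos_def mem_Collect_eq
  proof (intro conjI ballI impI)
    show "f \<in> linear_isos (L'\<lparr>carrier := local_part L' G'\<rparr>) (L\<lparr>carrier := local_part L G\<rparr>)"
      unfolding linear_isos_def mem_Collect_eq
    proof (intro conjI linear_mapsI)
      show "bij_betw f (carrier (L'\<lparr>carrier := local_part L' G'\<rparr>)) (carrier (L\<lparr>carrier := local_part L G\<rparr>))"
        unfolding f_def locL' using r_inj by (simp add: bij_betw_inv_into bij_betw_imageI)
      fix u v c assume "u \<in> carrier (L'\<lparr>carrier := local_part L' G'\<rparr>)"
      then obtain u' where u: "u = r u'" "u' \<in> local_part L G" by (auto simp: locL')
      show "f u \<in> carrier (L\<lparr>carrier := local_part L G\<rparr>)" using u fr by simp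
      show "f (c \<odot>\<^bsub>L'\<lparr>carrier := local_part L' G'\<rparr>\<^esub> u) = c \<odot>\<^bsub>L\<lparr>carrier := local_part L G\<rparr>\<^esub> f u"
        using u fr Lsmult locD by simp
      assume "v \<in> carrier (L'\<lparr>carrier := local_part L' G'\<rparr>)"
      then obtain v' where v: "v = r v'" "v' \<in> local_part L G" by (auto simp: locL')
      show "f (u \<oplus>\<^bsub>L'\<lparr>carrier := local_part L' G'\<rparr>\<^esub> v) = f u \<oplus>\<^bsub>L\<lparr>carrier := local_part L G\<rparr>\<^esub> f v"
        using u v fr Ladd locD by simp
    qed
    show "f ` G' i = G i" if "i \<in> {-1, 0, 1}" for i
    proof -
      have "f ` G' i = (\<lambda>a. a) ` G i"
        unfolding G'_def image_image using fr Gloc[OF _ that] by (intro image_cong) auto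
      then show ?thesis by simp
    qed
    fix i j :: int and a b
    assume ij: "i \<in> {-1, 0, 1}" "j \<in> {-1, 0, 1}" "i + j \<in> {-1, 0, 1}" and ab: "a \<in> G' i" "b \<in> G' j"
    obtain a' b' where x: "a = r a'" "b = r b'" "a' \<in> G i" "b' \<in> G j" using ab by (auto simp: G'_def)
    show "f (bracket L' a b) = bracket L (f a) (f b)"
      using x ij fr Gloc bracket_graded[OF x(3,4)] Lbracket summand_in by simp
  qed
  then obtain F where F: "F \<in> lie_epis L' L" "\<And>a. a \<in> local_part L' G' \<Longrightarrow> F a = f a"
    using min GL'.graded_lie_algebra unfolding minimal_graded_lie_algebra_def by blast
  have Fhom: "F \<in> lie_homs L' L" using F by (simp add: lie_epis_def)
  then have Flin: "F \<in> linear_maps L' L" by (simp add: lie_homs_def)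
  \<comment> \<open>This endomorphism of \<open>L\<close> is the identity on the local part, hence
    everywhere. So \<open>r\<close> is injective, and as it identifies \<open>I\<close> with zero,
    \<open>I\<close> vanishes.\<close>
  have "(\<lambda>a. F (r a)) \<in> lie_homs L L"
    unfolding lie_homs_def using linear_maps_comp[OF r_lin Flin] Fhom
    by (auto simp: lie_homs_def Lbracket[symmetric] L'_simps(1))
  moreover have "(\<lambda>a. a) \<in> lie_homs L L" by (auto simp: lie_homs_def intro: linear_mapsI)
  moreover have "F (r a) = a" if "i \<in> {-1, 0, 1}" "a \<in> G i" for a i
    using F(2)[of "r a"] fr Gloc[OF that(2,1)] by (auto simp: locL')
  ultimately have Fr: "F (r a) = a" if "a \<in> carrier L" for a
    using lie_homs_eqI[OF lie_algebra_axioms, of "\<lambda>a. F (r a)" "\<lambda>a. a" a] that by blast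
  show ?thesis
  proof (intro equalityI subsetI)
    fix a assume a: "a \<in> I"
    then have aL: "a \<in> carrier L" using ID(1) by blast
    have "df a \<zero>\<^bsub>L\<^esub> \<in> I" using a aL by (simp add: df_def)
    then have "r a = r \<zero>\<^bsub>L\<^esub>" using r_eq aL by simp
    then have "F (r a) = F (r \<zero>\<^bsub>L\<^esub>)" by (rule arg_cong)
    then have "a = \<zero>\<^bsub>L\<^esub>" unfolding Fr[OF aL] Fr[OF M.zero_closed] .
    then show "a \<in> {\<zero>\<^bsub>L\<^esub>}" by simp
  qed (use ID(2) in simp)
qed

text \<open>Minimality with \<open>L\<close> itself as test algebra. The maps are given degree by
  degree because this is how automorphisms arise from a pentad.\<close>

lemma minimal_local_automorphism:
  fixes L :: "'a lie"
  assumes min: "minimal_graded_lie_algebra L G"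
    and g: "\<And>i. i \<in> {-1, 0, 1} \<Longrightarrow> g i \<in> linear_isos (L\<lparr>carrier := G i\<rparr>) (L\<lparr>carrier := G i\<rparr>)"
    and br: "\<And>i j a b. i \<in> {-1, 0, 1} \<Longrightarrow> j \<in> {-1, 0, 1} \<Longrightarrow> i + j \<in> {-1, 0, 1} \<Longrightarrow>
      a \<in> G i \<Longrightarrow> b \<in> G j \<Longrightarrow> g (i + j) (bracket L a b) = bracket L (g i a) (g j b)"
  obtains F where "F \<in> lie_homs L L" "\<And>i a. i \<in> {-1, 0, 1} \<Longrightarrow> a \<in> G i \<Longrightarrow> F a = g i a"
proof -
  have gr: "graded_lie_algebra L G" using min by (simp add: minimal_graded_lie_algebra_def)
  interpret graded_lie L G "component L G" by (rule graded_lieI[OF gr])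
  let ?pr = "component L G"
  have g_in: "g i a \<in> G i" and g_add: "b \<in> G i \<Longrightarrow> g i (a \<oplus>\<^bsub>L\<^esub> b) = g i a \<oplus>\<^bsub>L\<^esub> g i b"
    and g_smult: "g i (c \<odot>\<^bsub>L\<^esub> a) = c \<odot>\<^bsub>L\<^esub> g i a" if "i \<in> {-1, 0, 1}" "a \<in> G i" for i a b c
    using linear_mapsD[OF linear_isosD(1)[OF g[OF that(1)]]] that(2) by simp_all
  have g_inj: "inj_on (g i) (G i)" and g_surj: "g i ` G i = G i" if "i \<in> {-1, 0, 1}" for i
    using linear_isosD(2,3)[OF g[OF that]] by simp_all
  have g_zero: "g i \<zero>\<^bsub>L\<^esub> = \<zero>\<^bsub>L\<^esub>" if "i \<in> {-1, 0, 1}" for i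
    using g_smult[OF that G_zero, of 0] g_in[OF that G_zero] summand_in by simp
  \<comment> \<open>Components outside the local part are dropped; \<open>f\<close> matters only on
    the local part, where it glues the three maps.\<close>
  define f where "f v = g (-1) (?pr (-1) v) \<oplus>\<^bsub>L\<^esub> g 0 (?pr 0 v) \<oplus>\<^bsub>L\<^esub> g 1 (?pr 1 v)" for v
  have pr_abc: "?pr (-1) (a \<oplus>\<^bsub>L\<^esub> b \<oplus>\<^bsub>L\<^esub> c) = a" "?pr 0 (a \<oplus>\<^bsub>L\<^esub> b \<oplus>\<^bsub>L\<^esub> c) = b" "?pr 1 (a \<oplus>\<^bsub>L\<^esub> b \<oplus>\<^bsub>L\<^esub> c) = c"
    if "a \<in> G (-1)" "b \<in> G 0" "c \<in> G 1" for a b c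
    using that summand_in[OF that(1)] summand_in[OF that(2)] summand_in[OF that(3)]
      pr_eq[OF that(1)] pr_eq[OF that(2)] pr_eq[OF that(3)] by (simp_all add: pr_add)
  have f_abc: "f (a \<oplus>\<^bsub>L\<^esub> b \<oplus>\<^bsub>L\<^esub> c) = g (-1) a \<oplus>\<^bsub>L\<^esub> g 0 b \<oplus>\<^bsub>L\<^esub> g 1 c"
    if "a \<in> G (-1)" "b \<in> G 0" "c \<in> G 1" for a b c
    unfolding f_def pr_abc[OF that] by simp
  have f_G: "f a = g i a" if "i \<in> {-1, 0, 1}" "a \<in> G i" for i a
    using that g_zero g_in[OF that] summand_in pr_eq[OF that(2)] unfolding f_def by auto
  have locI: "a \<oplus>\<^bsub>L\<^esub> b \<oplus>\<^bsub>L\<^esub> c \<in> local_part L G" if "a \<in> G (-1)" "b \<in> G 0" "c \<in> G 1" for a b c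
    using that unfolding local_part_def by blast
  note locD = submodule_CD[OF local_part_submodule]
  have pr_G: "?pr i v \<in> G i" if "v \<in> local_part L G" for i v using pr_in locD(1)[OF that] .
  have "f \<in> local_isos L G L G"
    unfolding local_isos_def mem_Collect_eq
  proof (intro conjI ballI impI)
    show "f \<in> linear_isos (L\<lparr>carrier := local_part L G\<rparr>) (L\<lparr>carrier := local_part L G\<rparr>)"
      unfolding linear_isos_def mem_Collect_eq
    proof (intro conjI linear_mapsI)
      fix u v c assume "u \<in> carrier (L\<lparr>carrier := local_part L G\<rparr>)"
      then have u: "u \<in> local_part L G" by simp
      show "f u \<in> carrier (L\<lparr>carrier := local_part L G\<rparr>)"
        using locI g_in pr_G[OF u] by (simp add: f_def)
      have in_L: "g i (?pr i u) \<in> carrier L" if "i \<in> {-1, 0, 1}" for i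
        using g_in[OF that pr_G[OF u]] summand_in by blast
      show "f (c \<odot>\<^bsub>L\<lparr>carrier := local_part L G\<rparr>\<^esub> u) = c \<odot>\<^bsub>L\<lparr>carrier := local_part L G\<rparr>\<^esub> f u"
        using locD(1)[OF u] in_L pr_G[OF u]
        by (simp add: f_def pr_smult g_smult smult_add_right)
      assume "v \<in> carrier (L\<lparr>carrier := local_part L G\<rparr>)"
      then have v: "v \<in> local_part L G" by simp
      have in_L': "g i (?pr i v) \<in> carrier L" if "i \<in> {-1, 0, 1}" for i
        using g_in[OF that pr_G[OF v]] summand_in by blast
      show "f (u \<oplus>\<^bsub>L\<lparr>carrier := local_part L G\<rparr>\<^esub> v) = f u \<oplus>\<^bsub>L\<lparr>carrier := local_part L G\<rparr>\<^esub> f v"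
        using locD(1)[OF u] locD(1)[OF v] in_L in_L' pr_G[OF u] pr_G[OF v]
        by (simp add: f_def pr_add g_add M.a_ac)
    next
      have "inj_on f (local_part L G)"
      proof (rule inj_onI)
        fix u v assume u: "u \<in> local_part L G" and v: "v \<in> local_part L G" and eq: "f u = f v"
        obtain a b c where u': "u = a \<oplus>\<^bsub>L\<^esub> b \<oplus>\<^bsub>L\<^esub> c" "a \<in> G (-1)" "b \<in> G 0" "c \<in> G 1"
          using u by (rule local_partE)
        obtain a' b' c' where v': "v = a' \<oplus>\<^bsub>L\<^esub> b' \<oplus>\<^bsub>L\<^esub> c'" "a' \<in> G (-1)" "b' \<in> G 0" "c' \<in> G 1"
          using v by (rule local_partE)
        have eq': "g (-1) a \<oplus>\<^bsub>L\<^esub> g 0 b \<oplus>\<^bsub>L\<^esub> g 1 c = g (-1) a' \<oplus>\<^bsub>L\<^esub> g 0 b' \<oplus>\<^bsub>L\<^esub> g 1 c'"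
          using eq f_abc[OF u'(2-)] f_abc[OF v'(2-)] u'(1) v'(1) by simp
        have gs: "g (-1) a \<in> G (-1)" "g 0 b \<in> G 0" "g 1 c \<in> G 1" "g (-1) a' \<in> G (-1)" "g 0 b' \<in> G 0" "g 1 c' \<in> G 1"
          using g_in u' v' by simp_all
        have "g (-1) a = g (-1) a'" "g 0 b = g 0 b'" "g 1 c = g 1 c'"
          using pr_abc[OF gs(1-3)] pr_abc[OF gs(4-6)] eq' by simp_all
        then have "a = a'" "b = b'" "c = c'"
          using g_inj[of "-1"] g_inj[of 0] g_inj[of 1] u' v' by (auto dest!: inj_onD)
        then show "u = v" using u'(1) v'(1) by simp
      qed
      moreover have "f ` local_part L G = local_part L G"
      proof (intro equalityI subsetI)
        fix w assume "w \<in> f ` local_part L G"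
        then show "w \<in> local_part L G" using locI g_in pr_G by (auto simp: f_def)
      next
        fix w assume "w \<in> local_part L G"
        then obtain a b c where w: "w = a \<oplus>\<^bsub>L\<^esub> b \<oplus>\<^bsub>L\<^esub> c" "a \<in> G (-1)" "b \<in> G 0" "c \<in> G 1"
          by (rule local_partE)
        have "a \<in> g (-1) ` G (-1)" "b \<in> g 0 ` G 0" "c \<in> g 1 ` G 1"
          using g_surj[of "-1"] g_surj[of 0] g_surj[of 1] w by simp_all
        then obtain a' b' c' where x: "a = g (-1) a'" "b = g 0 b'" "c = g 1 c'"
          "a' \<in> G (-1)" "b' \<in> G 0" "c' \<in> G 1" by blast
        have "w = f (a' \<oplus>\<^bsub>L\<^esub> b' \<oplus>\<^bsub>L\<^esub> c')" using f_abc[OF x(4-6)] w(1) x by simp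
        then show "w \<in> f ` local_part L G" using locI[OF x(4-6)] by blast
      qed
      ultimately show "bij_betw f (carrier (L\<lparr>carrier := local_part L G\<rparr>)) (carrier (L\<lparr>carrier := local_part L G\<rparr>))"
        by (simp add: bij_betw_def)
    qed
    show "f ` G i = G i" if "i \<in> {-1, 0, 1}" for i
      using f_G[OF that] g_surj[OF that] by (metis image_cong)
    show "f (bracket L a b) = bracket L (f a) (f b)"
      if "i \<in> {-1, 0, 1}" "j \<in> {-1, 0, 1}" "i + j \<in> {-1, 0, 1}" "a \<in> G i" "b \<in> G j" for i j a b
      using br[OF that] f_G[OF that(1,4)] f_G[OF that(2,5)] f_G[OF that(3) bracket_graded[OF that(4,5)]] by simp
  qed
  then obtain F where F: "F \<in> lie_epis L L" "\<And>a. a \<in> local_part L G \<Longrightarrow> F a = f a"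
    using min gr unfolding minimal_graded_lie_algebra_def by blast
  show ?thesis
    by (rule that[of F]) (use F f_G local_part_base in \<open>auto simp: lie_epis_def\<close>)
qed

section \<open>Associated Lie algebras\<close>

text \<open>
  The data of an associated Lie algebra, with \<open>\<V>\<close> replaced by a space \<open>W\<close> that is paired
  with \<open>V\<close> by \<open>p\<close>.
\<close>

locale pairing_algebra =
  g: lie_algebra g + V: complex_space V + W: complex_space W + graded_lie L G "component L G"
  for g :: "'g lie" and V :: "(complex, 'v) module" and W :: "(complex, 'w) module"
    and L :: "'a lie" and G :: "int \<Rightarrow> 'a set" +
  fixes \<rho> :: "'g \<Rightarrow> 'v \<Rightarrow> 'v" and \<rho>' :: "'g \<Rightarrow> 'w \<Rightarrow> 'w" and B :: "'g \<Rightarrow> 'g \<Rightarrow> complex"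
    and p :: "'v \<Rightarrow> 'w \<Rightarrow> complex" and P :: "'v \<Rightarrow> 'w \<Rightarrow> 'g"
    and i0 :: "'g \<Rightarrow> 'a" and i1 :: "'v \<Rightarrow> 'a" and im :: "'w \<Rightarrow> 'a"
  assumes minimal: "minimal_graded_lie_algebra L G"
    and rho: "a \<in> carrier g \<Longrightarrow> v \<in> carrier V \<Longrightarrow> \<rho> a v \<in> carrier V"
    and rho': "a \<in> carrier g \<Longrightarrow> w \<in> carrier W \<Longrightarrow> \<rho>' a w \<in> carrier W"
    and B_linear: "a \<in> carrier g \<Longrightarrow> B a \<in> linear_maps g scalar_space"
    and B_nondeg: "b \<in> carrier g \<Longrightarrow> (\<And>a. a \<in> carrier g \<Longrightarrow> B a b = 0) \<Longrightarrow> b = \<zero>\<^bsub>g\<^esub>"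
    and p_bilinear: "p \<in> bilinear_maps V W scalar_space"
    and p_nondeg: "w \<in> carrier W \<Longrightarrow> (\<And>v. v \<in> carrier V \<Longrightarrow> p v w = 0) \<Longrightarrow> w = \<zero>\<^bsub>W\<^esub>"
    and p_invariant: "a \<in> carrier g \<Longrightarrow> v \<in> carrier V \<Longrightarrow> w \<in> carrier W \<Longrightarrow> p (\<rho> a v) w = - p v (\<rho>' a w)"
    and i0: "i0 \<in> linear_isos g (L\<lparr>carrier := G 0\<rparr>)"
    and i1: "i1 \<in> linear_isos V (L\<lparr>carrier := G 1\<rparr>)"
    and im: "im \<in> linear_isos W (L\<lparr>carrier := G (-1)\<rparr>)"
    and bracket_00: "a \<in> carrier g \<Longrightarrow> b \<in> carrier g \<Longrightarrow> bracket L (i0 a) (i0 b) = i0 (bracket g a b)"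
    and bracket_01: "a \<in> carrier g \<Longrightarrow> v \<in> carrier V \<Longrightarrow> bracket L (i0 a) (i1 v) = i1 (\<rho> a v)"
    and bracket_0m: "a \<in> carrier g \<Longrightarrow> w \<in> carrier W \<Longrightarrow> bracket L (i0 a) (im w) = im (\<rho>' a w)"
    and bracket_1m: "v \<in> carrier V \<Longrightarrow> w \<in> carrier W \<Longrightarrow> bracket L (i1 v) (im w) = i0 (P v w)"
    and P_in: "v \<in> carrier V \<Longrightarrow> w \<in> carrier W \<Longrightarrow> P v w \<in> carrier g"
    and P: "a \<in> carrier g \<Longrightarrow> v \<in> carrier V \<Longrightarrow> w \<in> carrier W \<Longrightarrow> B a (P v w) = p (\<rho> a v) w"

text \<open>\<open>associated_lie_algebra\<close> works with functionals on \<open>V\<close>.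
  Nondegeneracy makes the map from \<open>W\<close> to functionals injective, so \<open>W\<close>
  itself can serve as the component of degree -1, with the action \<open>\<rho>'\<close>.\<close>

lemma pairing_algebraI:
  fixes g :: "'g lie" and V :: "(complex, 'v) module" and W :: "(complex, 'w) module" and L :: "'a lie"
  assumes L: "associated_lie_algebra g \<rho> V (dual_image V W p) B L G"
    and g: "lie_algebra g" and V: "complex_space V" and W: "complex_space W"
    and rho: "\<And>a v. a \<in> carrier g \<Longrightarrow> v \<in> carrier V \<Longrightarrow> \<rho> a v \<in> carrier V"
    and rho': "\<And>a w. a \<in> carrier g \<Longrightarrow> w \<in> carrier W \<Longrightarrow> \<rho>' a w \<in> carrier W"
    and B_linear: "\<And>a. a \<in> carrier g \<Longrightarrow> B a \<in> linear_maps g scalar_space"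
    and B_nondeg: "\<And>b. b \<in> carrier g \<Longrightarrow> (\<And>a. a \<in> carrier g \<Longrightarrow> B a b = 0) \<Longrightarrow> b = \<zero>\<^bsub>g\<^esub>"
    and p_bilinear: "p \<in> bilinear_maps V W scalar_space"
    and p_nondeg: "\<And>w. w \<in> carrier W \<Longrightarrow> (\<And>v. v \<in> carrier V \<Longrightarrow> p v w = 0) \<Longrightarrow> w = \<zero>\<^bsub>W\<^esub>"
    and p_invariant: "\<And>a v w. a \<in> carrier g \<Longrightarrow> v \<in> carrier V \<Longrightarrow> w \<in> carrier W \<Longrightarrow>
      p (\<rho> a v) w = - p v (\<rho>' a w)"
  obtains P i0 i1 im where "pairing_algebra g V W L G \<rho> \<rho>' B p P i0 i1 im"
proof -
  interpret g: lie_algebra g by fact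
  interpret V: complex_space V by fact
  interpret W: complex_space W by fact
  have min: "minimal_graded_lie_algebra L G" using L by (simp add: associated_lie_algebra_def)
  have gr: "graded_lie_algebra L G" using min by (simp add: minimal_graded_lie_algebra_def)
  interpret graded_lie L G "component L G" by (rule graded_lieI[OF gr])
  define D where "D w = (\<lambda>v\<in>carrier V. p v w)" for w
  have DV: "dual_image V W p = D ` carrier W" by (simp add: dual_image_def D_def)
  obtain \<Phi> \<iota>0 \<iota>1 \<iota>m where Phi: "is_Phi g \<rho> V (D ` carrier W) B \<Phi>"
    and i0: "\<iota>0 \<in> linear_isos g (L\<lparr>carrier := G 0\<rparr>)" and i1: "\<iota>1 \<in> linear_isos V (L\<lparr>carrier := G 1\<rparr>)"
    and im: "\<iota>m \<in> linear_isos ((dual_space V)\<lparr>carrier := D ` carrier W\<rparr>) (L\<lparr>carrier := G (-1)\<rparr>)"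
    and b00: "\<forall>a\<in>carrier g. \<forall>b\<in>carrier g. bracket L (\<iota>0 a) (\<iota>0 b) = \<iota>0 (bracket g a b)"
    and b01: "\<forall>a\<in>carrier g. \<forall>v\<in>carrier V. bracket L (\<iota>0 a) (\<iota>1 v) = \<iota>1 (\<rho> a v)"
    and b0m: "\<forall>a\<in>carrier g. \<forall>\<phi>\<in>D ` carrier W. bracket L (\<iota>0 a) (\<iota>m \<phi>) = \<iota>m (dual_action V \<rho> a \<phi>)"
    and b1m: "\<forall>v\<in>carrier V. \<forall>\<phi>\<in>D ` carrier W. bracket L (\<iota>1 v) (\<iota>m \<phi>) = \<iota>0 (\<Phi> v \<phi>)"
    using L unfolding associated_lie_algebra_def DV by blast
  note imD = linear_isosD[OF im]
  note pl = linear_mapsD[OF bilinear_mapsD(1)[OF p_bilinear]]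
  have D_add: "D (w \<oplus>\<^bsub>W\<^esub> w') = D w \<oplus>\<^bsub>dual_space V\<^esub> D w'" if "w \<in> carrier W" "w' \<in> carrier W" for w w'
    using that pl(2) by (auto simp: D_def dual_space_def fun_eq_iff)
  have D_smult: "D (c \<odot>\<^bsub>W\<^esub> w) = c \<odot>\<^bsub>dual_space V\<^esub> D w" if "w \<in> carrier W" for w c
    using that pl(3) by (auto simp: D_def dual_space_def fun_eq_iff)
  have D_inj: "inj_on D (carrier W)"
  proof (rule inj_onI)
    fix w w' assume w: "w \<in> carrier W" "w' \<in> carrier W" and eq: "D w = D w'"
    have "p v w = p v w'" if "v \<in> carrier V" for v
      using fun_cong[OF eq, of v] that by (simp add: D_def)
    then have "p v (w \<oplus>\<^bsub>W\<^esub> (-1) \<odot>\<^bsub>W\<^esub> w') = 0" if "v \<in> carrier V" for v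
      using that w pl(2,3) by simp
    then have "w \<oplus>\<^bsub>W\<^esub> (-1) \<odot>\<^bsub>W\<^esub> w' = \<zero>\<^bsub>W\<^esub>" using w by (intro p_nondeg) auto
    then show "w = w'" using W.eq_iff_diff_zero[OF w] by simp
  qed
  \<comment> \<open>Invariance of \<open>p\<close> says precisely that the dual action on the
    functional of \<open>w\<close> is given by \<open>\<rho>'\<close>.\<close>
  have D_act: "dual_action V \<rho> a (D w) = D (\<rho>' a w)" if "a \<in> carrier g" "w \<in> carrier W" for a w
    using that rho p_invariant by (auto simp: dual_action_def D_def fun_eq_iff)
  have "pairing_algebra g V W L G \<rho> \<rho>' B p (\<lambda>v w. \<Phi> v (D w)) \<iota>0 \<iota>1 (\<lambda>w. \<iota>m (D w))"
  proof (intro pairing_algebra.intro pairing_algebra_axioms.intro graded_lie_axioms g V W min i0 i1 p_bilinear)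
    show "(\<lambda>w. \<iota>m (D w)) \<in> linear_isos W (L\<lparr>carrier := G (-1)\<rparr>)"
      unfolding linear_isos_def mem_Collect_eq
    proof (intro conjI linear_mapsI)
      show "bij_betw (\<lambda>w. \<iota>m (D w)) (carrier W) (carrier (L\<lparr>carrier := G (-1)\<rparr>))"
        using imD(2,3) D_inj by (auto simp: bij_betw_def inj_on_def)
    qed (use linear_mapsD[OF imD(1)] D_add D_smult in auto)
    show "\<Phi> v (D w) \<in> carrier g" if "v \<in> carrier V" "w \<in> carrier W" for v w
    proof -
      have "\<Phi> \<in> bilinear_maps V ((dual_space V)\<lparr>carrier := D ` carrier W\<rparr>) g"
        using Phi by (simp add: is_Phi_def)
      from linear_mapsD(1)[OF bilinear_mapsD(1)[OF this that(1)], of "D w"] that(2) show ?thesis by simp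
    qed
    show "B a (\<Phi> v (D w)) = p (\<rho> a v) w" if "a \<in> carrier g" "v \<in> carrier V" "w \<in> carrier W" for a v w
      using Phi that rho by (auto simp: is_Phi_def D_def)
    show "bracket L (\<iota>0 a) (\<iota>m (D w)) = \<iota>m (D (\<rho>' a w))" if "a \<in> carrier g" "w \<in> carrier W" for a w
      using b0m D_act that by auto
    show "w = \<zero>\<^bsub>W\<^esub>" if "w \<in> carrier W" "\<And>v. v \<in> carrier V \<Longrightarrow> p v w = 0" for w
      using p_nondeg that by blast
    show "b = \<zero>\<^bsub>g\<^esub>" if "b \<in> carrier g" "\<And>a. a \<in> carrier g \<Longrightarrow> B a b = 0" for b
      using B_nondeg that by blast
  qed (use rho rho' p_invariant b00 b01 b1m B_linear in auto)
  then show ?thesis by (rule that)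
qed

context pairing_algebra
begin

lemma i0_simps:
  "a \<in> carrier g \<Longrightarrow> i0 a \<in> G 0"
  "a \<in> carrier g \<Longrightarrow> b \<in> carrier g \<Longrightarrow> i0 (a \<oplus>\<^bsub>g\<^esub> b) = i0 a \<oplus>\<^bsub>L\<^esub> i0 b"
  "a \<in> carrier g \<Longrightarrow> i0 (c \<odot>\<^bsub>g\<^esub> a) = c \<odot>\<^bsub>L\<^esub> i0 a"
  using linear_mapsD[OF linear_isosD(1)[OF i0]] by simp_all

lemma i1_simps:
  "v \<in> carrier V \<Longrightarrow> i1 v \<in> G 1"
  "u \<in> carrier V \<Longrightarrow> v \<in> carrier V \<Longrightarrow> i1 (u \<oplus>\<^bsub>V\<^esub> v) = i1 u \<oplus>\<^bsub>L\<^esub> i1 v"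
  "v \<in> carrier V \<Longrightarrow> i1 (c \<odot>\<^bsub>V\<^esub> v) = c \<odot>\<^bsub>L\<^esub> i1 v"
  using linear_mapsD[OF linear_isosD(1)[OF i1]] by simp_all

lemma im_simps:
  "w \<in> carrier W \<Longrightarrow> im w \<in> G (-1)"
  "u \<in> carrier W \<Longrightarrow> w \<in> carrier W \<Longrightarrow> im (u \<oplus>\<^bsub>W\<^esub> w) = im u \<oplus>\<^bsub>L\<^esub> im w"
  "w \<in> carrier W \<Longrightarrow> im (c \<odot>\<^bsub>W\<^esub> w) = c \<odot>\<^bsub>L\<^esub> im w"
  using linear_mapsD[OF linear_isosD(1)[OF im]] by simp_all

lemma i_in [simp]:
  "a \<in> carrier g \<Longrightarrow> i0 a \<in> carrier L" "v \<in> carrier V \<Longrightarrow> i1 v \<in> carrier L" "w \<in> carrier W \<Longrightarrow> im w \<in> carrier L"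
  using i0_simps(1) i1_simps(1) im_simps(1) summand_in by blast+

lemma i_linear: "i0 \<in> linear_maps g L" "i1 \<in> linear_maps V L" "im \<in> linear_maps W L"
  using i0_simps i1_simps im_simps by (auto intro!: linear_mapsI)

lemma i_inj: "inj_on i0 (carrier g)" "inj_on i1 (carrier V)" "inj_on im (carrier W)"
  using linear_isosD(2)[OF i0] linear_isosD(2)[OF i1] linear_isosD(2)[OF im] .

lemma G_images: "G 0 = i0 ` carrier g" "G 1 = i1 ` carrier V" "G (-1) = im ` carrier W"
  using linear_isosD(3)[OF i0] linear_isosD(3)[OF i1] linear_isosD(3)[OF im] by simp_all

lemma i_zero:
  "i0 \<zero>\<^bsub>g\<^esub> = \<zero>\<^bsub>L\<^esub>" "i1 \<zero>\<^bsub>V\<^esub> = \<zero>\<^bsub>L\<^esub>" "im \<zero>\<^bsub>W\<^esub> = \<zero>\<^bsub>L\<^esub>"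
  using linear_maps_zero[OF g.complex_space_axioms complex_space_axioms i_linear(1)]
    linear_maps_zero[OF V.complex_space_axioms complex_space_axioms i_linear(2)]
    linear_maps_zero[OF W.complex_space_axioms complex_space_axioms i_linear(3)] .

lemma i_eq_zero:
  "a \<in> carrier g \<Longrightarrow> i0 a = \<zero>\<^bsub>L\<^esub> \<Longrightarrow> a = \<zero>\<^bsub>g\<^esub>"
  "v \<in> carrier V \<Longrightarrow> i1 v = \<zero>\<^bsub>L\<^esub> \<Longrightarrow> v = \<zero>\<^bsub>V\<^esub>"
  "w \<in> carrier W \<Longrightarrow> im w = \<zero>\<^bsub>L\<^esub> \<Longrightarrow> w = \<zero>\<^bsub>W\<^esub>"
  using inj_onD[OF i_inj(1), of a "\<zero>\<^bsub>g\<^esub>"] inj_onD[OF i_inj(2), of v "\<zero>\<^bsub>V\<^esub>"]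
    inj_onD[OF i_inj(3), of w "\<zero>\<^bsub>W\<^esub>"] i_zero by simp_all

text \<open>Compatibility of \<open>\<tau>\<close> with the action and of \<open>s\<close> with
  \<open>P\<close> follows from the nondegeneracy of \<open>p\<close> and \<open>B\<close>, so for a
  candidate only the bracket, the action on \<open>V\<close> and the two forms have to be
  checked.\<close>

lemma automorphism:
  assumes s: "s \<in> linear_isos g g" and s_br: "\<And>a b. a \<in> carrier g \<Longrightarrow> b \<in> carrier g \<Longrightarrow> s (bracket g a b) = bracket g (s a) (s b)"
    and s_B: "\<And>a b. a \<in> carrier g \<Longrightarrow> b \<in> carrier g \<Longrightarrow> B (s a) (s b) = B a b"
    and \<sigma>: "\<sigma> \<in> linear_isos V V" and \<sigma>_rho: "\<And>a v. a \<in> carrier g \<Longrightarrow> v \<in> carrier V \<Longrightarrow> \<sigma> (\<rho> a v) = \<rho> (s a) (\<sigma> v)"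
    and \<tau>: "\<tau> \<in> linear_isos W W" and \<tau>_p: "\<And>v w. v \<in> carrier V \<Longrightarrow> w \<in> carrier W \<Longrightarrow> p (\<sigma> v) (\<tau> w) = p v w"
  obtains F where "F \<in> lie_homs L L" "\<And>a. a \<in> carrier g \<Longrightarrow> F (i0 a) = i0 (s a)"
    "\<And>v. v \<in> carrier V \<Longrightarrow> F (i1 v) = i1 (\<sigma> v)" "\<And>w. w \<in> carrier W \<Longrightarrow> F (im w) = im (\<tau> w)"
proof -
  note sD = linear_isosD[OF s] and \<sigma>D = linear_isosD[OF \<sigma>] and \<tau>D = linear_isosD[OF \<tau>]
  note s_in = linear_mapsD(1)[OF sD(1)] and \<sigma>_in = linear_mapsD(1)[OF \<sigma>D(1)] and \<tau>_in = linear_mapsD(1)[OF \<tau>D(1)]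
  note pl = linear_mapsD[OF bilinear_mapsD(1)[OF p_bilinear]]
  have \<tau>_rho: "\<tau> (\<rho>' a w) = \<rho>' (s a) (\<tau> w)" if a: "a \<in> carrier g" and w: "w \<in> carrier W" for a w
  proof -
    let ?u = "\<tau> (\<rho>' a w)" and ?u' = "\<rho>' (s a) (\<tau> w)"
    have u: "?u \<in> carrier W" "?u' \<in> carrier W" using a w s_in \<tau>_in rho' by auto
    \<comment> \<open>Every \<open>v\<close> is a value of \<open>\<sigma>\<close>, so the pairing
      with \<open>v\<close> can be moved back to a preimage.\<close>
    have "p v (?u \<oplus>\<^bsub>W\<^esub> (-1) \<odot>\<^bsub>W\<^esub> ?u') = 0" if "v \<in> carrier V" for v
    proof -
      have "v \<in> \<sigma> ` carrier V" using that \<sigma>D(3) by simp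
      then obtain v' where v': "v = \<sigma> v'" "v' \<in> carrier V" by blast
      have "p v ?u = p v' (\<rho>' a w)" using v' \<tau>_p rho' a w by simp
      also have "\<dots> = - p (\<rho> a v') w" using p_invariant[OF a v'(2) w] by simp
      also have "\<dots> = - p (\<rho> (s a) v) (\<tau> w)" using \<tau>_p[of "\<rho> a v'" w] \<sigma>_rho rho a w v' by simp
      also have "\<dots> = p v ?u'" using p_invariant[of "s a" v "\<tau> w"] s_in \<tau>_in a w that by simp
      finally show ?thesis using that u pl(2,3) by simp
    qed
    then have "?u \<oplus>\<^bsub>W\<^esub> (-1) \<odot>\<^bsub>W\<^esub> ?u' = \<zero>\<^bsub>W\<^esub>" using u by (intro p_nondeg) auto
    then show ?thesis using W.eq_iff_diff_zero[OF u] by simp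
  qed
  have s_P: "s (P v w) = P (\<sigma> v) (\<tau> w)" if v: "v \<in> carrier V" and w: "w \<in> carrier W" for v w
  proof -
    let ?u = "s (P v w)" and ?u' = "P (\<sigma> v) (\<tau> w)"
    have u: "?u \<in> carrier g" "?u' \<in> carrier g" using v w P_in s_in \<sigma>_in \<tau>_in by auto
    have "B a (?u \<oplus>\<^bsub>g\<^esub> (-1) \<odot>\<^bsub>g\<^esub> ?u') = 0" if a: "a \<in> carrier g" for a
    proof -
      have "a \<in> s ` carrier g" using a sD(3) by simp
      then obtain a' where a': "a = s a'" "a' \<in> carrier g" by blast
      have "B a ?u = B a' (P v w)" using a' s_B P_in v w by simp
      also have "\<dots> = p (\<rho> a' v) w" using P a' v w by simp
      also have "\<dots> = p (\<rho> a (\<sigma> v)) (\<tau> w)" using \<tau>_p[of "\<rho> a' v" w] \<sigma>_rho rho a' v w by simp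
      also have "\<dots> = B a ?u'" using P a \<sigma>_in \<tau>_in v w by simp
      finally show ?thesis using u linear_mapsD(2,3)[OF B_linear[OF a]] by simp
    qed
    then have "?u \<oplus>\<^bsub>g\<^esub> (-1) \<odot>\<^bsub>g\<^esub> ?u' = \<zero>\<^bsub>g\<^esub>" using u by (intro B_nondeg) auto
    then show ?thesis using g.eq_iff_diff_zero[OF u] by simp
  qed
  \<comment> \<open>The maps of \<open>g\<close>, \<open>V\<close>, \<open>W\<close> carried over to
    the components of degree 0, 1 and -1; the last branch is meant for -1 only.\<close>
  define k where "k i = (if i = (0::int) then (\<lambda>a. i0 (s (inv_into (carrier g) i0 a)))
     else if i = 1 then (\<lambda>a. i1 (\<sigma> (inv_into (carrier V) i1 a)))
     else (\<lambda>a. im (\<tau> (inv_into (carrier W) im a))))" for i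
  have k0: "k 0 (i0 a) = i0 (s a)" if "a \<in> carrier g" for a
    using that i_inj(1) by (simp add: k_def)
  have k1: "k 1 (i1 v) = i1 (\<sigma> v)" if "v \<in> carrier V" for v
    using that i_inj(2) by (simp add: k_def)
  have km: "k (-1) (im w) = im (\<tau> w)" if "w \<in> carrier W" for w
    using that i_inj(3) by (simp add: k_def)
  \<comment> \<open>An automorphism \<open>t\<close> of \<open>M\<close> conjugated by an embedding
    \<open>\<iota>\<close>; the three components are instances.\<close>
  have transport: "f \<in> linear_isos (L\<lparr>carrier := \<iota> ` carrier M\<rparr>) (L\<lparr>carrier := \<iota> ` carrier M\<rparr>)"
    if M: "complex_space M" and \<iota>: "\<iota> \<in> linear_maps M L" "inj_on \<iota> (carrier M)" and t: "t \<in> linear_isos M M"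
      and f: "\<And>v. v \<in> carrier M \<Longrightarrow> f (\<iota> v) = \<iota> (t v)"
    for M :: "(complex, 'z, 'n) module_scheme" and \<iota> t f
  proof -
    interpret M: complex_space M by fact
    note tD = linear_isosD[OF t] and il = linear_mapsD[OF \<iota>(1)]
    note tl = linear_mapsD[OF tD(1)]
    have "f ` \<iota> ` carrier M = \<iota> ` t ` carrier M"
      unfolding image_image using f by (intro image_cong) auto
    then have surj: "f ` \<iota> ` carrier M = \<iota> ` carrier M" using tD(3) by simp
    have inj: "inj_on f (\<iota> ` carrier M)"
    proof (rule inj_onI)
      fix u v assume "u \<in> \<iota> ` carrier M" "v \<in> \<iota> ` carrier M" and eq: "f u = f v"
      then obtain u' v' where x: "u = \<iota> u'" "v = \<iota> v'" "u' \<in> carrier M" "v' \<in> carrier M" by blast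
      then have "t u' = t v'" using eq f tl(1) inj_onD[OF \<iota>(2), of "t u'" "t v'"] by simp
      then show "u = v" using inj_onD[OF tD(2)] x by blast
    qed
    show ?thesis
      unfolding linear_isos_def mem_Collect_eq
    proof (intro conjI linear_mapsI)
      fix u v c assume "u \<in> carrier (L\<lparr>carrier := \<iota> ` carrier M\<rparr>)"
      then obtain u' where u: "u = \<iota> u'" "u' \<in> carrier M" by auto
      show "f u \<in> carrier (L\<lparr>carrier := \<iota> ` carrier M\<rparr>)" using u f tl(1) by simp
      show "f (c \<odot>\<^bsub>L\<lparr>carrier := \<iota> ` carrier M\<rparr>\<^esub> u) = c \<odot>\<^bsub>L\<lparr>carrier := \<iota> ` carrier M\<rparr>\<^esub> f u"
        using u f tl il f[of "c \<odot>\<^bsub>M\<^esub> u'"] by simp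
      assume "v \<in> carrier (L\<lparr>carrier := \<iota> ` carrier M\<rparr>)"
      then obtain v' where v: "v = \<iota> v'" "v' \<in> carrier M" by auto
      show "f (u \<oplus>\<^bsub>L\<lparr>carrier := \<iota> ` carrier M\<rparr>\<^esub> v) = f u \<oplus>\<^bsub>L\<lparr>carrier := \<iota> ` carrier M\<rparr>\<^esub> f v"
        using u v f tl il f[of "u' \<oplus>\<^bsub>M\<^esub> v'"] by simp
    qed (use surj inj in \<open>simp add: bij_betw_def\<close>)
  qed
  have k_iso: "k i \<in> linear_isos (L\<lparr>carrier := G i\<rparr>) (L\<lparr>carrier := G i\<rparr>)" if i: "i \<in> {-1, 0, 1}" for i
  proof -
    consider "i = -1" | "i = 0" | "i = 1" using i by blast
    then show ?thesis
    proof cases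
      case 1
      then show ?thesis unfolding 1 G_images
        by (intro transport[OF W.complex_space_axioms i_linear(3) i_inj(3) \<tau>]) (use km in auto)
    next
      case 2
      then show ?thesis unfolding 2 G_images
        by (intro transport[OF g.complex_space_axioms i_linear(1) i_inj(1) s]) (use k0 in auto)
    next
      case 3
      then show ?thesis unfolding 3 G_images
        by (intro transport[OF V.complex_space_axioms i_linear(2) i_inj(2) \<sigma>]) (use k1 in auto)
    qed
  qed
  \<comment> \<open>Antisymmetry halves the work: of two different degrees only one order is checked
    directly.\<close>
  have swap: "k n (bracket L b a) = bracket L (k j b) (k i a)"
    if eq: "k n (bracket L a b) = bracket L (k i a) (k j b)" and n: "n \<in> {-1, 0, 1}"
      and i: "i \<in> {-1, 0, 1}" "a \<in> G i" and j: "j \<in> {-1, 0, 1}" "b \<in> G j" and nij: "n = i + j" for n i j a b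
  proof -
    have ab: "bracket L a b \<in> G n" unfolding nij by (rule bracket_graded[OF i(2) j(2)])
    have in_L: "a \<in> carrier L" "b \<in> carrier L" using i j summand_in by blast+
    have kG: "k i a \<in> carrier L" "k j b \<in> carrier L"
      using linear_mapsD(1)[OF linear_isosD(1)[OF k_iso[OF i(1)]], of a]
        linear_mapsD(1)[OF linear_isosD(1)[OF k_iso[OF j(1)]], of b] i j summand_in by auto
    have "k n (bracket L b a) = (-1) \<odot>\<^bsub>L\<^esub> k n (bracket L a b)"
      using linear_mapsD(3)[OF linear_isosD(1)[OF k_iso[OF n]], of "bracket L a b" "-1"] ab
        bracket_swap[OF in_L(2,1)] by simp
    also have "\<dots> = bracket L (k j b) (k i a)" unfolding eq using bracket_swap[OF kG(2,1)] by simp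
    finally show ?thesis .
  qed
  have b00: "k 0 (bracket L a b) = bracket L (k 0 a) (k 0 b)" if ab: "a \<in> G 0" "b \<in> G 0" for a b
  proof -
    obtain u v where "a = i0 u" "b = i0 v" "u \<in> carrier g" "v \<in> carrier g"
      using ab unfolding G_images by blast
    then show ?thesis by (simp add: k0 bracket_00 s_br s_in)
  qed
  have b01: "k 1 (bracket L a b) = bracket L (k 0 a) (k 1 b)" if ab: "a \<in> G 0" "b \<in> G 1" for a b
  proof -
    obtain u v where "a = i0 u" "b = i1 v" "u \<in> carrier g" "v \<in> carrier V"
      using ab unfolding G_images by blast
    then show ?thesis by (simp add: k0 k1 bracket_01 \<sigma>_rho s_in \<sigma>_in rho)
  qed
  have b0m: "k (-1) (bracket L a b) = bracket L (k 0 a) (k (-1) b)" if ab: "a \<in> G 0" "b \<in> G (-1)" for a b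
  proof -
    obtain u v where "a = i0 u" "b = im v" "u \<in> carrier g" "v \<in> carrier W"
      using ab unfolding G_images by blast
    then show ?thesis by (simp add: k0 km bracket_0m \<tau>_rho s_in \<tau>_in rho')
  qed
  have b1m: "k 0 (bracket L a b) = bracket L (k 1 a) (k (-1) b)" if ab: "a \<in> G 1" "b \<in> G (-1)" for a b
  proof -
    obtain u v where "a = i1 u" "b = im v" "u \<in> carrier V" "v \<in> carrier W"
      using ab unfolding G_images by blast
    then show ?thesis by (simp add: k0 k1 km bracket_1m s_P \<sigma>_in \<tau>_in P_in)
  qed
  have "k (i + j) (bracket L a b) = bracket L (k i a) (k j b)"
    if ij: "i \<in> {-1, 0, 1}" "j \<in> {-1, 0, 1}" "i + j \<in> {-1, 0, 1}" and ab: "a \<in> G i" "b \<in> G j" for i j a b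
  proof -
    consider "i = 0" "j = 0" | "i = 0" "j = 1" | "i = 0" "j = -1" | "i = 1" "j = 0" | "i = -1" "j = 0"
      | "i = 1" "j = -1" | "i = -1" "j = 1" using ij by auto
    then show ?thesis
    proof cases
      case 1 then show ?thesis using b00 ab by simp
    next
      case 2 then show ?thesis using b01 ab by simp
    next
      case 3 then show ?thesis using b0m ab by simp
    next
      case 4 then show ?thesis using swap[OF b01[of b a]] ab by simp
    next
      case 5 then show ?thesis using swap[OF b0m[of b a]] ab by simp
    next
      case 6 then show ?thesis using b1m ab by simp
    next
      case 7 then show ?thesis using swap[OF b1m[of b a]] ab by simp
    qed
  qed
  then obtain F where F: "F \<in> lie_homs L L" "\<And>i a. i \<in> {-1, 0, 1} \<Longrightarrow> a \<in> G i \<Longrightarrow> F a = k i a"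
    using minimal_local_automorphism[OF minimal k_iso] by blast
  show ?thesis
    by (rule that[OF F(1)]) (use F(2)[of 0] F(2)[of 1] F(2)[of "-1"] k0 k1 km i0_simps(1) i1_simps(1) im_simps(1) in auto)
qed

end

section \<open>Subalgebras generated by a local part\<close>

definition direct_sum_lie :: "'a lie \<Rightarrow> 'b lie \<Rightarrow> ('a \<times> 'b) lie" where
  "direct_sum_lie L M =
     \<lparr>carrier = carrier L \<times> carrier M, mult = undefined, one = undefined,
      zero = (\<zero>\<^bsub>L\<^esub>, \<zero>\<^bsub>M\<^esub>),
      add = (\<lambda>(a, b) (a', b'). (a \<oplus>\<^bsub>L\<^esub> a', b \<oplus>\<^bsub>M\<^esub> b')),
      module.smult = (\<lambda>c (a, b). (c \<odot>\<^bsub>L\<^esub> a, c \<odot>\<^bsub>M\<^esub> b)),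
      bracket = (\<lambda>(a, b) (a', b'). (bracket L a a', bracket M b b'))\<rparr>"

lemma direct_sum_lie_simps [simp]:
  "carrier (direct_sum_lie L M) = carrier L \<times> carrier M"
  "\<zero>\<^bsub>direct_sum_lie L M\<^esub> = (\<zero>\<^bsub>L\<^esub>, \<zero>\<^bsub>M\<^esub>)"
  "(a, b) \<oplus>\<^bsub>direct_sum_lie L M\<^esub> (a', b') = (a \<oplus>\<^bsub>L\<^esub> a', b \<oplus>\<^bsub>M\<^esub> b')"
  "c \<odot>\<^bsub>direct_sum_lie L M\<^esub> (a, b) = (c \<odot>\<^bsub>L\<^esub> a, c \<odot>\<^bsub>M\<^esub> b)"
  "bracket (direct_sum_lie L M) (a, b) (a', b') = (bracket L a a', bracket M b b')"
  by (simp_all add: direct_sum_lie_def)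

lemma lie_algebra_direct_sum:
  assumes "lie_algebra L" "lie_algebra M"
  shows "lie_algebra (direct_sum_lie L M)"
proof (intro lie_algebra.intro lie_algebra_axioms.intro)
  interpret L: lie_algebra L by fact
  interpret M: lie_algebra M by fact
  \<comment> \<open>The vector space is that of \<open>direct_sum_space\<close>, placed in a record
    with a bracket; the identity transports it.\<close>
  have "complex_space (direct_sum_lie L M)"
    by (rule complex_space_image[OF complex_space_direct_sum[OF L.complex_space_axioms M.complex_space_axioms], of _ "\<lambda>v. v"])
      auto
  then show "vector_space_CC (direct_sum_lie L M)" by (simp add: complex_space_def)
  show "bracket (direct_sum_lie L M) \<in> bilinear_maps (direct_sum_lie L M) (direct_sum_lie L M) (direct_sum_lie L M)"
    unfolding bilinear_maps_def
    by (auto intro!: linear_mapsI simp: L.bracket_add_left L.bracket_add_right L.bracket_smult_left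
        L.bracket_smult_right M.bracket_add_left M.bracket_add_right M.bracket_smult_left M.bracket_smult_right)
qed (auto simp: lie_algebra.bracket_alternating[OF assms(1)] lie_algebra.bracket_alternating[OF assms(2)]
  lie_algebra.jacobi[OF assms(1)] lie_algebra.jacobi[OF assms(2)])

lemma direct_sum_lie_projections:
  "fst \<in> linear_maps (direct_sum_lie L M) L" "snd \<in> linear_maps (direct_sum_lie L M) M"
  by (auto intro!: linear_mapsI)

inductive_set lie_span :: "'a lie \<Rightarrow> 'a set \<Rightarrow> 'a set" for L A where
  base: "a \<in> A \<Longrightarrow> a \<in> lie_span L A"
| zero: "\<zero>\<^bsub>L\<^esub> \<in> lie_span L A"
| add: "a \<in> lie_span L A \<Longrightarrow> b \<in> lie_span L A \<Longrightarrow> a \<oplus>\<^bsub>L\<^esub> b \<in> lie_span L A"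
| smult: "a \<in> lie_span L A \<Longrightarrow> c \<odot>\<^bsub>L\<^esub> a \<in> lie_span L A"
| bracket: "a \<in> lie_span L A \<Longrightarrow> b \<in> lie_span L A \<Longrightarrow> bracket L a b \<in> lie_span L A"

text \<open>
  Brackets that stay on one side of degree \<open>0\<close> suffice, since \<open>R 1\<close> and \<open>R (-1)\<close> bracket
  into \<open>R 0\<close>; hence nothing new appears in the degrees \<open>-1\<close>, \<open>0\<close>, \<open>1\<close>.
\<close>

inductive graded_span :: "'a lie \<Rightarrow> (int \<Rightarrow> 'a set) \<Rightarrow> int \<Rightarrow> 'a \<Rightarrow> bool" for L R where
  base: "n \<in> {-1, 0, 1} \<Longrightarrow> a \<in> R n \<Longrightarrow> graded_span L R n a"
| up: "n \<ge> 1 \<Longrightarrow> a \<in> R 1 \<Longrightarrow> graded_span L R n b \<Longrightarrow> graded_span L R (n + 1) (bracket L a b)"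
| down: "n \<le> -1 \<Longrightarrow> a \<in> R (-1) \<Longrightarrow> graded_span L R n b \<Longrightarrow> graded_span L R (n - 1) (bracket L a b)"
| zero: "graded_span L R n \<zero>\<^bsub>L\<^esub>"
| add: "graded_span L R n a \<Longrightarrow> graded_span L R n b \<Longrightarrow> graded_span L R n (a \<oplus>\<^bsub>L\<^esub> b)"
| smult: "graded_span L R n a \<Longrightarrow> graded_span L R n (c \<odot>\<^bsub>L\<^esub> a)"

context lie_algebra
begin

lemma bracket_bracket_left:
  assumes "a \<in> carrier L" "b \<in> carrier L" "c \<in> carrier L"
  shows "bracket L (bracket L a b) c = bracket L a (bracket L b c) \<oplus> (-1) \<odot> bracket L b (bracket L a c)"
  using jacobi_derivation[OF assms] assms by (simp add: M.a_assoc)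

lemma lie_span_in: "A \<subseteq> carrier L \<Longrightarrow> a \<in> lie_span L A \<Longrightarrow> a \<in> carrier L"
  by (rotate_tac, induction rule: lie_span.induct) auto

lemma lie_subalgebra_lie_span:
  assumes "A \<subseteq> carrier L"
  shows "lie_subalgebra (lie_span L A) L"
  unfolding lie_subalgebra_def
proof (intro conjI ballI submodule_CI)
  show "lie_span L A \<subseteq> carrier L" using lie_span_in[OF assms] by blast
qed (auto intro: lie_span.intros)

text \<open>The elements whose adjoint action preserves \<open>S\<close> are closed under brackets
  by the Jacobi identity, so stability under the generators extends to their whole span.\<close>

lemma lie_span_subset:
  assumes A: "A \<subseteq> carrier L" and S: "submodule S CC L" "A \<subseteq> S"
    and stable: "\<And>a z. a \<in> A \<Longrightarrow> z \<in> S \<Longrightarrow> bracket L a z \<in> S"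
  shows "lie_span L A \<subseteq> S"
proof -
  note SD = submodule_CD[OF S(1)]
  have ad: "bracket L a z \<in> S" if "a \<in> lie_span L A" "z \<in> S" for a z
    using that
  proof (induction arbitrary: z rule: lie_span.induct)
    case (bracket a b)
    have "a \<in> carrier L" "b \<in> carrier L" "z \<in> carrier L"
      using bracket lie_span_in[OF A] SD(1) by blast+
    then show ?case using bracket SD by (simp add: bracket_bracket_left)
  next
    case (add a b)
    then show ?case using lie_span_in[OF A] SD by (simp add: bracket_add_left)
  next
    case (smult a c)
    then show ?case using lie_span_in[OF A] SD by (simp add: bracket_smult_left)
  qed (use stable SD in auto)
  have "a \<in> S" if "a \<in> lie_span L A" for a
    using that by induction (use ad S(2) SD in auto)
  then show ?thesis by blast
qed

end

text \<open>A local Lie algebra inside \<open>L\<close>: only brackets whose degree stays in -1, 0,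
  1 are constrained. The degree is merely a label here.\<close>

locale local_generators = lie_algebra L for L :: "'a lie" (structure) and R :: "int \<Rightarrow> 'a set" +
  assumes R_submodule: "n \<in> {-1, 0, 1} \<Longrightarrow> submodule (R n) CC L"
    and R_bracket: "a \<in> R 0 \<Longrightarrow> b \<in> R 0 \<Longrightarrow> bracket L a b \<in> R 0"
      "a \<in> R 0 \<Longrightarrow> b \<in> R 1 \<Longrightarrow> bracket L a b \<in> R 1"
      "a \<in> R 0 \<Longrightarrow> b \<in> R (-1) \<Longrightarrow> bracket L a b \<in> R (-1)"
      "a \<in> R 1 \<Longrightarrow> b \<in> R (-1) \<Longrightarrow> bracket L a b \<in> R 0"
begin

lemma R_in: "n \<in> {-1, 0, 1} \<Longrightarrow> a \<in> R n \<Longrightarrow> a \<in> carrier L"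
  using submodule_CD(1)[OF R_submodule] .

lemma R_bracket_swap:
  "a \<in> R 1 \<Longrightarrow> b \<in> R 0 \<Longrightarrow> bracket L a b \<in> R 1"
  "a \<in> R (-1) \<Longrightarrow> b \<in> R 0 \<Longrightarrow> bracket L a b \<in> R (-1)"
  "a \<in> R (-1) \<Longrightarrow> b \<in> R 1 \<Longrightarrow> bracket L a b \<in> R 0"
  using R_bracket(2)[of b a] R_bracket(3)[of b a] R_bracket(4)[of b a] bracket_swap[of a b]
    R_in[of 0 b] R_in[of 1 a] R_in[of 1 b] R_in[of "-1" a]
    submodule_CD(4)[OF R_submodule[of 1], of "bracket L b a" "-1"]
    submodule_CD(4)[OF R_submodule[of 0], of "bracket L b a" "-1"]
    submodule_CD(4)[OF R_submodule[of "-1"], of "bracket L b a" "-1"] by simp_all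

lemma graded_span_in: "graded_span L R n a \<Longrightarrow> a \<in> carrier L"
  by (induction rule: graded_span.induct) (auto intro: R_in)

text \<open>The rules \<open>up\<close> and \<open>down\<close> land in degrees beyond 1 and -1, so
  in the local degrees only the base rule and the linear rules act.\<close>

lemma graded_span_local:
  "graded_span L R n a \<Longrightarrow> n \<in> {-1, 0, 1} \<Longrightarrow> a \<in> R n"
  by (induction rule: graded_span.induct) (use submodule_CD[OF R_submodule] in auto)

text \<open>\<open>R 0\<close> acts by derivations that preserve \<open>R 1\<close> and
  \<open>R (-1)\<close>, hence it preserves what they build.\<close>

lemma graded_span_0:
  assumes a: "a \<in> R 0" and b: "graded_span L R n b"
  shows "graded_span L R n (bracket L a b)"
  using b
proof (induction rule: graded_span.induct)
  case (base n b)
  then show ?case using a R_bracket by (auto intro!: graded_span.base)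
next
  case (up n c b)
  have in_L: "a \<in> carrier L" "c \<in> carrier L" "b \<in> carrier L"
    using a up graded_span_in R_in by blast+
  show ?case unfolding jacobi_derivation[OF in_L]
    using up R_bracket(2)[OF a] by (intro graded_span.add graded_span.up) auto
next
  case (down n c b)
  have in_L: "a \<in> carrier L" "c \<in> carrier L" "b \<in> carrier L"
    using a down graded_span_in R_in by blast+
  show ?case unfolding jacobi_derivation[OF in_L]
    using down R_bracket(3)[OF a] by (intro graded_span.add graded_span.down) auto
next
  case (zero n) then show ?case using a R_in[of 0 a] by (auto intro: graded_span.zero)
next
  case (add n b c)
  then show ?case using a R_in[of 0 a] graded_span_in by (auto simp: bracket_add_right intro: graded_span.add)
next
  case (smult n b c)
  then show ?case using a R_in[of 0 a] graded_span_in by (auto simp: bracket_smult_right intro: graded_span.smult)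
qed

text \<open>In positive degrees this is a rule. In negative degrees \<open>a\<close> is moved past
  the outermost factor \<open>c\<close> from \<open>R (-1)\<close>; the bracket of \<open>a\<close>
  and \<open>c\<close> lies in \<open>R 0\<close>, which is already settled.\<close>

lemma graded_span_up:
  assumes a: "a \<in> R 1" and b: "graded_span L R n b"
  shows "graded_span L R (n + 1) (bracket L a b)"
  using b
proof (induction rule: graded_span.induct)
  case (base n b)
  then consider "n = -1" | "n = 0" | "n = 1" by blast
  then show ?case
  proof cases
    case 3 then show ?thesis using base a by (intro graded_span.up graded_span.base) auto
  qed (use base a R_bracket R_bracket_swap in \<open>auto intro!: graded_span.base\<close>)
next
  case (up n c b)
  then show ?case using a by (intro graded_span.up) auto
next
  case (down n c b)
  have in_L: "a \<in> carrier L" "c \<in> carrier L" "b \<in> carrier L"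
    using a down graded_span_in R_in by blast+
  have 1: "graded_span L R n (bracket L (bracket L a c) b)"
    using down a R_bracket(4) by (intro graded_span_0) auto
  \<comment> \<open>For \<open>n = -1\<close> the inner bracket has degree 0, where
    \<open>down\<close> does not apply; it then lies in \<open>R 0\<close>, and the outer bracket is
    a base element.\<close>
  have 2: "graded_span L R n (bracket L c (bracket L a b))"
  proof (cases "n = -1")
    case True
    then have "bracket L a b \<in> R 0" using down graded_span_local by fastforce
    then show ?thesis using True down R_bracket_swap(2) by (auto intro!: graded_span.base)
  next
    case False
    then show ?thesis using graded_span.down[of "n + 1" c R L "bracket L a b"] down by simp
  qed
  show ?case unfolding jacobi_derivation[OF in_L] using graded_span.add[OF 1 2] by simp
next
  case (zero n) then show ?case using a R_in[of 1 a] by (auto intro: graded_span.zero)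
next
  case (add n b c)
  then show ?case using a R_in[of 1 a] graded_span_in by (auto simp: bracket_add_right intro: graded_span.add)
next
  case (smult n b c)
  then show ?case using a R_in[of 1 a] graded_span_in by (auto simp: bracket_smult_right intro: graded_span.smult)
qed

text \<open>Mirror image of \<open>graded_span_up\<close>, with positive and negative degrees
  exchanged.\<close>

lemma graded_span_down:
  assumes a: "a \<in> R (-1)" and b: "graded_span L R n b"
  shows "graded_span L R (n - 1) (bracket L a b)"
  using b
proof (induction rule: graded_span.induct)
  case (base n b)
  then consider "n = -1" | "n = 0" | "n = 1" by blast
  then show ?case
  proof cases
    case 1 then show ?thesis using base a by (intro graded_span.down graded_span.base) auto
  qed (use base a R_bracket R_bracket_swap in \<open>auto intro!: graded_span.base\<close>)
next
  case (down n c b)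
  then show ?case using a by (intro graded_span.down) auto
next
  case (up n c b)
  have in_L: "a \<in> carrier L" "c \<in> carrier L" "b \<in> carrier L"
    using a up graded_span_in R_in by blast+
  have 1: "graded_span L R n (bracket L (bracket L a c) b)"
    using up a R_bracket_swap(3) by (intro graded_span_0) auto
  have 2: "graded_span L R n (bracket L c (bracket L a b))"
  proof (cases "n = 1")
    case True
    then have "bracket L a b \<in> R 0" using up graded_span_local by fastforce
    then show ?thesis using True up R_bracket_swap(1) by (auto intro!: graded_span.base)
  next
    case False
    then show ?thesis using graded_span.up[of "n - 1" c R L "bracket L a b"] up by simp
  qed
  show ?case unfolding jacobi_derivation[OF in_L] using graded_span.add[OF 1 2] by simp
next
  case (zero n) then show ?case using a R_in[of "-1" a] by (auto intro: graded_span.zero)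
next
  case (add n b c)
  then show ?case using a R_in[of "-1" a] graded_span_in by (auto simp: bracket_add_right intro: graded_span.add)
next
  case (smult n b c)
  then show ?case using a R_in[of "-1" a] graded_span_in by (auto simp: bracket_smult_right intro: graded_span.smult)
qed

text \<open>The sum of all graded spans, built one summand at a time; degrees may repeat, which
  keeps closure under addition simple.\<close>

inductive_set graded_sums :: "'a set" where
  zero: "\<zero> \<in> graded_sums"
| add: "z \<in> graded_sums \<Longrightarrow> graded_span L R n b \<Longrightarrow> z \<oplus> b \<in> graded_sums"

lemma graded_sums_in: "z \<in> graded_sums \<Longrightarrow> z \<in> carrier L"
  by (induction rule: graded_sums.induct) (auto intro: graded_span_in)

lemma graded_sums_submodule: "submodule graded_sums CC L"
proof (rule submodule_CI)
  show "graded_sums \<subseteq> carrier L" using graded_sums_in by blast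
  show "\<zero> \<in> graded_sums" by (rule graded_sums.zero)
  show "a \<oplus> b \<in> graded_sums" if a: "a \<in> graded_sums" and b: "b \<in> graded_sums" for a b
    using b
  proof induction
    case zero then show ?case using a graded_sums_in by simp
  next
    case (add z n b)
    then show ?case using a graded_sums.add[OF add.IH add.hyps(2)] graded_sums_in graded_span_in
      by (simp add: M.a_assoc)
  qed
  show "c \<odot> a \<in> graded_sums" if a: "a \<in> graded_sums" for a c
    using a
  proof induction
    case zero then show ?case by (simp add: graded_sums.zero)
  next
    case (add z n b)
    then show ?case using graded_sums.add[OF add.IH graded_span.smult[OF add.hyps(2)]] graded_sums_in graded_span_in
      by (simp add: smult_add_right)
  qed
qed

lemma graded_span_sums: "graded_span L R n b \<Longrightarrow> b \<in> graded_sums"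
  using graded_sums.add[OF graded_sums.zero, of n b] graded_span_in by simp

text \<open>By \<open>lie_span_subset\<close> it is enough to act with \<open>R (-1)\<close>,
  \<open>R 0\<close> and \<open>R 1\<close>, and these respect the graded spans.\<close>

lemma lie_span_graded_sums: "lie_span L (R (-1) \<union> R 0 \<union> R 1) \<subseteq> graded_sums"
proof (rule lie_span_subset[OF _ graded_sums_submodule])
  show "R (-1) \<union> R 0 \<union> R 1 \<subseteq> carrier L" using R_in by auto
  show "R (-1) \<union> R 0 \<union> R 1 \<subseteq> graded_sums"
    by (auto intro: graded_span_sums graded_span.base)
  fix a z assume a: "a \<in> R (-1) \<union> R 0 \<union> R 1" and z: "z \<in> graded_sums"
  have aL: "a \<in> carrier L" using a R_in by auto
  note sub = submodule_CD[OF graded_sums_submodule]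
  have step: "bracket L a b \<in> graded_sums" if "graded_span L R n b" for n b
    using a graded_span_0[OF _ that] graded_span_up[OF _ that] graded_span_down[OF _ that] graded_span_sums by blast
  show "bracket L a z \<in> graded_sums"
    using z
  proof induction
    case zero then show ?case using aL graded_sums.zero by simp
  next
    case (add z n b)
    then show ?case using aL step sub graded_sums_in graded_span_in by (simp add: bracket_add_right)
  qed
qed

lemma graded_span_lie_span: "graded_span L R n b \<Longrightarrow> b \<in> lie_span L (R (-1) \<union> R 0 \<union> R 1)"
  by (induction rule: graded_span.induct) (auto intro: lie_span.intros)

text \<open>Summands of equal degree are merged, so that each degree contributes one term and the
  eigenvalues attached to the terms are distinct.\<close>

lemma graded_sums_finsum:
  assumes "z \<in> graded_sums"
  shows "\<exists>A c. finite A \<and> (\<forall>n. graded_span L R n (c n)) \<and> (\<forall>n. n \<notin> A \<longrightarrow> c n = \<zero>) \<and> z = (\<Oplus>n\<in>A. c n)"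
  using assms
proof induction
  case zero
  show ?case by (rule exI[of _ "{}"], rule exI[of _ "\<lambda>_. \<zero>"]) (auto intro: graded_span.zero)
next
  case (add z n b)
  then obtain A c where A: "finite A" and c: "\<And>n. graded_span L R n (c n)" "\<And>n. n \<notin> A \<Longrightarrow> c n = \<zero>"
    and z: "z = (\<Oplus>n\<in>A. c n)" by blast
  define d where "d m = c m \<oplus> (if m = n then b else \<zero>)" for m
  have cL: "c m \<in> carrier L" for m using c graded_span_in by blast
  have bL: "b \<in> carrier L" using add graded_span_in by blast
  have "(\<Oplus>m\<in>insert n A. d m) = (\<Oplus>m\<in>insert n A. c m) \<oplus> (\<Oplus>m\<in>insert n A. if m = n then b else \<zero>)"
    unfolding d_def using cL bL by (intro M.finsum_addf) auto
  also have "(\<Oplus>m\<in>insert n A. c m) = (\<Oplus>m\<in>A. c m)"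
    using A c cL by (intro finsum_superset[symmetric]) auto
  also have "(\<Oplus>m\<in>insert n A. if m = n then b else \<zero>) = (\<Oplus>m\<in>{n}. if m = n then b else \<zero>)"
    using A bL by (intro finsum_superset[symmetric]) auto
  also have "\<dots> = b" using bL by simp
  finally have "z \<oplus> b = (\<Oplus>m\<in>insert n A. d m)" using z by simp
  moreover have "graded_span L R m (d m)" for m
    unfolding d_def using c(1)[of m] add.hyps(2) cL by (auto intro: graded_span.add)
  moreover have "d m = \<zero>" if "m \<notin> insert n A" for m
    using that c(2) by (simp add: d_def)
  ultimately show ?case using A by (intro exI[of _ "insert n A"] exI[of _ d]) auto
qed

end

text \<open>The inverse is the diagonal operator with the reciprocal entries.\<close>

lemma (in decomposition) diagonal_isomorphism:
  fixes l :: "'i \<Rightarrow> complex"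
  assumes l: "\<And>i. l i \<noteq> 0"
  obtains \<sigma> where "\<sigma> \<in> linear_isos V V" "\<And>i v. v \<in> F i \<Longrightarrow> \<sigma> v = l i \<odot> v"
proof -
  obtain \<sigma> where s: "\<sigma> \<in> linear_maps V V" "\<And>i v. v \<in> F i \<Longrightarrow> \<sigma> v = l i \<odot> v"
    using diagonal_operator[of l] by blast
  obtain \<tau> where t: "\<tau> \<in> linear_maps V V" "\<And>i v. v \<in> F i \<Longrightarrow> \<tau> v = inverse (l i) \<odot> v"
    using diagonal_operator[of "\<lambda>i. inverse (l i)"] by blast
  have id: "(\<lambda>v. v) \<in> linear_maps V V" by (auto intro: linear_mapsI)
  note F_smult = submodule_CD(4)[OF summand]
  have st: "\<sigma> (\<tau> v) = v" if "v \<in> carrier V" for v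
    by (rule linear_maps_eqI[OF complex_space_axioms linear_maps_comp[OF t(1) s(1)] id _ that])
      (use s(2)[OF F_smult] t(2) summand_in l in auto)
  have ts: "\<tau> (\<sigma> v) = v" if "v \<in> carrier V" for v
    by (rule linear_maps_eqI[OF complex_space_axioms linear_maps_comp[OF s(1) t(1)] id _ that])
      (use s(2) t(2)[OF F_smult] summand_in l in auto)
  have "bij_betw \<sigma> (carrier V) (carrier V)"
    by (rule bij_betw_byWitness[of _ \<tau>]) (use st ts linear_mapsD(1)[OF s(1)] linear_mapsD(1)[OF t(1)] in auto)
  then have "\<sigma> \<in> linear_isos V V" using s(1) by (simp add: linear_isos_def)
  then show ?thesis using s(2) by (rule that)
qed

section \<open>The module \<open>U\<close>\<close>

locale fd_module = sl2_basis +
  fixes U :: "(complex, 'u) module" and \<rho> :: "complex^2^2 \<Rightarrow> 'u \<Rightarrow> 'u"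
    and C :: "nat \<times> nat \<Rightarrow> 'u set" and p :: "'u \<Rightarrow> 'u \<Rightarrow> complex"
  assumes fd: "fd_sum U \<rho> C" and pairing: "fd_pairing U \<rho> C p"
begin

sublocale U: decomposition U C "component U C"
proof (rule decomposition_component)
  show "complex_space U" using fd by (simp add: fd_sum_def lie_representation_def complex_space_def)
  show "is_direct_sum U C" using fd by (simp add: fd_sum_def)
qed

lemma rho_bilinear: "\<rho> \<in> bilinear_maps sl2 U U"
  using fd by (simp add: fd_sum_def lie_representation_def)

lemmas rho_linear = bilinear_mapsD(1)[OF rho_bilinear]
lemmas rho_add = linear_mapsD(2)[OF rho_linear] and rho_smult = linear_mapsD(3)[OF rho_linear]

lemma rho_in [simp]: "a \<in> carrier sl2 \<Longrightarrow> u \<in> carrier U \<Longrightarrow> \<rho> a u \<in> carrier U"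
  using linear_mapsD(1)[OF rho_linear] .

lemma rho_zero [simp]: "a \<in> carrier sl2 \<Longrightarrow> \<rho> a \<zero>\<^bsub>U\<^esub> = \<zero>\<^bsub>U\<^esub>"
  using linear_maps_zero[OF U.complex_space_axioms U.complex_space_axioms rho_linear] .

lemma rho_scale: "a \<in> carrier sl2 \<Longrightarrow> u \<in> carrier U \<Longrightarrow> \<rho> (c \<odot>\<^bsub>sl2\<^esub> a) u = c \<odot>\<^bsub>U\<^esub> \<rho> a u"
  using linear_mapsD(3)[OF bilinear_mapsD(2)[OF rho_bilinear]] .

lemma rho_expand:
  assumes a: "a \<in> carrier sl2" and u: "u \<in> carrier U"
  shows "\<rho> a u = cy a \<odot>\<^bsub>U\<^esub> \<rho> y u \<oplus>\<^bsub>U\<^esub> (ch a \<odot>\<^bsub>U\<^esub> \<rho> h u \<oplus>\<^bsub>U\<^esub> cx a \<odot>\<^bsub>U\<^esub> \<rho> x u)"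
proof -
  note l = linear_mapsD[OF bilinear_mapsD(2)[OF rho_bilinear u]]
  have "\<rho> a u = \<rho> (cy a \<odot>\<^bsub>sl2\<^esub> y \<oplus>\<^bsub>sl2\<^esub> (ch a \<odot>\<^bsub>sl2\<^esub> h \<oplus>\<^bsub>sl2\<^esub> cx a \<odot>\<^bsub>sl2\<^esub> x)) u"
    unfolding sl2_simps using arg_cong[OF expand[OF a], of "\<lambda>a. \<rho> a u"] .
  also have "\<dots> = cy a \<odot>\<^bsub>U\<^esub> \<rho> y u \<oplus>\<^bsub>U\<^esub> (ch a \<odot>\<^bsub>U\<^esub> \<rho> h u \<oplus>\<^bsub>U\<^esub> cx a \<odot>\<^bsub>U\<^esub> \<rho> x u)"
    using yhx_in by (simp add: l del: sl2_simps)
  finally show ?thesis .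
qed

section \<open>The summands and their weight bases\<close>

lemma C_space: "complex_space (U\<lparr>carrier := C k\<rparr>)"
  by (rule U.complex_space_submodule[OF U.summand])

lemma C_irreducible: "irreducible_representation sl2 (U\<lparr>carrier := C k\<rparr>) \<rho>"
  using fd by (cases k) (simp add: fd_sum_def)

lemma C_rho_linear: "a \<in> carrier sl2 \<Longrightarrow> \<rho> a \<in> linear_maps (U\<lparr>carrier := C k\<rparr>) (U\<lparr>carrier := C k\<rparr>)"
  using C_irreducible[of k] bilinear_mapsD(1)[of \<rho> sl2]
  by (auto simp: irreducible_representation_def lie_representation_def)

lemma C_rho: "a \<in> carrier sl2 \<Longrightarrow> u \<in> C k \<Longrightarrow> \<rho> a u \<in> C k"
  using linear_mapsD(1)[OF C_rho_linear, of a u k] by simp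

lemma C_D: "\<zero>\<^bsub>U\<^esub> \<in> C k" "u \<in> C k \<Longrightarrow> w \<in> C k \<Longrightarrow> u \<oplus>\<^bsub>U\<^esub> w \<in> C k" "u \<in> C k \<Longrightarrow> c \<odot>\<^bsub>U\<^esub> u \<in> C k"
  using U.submodule_CD[OF U.summand] by auto

lemma C_invariant_submodule:
  assumes W: "submodule W CC (U\<lparr>carrier := C k\<rparr>)" and inv: "\<forall>w\<in>W. \<rho> x w \<in> W \<and> \<rho> y w \<in> W \<and> \<rho> h w \<in> W"
  shows "W = {\<zero>\<^bsub>U\<^esub>} \<or> W = C k"
proof -
  interpret Ck: complex_space "U\<lparr>carrier := C k\<rparr>" by (rule C_space)
  note WD = Ck.submodule_CD[OF W]
  have "\<rho> a w \<in> W" if "a \<in> carrier sl2" "w \<in> W" for a w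
  proof -
    have "w \<in> carrier U" using WD(1)[OF that(2)] U.summand_in by simp
    then show ?thesis using rho_expand[OF that(1)] inv that(2) WD(3,4) by simp
  qed
  then have "lie_submodule sl2 (U\<lparr>carrier := C k\<rparr>) \<rho> W"
    using W by (simp add: lie_submodule_def)
  then show ?thesis using C_irreducible[of k] by (auto simp: irreducible_representation_def)
qed

text \<open>A lowest weight vector of \<open>C k\<close>. The first index of \<open>k\<close> is the
  highest weight, so the string has \<open>Suc (fst k)\<close> members, with weights from
  \<open>- fst k\<close> to \<open>fst k\<close> in steps of 2.\<close>

definition weight_vector :: "nat \<times> nat \<Rightarrow> 'u \<Rightarrow> bool" where
  "weight_vector k e \<longleftrightarrow> e \<in> C k \<and> e \<noteq> \<zero>\<^bsub>U\<^esub> \<and> \<rho> y e = \<zero>\<^bsub>U\<^esub> \<and> (\<rho> x ^^ Suc (fst k)) e = \<zero>\<^bsub>U\<^esub> \<and>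
    is_basis (U\<lparr>carrier := C k\<rparr>) (Suc (fst k)) (\<lambda>i. (\<rho> x ^^ i) e) \<and>
    (\<forall>i. \<rho> h ((\<rho> x ^^ i) e) = (2 * of_nat i - of_nat (fst k)) \<odot>\<^bsub>U\<^esub> (\<rho> x ^^ i) e) \<and>
    (\<forall>i. \<rho> y ((\<rho> x ^^ Suc i) e) = (of_nat (Suc i) * (of_nat (fst k) - of_nat i)) \<odot>\<^bsub>U\<^esub> (\<rho> x ^^ i) e)"

lemma weight_vector_exists: "\<exists>e. weight_vector k e"
proof -
  let ?V = "U\<lparr>carrier := C k\<rparr>"
  interpret Ck: complex_space ?V by (rule C_space)
  have com: "\<rho> a (\<rho> b u) = \<rho> b (\<rho> a u) \<oplus>\<^bsub>U\<^esub> \<rho> (bracket sl2 a b) u"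
    if ab: "a \<in> carrier sl2" "b \<in> carrier sl2" and u: "u \<in> C k" for a b u
  proof -
    have uU: "u \<in> carrier U" using u U.summand_in by blast
    have "\<rho> (bracket sl2 a b) u = \<rho> a (\<rho> b u) \<ominus>\<^bsub>U\<^esub> \<rho> b (\<rho> a u)"
      using fd ab uU by (simp add: fd_sum_def lie_representation_def)
    also have "\<dots> = \<rho> a (\<rho> b u) \<oplus>\<^bsub>U\<^esub> (-1) \<odot>\<^bsub>U\<^esub> \<rho> b (\<rho> a u)"
      using ab uU by (intro U.minus_eq_smult) auto
    finally have "\<rho> b (\<rho> a u) \<oplus>\<^bsub>U\<^esub> \<rho> (bracket sl2 a b) u
      = (\<rho> b (\<rho> a u) \<oplus>\<^bsub>U\<^esub> (-1) \<odot>\<^bsub>U\<^esub> \<rho> b (\<rho> a u)) \<oplus>\<^bsub>U\<^esub> \<rho> a (\<rho> b u)"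
      using ab uU by (simp add: U.M.a_ac del: U.smult_collect)
    then show ?thesis using ab uU by simp
  qed
  obtain b where b: "is_basis ?V (Suc (fst k)) b"
    using fd by (cases k) (auto simp: fd_sum_def has_dimension_def)
  have car: "C k \<noteq> {\<zero>\<^bsub>U\<^esub>}" using C_irreducible[of k] by (simp add: irreducible_representation_def)
  show ?thesis
  proof (rule Ck.sl2_irreducible_weight_basis[OF C_rho_linear[OF yhx_in(3)] C_rho_linear[OF yhx_in(1)] C_rho_linear[OF yhx_in(2)] _ _ _ _ _ b])
    fix u assume "u \<in> carrier ?V"
    then have u: "u \<in> C k" by simp
    then have uU: "u \<in> carrier U" using U.summand_in by blast
    show "\<rho> x (\<rho> y u) = \<rho> y (\<rho> x u) \<oplus>\<^bsub>?V\<^esub> \<rho> h u" using com[OF _ _ u, of x y] xy by simp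
    show "\<rho> h (\<rho> x u) = \<rho> x (\<rho> h u) \<oplus>\<^bsub>?V\<^esub> 2 \<odot>\<^bsub>?V\<^esub> \<rho> x u" using com[OF _ _ u, of h x] hx uU rho_scale by simp
    show "\<rho> h (\<rho> y u) = \<rho> y (\<rho> h u) \<oplus>\<^bsub>?V\<^esub> (-2) \<odot>\<^bsub>?V\<^esub> \<rho> y u" using com[OF _ _ u, of h y] hy uU rho_scale by simp
  next
    fix W assume "submodule W CC ?V" "\<forall>w\<in>W. \<rho> x w \<in> W \<and> \<rho> y w \<in> W \<and> \<rho> h w \<in> W"
    then show "W = {\<zero>\<^bsub>?V\<^esub>} \<or> W = carrier ?V" using C_invariant_submodule by simp
  next
    show "carrier ?V \<noteq> {\<zero>\<^bsub>?V\<^esub>}" using car by simp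
  next
    fix e assume "e \<in> carrier ?V" "e \<noteq> \<zero>\<^bsub>?V\<^esub>" "\<rho> y e = \<zero>\<^bsub>?V\<^esub>" "(\<rho> x ^^ Suc (fst k)) e = \<zero>\<^bsub>?V\<^esub>"
      "is_basis ?V (Suc (fst k)) (\<lambda>i. (\<rho> x ^^ i) e)"
      "\<And>i. \<rho> h ((\<rho> x ^^ i) e) = (2 * of_nat i - of_nat (fst k)) \<odot>\<^bsub>?V\<^esub> (\<rho> x ^^ i) e"
      "\<And>i. \<rho> y ((\<rho> x ^^ Suc i) e) = (of_nat (Suc i) * (of_nat (fst k) - of_nat i)) \<odot>\<^bsub>?V\<^esub> (\<rho> x ^^ i) e"
    then have "weight_vector k e" unfolding weight_vector_def by simp
    then show ?thesis by blast
  qed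
qed

definition low :: "nat \<times> nat \<Rightarrow> 'u" where "low k = (SOME e. weight_vector k e)"

definition wv :: "nat \<times> nat \<Rightarrow> nat \<Rightarrow> 'u" where "wv k i = (\<rho> x ^^ i) (low k)"

lemma weight_vector_low: "weight_vector k (low k)"
  unfolding low_def by (rule someI_ex[OF weight_vector_exists])

lemma wv_0: "wv k 0 = low k"
  by (simp add: wv_def)

lemma wv_C: "wv k i \<in> C k"
  unfolding wv_def by (induction i) (use weight_vector_low[of k] C_rho in \<open>auto simp: weight_vector_def\<close>)

lemma wv_in [simp]: "wv k i \<in> carrier U"
  using wv_C U.summand_in by blast

lemma wv_basis: "is_basis (U\<lparr>carrier := C k\<rparr>) (Suc (fst k)) (wv k)"
  using weight_vector_low[of k] unfolding weight_vector_def wv_def by blast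

lemma rho_x_wv: "\<rho> x (wv k i) = wv k (Suc i)"
  by (simp add: wv_def)

lemma rho_h_wv: "\<rho> h (wv k i) = (2 * of_nat i - of_nat (fst k)) \<odot>\<^bsub>U\<^esub> wv k i"
  using weight_vector_low[of k] unfolding weight_vector_def wv_def by blast

lemma rho_y_wv_0: "\<rho> y (wv k 0) = \<zero>\<^bsub>U\<^esub>"
  using weight_vector_low[of k] unfolding weight_vector_def wv_def by simp

lemma rho_y_wv_Suc: "\<rho> y (wv k (Suc i)) = (of_nat (Suc i) * (of_nat (fst k) - of_nat i)) \<odot>\<^bsub>U\<^esub> wv k i"
  using weight_vector_low[of k] unfolding weight_vector_def wv_def by blast

lemma wv_vanish: "fst k < i \<Longrightarrow> wv k i = \<zero>\<^bsub>U\<^esub>"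
proof (induction i)
  case (Suc i)
  show ?case
  proof (cases "i = fst k")
    case True
    then show ?thesis using weight_vector_low[of k] unfolding weight_vector_def wv_def by blast
  next
    case False
    then show ?thesis using Suc rho_x_wv[of k i] by simp
  qed
qed simp

definition wcoord :: "nat \<times> nat \<Rightarrow> nat \<Rightarrow> 'u \<Rightarrow> complex" where
  "wcoord k = (SOME \<xi>. (\<forall>i. \<xi> i \<in> linear_maps (U\<lparr>carrier := C k\<rparr>) scalar_space) \<and>
     (\<forall>i\<le>fst k. \<forall>j\<le>fst k. \<xi> i (wv k j) = (if i = j then 1 else 0)))"

lemma wcoord:
  "wcoord k i \<in> linear_maps (U\<lparr>carrier := C k\<rparr>) scalar_space"
  "i \<le> fst k \<Longrightarrow> j \<le> fst k \<Longrightarrow> wcoord k i (wv k j) = (if i = j then 1 else 0)"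
proof -
  obtain \<xi> where "\<And>i. \<xi> i \<in> linear_maps (U\<lparr>carrier := C k\<rparr>) scalar_space"
    "\<And>v. v \<in> carrier (U\<lparr>carrier := C k\<rparr>) \<Longrightarrow>
       v = (\<Oplus>\<^bsub>U\<lparr>carrier := C k\<rparr>\<^esub>i\<in>{..<Suc (fst k)}. \<xi> i v \<odot>\<^bsub>U\<lparr>carrier := C k\<rparr>\<^esub> wv k i)"
    "\<And>i j. i < Suc (fst k) \<Longrightarrow> j < Suc (fst k) \<Longrightarrow> \<xi> i (wv k j) = (if i = j then 1 else 0)"
    by (rule basis_coordinates[OF C_space wv_basis[of k]]) (rule that)
  then have "(\<forall>i. \<xi> i \<in> linear_maps (U\<lparr>carrier := C k\<rparr>) scalar_space) \<and>
     (\<forall>i\<le>fst k. \<forall>j\<le>fst k. \<xi> i (wv k j) = (if i = j then 1 else 0))" by (simp add: less_Suc_eq_le)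
  then have "(\<forall>i. wcoord k i \<in> linear_maps (U\<lparr>carrier := C k\<rparr>) scalar_space) \<and>
     (\<forall>i\<le>fst k. \<forall>j\<le>fst k. wcoord k i (wv k j) = (if i = j then 1 else 0))"
    unfolding wcoord_def
    by (rule someI[where P = "\<lambda>\<xi>. (\<forall>i. \<xi> i \<in> linear_maps (U\<lparr>carrier := C k\<rparr>) scalar_space) \<and>
     (\<forall>i\<le>fst k. \<forall>j\<le>fst k. \<xi> i (wv k j) = (if i = j then 1 else 0))"])
  then show "wcoord k i \<in> linear_maps (U\<lparr>carrier := C k\<rparr>) scalar_space"
    "i \<le> fst k \<Longrightarrow> j \<le> fst k \<Longrightarrow> wcoord k i (wv k j) = (if i = j then 1 else 0)" by blast+
qed

lemma wcoord_add: "u \<in> C k \<Longrightarrow> v \<in> C k \<Longrightarrow> wcoord k i (u \<oplus>\<^bsub>U\<^esub> v) = wcoord k i u + wcoord k i v"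
  and wcoord_smult: "u \<in> C k \<Longrightarrow> wcoord k i (c \<odot>\<^bsub>U\<^esub> u) = c * wcoord k i u"
  using linear_mapsD(2,3)[OF wcoord(1), of u k] by simp_all

lemma wcoord_zero: "wcoord k i \<zero>\<^bsub>U\<^esub> = 0"
  using linear_maps_zero[OF C_space complex_space_scalar wcoord(1)[of k i]] by simp

lemma wv_nonzero: "i \<le> fst k \<Longrightarrow> wv k i \<noteq> \<zero>\<^bsub>U\<^esub>"
  using wcoord(2)[of i k i] wcoord_zero[of k i] by auto

lemma C_span:
  assumes Z: "submodule Z CC U" and wv: "\<And>i. i \<le> fst k \<Longrightarrow> wv k i \<in> Z"
  shows "C k \<subseteq> Z"
proof
  interpret Ck: complex_space "U\<lparr>carrier := C k\<rparr>" by (rule C_space)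
  fix v assume v: "v \<in> C k"
  \<comment> \<open>The span is taken inside \<open>C k\<close>, so \<open>Z\<close> is first cut
    down to it.\<close>
  have "submodule (Z \<inter> C k) CC (U\<lparr>carrier := C k\<rparr>)"
    using U.submodule_CD[OF Z] C_D by (intro Ck.submodule_CI) auto
  then have sub: "finite_span (U\<lparr>carrier := C k\<rparr>) (Suc (fst k)) (wv k) \<subseteq> Z \<inter> C k"
    by (rule Ck.finite_span_least) (use wv wv_C in auto)
  obtain c where "v = (\<Oplus>\<^bsub>U\<lparr>carrier := C k\<rparr>\<^esub>i\<in>{..<Suc (fst k)}. c i \<odot>\<^bsub>U\<lparr>carrier := C k\<rparr>\<^esub> wv k i)"
    using wv_basis[of k] v by (auto simp: is_basis_def)
  then have "v \<in> finite_span (U\<lparr>carrier := C k\<rparr>) (Suc (fst k)) (wv k)" by (rule finite_spanI)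
  then show "v \<in> Z" using sub by blast
qed

lemma U_span: "submodule Z CC U \<Longrightarrow> (\<And>k i. i \<le> fst k \<Longrightarrow> wv k i \<in> Z) \<Longrightarrow> carrier U \<subseteq> Z"
  using U.span C_span by blast

lemma linear_eq_on_wv:
  assumes "complex_space W" "f \<in> linear_maps U W" "g \<in> linear_maps U W"
    "\<And>k i. i \<le> fst k \<Longrightarrow> f (wv k i) = g (wv k i)" "u \<in> carrier U"
  shows "f u = g u"
  using U_span[OF submodule_equalizer[OF U.complex_space_axioms assms(1-3)]] assms(4,5) by auto

text \<open>Lines indexed by a summand and a step of its string. Steps beyond the highest weight get
  the zero space, so that the index type is a plain product.\<close>

definition wspace :: "(nat \<times> nat) \<times> nat \<Rightarrow> 'u set" where
  "wspace t = (if snd t \<le> fst (fst t) then range (\<lambda>c. c \<odot>\<^bsub>U\<^esub> wv (fst t) (snd t)) else {\<zero>\<^bsub>U\<^esub>})"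

definition wproj :: "(nat \<times> nat) \<times> nat \<Rightarrow> 'u \<Rightarrow> 'u" where
  "wproj t u = (if snd t \<le> fst (fst t)
     then wcoord (fst t) (snd t) (component U C (fst t) u) \<odot>\<^bsub>U\<^esub> wv (fst t) (snd t) else \<zero>\<^bsub>U\<^esub>)"

text \<open>Refines the summands to lines on which the number of raising steps is constant, so that
  diagonal operators can depend on it.\<close>

sublocale wd: decomposition U wspace wproj
proof (intro decomposition.intro decomposition_axioms.intro U.complex_space_axioms)
  show sub: "submodule (wspace t) CC U" for t
  proof (cases "snd t \<le> fst (fst t)")
    case True
    show ?thesis
    proof (rule U.submodule_CI)
      show "\<zero>\<^bsub>U\<^esub> \<in> wspace t" using True by (auto simp: wspace_def intro!: image_eqI[of _ _ 0])
      show "a \<oplus>\<^bsub>U\<^esub> b \<in> wspace t" if "a \<in> wspace t" "b \<in> wspace t" for a b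
        using that True by (auto simp: wspace_def)
    qed (use True in \<open>auto simp: wspace_def\<close>)
  next
    case False
    then show ?thesis by (intro U.submodule_CI) (auto simp: wspace_def)
  qed
  show "wproj t \<in> linear_maps U U" for t
    using U.pr_in by (intro linear_mapsI)
      (auto simp: wproj_def U.pr_add U.pr_smult wcoord_add wcoord_smult)
  show "wproj t v \<in> wspace t" if "v \<in> carrier U" for v t
    by (auto simp: wproj_def wspace_def)
  have eq: "wproj t' v = (if t = t' then v else \<zero>\<^bsub>U\<^esub>)" if v: "v \<in> wspace t" for v t t'
  proof (cases "snd t \<le> fst (fst t)")
    case True
    then obtain c where c: "v = c \<odot>\<^bsub>U\<^esub> wv (fst t) (snd t)" using v by (auto simp: wspace_def)
    have "v \<in> C (fst t)" unfolding c using C_D(3)[OF wv_C] .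
    then have comp: "component U C l v = (if fst t = l then v else \<zero>\<^bsub>U\<^esub>)" for l by (rule U.pr_eq)
    show ?thesis
    proof (cases "fst t = fst t'")
      case True
      have "wcoord (fst t') i v = c * wcoord (fst t) i (wv (fst t) (snd t))" for i
        using wcoord_smult[OF wv_C] True by (simp add: c)
      moreover have "t = t' \<longleftrightarrow> snd t = snd t'" using True by (simp add: prod_eq_iff)
      ultimately show ?thesis
        using True comp[of "fst t'"] \<open>snd t \<le> fst (fst t)\<close> wcoord(2)[of "snd t'" "fst t" "snd t"]
        by (cases "snd t = snd t'") (simp_all add: wproj_def c)
    next
      case False
      then show ?thesis using comp[of "fst t'"] by (auto simp: wproj_def wcoord_zero)
    qed
  next
    case False
    then have "v = \<zero>\<^bsub>U\<^esub>" using v by (simp add: wspace_def)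
    then show ?thesis by (auto simp: wproj_def wcoord_zero)
  qed
  show "wproj t v = v" if "v \<in> wspace t" for v t using eq[OF that, of t] by simp
  show "wproj t' v = \<zero>\<^bsub>U\<^esub>" if "v \<in> wspace t" "t \<noteq> t'" for v t t' using eq[OF that(1), of t'] that(2) by simp
  show "finite {t. wproj t v \<noteq> \<zero>\<^bsub>U\<^esub>}" if v: "v \<in> carrier U" for v
  proof (rule finite_subset)
    show "{t. wproj t v \<noteq> \<zero>\<^bsub>U\<^esub>} \<subseteq> Sigma {k. component U C k v \<noteq> \<zero>\<^bsub>U\<^esub>} (\<lambda>k. {..fst k})"
      by (auto simp: wproj_def wcoord_zero split: if_splits)
    show "finite (Sigma {k. component U C k v \<noteq> \<zero>\<^bsub>U\<^esub>} (\<lambda>k. {..fst k}))"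
      using U.pr_finite[OF v] by auto
  qed
  show "carrier U \<subseteq> Z" if Z: "submodule Z CC U" "\<And>t. wspace t \<subseteq> Z" for Z
  proof (rule U_span[OF Z(1)])
    fix k i assume "i \<le> fst (k :: nat \<times> nat)"
    then have "wv k i \<in> wspace (k, i)" by (auto simp: wspace_def intro!: image_eqI[of _ _ 1])
    then show "wv k i \<in> Z" using Z(2) by blast
  qed
qed

lemma wv_wspace: "i \<le> fst k \<Longrightarrow> wv k i \<in> wspace (k, i)"
  by (auto simp: wspace_def intro!: image_eqI[of _ _ 1])

text \<open>A nonzero \<open>u\<close> killed by all of \<open>sl2\<close> spans \<open>C k\<close>,
  which is then a line. This holds for any nonzero \<open>w\<close>, hence for lowest and highest
  weight vectors alike.\<close>

lemma killed_multiple: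
  assumes u: "u \<in> C k" "\<rho> x u = \<zero>\<^bsub>U\<^esub>" "\<rho> y u = \<zero>\<^bsub>U\<^esub>" "\<rho> h u = \<zero>\<^bsub>U\<^esub>"
    and w: "w \<in> C k" "w \<noteq> \<zero>\<^bsub>U\<^esub>"
  shows "\<exists>c. u = c \<odot>\<^bsub>U\<^esub> w"
proof (cases "u = \<zero>\<^bsub>U\<^esub>")
  case True
  then show ?thesis using w U.summand_in by (intro exI[of _ 0]) auto
next
  case False
  interpret Ck: complex_space "U\<lparr>carrier := C k\<rparr>" by (rule C_space)
  have uU: "u \<in> carrier U" using u U.summand_in by blast
  obtain c where c: "w = c \<odot>\<^bsub>U\<^esub> u"
  proof (rule Ck.irreducible_line[OF C_rho_linear[OF yhx_in(3)] C_rho_linear[OF yhx_in(1)] C_rho_linear[OF yhx_in(2)], of u w])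
    fix W assume "submodule W CC (U\<lparr>carrier := C k\<rparr>)" "\<forall>w\<in>W. \<rho> x w \<in> W \<and> \<rho> y w \<in> W \<and> \<rho> h w \<in> W"
    then show "W = {\<zero>\<^bsub>U\<lparr>carrier := C k\<rparr>\<^esub>} \<or> W = carrier (U\<lparr>carrier := C k\<rparr>)"
      using C_invariant_submodule by simp
  qed (use u w False that in auto)
  have "c \<noteq> 0" using c w uU by auto
  then show ?thesis using c uU by (intro exI[of _ "inverse c"]) simp
qed

section \<open>The invariant pairing on \<open>U\<close>\<close>

lemma p_bilinear: "p \<in> bilinear_maps U U scalar_space"
  using pairing by (simp add: fd_pairing_def)

lemmas p_linear_right = bilinear_mapsD(1)[OF p_bilinear]
lemmas p_linear_left = bilinear_mapsD(2)[OF p_bilinear]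

lemma p_simps:
  "u \<in> carrier U \<Longrightarrow> v \<in> carrier U \<Longrightarrow> w \<in> carrier U \<Longrightarrow> p u (v \<oplus>\<^bsub>U\<^esub> w) = p u v + p u w"
  "u \<in> carrier U \<Longrightarrow> w \<in> carrier U \<Longrightarrow> p u (c \<odot>\<^bsub>U\<^esub> w) = c * p u w"
  "u \<in> carrier U \<Longrightarrow> v \<in> carrier U \<Longrightarrow> w \<in> carrier U \<Longrightarrow> p (u \<oplus>\<^bsub>U\<^esub> v) w = p u w + p v w"
  "u \<in> carrier U \<Longrightarrow> w \<in> carrier U \<Longrightarrow> p (c \<odot>\<^bsub>U\<^esub> u) w = c * p u w"
  "u \<in> carrier U \<Longrightarrow> p u \<zero>\<^bsub>U\<^esub> = 0" "u \<in> carrier U \<Longrightarrow> p \<zero>\<^bsub>U\<^esub> u = 0"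
  using linear_mapsD[OF p_linear_right] linear_mapsD[OF p_linear_left]
    linear_maps_zero[OF U.complex_space_axioms complex_space_scalar p_linear_right]
    linear_maps_zero[OF U.complex_space_axioms complex_space_scalar p_linear_left] by simp_all

lemma p_orthogonal: "k \<noteq> l \<Longrightarrow> u \<in> C k \<Longrightarrow> w \<in> C l \<Longrightarrow> p u w = 0"
  using pairing unfolding fd_pairing_def by blast

text \<open>\<open>fd_pairing\<close> gives invariance inside one summand; across summands both
  sides vanish by orthogonality, and linearity does the rest.\<close>

lemma p_invariant:
  assumes a: "a \<in> carrier sl2" and u: "u \<in> carrier U" and w: "w \<in> carrier U"
  shows "p (\<rho> a u) w = - p u (\<rho> a w)"
proof -
  have base: "p (\<rho> a u) w = (-1) * p u (\<rho> a w)" if "u \<in> C k" "w \<in> C l" for u w k l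
  proof (cases "k = l")
    case True
    have "\<forall>k. \<forall>a\<in>carrier sl2. \<forall>u\<in>C k. \<forall>w\<in>C k. p (\<rho> a u) w = - p u (\<rho> a w)"
      using pairing unfolding fd_pairing_def by blast
    then have "p (\<rho> a u) w = - p u (\<rho> a w)" using a that True by blast
    then show ?thesis by simp
  next
    case False
    then show ?thesis using p_orthogonal[OF False] C_rho[OF a] that by simp
  qed
  have 1: "p (\<rho> a u) w = (-1) * p u (\<rho> a w)" if u: "u \<in> carrier U" and w: "w \<in> C l" for u w l
  proof (rule U.linear_maps_eqI[OF complex_space_scalar _ _ _ u])
    have wU: "w \<in> carrier U" using w U.summand_in by blast
    show "(\<lambda>u. p (\<rho> a u) w) \<in> linear_maps U scalar_space"
      by (rule linear_maps_comp[OF rho_linear[OF a] p_linear_left[OF wU]])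
    show "(\<lambda>u. (-1) * p u (\<rho> a w)) \<in> linear_maps U scalar_space"
      using wU a by (intro linear_mapsI) (auto simp: p_simps)
    show "p (\<rho> a v) w = (-1) * p v (\<rho> a w)" if "v \<in> C k" for k v using base[OF that w] .
  qed
  have "p (\<rho> a u) w = (-1) * p u (\<rho> a w)"
  proof (rule U.linear_maps_eqI[OF complex_space_scalar _ _ _ w])
    show "p (\<rho> a u) \<in> linear_maps U scalar_space" using p_linear_right a u by simp
    show "(\<lambda>w. (-1) * p u (\<rho> a w)) \<in> linear_maps U scalar_space"
      using u a by (intro linear_mapsI) (auto simp: p_simps rho_add rho_smult)
    show "p (\<rho> a u) v = (-1) * p u (\<rho> a v)" if "v \<in> C l" for l v using 1[OF u that] .
  qed
  then show ?thesis by simp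
qed

lemma p_component:
  assumes v: "v \<in> C k" and w: "w \<in> carrier U"
  shows "p v w = p v (component U C k w)" "p w v = p (component U C k w) v"
proof -
  have vU: "v \<in> carrier U" using v U.summand_in by blast
  have "p v u = p v (component U C k u)" "p u v = p (component U C k u) v" if "u \<in> C l" for l u
    using U.pr_eq[OF that, of k] p_orthogonal[of k l v u] p_orthogonal[of l k u v] v vU that p_simps(5,6)[OF vU]
    by (cases "k = l"; simp)+
  note eq = this
  show "p v w = p v (component U C k w)"
    by (rule U.linear_maps_eqI[OF complex_space_scalar p_linear_right[OF vU]
          linear_maps_comp[OF U.pr_linear p_linear_right[OF vU]] eq(1) w])
  show "p w v = p (component U C k w) v"
    by (rule U.linear_maps_eqI[OF complex_space_scalar p_linear_left[OF vU]
          linear_maps_comp[OF U.pr_linear p_linear_left[OF vU]] eq(2) w])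
qed

text \<open>If \<open>w\<close> is orthogonal to \<open>U\<close>, each component of
  \<open>w\<close> is orthogonal to its own summand, where the pairing is nondegenerate.\<close>

lemma p_nondegenerate:
  assumes w: "w \<in> carrier U"
  shows "(\<And>v. v \<in> carrier U \<Longrightarrow> p v w = 0) \<Longrightarrow> w = \<zero>\<^bsub>U\<^esub>"
    "(\<And>v. v \<in> carrier U \<Longrightarrow> p w v = 0) \<Longrightarrow> w = \<zero>\<^bsub>U\<^esub>"
proof -
  have nd: "nondegenerate (U\<lparr>carrier := C k\<rparr>) (U\<lparr>carrier := C k\<rparr>) p" for k
    using pairing by (cases k) (simp add: fd_pairing_def)
  show "w = \<zero>\<^bsub>U\<^esub>" if "\<And>v. v \<in> carrier U \<Longrightarrow> p v w = 0"
  proof (rule U.eq_zero_if_pr_zero[OF w])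
    fix k
    have "p v (component U C k w) = 0" if v: "v \<in> C k" for v
      using p_component(1)[OF v w] v U.summand_in \<open>\<And>v. v \<in> carrier U \<Longrightarrow> p v w = 0\<close> by simp
    then show "component U C k w = \<zero>\<^bsub>U\<^esub>"
      using nd[of k] U.pr_in[OF w, of k] by (simp add: nondegenerate_def)
  qed
  show "w = \<zero>\<^bsub>U\<^esub>" if "\<And>v. v \<in> carrier U \<Longrightarrow> p w v = 0"
  proof (rule U.eq_zero_if_pr_zero[OF w])
    fix k
    have "p (component U C k w) v = 0" if v: "v \<in> C k" for v
      using p_component(2)[OF v w] v U.summand_in \<open>\<And>v. v \<in> carrier U \<Longrightarrow> p w v = 0\<close> by simp
    then show "component U C k w = \<zero>\<^bsub>U\<^esub>"
      using nd[of k] U.pr_in[OF w, of k] by (simp add: nondegenerate_def)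
  qed
qed

text \<open>Invariance under \<open>h\<close> makes weight vectors orthogonal unless their weights
  are opposite; inside one summand this means \<open>i + j = fst k\<close>.\<close>

lemma p_wv:
  assumes "k \<noteq> l \<or> i + j \<noteq> fst k"
  shows "p (wv k i) (wv l j) = 0"
proof (cases "k = l")
  case True
  have "(2 * of_nat i - of_nat (fst k)) * p (wv k i) (wv l j) = - ((2 * of_nat j - of_nat (fst k)) * p (wv k i) (wv l j))"
    using p_invariant[of h "wv k i" "wv l j"] True by (simp add: rho_h_wv p_simps)
  then have "2 * (of_nat (i + j) - of_nat (fst k)) * p (wv k i) (wv l j) = 0"
    by (simp add: algebra_simps)
  moreover have "of_nat (i + j) - (of_nat (fst k) :: complex) \<noteq> 0"
    using assms True by (metis of_nat_eq_iff right_minus_eq)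
  ultimately show ?thesis by (metis mult_eq_0_iff zero_neq_numeral)
next
  case False
  then show ?thesis by (rule p_orthogonal[OF _ wv_C wv_C])
qed

text \<open>\<open>low k\<close> is orthogonal to every other weight vector, so a zero here would
  make it orthogonal to all of \<open>U\<close>.\<close>

lemma p_low_top: "p (low k) (wv k (fst k)) \<noteq> 0"
proof
  assume z: "p (low k) (wv k (fst k)) = 0"
  have "p (low k) w = 0" if w: "w \<in> carrier U" for w
  proof (rule linear_eq_on_wv[OF complex_space_scalar _ _ _ w])
    show "p (low k) \<in> linear_maps U scalar_space" using p_linear_right[OF wv_in[of k 0]] by (simp add: wv_0)
    show "(\<lambda>w. 0) \<in> linear_maps U scalar_space" by (auto intro: linear_mapsI)
    show "p (low k) (wv l j) = 0" for l j
      using p_wv[of k l 0 j] z wv_0[of k] by (cases "k = l \<and> j = fst k") auto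
  qed
  then have "low k = \<zero>\<^bsub>U\<^esub>" using p_nondegenerate(2)[of "low k"] wv_in[of k 0] wv_0[of k] by simp
  then show False using wv_nonzero[of 0 k] wv_0 by simp
qed

text \<open>The highest weight vector, scaled to pair to 4 with \<open>low k\<close>, just as equal
  formal vectors pair under \<open>q\<close>.\<close>

definition top :: "nat \<times> nat \<Rightarrow> 'u" where
  "top k = (4 / p (low k) (wv k (fst k))) \<odot>\<^bsub>U\<^esub> wv k (fst k)"

lemma low_top_in [simp]: "low k \<in> carrier U" "top k \<in> carrier U"
  using wv_in[of k 0] wv_in[of k "fst k"] by (simp_all add: wv_0 top_def)

lemma low_top_C: "low k \<in> C k" "top k \<in> C k"
  using wv_C[of k 0] C_D(3)[OF wv_C[of k "fst k"]] by (simp_all add: wv_0 top_def)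

lemma low_top_nonzero: "low k \<noteq> \<zero>\<^bsub>U\<^esub>" "top k \<noteq> \<zero>\<^bsub>U\<^esub>"
  using wv_nonzero[of 0 k] wv_nonzero[of "fst k" k] p_low_top[of k]
  by (simp_all add: wv_0 top_def U.smult_eq_zero_iff)

lemma p_low_top_eq: "p (low k) (top l) = (if k = l then 4 else 0)"
  using p_wv[of k l 0 "fst l"] p_low_top[of k] wv_0[of k] low_top_in(1)[of k]
  by (auto simp: top_def p_simps)

lemma rho_low_top:
  "\<rho> y (low k) = \<zero>\<^bsub>U\<^esub>" "\<rho> h (low k) = (- of_nat (fst k)) \<odot>\<^bsub>U\<^esub> low k"
  "\<rho> x (top k) = \<zero>\<^bsub>U\<^esub>" "\<rho> h (top k) = of_nat (fst k) \<odot>\<^bsub>U\<^esub> top k"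
  using rho_y_wv_0[of k] rho_h_wv[of k 0] rho_x_wv[of k "fst k"] wv_vanish[of k "Suc (fst k)"] rho_h_wv[of k "fst k"]
  by (simp_all add: wv_0 top_def rho_smult mult.commute)

lemma low_generates:
  assumes Z: "submodule Z CC U" "\<And>k. low k \<in> Z" "\<And>u. u \<in> Z \<Longrightarrow> \<rho> x u \<in> Z"
  shows "carrier U \<subseteq> Z"
proof (rule U_span[OF Z(1)])
  show "wv k i \<in> Z" for k i
    by (induction i) (use Z(2,3) wv_0 rho_x_wv[symmetric] in auto)
qed

text \<open>Lowering from the top reaches every weight vector because the coefficients in
  \<open>rho_y_wv_Suc\<close> are nonzero below the top.\<close>

lemma top_generates:
  assumes Z: "submodule Z CC U" "\<And>k. top k \<in> Z" "\<And>u. u \<in> Z \<Longrightarrow> \<rho> y u \<in> Z"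
  shows "carrier U \<subseteq> Z"
proof (rule U_span[OF Z(1)])
  fix k i assume "i \<le> fst (k :: nat \<times> nat)"
  then show "wv k i \<in> Z"
  proof (induction rule: inc_induct)
    case base
    have "wv k (fst k) = (p (low k) (wv k (fst k)) / 4) \<odot>\<^bsub>U\<^esub> top k"
      using p_low_top[of k] by (simp add: top_def)
    then show ?case using Z(2) U.submodule_CD(4)[OF Z(1)] by metis
  next
    case (step i)
    let ?c = "of_nat (Suc i) * (of_nat (fst k) - of_nat i) :: complex"
    have c: "?c \<noteq> 0" using step(2) by (simp del: of_nat_Suc)
    have "inverse ?c \<odot>\<^bsub>U\<^esub> \<rho> y (wv k (Suc i)) \<in> Z" using Z(3)[OF step(3)] U.submodule_CD(4)[OF Z(1)] by blast
    moreover have "inverse ?c \<odot>\<^bsub>U\<^esub> \<rho> y (wv k (Suc i)) = wv k i"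
      by (simp only: rho_y_wv_Suc U.smult_smult[OF wv_in] left_inverse[OF c] U.smult_1[OF wv_in])
    ultimately show ?case by simp
  qed
qed

text \<open>Distinct formal vectors go to distinct summands, which gives injectivity. The image
  consists of the vectors with all components on the chosen lines; this is how vectors killed by
  \<open>sl2\<close> are recognised later.\<close>

lemma formal_embedding:
  assumes w: "\<And>k. w k \<in> C k" "\<And>k. w k \<noteq> \<zero>\<^bsub>U\<^esub>"
  obtains E where "E \<in> linear_maps formal_space U" "\<And>i j. E (formal_vec i j) = w (i, j)"
    "\<And>f. f \<in> carrier formal_space \<Longrightarrow> E f = \<zero>\<^bsub>U\<^esub> \<Longrightarrow> f = (\<lambda>k. 0)"
    "\<And>u. u \<in> carrier U \<Longrightarrow> (\<forall>k. \<exists>c. component U C k u = c \<odot>\<^bsub>U\<^esub> w k) \<Longrightarrow>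
      \<exists>f\<in>carrier formal_space. u = E f"
proof -
  have wU [simp]: "w k \<in> carrier U" for k using w(1) U.summand_in by blast
  obtain E where E: "E \<in> linear_maps formal_space U" "\<And>i j. E (formal_vec i j) = w (i, j)"
    using formal_space_linear_map[OF U.complex_space_axioms, of w] by auto
  have comp: "component U C k (E f) = f k \<odot>\<^bsub>U\<^esub> w k" if f: "f \<in> carrier formal_space" for k f
  proof (rule formal_space_linear_eqI[OF U.complex_space_axioms linear_maps_comp[OF E(1) U.pr_linear] _ _ f])
    show "(\<lambda>f. f k \<odot>\<^bsub>U\<^esub> w k) \<in> linear_maps formal_space U"
      by (intro linear_mapsI) (simp_all add: mult.commute)
    show "component U C k (E (formal_vec i j)) = formal_vec i j k \<odot>\<^bsub>U\<^esub> w k" for i j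
      unfolding E(2) using U.pr_eq[OF w(1)[of "(i, j)"], of k] by (auto simp: formal_vec_def)
  qed
  show ?thesis
  proof (rule that[OF E])
    fix f assume f: "f \<in> carrier formal_space" "E f = \<zero>\<^bsub>U\<^esub>"
    then have "f k \<odot>\<^bsub>U\<^esub> w k = \<zero>\<^bsub>U\<^esub>" for k using comp[OF f(1), of k] by simp
    then show "f = (\<lambda>k. 0)" using U.smult_eq_zero_iff[OF wU] w(2) by (auto simp: fun_eq_iff)
  next
    fix u assume u: "u \<in> carrier U" "\<forall>k. \<exists>c. component U C k u = c \<odot>\<^bsub>U\<^esub> w k"
    then obtain f where f: "\<And>k. component U C k u = f k \<odot>\<^bsub>U\<^esub> w k" by metis
    have "{k. f k \<noteq> 0} \<subseteq> {k. component U C k u \<noteq> \<zero>\<^bsub>U\<^esub>}"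
      using f U.smult_eq_zero_iff[OF wU] w(2) by auto
    then have fin: "f \<in> carrier formal_space" using U.pr_finite[OF u(1)] by (auto intro: finite_subset)
    have EU: "E f \<in> carrier U" using linear_mapsD(1)[OF E(1) fin] .
    have "u \<oplus>\<^bsub>U\<^esub> (-1) \<odot>\<^bsub>U\<^esub> E f = \<zero>\<^bsub>U\<^esub>"
      by (rule U.eq_zero_if_pr_zero) (use u EU f comp[OF fin] in \<open>auto simp: U.pr_add U.pr_smult\<close>)
    then have "u = E f" using U.eq_iff_diff_zero[OF u(1) EU] by simp
    then show "\<exists>f\<in>carrier formal_space. u = E f" using fin by blast
  qed
qed

text \<open>The torus automorphism of \<open>sl2\<close> with entry \<open>2 powi d\<close>, where
  \<open>d\<close> is the degree -1, 0, 1 that \<open>y\<close>, \<open>h\<close>, \<open>x\<close>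
  receive in the second grading.\<close>

definition scale :: "complex^2^2 \<Rightarrow> complex^2^2" where
  "scale a = (cy a / 2) \<odot>\<^bsub>sl2\<^esub> y + (ch a \<odot>\<^bsub>sl2\<^esub> h + (2 * cx a) \<odot>\<^bsub>sl2\<^esub> x)"

lemma combination_in: "c \<odot>\<^bsub>sl2\<^esub> y + (d \<odot>\<^bsub>sl2\<^esub> h + d' \<odot>\<^bsub>sl2\<^esub> x) \<in> carrier sl2"
  using sl2.add_in[of "c \<odot>\<^bsub>sl2\<^esub> y" "d \<odot>\<^bsub>sl2\<^esub> h \<oplus>\<^bsub>sl2\<^esub> d' \<odot>\<^bsub>sl2\<^esub> x"]
    sl2.add_in[of "d \<odot>\<^bsub>sl2\<^esub> h" "d' \<odot>\<^bsub>sl2\<^esub> x"] by simp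

lemma coord_combination:
  "cy (c \<odot>\<^bsub>sl2\<^esub> y + (d \<odot>\<^bsub>sl2\<^esub> h + d' \<odot>\<^bsub>sl2\<^esub> x)) = c"
  "ch (c \<odot>\<^bsub>sl2\<^esub> y + (d \<odot>\<^bsub>sl2\<^esub> h + d' \<odot>\<^bsub>sl2\<^esub> x)) = d"
  "cx (c \<odot>\<^bsub>sl2\<^esub> y + (d \<odot>\<^bsub>sl2\<^esub> h + d' \<odot>\<^bsub>sl2\<^esub> x)) = d'"
proof -
  have "d \<odot>\<^bsub>sl2\<^esub> h + d' \<odot>\<^bsub>sl2\<^esub> x \<in> carrier sl2"
    using sl2.add_in[of "d \<odot>\<^bsub>sl2\<^esub> h" "d' \<odot>\<^bsub>sl2\<^esub> x"] by simp
  then show "cy (c \<odot>\<^bsub>sl2\<^esub> y + (d \<odot>\<^bsub>sl2\<^esub> h + d' \<odot>\<^bsub>sl2\<^esub> x)) = c"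
    "ch (c \<odot>\<^bsub>sl2\<^esub> y + (d \<odot>\<^bsub>sl2\<^esub> h + d' \<odot>\<^bsub>sl2\<^esub> x)) = d"
    "cx (c \<odot>\<^bsub>sl2\<^esub> y + (d \<odot>\<^bsub>sl2\<^esub> h + d' \<odot>\<^bsub>sl2\<^esub> x)) = d'"
    by (simp_all add: coord_add coord_smult)
qed

lemma scale_in [simp]: "scale a \<in> carrier sl2"
  unfolding scale_def by (rule combination_in)

lemma coord_scale [simp]: "cy (scale a) = cy a / 2" "ch (scale a) = ch a" "cx (scale a) = 2 * cx a"
  unfolding scale_def by (rule coord_combination)+

lemma scale_iso: "scale \<in> linear_isos sl2 sl2"
proof -
  have lin: "scale \<in> linear_maps sl2 sl2"
  proof (rule linear_mapsI)
    fix a b assume ab: "a \<in> carrier sl2" "b \<in> carrier sl2"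
    show "scale (a \<oplus>\<^bsub>sl2\<^esub> b) = scale a \<oplus>\<^bsub>sl2\<^esub> scale b"
      by (rule sl2_eqI) (use ab sl2.add_in[of "scale a" "scale b"] in \<open>auto simp: coord_add field_simps\<close>)
  next
    fix c a assume a: "a \<in> carrier sl2"
    show "scale (c \<odot>\<^bsub>sl2\<^esub> a) = c \<odot>\<^bsub>sl2\<^esub> scale a"
      by (rule sl2_eqI) (use a in \<open>auto simp: coord_smult\<close>)
  qed auto
  moreover have "bij_betw scale (carrier sl2) (carrier sl2)"
  \<comment> \<open>The inverse torus element.\<close>
  proof (rule bij_betw_byWitness[of _ "\<lambda>a. (2 * cy a) \<odot>\<^bsub>sl2\<^esub> y + (ch a \<odot>\<^bsub>sl2\<^esub> h + (cx a / 2) \<odot>\<^bsub>sl2\<^esub> x)"])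
  qed (auto intro!: sl2_eqI combination_in simp: coord_combination)
  ultimately show ?thesis by (simp add: linear_isos_def)
qed

text \<open>In the second grading \<open>low k\<close> has degree 1 and each \<open>x\<close> adds
  1, so \<open>\<sigma>\<close> is \<open>2 ^ Suc i\<close> on \<open>wv k i\<close>. Dually
  \<open>top k\<close> has degree -1 and each \<open>y\<close> subtracts 1, which gives
  \<open>\<tau>\<close>. The pairing is kept because only vectors with \<open>i + j = fst k\<close>
  meet.\<close>

lemma scaling_operators:
  obtains \<sigma> \<tau> where "\<sigma> \<in> linear_isos U U" "\<tau> \<in> linear_isos U U"
    "\<And>a u. a \<in> carrier sl2 \<Longrightarrow> u \<in> carrier U \<Longrightarrow> \<sigma> (\<rho> a u) = \<rho> (scale a) (\<sigma> u)"
    "\<And>u w. u \<in> carrier U \<Longrightarrow> w \<in> carrier U \<Longrightarrow> p (\<sigma> u) (\<tau> w) = p u w"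
    "\<And>k. \<sigma> (low k) = 2 \<odot>\<^bsub>U\<^esub> low k" "\<And>k. \<tau> (top k) = (1 / 2) \<odot>\<^bsub>U\<^esub> top k"
proof -
  obtain \<sigma> where s: "\<sigma> \<in> linear_isos U U" "\<And>t v. v \<in> wspace t \<Longrightarrow> \<sigma> v = 2 ^ Suc (snd t) \<odot>\<^bsub>U\<^esub> v"
    by (rule wd.diagonal_isomorphism[of "\<lambda>t. 2 ^ Suc (snd t)"]) auto
  obtain \<tau> where t: "\<tau> \<in> linear_isos U U"
    "\<And>t v. v \<in> wspace t \<Longrightarrow> \<tau> v = (1 / 2) ^ Suc (fst (fst t) - snd t) \<odot>\<^bsub>U\<^esub> v"
    by (rule wd.diagonal_isomorphism[of "\<lambda>t. (1 / 2) ^ Suc (fst (fst t) - snd t)"]) auto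
  note sl = linear_isosD(1)[OF s(1)] and tl = linear_isosD(1)[OF t(1)]
  note sn = linear_mapsD[OF sl] and tn = linear_mapsD[OF tl]
  have s0: "\<sigma> \<zero>\<^bsub>U\<^esub> = \<zero>\<^bsub>U\<^esub>" by (rule linear_maps_zero[OF U.complex_space_axioms U.complex_space_axioms sl])
  have sw: "\<sigma> (wv k i) = 2 ^ Suc i \<odot>\<^bsub>U\<^esub> wv k i" for k i
    using s(2)[OF wv_wspace[of i k]] wv_vanish[of k i] s0 by (cases "i \<le> fst k") auto
  have tw: "\<tau> (wv k i) = (1 / 2) ^ Suc (fst k - i) \<odot>\<^bsub>U\<^esub> wv k i" if "i \<le> fst k" for k i
    using t(2)[OF wv_wspace[OF that]] by simp
  have lin: "(\<lambda>u. \<sigma> (\<rho> a u)) \<in> linear_maps U U" "(\<lambda>u. \<rho> a (\<sigma> u)) \<in> linear_maps U U"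
    "(\<lambda>u. c \<odot>\<^bsub>U\<^esub> \<rho> a (\<sigma> u)) \<in> linear_maps U U" if "a \<in> carrier sl2" for a c
    using linear_maps_comp[OF rho_linear[OF that] sl] linear_maps_comp[OF sl rho_linear[OF that]]
      linear_maps_smult[OF U.complex_space_axioms linear_maps_comp[OF sl rho_linear[OF that]]] by auto
  have sx: "\<sigma> (\<rho> x u) = 2 \<odot>\<^bsub>U\<^esub> \<rho> x (\<sigma> u)" if "u \<in> carrier U" for u
    by (rule linear_eq_on_wv[OF U.complex_space_axioms lin(1,3) _ that]) (auto simp: rho_x_wv sw rho_smult)
  have sh: "\<sigma> (\<rho> h u) = \<rho> h (\<sigma> u)" if "u \<in> carrier U" for u
    by (rule linear_eq_on_wv[OF U.complex_space_axioms lin(1,2) _ that])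
      (auto simp: rho_h_wv sw rho_smult sn mult.commute)
  have sy: "\<sigma> (\<rho> y u) = (1 / 2) \<odot>\<^bsub>U\<^esub> \<rho> y (\<sigma> u)" if "u \<in> carrier U" for u
  proof (rule linear_eq_on_wv[OF U.complex_space_axioms lin(1,3) _ that])
    show "\<sigma> (\<rho> y (wv k i)) = (1 / 2) \<odot>\<^bsub>U\<^esub> \<rho> y (\<sigma> (wv k i))" for k i
    proof (cases i)
      case 0
      then show ?thesis using s0 rho_y_wv_0 by (simp add: sw rho_smult)
    next
      case (Suc j)
      then show ?thesis using sn(3)[OF wv_in] by (simp add: sw rho_smult rho_y_wv_Suc mult_ac del: of_nat_Suc)
    qed
  qed auto
  have 1: "\<sigma> (\<rho> a u) = \<rho> (scale a) (\<sigma> u)" if a: "a \<in> carrier sl2" and u: "u \<in> carrier U" for a u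
  proof -
    have su: "\<sigma> u \<in> carrier U" using sn(1)[OF u] .
    have "\<sigma> (\<rho> a u) = cy a \<odot>\<^bsub>U\<^esub> \<sigma> (\<rho> y u) \<oplus>\<^bsub>U\<^esub> (ch a \<odot>\<^bsub>U\<^esub> \<sigma> (\<rho> h u) \<oplus>\<^bsub>U\<^esub> cx a \<odot>\<^bsub>U\<^esub> \<sigma> (\<rho> x u))"
      unfolding rho_expand[OF a u] using u by (simp add: sn)
    also have "\<dots> = \<rho> (scale a) (\<sigma> u)"
      unfolding rho_expand[OF scale_in su] using u su by (simp add: sx sy sh mult.commute)
    finally show ?thesis .
  qed
  have "p (\<sigma> (wv k i)) (\<tau> (wv l j)) = p (wv k i) (wv l j)" if "i \<le> fst k" "j \<le> fst l" for k i l j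
  proof (cases "k = l \<and> i + j = fst k")
    case True
    \<comment> \<open>Here \<open>fst l - j = i\<close>, so the two powers are reciprocal.\<close>
    then have "2 ^ Suc i * (1 / 2) ^ Suc (fst l - j) = (1 :: complex)"
      by (metis add_diff_cancel_right' power_mult_distrib power_one mult.commute nonzero_mult_div_cancel_left times_divide_eq_right mult_1_right zero_neq_numeral)
    then show ?thesis using sw[of k i] tw[OF that(2)] by (simp add: p_simps mult.commute del: power_Suc)
  next
    case False
    then show ?thesis using p_wv[of k l i j] sw[of k i] tw[OF that(2)] by (simp add: p_simps)
  qed
  note p_wv_wv = this
  have 2: "p (\<sigma> (wv k i)) (\<tau> w) = p (wv k i) w" if i: "i \<le> fst k" and w: "w \<in> carrier U" for k i w
    by (rule linear_eq_on_wv[OF complex_space_scalar linear_maps_comp[OF tl p_linear_right[OF sn(1)[OF wv_in]]]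
          p_linear_right[OF wv_in] _ w]) (rule p_wv_wv[OF i])
  have 3: "p (\<sigma> u) (\<tau> w) = p u w" if u: "u \<in> carrier U" and w: "w \<in> carrier U" for u w
    by (rule linear_eq_on_wv[OF complex_space_scalar linear_maps_comp[OF sl p_linear_left[OF tn(1)[OF w]]]
          p_linear_left[OF w] _ u]) (rule 2[OF _ w])
  have "\<sigma> (low k) = 2 \<odot>\<^bsub>U\<^esub> low k" "\<tau> (top k) = (1 / 2) \<odot>\<^bsub>U\<^esub> top k" for k
    using sw[of k 0] tw[of "fst k" k] tn(3)[OF wv_in] by (simp_all add: wv_0 top_def mult.commute)
  then show ?thesis using that[OF s(1) t(1) 1 3] by blast
qed

end

section \<open>The Killing form as the form of the first pentad\<close>

lemma (in sl2_basis) sl2_span: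
  assumes Z: "submodule Z CC sl2" "y \<in> Z" "h \<in> Z" "x \<in> Z"
  shows "carrier sl2 \<subseteq> Z"
proof
  fix a assume a: "a \<in> carrier sl2"
  note ZD = sl2.submodule_CD[OF Z(1)]
  have "cy a \<odot>\<^bsub>sl2\<^esub> y \<oplus>\<^bsub>sl2\<^esub> (ch a \<odot>\<^bsub>sl2\<^esub> h \<oplus>\<^bsub>sl2\<^esub> cx a \<odot>\<^bsub>sl2\<^esub> x) \<in> Z"
    by (intro ZD(3) ZD(4) Z(2-))
  then have "cy a \<odot>\<^bsub>sl2\<^esub> y + (ch a \<odot>\<^bsub>sl2\<^esub> h + cx a \<odot>\<^bsub>sl2\<^esub> x) \<in> Z" by simp
  then show "a \<in> Z" unfolding expand[OF a, symmetric] .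
qed

lemma (in sl2_basis) killing_form_linear:
  assumes a: "a \<in> carrier sl2"
  shows "killing_form sl2 a \<in> linear_maps sl2 scalar_space"
proof (rule linear_mapsI)
  fix b c assume bc: "b \<in> carrier sl2" "c \<in> carrier sl2"
  then have "b + c \<in> carrier sl2" using sl2.add_in[of b c] by simp
  then show "killing_form sl2 a (b \<oplus>\<^bsub>sl2\<^esub> c) = killing_form sl2 a b \<oplus>\<^bsub>scalar_space\<^esub> killing_form sl2 a c"
    using a bc by (simp add: killing_form_sl2 coord_add algebra_simps)
next
  fix c b assume "b \<in> carrier sl2"
  then show "killing_form sl2 a (c \<odot>\<^bsub>sl2\<^esub> b) = c \<odot>\<^bsub>scalar_space\<^esub> killing_form sl2 a b"
    using a by (simp add: killing_form_sl2 coord_smult algebra_simps)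
qed auto

text \<open>The form with \<open>x\<close>, \<open>h\<close>, \<open>y\<close> returns the
  coordinates of \<open>b\<close> with the factors 4, 8, 4.\<close>

lemma (in sl2_basis) killing_form_nondegenerate:
  assumes b: "b \<in> carrier sl2" and z: "\<And>a. a \<in> carrier sl2 \<Longrightarrow> killing_form sl2 a b = 0"
  shows "b = \<zero>\<^bsub>sl2\<^esub>"
proof (rule sl2_eqI[OF b sl2.M.zero_closed])
  have "cy (0 \<odot>\<^bsub>sl2\<^esub> y) = 0" "ch (0 \<odot>\<^bsub>sl2\<^esub> y) = 0" "cx (0 \<odot>\<^bsub>sl2\<^esub> y) = 0" by (simp_all only: coord_smult yhx_in) simp_all
  then have z0: "cy \<zero>\<^bsub>sl2\<^esub> = 0" "ch \<zero>\<^bsub>sl2\<^esub> = 0" "cx \<zero>\<^bsub>sl2\<^esub> = 0" using sl2.smult_0_left[of y] by simp_all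
  show "cy b = cy \<zero>\<^bsub>sl2\<^esub>" "ch b = ch \<zero>\<^bsub>sl2\<^esub>" "cx b = cx \<zero>\<^bsub>sl2\<^esub>"
    unfolding z0 using z[of x] z[of h] z[of y] b by (simp_all add: killing_form_sl2)
qed

section \<open>The pentad of the line spanned by \<open>h\<close>\<close>

locale formal_pairing = sl2_basis +
  fixes q :: "(complex^2^2) \<times> (nat \<times> nat \<Rightarrow> complex) \<Rightarrow> (complex^2^2) \<times> (nat \<times> nat \<Rightarrow> complex) \<Rightarrow> complex"
  assumes q: "q \<in> bilinear_maps (line_formal_space x) (line_formal_space y) scalar_space"
    and q_x_e: "\<And>i j. q (x, \<zero>\<^bsub>formal_space\<^esub>) (\<zero>\<^bsub>sl2\<^esub>, formal_vec i j) = 0"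
    and q_e_y: "\<And>i j. q (\<zero>\<^bsub>sl2\<^esub>, formal_vec i j) (y, \<zero>\<^bsub>formal_space\<^esub>) = 0"
    and q_x_y: "q (x, \<zero>\<^bsub>formal_space\<^esub>) (y, \<zero>\<^bsub>formal_space\<^esub>) = 4"
    and q_e_e: "\<And>i j k l. q (\<zero>\<^bsub>sl2\<^esub>, formal_vec i j) (\<zero>\<^bsub>sl2\<^esub>, formal_vec k l) =
      (if (i, j) = (k, l) then 4 else 0)"
begin

abbreviation "V2 \<equiv> line_formal_space x"
abbreviation "W2 \<equiv> line_formal_space y"
abbreviation "\<rho>2 \<equiv> direct_sum_action (bracket sl2) (rho_minus h)"
abbreviation "\<rho>2' \<equiv> direct_sum_action (bracket sl2) (rho_plus h)"

lemma q_values: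
  "q (x, \<lambda>p. 0) (0, formal_vec i j) = 0" "q (0, formal_vec i j) (y, \<lambda>p. 0) = 0" "q (x, \<lambda>p. 0) (y, \<lambda>p. 0) = 4"
  "q (0, formal_vec i j) (0, formal_vec k l) = (if (i, j) = (k, l) then 4 else 0)"
  using q_x_e q_e_y q_x_y q_e_e by simp_all

lemma V2_space: "complex_space V2" and W2_space: "complex_space W2"
  by (simp_all add: complex_space_line_formal)

lemmas q_linear_right = bilinear_mapsD(1)[OF q]
lemmas q_linear_left = bilinear_mapsD(2)[OF q]

lemma line_coord_h: "line_coord h (c \<odot>\<^bsub>sl2\<^esub> h) = c"
  unfolding line_coord_def
proof (rule the_equality)
  fix d assume "c \<odot>\<^bsub>sl2\<^esub> h = d \<odot>\<^bsub>sl2\<^esub> h"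
  then have "ch (c \<odot>\<^bsub>sl2\<^esub> h) = ch (d \<odot>\<^bsub>sl2\<^esub> h)" by simp
  then show "d = c" by (simp add: coord_smult)
qed simp

lemma smult_zero_sl2 [simp]: "c \<odot>\<^bsub>sl2\<^esub> 0 = 0"
  using sl2.smult_0_right[of c] by simp

lemma zero_sl2_in [simp]: "0 \<in> carrier sl2"
  using sl2.M.zero_closed by simp

lemma rho2_h:
  "\<rho>2 (c \<odot>\<^bsub>sl2\<^esub> h) (d \<odot>\<^bsub>sl2\<^esub> x, f) = ((2 * c * d) \<odot>\<^bsub>sl2\<^esub> x, \<lambda>(i, j). c * (- of_nat i * f (i, j)))"
  "\<rho>2' (c \<odot>\<^bsub>sl2\<^esub> h) (d \<odot>\<^bsub>sl2\<^esub> y, f) = ((- 2 * c * d) \<odot>\<^bsub>sl2\<^esub> y, \<lambda>(i, j). c * (of_nat i * f (i, j)))"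
proof -
  have "bracket sl2 (c \<odot>\<^bsub>sl2\<^esub> h) (d \<odot>\<^bsub>sl2\<^esub> z) = c \<odot>\<^bsub>sl2\<^esub> (d \<odot>\<^bsub>sl2\<^esub> bracket sl2 h z)" if "z \<in> carrier sl2" for z
    using that by (simp add: sl2.bracket_smult_left sl2.bracket_smult_right mult.commute)
  then have "bracket sl2 (c \<odot>\<^bsub>sl2\<^esub> h) (d \<odot>\<^bsub>sl2\<^esub> x) = (2 * c * d) \<odot>\<^bsub>sl2\<^esub> x"
    "bracket sl2 (c \<odot>\<^bsub>sl2\<^esub> h) (d \<odot>\<^bsub>sl2\<^esub> y) = (- 2 * c * d) \<odot>\<^bsub>sl2\<^esub> y"
    by (simp_all add: hx hy mult_ac)
  then show "\<rho>2 (c \<odot>\<^bsub>sl2\<^esub> h) (d \<odot>\<^bsub>sl2\<^esub> x, f) = ((2 * c * d) \<odot>\<^bsub>sl2\<^esub> x, \<lambda>(i, j). c * (- of_nat i * f (i, j)))"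
    "\<rho>2' (c \<odot>\<^bsub>sl2\<^esub> h) (d \<odot>\<^bsub>sl2\<^esub> y, f) = ((- 2 * c * d) \<odot>\<^bsub>sl2\<^esub> y, \<lambda>(i, j). c * (of_nat i * f (i, j)))"
    by (simp_all add: direct_sum_action_def rho_minus_def rho_plus_def line_coord_h)
qed

lemma rho2_basis:
  assumes a: "a = c \<odot>\<^bsub>sl2\<^esub> h"
  shows "\<rho>2 a (x, \<lambda>p. 0) = (2 * c) \<odot>\<^bsub>V2\<^esub> (x, \<lambda>p. 0)"
    "\<rho>2 a (0, formal_vec i j) = (- c * of_nat i) \<odot>\<^bsub>V2\<^esub> (0, formal_vec i j)"
    "\<rho>2' a (y, \<lambda>p. 0) = (- 2 * c) \<odot>\<^bsub>W2\<^esub> (y, \<lambda>p. 0)"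
    "\<rho>2' a (0, formal_vec i j) = (c * of_nat i) \<odot>\<^bsub>W2\<^esub> (0, formal_vec i j)"
proof -
  have [simp]: "1 \<odot>\<^bsub>sl2\<^esub> x = x" "1 \<odot>\<^bsub>sl2\<^esub> y = y" "0 \<odot>\<^bsub>sl2\<^esub> x = 0" "0 \<odot>\<^bsub>sl2\<^esub> y = 0"
    using sl2.smult_1 sl2.smult_0_left by simp_all
  show "\<rho>2 a (x, \<lambda>p. 0) = (2 * c) \<odot>\<^bsub>V2\<^esub> (x, \<lambda>p. 0)"
    using rho2_h(1)[of c 1 "\<lambda>p. 0"] by (simp add: a fun_eq_iff)
  show "\<rho>2' a (y, \<lambda>p. 0) = (- 2 * c) \<odot>\<^bsub>W2\<^esub> (y, \<lambda>p. 0)"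
    using rho2_h(2)[of c 1 "\<lambda>p. 0"] by (simp add: a fun_eq_iff)
  have "(\<lambda>(k, l). c * (- of_nat k * formal_vec i j (k, l))) = (\<lambda>p. (- c * of_nat i) * formal_vec i j p)"
    "(\<lambda>(k, l). c * (of_nat k * formal_vec i j (k, l))) = (\<lambda>p. (c * of_nat i) * formal_vec i j p)"
    by (auto simp: fun_eq_iff formal_vec_def)
  then show "\<rho>2 a (0, formal_vec i j) = (- c * of_nat i) \<odot>\<^bsub>V2\<^esub> (0, formal_vec i j)"
    "\<rho>2' a (0, formal_vec i j) = (c * of_nat i) \<odot>\<^bsub>W2\<^esub> (0, formal_vec i j)"
    using rho2_h(1)[of c 0 "formal_vec i j"] rho2_h(2)[of c 0 "formal_vec i j"] by (simp_all add: a)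
qed

lemma rho2_linear:
  assumes a: "a \<in> carrier (sl2_line h)"
  shows "\<rho>2 a \<in> linear_maps V2 V2" "\<rho>2' a \<in> linear_maps W2 W2"
proof -
  obtain c where c: "a = c \<odot>\<^bsub>sl2\<^esub> h" using a by auto
  have fin: "finite {p. (case p of (i, j) \<Rightarrow> c * (g i * f (i, j))) \<noteq> 0}" if "finite {p. f p \<noteq> 0}"
    for f and g :: "nat \<Rightarrow> complex" by (rule finite_subset[OF _ that]) auto
  have sm: "u \<odot>\<^bsub>sl2\<^esub> z + v \<odot>\<^bsub>sl2\<^esub> z = (u + v) \<odot>\<^bsub>sl2\<^esub> z" if "z \<in> carrier sl2" for u v z
    using sl2.smult_add_left[OF that, of u v] by simp
  show "\<rho>2 a \<in> linear_maps V2 V2"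
  proof (rule linear_mapsI)
    fix u v k assume "u \<in> carrier V2"
    then obtain d f where u: "u = (d \<odot>\<^bsub>sl2\<^esub> x, f)" "finite {p. f p \<noteq> 0}" by (cases u) auto
    show "\<rho>2 a u \<in> carrier V2" using fin[OF u(2), of "\<lambda>i. - of_nat i"] by (auto simp: c u(1) rho2_h)
    show "\<rho>2 a (k \<odot>\<^bsub>V2\<^esub> u) = k \<odot>\<^bsub>V2\<^esub> \<rho>2 a u" by (auto simp: c u(1) rho2_h mult_ac)
    assume "v \<in> carrier V2"
    then obtain d' f' where v: "v = (d' \<odot>\<^bsub>sl2\<^esub> x, f')" by (cases v) auto
    show "\<rho>2 a (u \<oplus>\<^bsub>V2\<^esub> v) = \<rho>2 a u \<oplus>\<^bsub>V2\<^esub> \<rho>2 a v"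
      by (auto simp: c u(1) v rho2_h sm algebra_simps)
  qed
  show "\<rho>2' a \<in> linear_maps W2 W2"
  proof (rule linear_mapsI)
    fix u v k assume "u \<in> carrier W2"
    then obtain d f where u: "u = (d \<odot>\<^bsub>sl2\<^esub> y, f)" "finite {p. f p \<noteq> 0}" by (cases u) auto
    show "\<rho>2' a u \<in> carrier W2" using fin[OF u(2), of of_nat] by (auto simp: c u(1) rho2_h)
    show "\<rho>2' a (k \<odot>\<^bsub>W2\<^esub> u) = k \<odot>\<^bsub>W2\<^esub> \<rho>2' a u" by (auto simp: c u(1) rho2_h mult_ac)
    assume "v \<in> carrier W2"
    then obtain d' f' where v: "v = (d' \<odot>\<^bsub>sl2\<^esub> y, f')" by (cases v) auto
    show "\<rho>2' a (u \<oplus>\<^bsub>W2\<^esub> v) = \<rho>2' a u \<oplus>\<^bsub>W2\<^esub> \<rho>2' a v"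
      by (auto simp: c u(1) v rho2_h sm algebra_simps)
  qed
qed

lemmas V2_basis_in = line_formal_basis_in[OF yhx_in(3)]
lemmas W2_basis_in = line_formal_basis_in[OF yhx_in(1)]

lemma q_smult:
  "v \<in> carrier V2 \<Longrightarrow> w \<in> carrier W2 \<Longrightarrow> q (c \<odot>\<^bsub>V2\<^esub> v) w = c * q v w"
  "v \<in> carrier V2 \<Longrightarrow> w \<in> carrier W2 \<Longrightarrow> q v (c \<odot>\<^bsub>W2\<^esub> w) = c * q v w"
  using linear_mapsD(3)[OF q_linear_left] linear_mapsD(3)[OF q_linear_right] by simp_all

lemma bilinear_eq_on_basis:
  fixes A :: "(complex, 'z, 'm) module_scheme"
  assumes A: "complex_space A"
    and f: "\<And>v. v \<in> carrier V2 \<Longrightarrow> f v \<in> linear_maps W2 A" "\<And>w. w \<in> carrier W2 \<Longrightarrow> (\<lambda>v. f v w) \<in> linear_maps V2 A"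
    and g: "\<And>v. v \<in> carrier V2 \<Longrightarrow> g v \<in> linear_maps W2 A" "\<And>w. w \<in> carrier W2 \<Longrightarrow> (\<lambda>v. g v w) \<in> linear_maps V2 A"
    and xy: "f (x, \<lambda>p. 0) (y, \<lambda>p. 0) = g (x, \<lambda>p. 0) (y, \<lambda>p. 0)"
    and xe: "\<And>i j. f (x, \<lambda>p. 0) (0, formal_vec i j) = g (x, \<lambda>p. 0) (0, formal_vec i j)"
    and ey: "\<And>i j. f (0, formal_vec i j) (y, \<lambda>p. 0) = g (0, formal_vec i j) (y, \<lambda>p. 0)"
    and ee: "\<And>i j k l. f (0, formal_vec i j) (0, formal_vec k l) = g (0, formal_vec i j) (0, formal_vec k l)"
    and v: "v \<in> carrier V2" and w: "w \<in> carrier W2"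
  shows "f v w = g v w"
proof (rule line_formal_linear_eqI[OF yhx_in(1) A f(1)[OF v] g(1)[OF v] _ _ w])
  show "f v (y, \<lambda>p. 0) = g v (y, \<lambda>p. 0)"
    by (rule line_formal_linear_eqI[OF yhx_in(3) A f(2) g(2) _ _ v]) (use W2_basis_in xy ey in auto)
  show "f v (0, formal_vec k l) = g v (0, formal_vec k l)" for k l
    by (rule line_formal_linear_eqI[OF yhx_in(3) A f(2) g(2) _ _ v]) (use W2_basis_in xe ee in auto)
qed

text \<open>\<open>x\<close> and \<open>y\<close> have the opposite weights 2 and -2,
  \<open>formal_vec i j\<close> has weight \<open>- i\<close> on one side and \<open>i\<close> on
  the other, and \<open>q\<close> pairs each basis vector only with its counterpart.\<close>

lemma q_invariant:
  assumes a: "a \<in> carrier (sl2_line h)" and v: "v \<in> carrier V2" and w: "w \<in> carrier W2"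
  shows "q (\<rho>2 a v) w = - q v (\<rho>2' a w)"
proof -
  obtain c where c: "a = c \<odot>\<^bsub>sl2\<^esub> h" using a by auto
  note l = rho2_linear[OF a]
  have "q (\<rho>2 a v) w = (-1) * q v (\<rho>2' a w)"
  proof (rule bilinear_eq_on_basis[OF complex_space_scalar _ _ _ _ _ _ _ _ v w])
    show "q (\<rho>2 a v) \<in> linear_maps W2 scalar_space" if "v \<in> carrier V2" for v
      using q_linear_right linear_mapsD(1)[OF l(1) that] .
    show "(\<lambda>v. q (\<rho>2 a v) w) \<in> linear_maps V2 scalar_space" if "w \<in> carrier W2" for w
      by (rule linear_maps_comp[OF l(1) q_linear_left[OF that]])
    show "(\<lambda>w. (-1) * q v (\<rho>2' a w)) \<in> linear_maps W2 scalar_space" if "v \<in> carrier V2" for v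
      using linear_maps_smult[OF complex_space_scalar linear_maps_comp[OF l(2) q_linear_right[OF that]], of "-1"] by simp
    show "(\<lambda>v. (-1) * q v (\<rho>2' a w)) \<in> linear_maps V2 scalar_space" if "w \<in> carrier W2" for w
      using linear_maps_smult[OF complex_space_scalar q_linear_left[OF linear_mapsD(1)[OF l(2) that]], of "-1"] by simp
  qed (simp_all add: rho2_basis[OF c] q_smult V2_basis_in W2_basis_in q_values
      del: line_formal_space_simps)
  then show ?thesis by simp
qed

text \<open>Pairing with \<open>x\<close> and with the formal vectors reads off the coordinates of
  \<open>w\<close>, multiplied by 4.\<close>

lemma q_nondegenerate:
  assumes w: "w \<in> carrier W2" and z: "\<And>v. v \<in> carrier V2 \<Longrightarrow> q v w = 0"
  shows "w = \<zero>\<^bsub>W2\<^esub>"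
proof -
  have cy: "q (x, \<lambda>p. 0) w = 4 * cy (fst w)"
  proof (rule line_formal_linear_eqI[OF yhx_in(1) complex_space_scalar q_linear_right _ _ _ w])
    show "(\<lambda>w. 4 * cy (fst w)) \<in> linear_maps W2 scalar_space"
    proof (rule linear_mapsI)
      fix u v k assume "u \<in> carrier W2"
      then obtain d f where u: "u = (d \<odot>\<^bsub>sl2\<^esub> y, f)" by (cases u) auto
      show "4 * cy (fst (k \<odot>\<^bsub>W2\<^esub> u)) = k \<odot>\<^bsub>scalar_space\<^esub> (4 * cy (fst u))" by (simp add: u coord_smult)
      assume "v \<in> carrier W2"
      then obtain d' f' where v: "v = (d' \<odot>\<^bsub>sl2\<^esub> y, f')" by (cases v) auto
      show "4 * cy (fst (u \<oplus>\<^bsub>W2\<^esub> v)) = 4 * cy (fst u) \<oplus>\<^bsub>scalar_space\<^esub> 4 * cy (fst v)"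
        by (simp add: u v coord_add)
    qed auto
    have "cy 0 = 0" using coord_smult(1)[OF yhx_in(1), of 0] sl2.smult_0_left[of y] by simp
    then show "q (x, \<lambda>p. 0) (0, formal_vec i j) = 4 * cy (fst (0, formal_vec i j))" for i j by (simp add: q_values)
  qed (use V2_basis_in in \<open>simp_all add: q_values\<close>)
  have e: "q (0, formal_vec i j) w = 4 * snd w (i, j)" for i j
  proof (rule line_formal_linear_eqI[OF yhx_in(1) complex_space_scalar q_linear_right _ _ _ w])
    show "(\<lambda>w. 4 * snd w (i, j)) \<in> linear_maps W2 scalar_space" by (rule linear_mapsI) auto
    show "q (0, formal_vec i j) (0, formal_vec k l) = 4 * snd (0, formal_vec k l) (i, j)" for k l
      unfolding q_values(4) by (auto simp: formal_vec_def)
  qed (use V2_basis_in in \<open>simp_all add: q_values\<close>)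
  obtain d f where w': "w = (d \<odot>\<^bsub>sl2\<^esub> y, f)" using w by (cases w) auto
  have "d = 0" using cy z[OF V2_basis_in(1)] by (simp add: w' coord_smult)
  moreover have "f p = 0" for p using e[of "fst p" "snd p"] z[OF V2_basis_in(2)] by (simp add: w')
  ultimately show ?thesis using sl2.smult_0_left[of y] by (auto simp: w')
qed

text \<open>The line is abelian, so each condition reduces to an identity between zeros.\<close>

lemma lie_algebra_line: "lie_algebra (sl2_line h)"
proof (intro lie_algebra.intro lie_algebra_axioms.intro)
  interpret H: complex_space "sl2_line h" by (rule complex_space_sl2_line) simp
  show "vector_space_CC (sl2_line h)" by (rule H.module_axioms)
  have br: "bracket sl2 a b = 0" if "a \<in> carrier (sl2_line h)" "b \<in> carrier (sl2_line h)" for a b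
    using that sl2.bracket_smult_left[of _ h] sl2.bracket_smult_right[of h h] brackets_basis(9) by auto
  have l: "(\<lambda>b. 0) \<in> linear_maps (sl2_line h) (sl2_line h)"
    by (rule linear_mapsI) simp_all
  have cong: "f \<in> linear_maps (sl2_line h) (sl2_line h)" if "\<And>b. b \<in> carrier (sl2_line h) \<Longrightarrow> f b = 0" for f
    using l that H.M.a_closed H.smult_in unfolding linear_maps_def by (auto simp del: sl2_line_simps(1))
  show "bracket (sl2_line h) \<in> bilinear_maps (sl2_line h) (sl2_line h) (sl2_line h)"
    unfolding bilinear_maps_def by (auto intro!: cong br simp del: sl2_line_simps(1))
  show "bracket (sl2_line h) a a = \<zero>\<^bsub>sl2_line h\<^esub>" if "a \<in> carrier (sl2_line h)" for a
    using br[OF that that] by simp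
  show "bracket (sl2_line h) a (bracket (sl2_line h) b c) \<oplus>\<^bsub>sl2_line h\<^esub> bracket (sl2_line h) b (bracket (sl2_line h) c a)
     \<oplus>\<^bsub>sl2_line h\<^esub> bracket (sl2_line h) c (bracket (sl2_line h) a b) = \<zero>\<^bsub>sl2_line h\<^esub>"
    if "a \<in> carrier (sl2_line h)" "b \<in> carrier (sl2_line h)" "c \<in> carrier (sl2_line h)" for a b c
  proof -
    have "0 \<in> carrier (sl2_line h)" using H.M.zero_closed by simp
    then show ?thesis using that by (simp add: br del: sl2_line_simps(1))
  qed
qed

end

section \<open>Forms and scalings of the two pentads\<close>

lemma (in fd_module) scale_bracket:
  "a \<in> carrier sl2 \<Longrightarrow> b \<in> carrier sl2 \<Longrightarrow> scale (bracket sl2 a b) = bracket sl2 (scale a) (scale b)"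
  by (rule sl2_eqI) (simp_all add: coord_bracket)

lemma (in fd_module) scale_killing_form:
  "a \<in> carrier sl2 \<Longrightarrow> b \<in> carrier sl2 \<Longrightarrow> killing_form sl2 (scale a) (scale b) = killing_form sl2 a b"
  by (simp add: killing_form_sl2)

lemma (in formal_pairing) killing_form_line:
  assumes "a \<in> carrier (sl2_line h)"
  shows "killing_form sl2 a \<in> linear_maps (sl2_line h) scalar_space"
proof -
  have sub: "b \<in> carrier sl2" if "b \<in> carrier (sl2_line h)" for b using that by auto
  note l = linear_mapsD[OF killing_form_linear[OF sub[OF assms]]]
  show ?thesis
    by (rule linear_mapsI) (use l(2)[OF sub sub] l(3)[OF sub] in simp_all)
qed

lemma (in formal_pairing) killing_form_line_nondegenerate:
  assumes b: "b \<in> carrier (sl2_line h)" and z: "\<And>a. a \<in> carrier (sl2_line h) \<Longrightarrow> killing_form sl2 a b = 0"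
  shows "b = \<zero>\<^bsub>sl2_line h\<^esub>"
proof -
  obtain c where c: "b = c \<odot>\<^bsub>sl2\<^esub> h" using b by auto
  have "c = 0" using z[of h] by (simp add: c killing_form_sl2 coord_smult)
  then show ?thesis using sl2.smult_0_left[of h] by (simp add: c)
qed

text \<open>Fixes the \<open>sl2\<close> part, which has degree 0 in the first grading, and scales
  the formal part, which has degree 1 or -1 there.\<close>

definition rescale :: "complex \<Rightarrow> (complex^2^2) \<times> (nat \<times> nat \<Rightarrow> complex) \<Rightarrow> (complex^2^2) \<times> (nat \<times> nat \<Rightarrow> complex)" where
  "rescale c v = (fst v, \<lambda>p. c * snd v p)"

lemma rescale_iso:
  assumes z: "z \<in> carrier sl2" and c: "c \<noteq> 0"
  shows "rescale c \<in> linear_isos (line_formal_space z) (line_formal_space z)"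
proof -
  have "bij_betw (rescale c) (carrier (line_formal_space z)) (carrier (line_formal_space z))"
    by (rule bij_betw_byWitness[of _ "rescale (inverse c)"])
      (use c in \<open>auto simp: rescale_def line_formal_space_def mult.assoc[symmetric]\<close>)
  moreover have "rescale c \<in> linear_maps (line_formal_space z) (line_formal_space z)"
    by (rule linear_mapsI) (use c in \<open>auto simp: rescale_def algebra_simps\<close>)
  ultimately show ?thesis by (simp add: linear_isos_def)
qed

lemma rescale_basis:
  "rescale c (z, \<lambda>p. 0) = (z, \<lambda>p. 0)" "rescale c (0, f) = c \<odot>\<^bsub>line_formal_space z\<^esub> (0, f)"
  using sl2.smult_0_right[of c] by (simp_all add: rescale_def)

context formal_pairing
begin

lemma rescale_rho2:
  assumes "a \<in> carrier (sl2_line h)" "v \<in> carrier V2"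
  shows "rescale c (\<rho>2 a v) = \<rho>2 a (rescale c v)"
proof -
  obtain b where b: "a = b \<odot>\<^bsub>sl2\<^esub> h" using assms(1) by auto
  obtain d f where v: "v = (d \<odot>\<^bsub>sl2\<^esub> x, f)" using assms(2) by (cases v) auto
  show ?thesis by (auto simp: b v rho2_h rescale_def fun_eq_iff)
qed

text \<open>The factors \<open>c\<close> and \<open>1 / c\<close> cancel on pairs of formal vectors,
  and the mixed pairs vanish.\<close>

lemma q_rescale:
  assumes v: "v \<in> carrier V2" and w: "w \<in> carrier W2" and c: "c \<noteq> 0"
  shows "q (rescale c v) (rescale (1 / c) w) = q v w"
proof -
  note s = linear_isosD(1)[OF rescale_iso[OF yhx_in(3) c]]
    and t = linear_isosD(1)[OF rescale_iso[OF yhx_in(1), of "1 / c"]]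
  have c': "1 / c \<noteq> 0" using c by simp
  show ?thesis
  proof (rule bilinear_eq_on_basis[OF complex_space_scalar _ _ q_linear_right q_linear_left _ _ _ _ v w])
    show "(\<lambda>w. q (rescale c v) (rescale (1 / c) w)) \<in> linear_maps W2 scalar_space" if "v \<in> carrier V2" for v
      by (rule linear_maps_comp[OF t[OF c'] q_linear_right[OF linear_mapsD(1)[OF s that]]])
    show "(\<lambda>v. q (rescale c v) (rescale (1 / c) w)) \<in> linear_maps V2 scalar_space" if "w \<in> carrier W2" for w
      by (rule linear_maps_comp[OF s q_linear_left[OF linear_mapsD(1)[OF t[OF c'] that]]])
    show "q (rescale c (x, \<lambda>p. 0)) (rescale (1 / c) (y, \<lambda>p. 0)) = q (x, \<lambda>p. 0) (y, \<lambda>p. 0)"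
      by (simp only: rescale_basis(1))
    show "q (rescale c (x, \<lambda>p. 0)) (rescale (1 / c) (0, formal_vec i j)) = q (x, \<lambda>p. 0) (0, formal_vec i j)" for i j
      by (simp only: rescale_basis(1) rescale_basis(2)[where z = y] q_smult(2)[OF V2_basis_in(1) W2_basis_in(2)] q_values) simp
    show "q (rescale c (0, formal_vec i j)) (rescale (1 / c) (y, \<lambda>p. 0)) = q (0, formal_vec i j) (y, \<lambda>p. 0)" for i j
      by (simp only: rescale_basis(1) rescale_basis(2)[where z = x] q_smult(1)[OF V2_basis_in(2) W2_basis_in(1)] q_values) simp
    show "q (rescale c (0, formal_vec i j)) (rescale (1 / c) (0, formal_vec k l)) = q (0, formal_vec i j) (0, formal_vec k l)" for i j k l
      unfolding rescale_basis(2)[where z = x and c = c] rescale_basis(2)[where z = y and c = "1 / c"]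
        q_smult(1)[OF V2_basis_in(2) complex_space.smult_in[OF W2_space W2_basis_in(2)]]
        q_smult(2)[OF V2_basis_in(2) W2_basis_in(2)] using c by simp
  qed
qed

end

section \<open>The isomorphism\<close>

text \<open>
  \<open>F\<close> is the endomorphism of \<open>L\<^sub>1\<close> that becomes \<open>2 ^ n\<close> in degree \<open>n\<close> of the grading of \<open>L\<^sub>2\<close>, and
  \<open>F'\<close> the endomorphism of \<open>L\<^sub>2\<close> that becomes \<open>2 ^ n\<close> in degree \<open>n\<close> of the grading of \<open>L\<^sub>1\<close>.
\<close>

locale comparison = fd_module y h x U \<rho> C p + formal_pairing y h x q +
  P1: pairing_algebra sl2 U U L\<^sub>1 G\<^sub>1 \<rho> \<rho> "killing_form sl2" p P i0 i1 im +
  P2: pairing_algebra "sl2_line h" "line_formal_space x" "line_formal_space y" L\<^sub>2 G\<^sub>2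
    "direct_sum_action (bracket sl2) (rho_minus h)" "direct_sum_action (bracket sl2) (rho_plus h)"
    "killing_form sl2" q Q j0 j1 jm
  for y h x and U :: "(complex, 'u) module" and \<rho> C p q
    and L\<^sub>1 :: "'a lie" and G\<^sub>1 P i0 i1 im and L\<^sub>2 :: "'b lie" and G\<^sub>2 Q j0 j1 jm +
  fixes E E' :: "(nat \<times> nat \<Rightarrow> complex) \<Rightarrow> 'u" and F :: "'a \<Rightarrow> 'a" and F' :: "'b \<Rightarrow> 'b"
  assumes E: "E \<in> linear_maps formal_space U" "\<And>i j. E (formal_vec i j) = low (i, j)"
    "\<And>f. f \<in> carrier formal_space \<Longrightarrow> E f = \<zero>\<^bsub>U\<^esub> \<Longrightarrow> f = (\<lambda>k. 0)"
    "\<And>u. u \<in> carrier U \<Longrightarrow> (\<forall>k. \<exists>c. component U C k u = c \<odot>\<^bsub>U\<^esub> low k) \<Longrightarrow>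
      \<exists>f\<in>carrier formal_space. u = E f"
    and E': "E' \<in> linear_maps formal_space U" "\<And>i j. E' (formal_vec i j) = top (i, j)"
    "\<And>f. f \<in> carrier formal_space \<Longrightarrow> E' f = \<zero>\<^bsub>U\<^esub> \<Longrightarrow> f = (\<lambda>k. 0)"
    "\<And>u. u \<in> carrier U \<Longrightarrow> (\<forall>k. \<exists>c. component U C k u = c \<odot>\<^bsub>U\<^esub> top k) \<Longrightarrow>
      \<exists>f\<in>carrier formal_space. u = E' f"
    and F: "F \<in> lie_homs L\<^sub>1 L\<^sub>1" "\<And>a. a \<in> carrier sl2 \<Longrightarrow> F (i0 a) = i0 (scale a)"
    "\<And>k. F (i1 (low k)) = 2 \<odot>\<^bsub>L\<^sub>1\<^esub> i1 (low k)" "\<And>k. F (im (top k)) = (1 / 2) \<odot>\<^bsub>L\<^sub>1\<^esub> im (top k)"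
    and F': "F' \<in> lie_homs L\<^sub>2 L\<^sub>2" "\<And>a. a \<in> carrier (sl2_line h) \<Longrightarrow> F' (j0 a) = j0 a"
    "F' (j1 (x, \<lambda>p. 0)) = j1 (x, \<lambda>p. 0)" "F' (jm (y, \<lambda>p. 0)) = jm (y, \<lambda>p. 0)"
    "\<And>i j. F' (j1 (0, formal_vec i j)) = 2 \<odot>\<^bsub>L\<^sub>2\<^esub> j1 (0, formal_vec i j)"
    "\<And>i j. F' (jm (0, formal_vec i j)) = (1 / 2) \<odot>\<^bsub>L\<^sub>2\<^esub> jm (0, formal_vec i j)"
begin

text \<open>The image in \<open>L\<^sub>1\<close> of the degree 1 component of
  \<open>L\<^sub>2\<close>: \<open>x\<close> stays in degree 0, and formal vectors become lowest
  weight vectors in degree 1. \<open>\<theta>'\<close> does the same for degree -1, with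
  \<open>y\<close> and highest weight vectors.\<close>

definition \<theta> :: "(complex^2^2) \<times> (nat \<times> nat \<Rightarrow> complex) \<Rightarrow> 'a" where
  "\<theta> v = i0 (fst v) \<oplus>\<^bsub>L\<^sub>1\<^esub> i1 (E (snd v))"

definition \<theta>' :: "(complex^2^2) \<times> (nat \<times> nat \<Rightarrow> complex) \<Rightarrow> 'a" where
  "\<theta>' w = i0 (fst w) \<oplus>\<^bsub>L\<^sub>1\<^esub> im (E' (snd w))"

lemma line_in: "a \<in> carrier sl2 \<Longrightarrow> b \<in> carrier (sl2_line a) \<Longrightarrow> b \<in> carrier sl2"
  by auto

lemma E_in [simp]: "finite {p. f p \<noteq> 0} \<Longrightarrow> E f \<in> carrier U" "finite {p. f p \<noteq> 0} \<Longrightarrow> E' f \<in> carrier U"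
  using linear_mapsD(1)[OF E(1)] linear_mapsD(1)[OF E'(1)] by simp_all

lemma E_zero [simp]: "E (\<lambda>p. 0) = \<zero>\<^bsub>U\<^esub>" "E' (\<lambda>p. 0) = \<zero>\<^bsub>U\<^esub>"
  using linear_maps_zero[OF formal_space.complex_space_axioms U.complex_space_axioms E(1)]
    linear_maps_zero[OF formal_space.complex_space_axioms U.complex_space_axioms E'(1)] by simp_all

lemma fst_snd_linear:
  assumes "z \<in> carrier sl2"
  shows "fst \<in> linear_maps (line_formal_space z) sl2" "snd \<in> linear_maps (line_formal_space z) formal_space"
  using assms by (auto intro!: linear_mapsI)

lemma \<theta>_linear: "\<theta> \<in> linear_maps V2 L\<^sub>1" "\<theta>' \<in> linear_maps W2 L\<^sub>1"
proof -
  have "(\<lambda>v. i0 (fst v) \<oplus>\<^bsub>L\<^sub>1\<^esub> i1 (E (snd v))) \<in> linear_maps V2 L\<^sub>1"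
    by (intro linear_maps_add P1.complex_space_axioms linear_maps_comp[OF _ P1.i_linear(1)]
        linear_maps_comp[OF linear_maps_comp[OF _ E(1)] P1.i_linear(2)] fst_snd_linear yhx_in)
  then show "\<theta> \<in> linear_maps V2 L\<^sub>1" by (simp add: \<theta>_def[abs_def])
  have "(\<lambda>v. i0 (fst v) \<oplus>\<^bsub>L\<^sub>1\<^esub> im (E' (snd v))) \<in> linear_maps W2 L\<^sub>1"
    by (intro linear_maps_add P1.complex_space_axioms linear_maps_comp[OF _ P1.i_linear(1)]
        linear_maps_comp[OF linear_maps_comp[OF _ E'(1)] P1.i_linear(3)] fst_snd_linear yhx_in)
  then show "\<theta>' \<in> linear_maps W2 L\<^sub>1" by (simp add: \<theta>'_def[abs_def])
qed

lemmas \<theta>_in [simp] = linear_mapsD(1)[OF \<theta>_linear(1)]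
lemmas \<theta>'_in [simp] = linear_mapsD(1)[OF \<theta>_linear(2)]

lemma i0_zero [simp]: "i0 0 = \<zero>\<^bsub>L\<^sub>1\<^esub>"
  using P1.i_zero(1) by simp

lemma \<theta>_basis:
  "\<theta> (x, \<lambda>p. 0) = i0 x" "\<theta> (0, formal_vec i j) = i1 (low (i, j))"
  "\<theta>' (y, \<lambda>p. 0) = i0 y" "\<theta>' (0, formal_vec i j) = im (top (i, j))"
  by (simp_all add: \<theta>_def \<theta>'_def P1.i_zero E(2) E'(2))

text \<open>The two terms lie in different degrees of the first grading, so they vanish separately,
  and \<open>i0\<close>, \<open>i1\<close>, \<open>im\<close>, \<open>E\<close>, \<open>E'\<close>
  are injective.\<close>

lemma \<theta>_inj:
  "v \<in> carrier V2 \<Longrightarrow> \<theta> v = \<zero>\<^bsub>L\<^sub>1\<^esub> \<Longrightarrow> v = \<zero>\<^bsub>V2\<^esub>"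
  "w \<in> carrier W2 \<Longrightarrow> \<theta>' w = \<zero>\<^bsub>L\<^sub>1\<^esub> \<Longrightarrow> w = \<zero>\<^bsub>W2\<^esub>"
proof -
  have split: "a = \<zero>\<^bsub>L\<^sub>1\<^esub> \<and> b = \<zero>\<^bsub>L\<^sub>1\<^esub>"
    if "a \<in> G\<^sub>1 0" "b \<in> G\<^sub>1 n" "n \<noteq> 0" "a \<oplus>\<^bsub>L\<^sub>1\<^esub> b = \<zero>\<^bsub>L\<^sub>1\<^esub>" for a b n
  proof -
    have in_L: "a \<in> carrier L\<^sub>1" "b \<in> carrier L\<^sub>1" using that P1.summand_in by blast+
    have "component L\<^sub>1 G\<^sub>1 0 (a \<oplus>\<^bsub>L\<^sub>1\<^esub> b) = a"
      using in_L that(3) P1.pr_eq[OF that(1), of 0] P1.pr_eq[OF that(2), of 0] by (simp add: P1.pr_add)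
    then have "a = \<zero>\<^bsub>L\<^sub>1\<^esub>" using that(4) by simp
    then show ?thesis using that(4) in_L by simp
  qed
  show "v = \<zero>\<^bsub>V2\<^esub>" if v: "v \<in> carrier V2" and z: "\<theta> v = \<zero>\<^bsub>L\<^sub>1\<^esub>"
  proof -
    obtain d f where v': "v = (d \<odot>\<^bsub>sl2\<^esub> x, f)" "finite {p. f p \<noteq> 0}" using v by (cases v) auto
    have "i0 (d \<odot>\<^bsub>sl2\<^esub> x) \<in> G\<^sub>1 0" "i1 (E f) \<in> G\<^sub>1 1" using P1.i0_simps(1) P1.i1_simps(1) v' by auto
    from split[OF this] z have "i0 (d \<odot>\<^bsub>sl2\<^esub> x) = \<zero>\<^bsub>L\<^sub>1\<^esub>" "i1 (E f) = \<zero>\<^bsub>L\<^sub>1\<^esub>" by (simp_all add: \<theta>_def v')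
    then have "d \<odot>\<^bsub>sl2\<^esub> x = 0" "E f = \<zero>\<^bsub>U\<^esub>" using P1.i_eq_zero v' by auto
    then show ?thesis using E(3)[of f] v' by simp
  qed
  show "w = \<zero>\<^bsub>W2\<^esub>" if w: "w \<in> carrier W2" and z: "\<theta>' w = \<zero>\<^bsub>L\<^sub>1\<^esub>"
  proof -
    obtain d f where w': "w = (d \<odot>\<^bsub>sl2\<^esub> y, f)" "finite {p. f p \<noteq> 0}" using w by (cases w) auto
    have "i0 (d \<odot>\<^bsub>sl2\<^esub> y) \<in> G\<^sub>1 0" "im (E' f) \<in> G\<^sub>1 (-1)" using P1.i0_simps(1) P1.im_simps(1) w' by auto
    from split[OF this] z have "i0 (d \<odot>\<^bsub>sl2\<^esub> y) = \<zero>\<^bsub>L\<^sub>1\<^esub>" "im (E' f) = \<zero>\<^bsub>L\<^sub>1\<^esub>" by (simp_all add: \<theta>'_def w')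
    then have "d \<odot>\<^bsub>sl2\<^esub> y = 0" "E' f = \<zero>\<^bsub>U\<^esub>" using P1.i_eq_zero w' by auto
    then show ?thesis using E'(3)[of f] w' by simp
  qed
qed

text \<open>The first index of a formal vector is the highest weight of its summand: the lowest
  weight \<open>- i\<close> and the highest weight \<open>i\<close> are the eigenvalues in
  \<open>rho_minus\<close> and \<open>rho_plus\<close>.\<close>

lemma bracket_h_\<theta>:
  assumes a: "a \<in> carrier (sl2_line h)"
  shows "v \<in> carrier V2 \<Longrightarrow> bracket L\<^sub>1 (i0 a) (\<theta> v) = \<theta> (\<rho>2 a v)"
    "w \<in> carrier W2 \<Longrightarrow> bracket L\<^sub>1 (i0 a) (\<theta>' w) = \<theta>' (\<rho>2' a w)"
proof -
  obtain c where c: "a = c \<odot>\<^bsub>sl2\<^esub> h" using a by auto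
  have a2: "a \<in> carrier sl2" using a by (rule line_in[OF yhx_in(2)])
  note ad = P1.ad_linear[OF P1.i_in(1)[OF a2]]
  have rl: "\<rho> a (low k) = (- c * of_nat (fst k)) \<odot>\<^bsub>U\<^esub> low k" "\<rho> a (top k) = (c * of_nat (fst k)) \<odot>\<^bsub>U\<^esub> top k" for k
    by (simp_all add: c rho_scale rho_low_top)
  have brs: "bracket sl2 a x = (2 * c) \<odot>\<^bsub>sl2\<^esub> x" "bracket sl2 a y = (- 2 * c) \<odot>\<^bsub>sl2\<^esub> y"
    by (simp_all add: c sl2.bracket_smult_left hx hy mult.commute)
  show "bracket L\<^sub>1 (i0 a) (\<theta> v) = \<theta> (\<rho>2 a v)" if "v \<in> carrier V2"
  proof (rule line_formal_linear_eqI[OF yhx_in(3) P1.complex_space_axioms linear_maps_comp[OF \<theta>_linear(1) ad]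
        linear_maps_comp[OF rho2_linear(1)[OF a] \<theta>_linear(1)] _ _ that])
    show "bracket L\<^sub>1 (i0 a) (\<theta> (x, \<lambda>p. 0)) = \<theta> (\<rho>2 a (x, \<lambda>p. 0))"
      unfolding rho2_basis[OF c] linear_mapsD(3)[OF \<theta>_linear(1) V2_basis_in(1)]
      using a2 by (simp add: \<theta>_basis P1.bracket_00 brs P1.i0_simps)
    show "bracket L\<^sub>1 (i0 a) (\<theta> (0, formal_vec i j)) = \<theta> (\<rho>2 a (0, formal_vec i j))" for i j
      unfolding rho2_basis[OF c] linear_mapsD(3)[OF \<theta>_linear(1) V2_basis_in(2)]
      using a2 by (simp add: \<theta>_basis P1.bracket_01 rl P1.i1_simps)
  qed
  show "bracket L\<^sub>1 (i0 a) (\<theta>' w) = \<theta>' (\<rho>2' a w)" if "w \<in> carrier W2"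
  proof (rule line_formal_linear_eqI[OF yhx_in(1) P1.complex_space_axioms linear_maps_comp[OF \<theta>_linear(2) ad]
        linear_maps_comp[OF rho2_linear(2)[OF a] \<theta>_linear(2)] _ _ that])
    show "bracket L\<^sub>1 (i0 a) (\<theta>' (y, \<lambda>p. 0)) = \<theta>' (\<rho>2' a (y, \<lambda>p. 0))"
      unfolding rho2_basis[OF c] linear_mapsD(3)[OF \<theta>_linear(2) W2_basis_in(1)]
      using a2 by (simp add: \<theta>_basis P1.bracket_00 brs P1.i0_simps)
    show "bracket L\<^sub>1 (i0 a) (\<theta>' (0, formal_vec i j)) = \<theta>' (\<rho>2' a (0, formal_vec i j))" for i j
      unfolding rho2_basis[OF c] linear_mapsD(3)[OF \<theta>_linear(2) W2_basis_in(2)]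
      using a2 by (simp add: \<theta>_basis P1.bracket_0m rl P1.im_simps)
  qed
qed

text \<open>\<open>x\<close> kills \<open>top l\<close> and \<open>y\<close> kills
  \<open>low k\<close>, so the Killing form leaves only a multiple of \<open>h\<close>; the weight
  \<open>- fst k\<close>, the pairing 4 and the Killing norm 8 of \<open>h\<close> give its
  factor.\<close>

lemma P_low_top: "P (low k) (top l) = (if k = l then (- of_nat (fst k) / 2) \<odot>\<^bsub>sl2\<^esub> h else 0)"
proof -
  let ?z = "P (low k) (top l)"
  have z: "?z \<in> carrier sl2" by (rule P1.P_in) simp_all
  have B: "killing_form sl2 a ?z = p (\<rho> a (low k)) (top l)" if "a \<in> carrier sl2" for a
    using P1.P[OF that] by simp
  have "killing_form sl2 x ?z = 0" using B[of x] p_invariant[of x "low k" "top l"] by (simp add: rho_low_top p_simps)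
  moreover have "killing_form sl2 y ?z = 0" using B[of y] by (simp add: rho_low_top p_simps)
  moreover have "killing_form sl2 h ?z = - of_nat (fst k) * (if k = l then 4 else 0)"
    using B[of h] by (simp add: rho_low_top p_simps p_low_top_eq)
  ultimately have c: "cy ?z = 0" "cx ?z = 0" "8 * ch ?z = - of_nat (fst k) * (if k = l then 4 else 0)"
    using z by (simp_all add: killing_form_sl2)
  have c0: "cy 0 = 0" "ch 0 = 0" "cx 0 = 0"
    using coord_smult[OF yhx_in(1), of 0] sl2.smult_0_left[of y] by simp_all
  show ?thesis
    by (rule sl2_eqI[OF z]) (use c in \<open>auto simp: coord_smult c0 field_simps split: if_splits\<close>)
qed

text \<open>The divisor 8 is the Killing form of \<open>h\<close> with itself.\<close>

lemma Q_eq: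
  assumes v: "v \<in> carrier V2" and w: "w \<in> carrier W2"
  shows "Q v w = (q (\<rho>2 h v) w / 8) \<odot>\<^bsub>sl2\<^esub> h"
proof -
  obtain c where c: "Q v w = c \<odot>\<^bsub>sl2\<^esub> h" using P2.P_in[OF v w] by auto
  have "killing_form sl2 h (Q v w) = q (\<rho>2 h v) w" using P2.P[OF _ v w, of h] by simp
  then have "c = q (\<rho>2 h v) w / 8" by (simp add: c killing_form_sl2 coord_smult eq_divide_eq mult.commute)
  then show ?thesis using c by (simp only:)
qed

text \<open>The decisive relation for a copy of the local part of \<open>L\<^sub>2\<close> inside
  \<open>L\<^sub>1\<close>. On basis pairs, \<open>[x, y] = h\<close> matches the factor 2 times 4
  over 8; the mixed brackets vanish because \<open>x\<close> kills highest and \<open>y\<close>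
  lowest weight vectors; the formal pairs are \<open>P_low_top\<close>.\<close>

lemma bracket_\<theta>_\<theta>':
  assumes v: "v \<in> carrier V2" and w: "w \<in> carrier W2"
  shows "bracket L\<^sub>1 (\<theta> v) (\<theta>' w) = i0 (Q v w)"
proof -
  have hl: "h \<in> carrier (sl2_line h)" by simp
  have hh: "h = 1 \<odot>\<^bsub>sl2\<^esub> h" using sl2.smult_1[of h] by simp
  let ?g = "\<lambda>v w. (q (\<rho>2 h v) w / 8) \<odot>\<^bsub>L\<^sub>1\<^esub> i0 h"
  have scal: "(\<lambda>v. (k v / 8) \<odot>\<^bsub>L\<^sub>1\<^esub> i0 h) \<in> linear_maps A L\<^sub>1" if "k \<in> linear_maps A scalar_space"
    for k and A :: "(complex, 'z, 'm) module_scheme"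
    using linear_mapsD(2,3)[OF that] by (intro linear_mapsI) (simp_all add: add_divide_distrib)
  have "bracket L\<^sub>1 (\<theta> v) (\<theta>' w) = ?g v w"
  proof (rule bilinear_eq_on_basis[OF P1.complex_space_axioms _ _ _ _ _ _ _ _ v w])
    show "(\<lambda>w. bracket L\<^sub>1 (\<theta> v) (\<theta>' w)) \<in> linear_maps W2 L\<^sub>1" if "v \<in> carrier V2" for v
      by (rule linear_maps_comp[OF \<theta>_linear(2) P1.ad_linear[OF \<theta>_in[OF that]]])
    show "(\<lambda>v. bracket L\<^sub>1 (\<theta> v) (\<theta>' w)) \<in> linear_maps V2 L\<^sub>1" if "w \<in> carrier W2" for w
      by (rule linear_maps_comp[OF \<theta>_linear(1) P1.ad_right_linear[OF \<theta>'_in[OF that]]])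
    show "?g v \<in> linear_maps W2 L\<^sub>1" if "v \<in> carrier V2" for v
      by (rule scal[OF q_linear_right[OF linear_mapsD(1)[OF rho2_linear(1)[OF hl] that]]])
    show "(\<lambda>v. ?g v w) \<in> linear_maps V2 L\<^sub>1" if "w \<in> carrier W2" for w
      by (rule scal[OF linear_maps_comp[OF rho2_linear(1)[OF hl] q_linear_left[OF that]]])
    show "bracket L\<^sub>1 (\<theta> (x, \<lambda>p. 0)) (\<theta>' (y, \<lambda>p. 0)) = ?g (x, \<lambda>p. 0) (y, \<lambda>p. 0)"
      unfolding rho2_basis[OF hh] q_smult(1)[OF V2_basis_in(1) W2_basis_in(1)]
      by (simp add: \<theta>_basis P1.bracket_00 xy q_values)
    show "bracket L\<^sub>1 (\<theta> (x, \<lambda>p. 0)) (\<theta>' (0, formal_vec i j)) = ?g (x, \<lambda>p. 0) (0, formal_vec i j)" for i j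
      unfolding rho2_basis[OF hh] q_smult(1)[OF V2_basis_in(1) W2_basis_in(2)]
      by (simp add: \<theta>_basis P1.bracket_0m rho_low_top P1.i_zero q_values)
    show "bracket L\<^sub>1 (\<theta> (0, formal_vec i j)) (\<theta>' (y, \<lambda>p. 0)) = ?g (0, formal_vec i j) (y, \<lambda>p. 0)" for i j
      unfolding rho2_basis[OF hh] q_smult(1)[OF V2_basis_in(2) W2_basis_in(1)]
      using P1.bracket_swap[of "i1 (low (i, j))" "i0 y"]
      by (simp add: \<theta>_basis P1.bracket_01 rho_low_top P1.i_zero q_values)
    show "bracket L\<^sub>1 (\<theta> (0, formal_vec i j)) (\<theta>' (0, formal_vec k l)) = ?g (0, formal_vec i j) (0, formal_vec k l)" for i j k l
      unfolding rho2_basis[OF hh] q_smult(1)[OF V2_basis_in(2) W2_basis_in(2)]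
      by (auto simp: \<theta>_basis P1.bracket_1m P_low_top q_values P1.i0_simps(3))
  qed
  also have "\<dots> = i0 (Q v w)" unfolding Q_eq[OF v w] by (simp add: P1.i0_simps(3))
  finally show ?thesis .
qed

section \<open>The subalgebra \<open>S\<close> of the product\<close>

abbreviation "M \<equiv> direct_sum_lie L\<^sub>1 L\<^sub>2"

text \<open>The graph of the identification of the local part of \<open>L\<^sub>2\<close> with its
  copy in \<open>L\<^sub>1\<close>. Every degree other than 0 and 1 receives the piece meant for
  -1.\<close>

definition R :: "int \<Rightarrow> ('a \<times> 'b) set" where
  "R n = (if n = 0 then (\<lambda>a. (i0 a, j0 a)) ` carrier (sl2_line h)
    else if n = 1 then (\<lambda>v. (\<theta> v, j1 v)) ` carrier V2
    else (\<lambda>w. (\<theta>' w, jm w)) ` carrier W2)"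

lemma R_simps:
  "R 0 = (\<lambda>a. (i0 a, j0 a)) ` carrier (sl2_line h)" "R 1 = (\<lambda>v. (\<theta> v, j1 v)) ` carrier V2"
  "R (-1) = (\<lambda>w. (\<theta>' w, jm w)) ` carrier W2"
  by (simp_all add: R_def)

sublocale M: lie_algebra M
  by (rule lie_algebra_direct_sum[OF P1.lie_algebra_axioms P2.lie_algebra_axioms])

lemma pair_linear:
  "f \<in> linear_maps A L\<^sub>1 \<Longrightarrow> g \<in> linear_maps A L\<^sub>2 \<Longrightarrow> (\<lambda>v. (f v, g v)) \<in> linear_maps A M"
  by (auto intro!: linear_mapsI dest: linear_mapsD)

lemma i0_line_linear: "i0 \<in> linear_maps (sl2_line h) L\<^sub>1"
proof (rule linear_mapsI)
  fix a b assume "a \<in> carrier (sl2_line h)" "b \<in> carrier (sl2_line h)"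
  then show "i0 (a \<oplus>\<^bsub>sl2_line h\<^esub> b) = i0 a \<oplus>\<^bsub>L\<^sub>1\<^esub> i0 b"
    using P1.i0_simps(2)[of a b] line_in[OF yhx_in(2)] by simp
next
  fix c a assume "a \<in> carrier (sl2_line h)"
  then show "i0 (c \<odot>\<^bsub>sl2_line h\<^esub> a) = c \<odot>\<^bsub>L\<^sub>1\<^esub> i0 a"
    using P1.i0_simps(3)[of a] line_in[OF yhx_in(2)] by simp
qed (use line_in[OF yhx_in(2)] in auto)

text \<open>Both coordinates obey the same bracket formulas, those of the second pentad.\<close>

sublocale R: local_generators M R
proof (intro local_generators.intro local_generators_axioms.intro M.lie_algebra_axioms)
  show "submodule (R n) CC M" for n
  proof -
    have "submodule (R 0) CC M" unfolding R_simps
      by (rule submodule_image[OF P2.g.complex_space_axioms M.complex_space_axioms pair_linear[OF i0_line_linear P2.i_linear(1)]])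
    moreover have "submodule (R 1) CC M" unfolding R_simps
      by (rule submodule_image[OF V2_space M.complex_space_axioms pair_linear[OF \<theta>_linear(1) P2.i_linear(2)]])
    moreover have "submodule ((\<lambda>w. (\<theta>' w, jm w)) ` carrier W2) CC M"
      by (rule submodule_image[OF W2_space M.complex_space_axioms pair_linear[OF \<theta>_linear(2) P2.i_linear(3)]])
    ultimately show ?thesis by (auto simp: R_def split: if_splits)
  qed
  show "bracket M a b \<in> R 0" if ab: "a \<in> R 0" "b \<in> R 0" for a b
  proof -
    obtain a' b' where x: "a = (i0 a', j0 a')" "b = (i0 b', j0 b')" "a' \<in> carrier (sl2_line h)" "b' \<in> carrier (sl2_line h)"
      using ab unfolding R_simps by blast
    have "bracket M a b = (i0 (bracket (sl2_line h) a' b'), j0 (bracket (sl2_line h) a' b'))"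
      using x P1.bracket_00[of a' b'] P2.bracket_00[of a' b'] line_in[OF yhx_in(2)] by simp
    then show ?thesis unfolding R_simps using P2.g.bracket_in[OF x(3,4)] by blast
  qed
  show "bracket M a b \<in> R 1" if ab: "a \<in> R 0" "b \<in> R 1" for a b
  proof -
    obtain a' v where x: "a = (i0 a', j0 a')" "b = (\<theta> v, j1 v)" "a' \<in> carrier (sl2_line h)" "v \<in> carrier V2"
      using ab unfolding R_simps by blast
    have "bracket M a b = (\<theta> (\<rho>2 a' v), j1 (\<rho>2 a' v))"
      using x(1,2) bracket_h_\<theta>(1)[OF x(3,4)] P2.bracket_01[OF x(3,4)] by simp
    then show ?thesis unfolding R_simps using linear_mapsD(1)[OF rho2_linear(1)[OF x(3)] x(4)] by blast
  qed
  show "bracket M a b \<in> R (-1)" if ab: "a \<in> R 0" "b \<in> R (-1)" for a b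
  proof -
    obtain a' v where x: "a = (i0 a', j0 a')" "b = (\<theta>' v, jm v)" "a' \<in> carrier (sl2_line h)" "v \<in> carrier W2"
      using ab unfolding R_simps by blast
    have "bracket M a b = (\<theta>' (\<rho>2' a' v), jm (\<rho>2' a' v))"
      using x(1,2) bracket_h_\<theta>(2)[OF x(3,4)] P2.bracket_0m[OF x(3,4)] by simp
    then show ?thesis unfolding R_simps using linear_mapsD(1)[OF rho2_linear(2)[OF x(3)] x(4)] by blast
  qed
  show "bracket M a b \<in> R 0" if ab: "a \<in> R 1" "b \<in> R (-1)" for a b
  proof -
    obtain v w where x: "a = (\<theta> v, j1 v)" "b = (\<theta>' w, jm w)" "v \<in> carrier V2" "w \<in> carrier W2"
      using ab unfolding R_simps by blast
    have "bracket M a b = (i0 (Q v w), j0 (Q v w))"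
      using x(1,2) bracket_\<theta>_\<theta>'[OF x(3,4)] P2.bracket_1m[OF x(3,4)] by simp
    then show ?thesis unfolding R_simps using P2.P_in[OF x(3,4)] by blast
  qed
qed

definition S :: "('a \<times> 'b) set" where "S = lie_span M (R (-1) \<union> R 0 \<union> R 1)"

lemma R_carrier: "R (-1) \<union> R 0 \<union> R 1 \<subseteq> carrier M"
  using R.R_in by auto

lemma S_subalgebra: "lie_subalgebra S M"
  unfolding S_def by (rule M.lie_subalgebra_lie_span[OF R_carrier])

lemma S_submodule: "submodule S CC M"
  using S_subalgebra by (simp add: lie_subalgebra_def)

lemma S_bracket: "a \<in> S \<Longrightarrow> b \<in> S \<Longrightarrow> bracket M a b \<in> S"
  using S_subalgebra by (simp add: lie_subalgebra_def)

lemma R_S: "n \<in> {-1, 0, 1} \<Longrightarrow> z \<in> R n \<Longrightarrow> z \<in> S"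
  unfolding S_def by (rule lie_span.base) auto

lemma S_generators:
  "a \<in> carrier (sl2_line h) \<Longrightarrow> (i0 a, j0 a) \<in> S"
  "v \<in> carrier V2 \<Longrightarrow> (\<theta> v, j1 v) \<in> S" "w \<in> carrier W2 \<Longrightarrow> (\<theta>' w, jm w) \<in> S"
  using R_S[of 0] R_S[of 1] R_S[of "-1"] by (auto simp: R_simps)

lemmas F_linear = CollectD[OF F(1)[unfolded lie_homs_def], THEN conjunct1]

lemma F_bracket: "a \<in> carrier L\<^sub>1 \<Longrightarrow> b \<in> carrier L\<^sub>1 \<Longrightarrow> F (bracket L\<^sub>1 a b) = bracket L\<^sub>1 (F a) (F b)"
  using F(1) by (simp add: lie_homs_def)

lemma scale_basis: "scale y = (1 / 2) \<odot>\<^bsub>sl2\<^esub> y" "scale h = h" "scale x = 2 \<odot>\<^bsub>sl2\<^esub> x"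
  by (rule sl2_eqI; simp add: coord_smult)+

lemma F_\<theta>:
  "v \<in> carrier V2 \<Longrightarrow> F (\<theta> v) = 2 \<odot>\<^bsub>L\<^sub>1\<^esub> \<theta> v" "w \<in> carrier W2 \<Longrightarrow> F (\<theta>' w) = (1 / 2) \<odot>\<^bsub>L\<^sub>1\<^esub> \<theta>' w"
  using line_formal_linear_eqI[OF yhx_in(3) P1.complex_space_axioms linear_maps_comp[OF \<theta>_linear(1) F_linear]
      linear_maps_smult[OF P1.complex_space_axioms \<theta>_linear(1), of 2], of v]
    line_formal_linear_eqI[OF yhx_in(1) P1.complex_space_axioms linear_maps_comp[OF \<theta>_linear(2) F_linear]
      linear_maps_smult[OF P1.complex_space_axioms \<theta>_linear(2), of "1 / 2"], of w]
  by (simp_all add: \<theta>_basis F scale_basis P1.i0_simps(3))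

text \<open>A bracket with \<open>R 1\<close> doubles the eigenvalue of \<open>F\<close> on the
  first coordinate and raises the degree of the second; a bracket with \<open>R (-1)\<close> halves
  and lowers. So one label controls both coordinates.\<close>

lemma graded_span_eigen:
  "graded_span M R n z \<Longrightarrow> F (fst z) = (2 powi n) \<odot>\<^bsub>L\<^sub>1\<^esub> fst z \<and> snd z \<in> G\<^sub>2 n"
proof (induction rule: graded_span.induct)
  case (base n z)
  then consider "n = -1" | "n = 0" | "n = 1" by blast
  then show ?case
  proof cases
    case 1
    then obtain w where w: "z = (\<theta>' w, jm w)" "w \<in> carrier W2" using base unfolding 1 R_simps by blast
    then show ?thesis using F_\<theta>(2)[OF w(2)] P2.im_simps(1)[OF w(2)] 1 by (simp add: power_int_minus inverse_eq_divide)
  next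
    case 2
    then obtain a where a: "z = (i0 a, j0 a)" "a \<in> carrier (sl2_line h)" using base unfolding 2 R_simps by blast
    obtain c where c: "a = c \<odot>\<^bsub>sl2\<^esub> h" using a(2) by auto
    have "scale a = a" by (rule sl2_eqI) (simp_all add: c coord_smult)
    then have "F (i0 a) = i0 a" using F(2)[of a] c by simp
    then show ?thesis using P2.i0_simps(1)[OF a(2)] a 2 c by simp
  next
    case 3
    then obtain v where v: "z = (\<theta> v, j1 v)" "v \<in> carrier V2" using base unfolding 3 R_simps by blast
    then show ?thesis using F_\<theta>(1)[OF v(2)] P2.i1_simps(1)[OF v(2)] 3 by simp
  qed
next
  case (up n a b)
  obtain v where v: "a = (\<theta> v, j1 v)" "v \<in> carrier V2" using up unfolding R_simps by blast
  have b: "fst b \<in> carrier L\<^sub>1" using R.graded_span_in[OF up(3)] by (cases b) auto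
  have "F (bracket L\<^sub>1 (\<theta> v) (fst b)) = (2 * 2 powi n) \<odot>\<^bsub>L\<^sub>1\<^esub> bracket L\<^sub>1 (\<theta> v) (fst b)"
    using up.IH v(2) b F_\<theta>(1) F_bracket by (simp add: P1.bracket_smult_left P1.bracket_smult_right mult.commute)
  moreover have "bracket L\<^sub>2 (j1 v) (snd b) \<in> G\<^sub>2 (n + 1)"
    using P2.bracket_graded[OF P2.i1_simps(1)[OF v(2)], of "snd b" n] up.IH by (simp add: add.commute)
  ultimately show ?case unfolding v(1) by (cases b) (simp add: power_int_add mult.commute)
next
  case (down n a b)
  obtain w where w: "a = (\<theta>' w, jm w)" "w \<in> carrier W2" using down unfolding R_simps by blast
  have b: "fst b \<in> carrier L\<^sub>1" using R.graded_span_in[OF down(3)] by (cases b) auto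
  have "F (bracket L\<^sub>1 (\<theta>' w) (fst b)) = ((1 / 2) * 2 powi n) \<odot>\<^bsub>L\<^sub>1\<^esub> bracket L\<^sub>1 (\<theta>' w) (fst b)"
    using down.IH w(2) b F_\<theta>(2) F_bracket by (simp add: P1.bracket_smult_left P1.bracket_smult_right mult.commute)
  moreover have "bracket L\<^sub>2 (jm w) (snd b) \<in> G\<^sub>2 (n - 1)"
    using P2.bracket_graded[OF P2.im_simps(1)[OF w(2)], of "snd b" n] down.IH by simp
  ultimately show ?case unfolding w(1) by (cases b) (simp add: power_int_diff)
next
  case (zero n)
  then show ?case using linear_maps_zero[OF P1.complex_space_axioms P1.complex_space_axioms F_linear] P2.G_zero by simp
next
  case (add n a b)
  have "fst a \<in> carrier L\<^sub>1" "fst b \<in> carrier L\<^sub>1"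
    using R.graded_span_in[OF add(1)] R.graded_span_in[OF add(2)] by (cases a; cases b; auto)+
  then show ?case using add.IH linear_mapsD(2)[OF F_linear] P2.submodule_CD(3)[OF P2.summand]
    by (cases a, cases b) (simp add: P1.smult_add_right)
next
  case (smult n a c)
  have "fst a \<in> carrier L\<^sub>1" using R.graded_span_in[OF smult(1)] by (cases a) auto
  then show ?case using smult.IH linear_mapsD(3)[OF F_linear] P2.submodule_CD(4)[OF P2.summand]
    by (cases a) (simp add: mult.commute)
qed

text \<open>The norm reduces this to strict growth of real powers. It makes eigenvalues tell degrees
  apart.\<close>

lemma powi_inj: "inj (\<lambda>n. (2::complex) powi n)"
proof (rule injI)
  fix m n :: int assume "(2::complex) powi m = 2 powi n"
  then have "norm ((2::complex) powi m) = norm ((2::complex) powi n)" by simp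
  then have "(2::real) powi m = 2 powi n" by (simp add: norm_power_int)
  then show "m = n"
    using power_int_strict_increasing[of m n "2::real"] power_int_strict_increasing[of n m "2::real"]
    by (cases m n rule: linorder_cases) auto
qed

text \<open>The first coordinates of the homogeneous terms are eigenvectors of \<open>F\<close> for
  distinct eigenvalues with sum zero, hence all vanish; their second coordinates are the components
  of \<open>b\<close>.\<close>

lemma S_zero_component:
  assumes b: "(\<zero>\<^bsub>L\<^sub>1\<^esub>, b) \<in> S"
  shows "graded_span M R n (\<zero>\<^bsub>L\<^sub>1\<^esub>, component L\<^sub>2 G\<^sub>2 n b)"
proof -
  obtain A c where A: "finite A" and c: "\<And>n. graded_span M R n (c n)" "\<And>n. n \<notin> A \<Longrightarrow> c n = \<zero>\<^bsub>M\<^esub>"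
    and eq: "(\<zero>\<^bsub>L\<^sub>1\<^esub>, b) = (\<Oplus>\<^bsub>M\<^esub>n\<in>A. c n)"
    using R.graded_sums_finsum[of "(\<zero>\<^bsub>L\<^sub>1\<^esub>, b)"] R.lie_span_graded_sums b unfolding S_def by blast
  have cM: "c n \<in> carrier M" for n by (rule R.graded_span_in[OF c(1)])
  have fst_in: "fst (c n) \<in> carrier L\<^sub>1" for n using cM[of n] by (cases "c n") auto
  have "fst (\<zero>\<^bsub>L\<^sub>1\<^esub>, b) = (\<Oplus>\<^bsub>L\<^sub>1\<^esub>n\<in>A. fst (c n))"
    unfolding eq by (rule linear_maps_finsum[OF M.complex_space_axioms P1.complex_space_axioms direct_sum_lie_projections(1) A cM])
  then have sum0: "(\<Oplus>\<^bsub>L\<^sub>1\<^esub>n\<in>A. fst (c n)) = \<zero>\<^bsub>L\<^sub>1\<^esub>" by simp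
  have "fst (c n) = \<zero>\<^bsub>L\<^sub>1\<^esub>" if "n \<in> A" for n
    by (rule eigenvectors_independent[OF P1.complex_space_axioms F_linear A inj_on_subset[OF powi_inj subset_UNIV]
          fst_in conjunct1[OF graded_span_eigen[OF c(1)]] sum0 that])
  then have fst0: "fst (c n) = \<zero>\<^bsub>L\<^sub>1\<^esub>" for n using c(2)[of n] by (cases "n \<in> A") auto
  have "snd (\<zero>\<^bsub>L\<^sub>1\<^esub>, b) = (\<Oplus>\<^bsub>L\<^sub>2\<^esub>n\<in>A. snd (c n))"
    unfolding eq by (rule linear_maps_finsum[OF M.complex_space_axioms P2.complex_space_axioms direct_sum_lie_projections(2) A cM])
  then have "component L\<^sub>2 G\<^sub>2 n b = snd (c n)"
    using P2.pr_finsum[OF A, of "\<lambda>n. snd (c n)" n] graded_span_eigen[OF c(1)] c(2) by simp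
  then have "c n = (\<zero>\<^bsub>L\<^sub>1\<^esub>, component L\<^sub>2 G\<^sub>2 n b)" using fst0[of n] by (cases "c n") simp
  then show ?thesis using c(1)[of n] by simp
qed

text \<open>\<open>i0\<close>, \<open>\<theta>\<close> and \<open>\<theta>'\<close> are injective,
  so the first coordinate determines the second.\<close>

lemma R_zero:
  assumes n: "n \<in> {-1, 0, 1}" and b: "(\<zero>\<^bsub>L\<^sub>1\<^esub>, b) \<in> R n"
  shows "b = \<zero>\<^bsub>L\<^sub>2\<^esub>"
proof -
  consider "n = -1" | "n = 0" | "n = 1" using n by blast
  then show ?thesis
  proof cases
    case 1
    then obtain w where w: "\<theta>' w = \<zero>\<^bsub>L\<^sub>1\<^esub>" "b = jm w" "w \<in> carrier W2" using b unfolding 1 R_simps by auto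
    then show ?thesis using \<theta>_inj(2)[OF w(3,1)] P2.i_zero(3) by (simp only:)
  next
    case 2
    then obtain a where a: "i0 a = \<zero>\<^bsub>L\<^sub>1\<^esub>" "b = j0 a" "a \<in> carrier (sl2_line h)" using b unfolding 2 R_simps by auto
    then have "a = 0" using P1.i_eq_zero(1)[OF line_in[OF yhx_in(2) a(3)]] by simp
    then show ?thesis using a(2) P2.i_zero(1) by simp
  next
    case 3
    then obtain v where v: "\<theta> v = \<zero>\<^bsub>L\<^sub>1\<^esub>" "b = j1 v" "v \<in> carrier V2" using b unfolding 3 R_simps by auto
    then show ?thesis using \<theta>_inj(1)[OF v(3,1)] P2.i_zero(2) by (simp only:)
  qed
qed

lemma lie_subalgebra_projections: "lie_subalgebra (fst ` S) L\<^sub>1" "lie_subalgebra (snd ` S) L\<^sub>2"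
proof -
  note SM = M.complex_space_submodule[OF S_submodule]
  have 1: "fst \<in> linear_maps (M\<lparr>carrier := S\<rparr>) L\<^sub>1" "snd \<in> linear_maps (M\<lparr>carrier := S\<rparr>) L\<^sub>2"
    using linear_mapsD[OF direct_sum_lie_projections(1)[of L\<^sub>1 L\<^sub>2]] linear_mapsD[OF direct_sum_lie_projections(2)[of L\<^sub>1 L\<^sub>2]]
      M.submodule_CD(1)[OF S_submodule] by (auto intro!: linear_mapsI)
  have "submodule (fst ` S) CC L\<^sub>1" "submodule (snd ` S) CC L\<^sub>2"
    using submodule_image[OF SM P1.complex_space_axioms 1(1)] submodule_image[OF SM P2.complex_space_axioms 1(2)] by simp_all
  moreover have "bracket L\<^sub>1 (fst a) (fst b) \<in> fst ` S \<and> bracket L\<^sub>2 (snd a) (snd b) \<in> snd ` S" if "a \<in> S" "b \<in> S" for a b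
    using S_bracket[OF that] by (cases a, cases b) force
  ultimately show "lie_subalgebra (fst ` S) L\<^sub>1" "lie_subalgebra (snd ` S) L\<^sub>2"
    unfolding lie_subalgebra_def by auto
qed

text \<open>The generators of \<open>S\<close> already project onto the local part of
  \<open>L\<^sub>2\<close>.\<close>

lemma snd_S: "snd ` S = carrier L\<^sub>2"
proof (rule P2.generated_by_components[OF lie_subalgebra_projections(2)])
  have S: "b \<in> snd ` S" if "(a, b) \<in> S" for a b using imageI[OF that, of snd] by simp
  show "G\<^sub>2 (-1) \<subseteq> snd ` S" unfolding P2.G_images using S[OF S_generators(3)] by blast
  show "G\<^sub>2 0 \<subseteq> snd ` S" unfolding P2.G_images using S[OF S_generators(1)] by blast
  show "G\<^sub>2 1 \<subseteq> snd ` S" unfolding P2.G_images using S[OF S_generators(2)] by blast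
qed

text \<open>A kernel element of local degree lies in the graded span of that degree, which is just
  \<open>R\<close>, and there the first coordinate determines the second.\<close>

lemma S_unique_zero:
  assumes "(\<zero>\<^bsub>L\<^sub>1\<^esub>, b) \<in> S"
  shows "b = \<zero>\<^bsub>L\<^sub>2\<^esub>"
proof -
  let ?I = "{b \<in> carrier L\<^sub>2. (\<zero>\<^bsub>L\<^sub>1\<^esub>, b) \<in> S}"
  note SD = M.submodule_CD[OF S_submodule]
  have SL: "b \<in> carrier L\<^sub>2" if "(a, b) \<in> S" for a b using SD(1)[OF that] by simp
  have "?I = {\<zero>\<^bsub>L\<^sub>2\<^esub>}"
  proof (rule minimal_graded_ideal_trivial[OF P2.minimal])
    show "submodule ?I CC L\<^sub>2"
    proof (rule P2.submodule_CI)
      show "\<zero>\<^bsub>L\<^sub>2\<^esub> \<in> ?I" using SD(2) by simp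
      show "a \<oplus>\<^bsub>L\<^sub>2\<^esub> b \<in> ?I" if "a \<in> ?I" "b \<in> ?I" for a b
        using SD(3)[of "(\<zero>\<^bsub>L\<^sub>1\<^esub>, a)" "(\<zero>\<^bsub>L\<^sub>1\<^esub>, b)"] that by simp
      show "c \<odot>\<^bsub>L\<^sub>2\<^esub> a \<in> ?I" if "a \<in> ?I" for a c
        using SD(4)[of "(\<zero>\<^bsub>L\<^sub>1\<^esub>, a)" c] that by simp
    qed auto
    show "bracket L\<^sub>2 d b \<in> ?I" if d: "d \<in> carrier L\<^sub>2" and b: "b \<in> ?I" for d b
    proof -
      \<comment> \<open>Surjectivity lifts \<open>d\<close> into \<open>S\<close>; bracketing the
        lift with a pair whose first coordinate is zero keeps that coordinate zero.\<close>
      have "d \<in> snd ` S" using d unfolding snd_S .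
      then obtain a where a: "(a, d) \<in> S" by auto
      then have "a \<in> carrier L\<^sub>1" using SD(1)[OF a] by simp
      then show ?thesis using S_bracket[OF a, of "(\<zero>\<^bsub>L\<^sub>1\<^esub>, b)"] b d by simp
    qed
    show "component L\<^sub>2 G\<^sub>2 n b \<in> ?I" if "b \<in> ?I" for n b
      using R.graded_span_lie_span[OF S_zero_component[of b n]] that SL unfolding S_def by blast
    show "b = \<zero>\<^bsub>L\<^sub>2\<^esub>" if n: "n \<in> {-1, 0, 1}" and b: "b \<in> ?I" "b \<in> G\<^sub>2 n" for n b
    proof -
      have "graded_span M R n (\<zero>\<^bsub>L\<^sub>1\<^esub>, b)" using S_zero_component[of b n] b P2.pr_same[OF b(2)] by simp
      then show ?thesis using R_zero[OF n] R.graded_span_local[OF _ n] by blast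
    qed
  qed
  then show ?thesis using assms SL by blast
qed

lemma S_unique:
  assumes "(a, b) \<in> S" "(a, b') \<in> S"
  shows "b = b'"
proof -
  note SD = M.submodule_CD[OF S_submodule]
  have in_L: "a \<in> carrier L\<^sub>1" "b \<in> carrier L\<^sub>2" "b' \<in> carrier L\<^sub>2" using SD(1)[OF assms(1)] SD(1)[OF assms(2)] by simp_all
  have "(a, b) \<oplus>\<^bsub>M\<^esub> (-1) \<odot>\<^bsub>M\<^esub> (a, b') \<in> S" using SD(3,4) assms by blast
  then have "(\<zero>\<^bsub>L\<^sub>1\<^esub>, b \<oplus>\<^bsub>L\<^sub>2\<^esub> (-1) \<odot>\<^bsub>L\<^sub>2\<^esub> b') \<in> S" using in_L by simp
  then show ?thesis using S_unique_zero P2.eq_iff_diff_zero[OF in_L(2,3)] by simp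
qed

section \<open>Generating the first local part from the generators of \<open>S\<close>\<close>

lemma i1_generated:
  assumes Z: "submodule Z CC L\<^sub>1" and low: "\<And>k. i1 (low k) \<in> Z"
    and x: "\<And>u. u \<in> carrier U \<Longrightarrow> i1 u \<in> Z \<Longrightarrow> bracket L\<^sub>1 (i0 x) (i1 u) \<in> Z"
  shows "G\<^sub>1 1 \<subseteq> Z"
proof -
  have "carrier U \<subseteq> {u \<in> carrier U. i1 u \<in> Z}"
    by (rule low_generates[OF submodule_vimage[OF U.complex_space_axioms P1.complex_space_axioms P1.i_linear(2) Z]])
      (use low x P1.bracket_01[of x] in auto)
  then show ?thesis by (auto simp: P1.G_images)
qed

lemma im_generated:
  assumes Z: "submodule Z CC L\<^sub>1" and top: "\<And>k. im (top k) \<in> Z"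
    and y: "\<And>u. u \<in> carrier U \<Longrightarrow> im u \<in> Z \<Longrightarrow> bracket L\<^sub>1 (i0 y) (im u) \<in> Z"
  shows "G\<^sub>1 (-1) \<subseteq> Z"
proof -
  have "carrier U \<subseteq> {u \<in> carrier U. im u \<in> Z}"
    by (rule top_generates[OF submodule_vimage[OF U.complex_space_axioms P1.complex_space_axioms P1.i_linear(3) Z]])
      (use top y P1.bracket_0m[of y] in auto)
  then show ?thesis by (auto simp: P1.G_images)
qed

lemma i0_generated:
  assumes Z: "submodule Z CC L\<^sub>1" and "i0 y \<in> Z" "i0 h \<in> Z" "i0 x \<in> Z"
  shows "G\<^sub>1 0 \<subseteq> Z"
proof -
  have "carrier sl2 \<subseteq> {a \<in> carrier sl2. i0 a \<in> Z}"
    by (rule sl2_span[OF submodule_vimage[OF sl2.complex_space_axioms P1.complex_space_axioms P1.i_linear(1) Z]])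
      (use assms in auto)
  then show ?thesis by (auto simp: P1.G_images)
qed

lemma S_basis:
  "(i0 h, j0 h) \<in> S" "(i0 x, j1 (x, \<lambda>p. 0)) \<in> S" "(i0 y, jm (y, \<lambda>p. 0)) \<in> S"
  "(i1 (low k), j1 (0, formal_vec (fst k) (snd k))) \<in> S" "(im (top k), jm (0, formal_vec (fst k) (snd k))) \<in> S"
  using S_generators(1)[of h] S_generators(2)[OF V2_basis_in(1)] S_generators(3)[OF W2_basis_in(1)]
    S_generators(2)[OF V2_basis_in(2)[of "fst k" "snd k"]] S_generators(3)[OF W2_basis_in(2)[of "fst k" "snd k"]]
  by (simp_all add: \<theta>_basis)

text \<open>Here the generators project to a proper part of the local part only: \<open>x\<close>
  raises the lowest weight vectors and \<open>y\<close> lowers the highest ones to reach the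
  rest.\<close>

lemma fst_S: "fst ` S = carrier L\<^sub>1"
proof (rule P1.generated_by_components[OF lie_subalgebra_projections(1)])
  have sub: "submodule (fst ` S) CC L\<^sub>1" and br: "\<And>a b. a \<in> fst ` S \<Longrightarrow> b \<in> fst ` S \<Longrightarrow> bracket L\<^sub>1 a b \<in> fst ` S"
    using lie_subalgebra_projections(1) unfolding lie_subalgebra_def by blast+
  have base: "i0 h \<in> fst ` S" "i0 x \<in> fst ` S" "i0 y \<in> fst ` S" "i1 (low k) \<in> fst ` S" "im (top k) \<in> fst ` S" for k
    using S_basis(1-3)[THEN imageI, of fst] S_basis(4,5)[of k, THEN imageI, of fst] by simp_all
  show "G\<^sub>1 (-1) \<subseteq> fst ` S" by (rule im_generated[OF sub base(5)]) (use br base in auto)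
  show "G\<^sub>1 0 \<subseteq> fst ` S" by (rule i0_generated[OF sub base(3,1,2)])
  show "G\<^sub>1 1 \<subseteq> fst ` S" by (rule i1_generated[OF sub base(4)]) (use br base in auto)
qed

section \<open>The homomorphism with graph \<open>S\<close>\<close>

definition \<phi> :: "'a \<Rightarrow> 'b" where "\<phi> a = (THE b. (a, b) \<in> S)"

lemma \<phi>_eq: "(a, b) \<in> S \<Longrightarrow> \<phi> a = b"
  unfolding \<phi>_def using S_unique by blast

lemma \<phi>_S: "a \<in> carrier L\<^sub>1 \<Longrightarrow> (a, \<phi> a) \<in> S"
proof -
  assume "a \<in> carrier L\<^sub>1"
  then have "a \<in> fst ` S" unfolding fst_S .
  then obtain b where "(a, b) \<in> S" by auto
  then show ?thesis using \<phi>_eq[of a b] by simp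
qed

lemma \<phi>_hom: "\<phi> \<in> lie_homs L\<^sub>1 L\<^sub>2"
proof -
  note SD = M.submodule_CD[OF S_submodule]
  have "\<phi> a \<in> carrier L\<^sub>2" if "a \<in> carrier L\<^sub>1" for a using SD(1)[OF \<phi>_S[OF that]] by simp
  moreover have "\<phi> (a \<oplus>\<^bsub>L\<^sub>1\<^esub> b) = \<phi> a \<oplus>\<^bsub>L\<^sub>2\<^esub> \<phi> b" "\<phi> (bracket L\<^sub>1 a b) = bracket L\<^sub>2 (\<phi> a) (\<phi> b)"
    if "a \<in> carrier L\<^sub>1" "b \<in> carrier L\<^sub>1" for a b
    using \<phi>_eq SD(3)[OF \<phi>_S[OF that(1)] \<phi>_S[OF that(2)]] S_bracket[OF \<phi>_S[OF that(1)] \<phi>_S[OF that(2)]] by simp_all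
  moreover have "\<phi> (c \<odot>\<^bsub>L\<^sub>1\<^esub> a) = c \<odot>\<^bsub>L\<^sub>2\<^esub> \<phi> a" if "a \<in> carrier L\<^sub>1" for a c
    using \<phi>_eq SD(4)[OF \<phi>_S[OF that], of c] by simp
  ultimately show ?thesis by (auto simp: lie_homs_def intro!: linear_mapsI)
qed

lemmas \<phi>_linear = CollectD[OF \<phi>_hom[unfolded lie_homs_def], THEN conjunct1]

lemma \<phi>_bracket: "a \<in> carrier L\<^sub>1 \<Longrightarrow> b \<in> carrier L\<^sub>1 \<Longrightarrow> \<phi> (bracket L\<^sub>1 a b) = bracket L\<^sub>2 (\<phi> a) (\<phi> b)"
  using \<phi>_hom by (simp add: lie_homs_def)

lemma \<phi>_in [simp]: "a \<in> carrier L\<^sub>1 \<Longrightarrow> \<phi> a \<in> carrier L\<^sub>2"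
  using linear_mapsD(1)[OF \<phi>_linear] .

lemma \<phi>_zero: "\<phi> \<zero>\<^bsub>L\<^sub>1\<^esub> = \<zero>\<^bsub>L\<^sub>2\<^esub>"
  using linear_maps_zero[OF P1.complex_space_axioms P2.complex_space_axioms \<phi>_linear] .

lemma \<phi>_surj: "\<phi> ` carrier L\<^sub>1 = carrier L\<^sub>2"
proof (intro equalityI subsetI)
  fix b assume "b \<in> carrier L\<^sub>2"
  then have "b \<in> snd ` S" unfolding snd_S .
  then obtain a where a: "(a, b) \<in> S" by auto
  then have "a \<in> carrier L\<^sub>1" using M.submodule_CD(1)[OF S_submodule a] by simp
  then show "b \<in> \<phi> ` carrier L\<^sub>1" using \<phi>_eq[OF a] by blast
qed auto

lemma \<phi>_basis:
  "\<phi> (i0 h) = j0 h" "\<phi> (i0 x) = j1 (x, \<lambda>p. 0)" "\<phi> (i0 y) = jm (y, \<lambda>p. 0)"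
  "\<phi> (i1 (low (i, j))) = j1 (0, formal_vec i j)" "\<phi> (im (top (i, j))) = jm (0, formal_vec i j)"
  using S_basis(1-3)[THEN \<phi>_eq] S_basis(4,5)[of "(i, j)", THEN \<phi>_eq] by simp_all

text \<open>Combinations of lowest or highest weight vectors go straight to the local part of
  \<open>L\<^sub>2\<close>, where injectivity is known. This settles the trivial summands
  below.\<close>

lemma \<phi>_E:
  assumes "f \<in> carrier formal_space"
  shows "\<phi> (i1 (E f)) = j1 (0, f)" "\<phi> (im (E' f)) = jm (0, f)"
  using \<phi>_eq[OF S_generators(2)[of "(0, f)"]] \<phi>_eq[OF S_generators(3)[of "(0, f)"]] assms
  by (simp_all add: \<theta>_def \<theta>'_def)

lemmas F'_linear = CollectD[OF F'(1)[unfolded lie_homs_def], THEN conjunct1]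

lemma F'_bracket: "a \<in> carrier L\<^sub>2 \<Longrightarrow> b \<in> carrier L\<^sub>2 \<Longrightarrow> F' (bracket L\<^sub>2 a b) = bracket L\<^sub>2 (F' a) (F' b)"
  using F'(1) by (simp add: lie_homs_def)

lemma F'_in [simp]: "b \<in> carrier L\<^sub>2 \<Longrightarrow> F' b \<in> carrier L\<^sub>2"
  using linear_mapsD(1)[OF F'_linear] .

text \<open>The sets \<open>Z c\<close> multiply under brackets. On the images of the generators
  \<open>F'\<close> has eigenvalue 1 in degree 0, 2 in degree 1 and 1/2 in degree -1, and brackets
  with \<open>x\<close> and \<open>y\<close>, of eigenvalue 1, extend this to the
  components.\<close>

lemma \<phi>_eigen:
  assumes a: "a \<in> G\<^sub>1 n"
  shows "F' (\<phi> a) = (2 powi n) \<odot>\<^bsub>L\<^sub>2\<^esub> \<phi> a"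
proof -
  define Z where "Z c = {a \<in> carrier L\<^sub>1. F' (\<phi> a) = c \<odot>\<^bsub>L\<^sub>2\<^esub> \<phi> a}" for c
  have Zsub: "submodule (Z c) CC L\<^sub>1" for c
    unfolding Z_def by (rule submodule_equalizer[OF P1.complex_space_axioms P2.complex_space_axioms
          linear_maps_comp[OF \<phi>_linear F'_linear] linear_maps_smult[OF P2.complex_space_axioms \<phi>_linear]])
  have Zbr: "bracket L\<^sub>1 a b \<in> Z (c * d)" if "a \<in> Z c" "b \<in> Z d" for a b c d
  proof -
    have ab: "a \<in> carrier L\<^sub>1" "b \<in> carrier L\<^sub>1" "F' (\<phi> a) = c \<odot>\<^bsub>L\<^sub>2\<^esub> \<phi> a" "F' (\<phi> b) = d \<odot>\<^bsub>L\<^sub>2\<^esub> \<phi> b"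
      using that by (auto simp: Z_def)
    have "F' (\<phi> (bracket L\<^sub>1 a b)) = bracket L\<^sub>2 (F' (\<phi> a)) (F' (\<phi> b))"
      using ab(1,2) by (simp add: \<phi>_bracket F'_bracket)
    also have "\<dots> = (c * d) \<odot>\<^bsub>L\<^sub>2\<^esub> \<phi> (bracket L\<^sub>1 a b)"
      unfolding ab(3,4) using ab(1,2)
      by (simp add: \<phi>_bracket P2.bracket_smult_left P2.bracket_smult_right mult.commute)
    finally show ?thesis using ab(1,2) by (simp add: Z_def)
  qed
  have base: "i0 h \<in> Z 1" "i0 x \<in> Z 1" "i0 y \<in> Z 1" "i1 (low k) \<in> Z 2" "im (top k) \<in> Z (1 / 2)" for k
    using F'(2)[of h] F'(3-) V2_basis_in W2_basis_in by (cases k; simp add: Z_def \<phi>_basis)+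
  have G1: "G\<^sub>1 1 \<subseteq> Z 2" by (rule i1_generated[OF Zsub base(4)]) (use Zbr[OF base(2)] in force)
  have Gm: "G\<^sub>1 (-1) \<subseteq> Z (1 / 2)" by (rule im_generated[OF Zsub base(5)]) (use Zbr[OF base(3)] in force)
  have G0: "G\<^sub>1 0 \<subseteq> Z 1" by (rule i0_generated[OF Zsub base(3,1,2)])
  have "a \<in> G\<^sub>1 n \<inter> Z (2 powi n)"
  proof (rule P1.graded_induct[OF _ _ _ _ a])
    show "submodule (G\<^sub>1 n \<inter> Z (2 powi n)) CC L\<^sub>1" for n
      using P1.submodule_CD[OF P1.summand] P1.submodule_CD[OF Zsub] by (intro P1.submodule_CI) auto
    show "bracket L\<^sub>1 a b \<in> G\<^sub>1 (n + m) \<inter> Z (2 powi (n + m))" if "a \<in> G\<^sub>1 n \<inter> Z (2 powi n)" "b \<in> G\<^sub>1 m \<inter> Z (2 powi m)" for n m a b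
      using that P1.bracket_graded Zbr by (simp add: power_int_add)
    show "G\<^sub>1 n \<subseteq> G\<^sub>1 n \<inter> Z (2 powi n)" if "n \<in> {-1, 0, 1}" for n
      using that G0 G1 Gm by (auto simp: power_int_minus inverse_eq_divide)
  qed auto
  then show ?thesis by (simp add: Z_def)
qed

text \<open>The kernel on \<open>sl2\<close> is an ideal, and simplicity is made explicit:
  bracketing twice with \<open>x\<close> isolates the coefficient of \<open>y\<close>, twice with
  \<open>y\<close> that of \<open>x\<close>, and the images of the basis are nonzero.\<close>

lemma \<phi>_i0:
  assumes z: "z \<in> carrier sl2" and 0: "\<phi> (i0 z) = \<zero>\<^bsub>L\<^sub>2\<^esub>"
  shows "z = \<zero>\<^bsub>sl2\<^esub>"
proof -
  have br: "\<phi> (i0 (bracket sl2 a b)) = \<zero>\<^bsub>L\<^sub>2\<^esub>"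
    if "a \<in> carrier sl2" "b \<in> carrier sl2" "\<phi> (i0 b) = \<zero>\<^bsub>L\<^sub>2\<^esub>" for a b
    using that P1.bracket_00[of a b] \<phi>_bracket[of "i0 a" "i0 b"] by simp
  have sm: "c = 0" if "\<phi> (i0 (c \<odot>\<^bsub>sl2\<^esub> a)) = \<zero>\<^bsub>L\<^sub>2\<^esub>" "\<phi> (i0 a) \<noteq> \<zero>\<^bsub>L\<^sub>2\<^esub>" "a \<in> carrier sl2" for c a
    using that linear_mapsD(3)[OF \<phi>_linear, of "i0 a" c] by (simp add: P1.i0_simps(3) P2.smult_eq_zero_iff)
  have nz: "y \<noteq> 0" "h \<noteq> 0" "x \<noteq> 0"
    using coord_basis coord_smult[OF yhx_in(1), of 0] sl2.smult_0_left[of y] by (metis mult_zero_left zero_neq_one sl2_simps(2) yhx_in(1))+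
  have nzx: "\<phi> (i0 x) \<noteq> \<zero>\<^bsub>L\<^sub>2\<^esub>" using \<phi>_basis(2) P2.i_eq_zero(2)[OF V2_basis_in(1)] nz by auto
  have nzy: "\<phi> (i0 y) \<noteq> \<zero>\<^bsub>L\<^sub>2\<^esub>" using \<phi>_basis(3) P2.i_eq_zero(3)[OF W2_basis_in(1)] nz by auto
  have nzh: "\<phi> (i0 h) \<noteq> \<zero>\<^bsub>L\<^sub>2\<^esub>" using \<phi>_basis(1) P2.i_eq_zero(1)[of h] nz by auto
  have "bracket sl2 x (bracket sl2 x z) = (- 2 * cy z) \<odot>\<^bsub>sl2\<^esub> x"
    by (rule sl2_eqI) (use z in \<open>simp_all add: coord_bracket coord_smult\<close>)
  then have cy: "cy z = 0" using sm[of "- 2 * cy z" x] br[OF _ _ br[OF _ z 0, of x], of x] z nzx by simp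
  have "bracket sl2 y (bracket sl2 y z) = (- 2 * cx z) \<odot>\<^bsub>sl2\<^esub> y"
    by (rule sl2_eqI) (use z in \<open>simp_all add: coord_bracket coord_smult\<close>)
  then have cx: "cx z = 0" using sm[of "- 2 * cx z" y] br[OF _ _ br[OF _ z 0, of y], of y] z nzy by simp
  \<comment> \<open>With the two outer coefficients gone, only a multiple of \<open>h\<close> is
    left.\<close>
  have zh: "z = ch z \<odot>\<^bsub>sl2\<^esub> h"
    by (rule sl2_eqI) (use z cx cy in \<open>simp_all add: coord_smult\<close>)
  then have "\<phi> (i0 (ch z \<odot>\<^bsub>sl2\<^esub> h)) = \<zero>\<^bsub>L\<^sub>2\<^esub>" using 0 by metis
  then have "ch z = 0" by (rule sm[OF _ nzh]) simp
  then have "z = 0 \<odot>\<^bsub>sl2\<^esub> h" using zh by metis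
  then show ?thesis using sl2.smult_0_left[of h] by simp
qed

lemma component_rho:
  assumes a: "a \<in> carrier sl2" and u: "u \<in> carrier U"
  shows "component U C k (\<rho> a u) = \<rho> a (component U C k u)"
proof (rule U.linear_maps_eqI[OF U.complex_space_axioms linear_maps_comp[OF rho_linear[OF a] U.pr_linear]
      linear_maps_comp[OF U.pr_linear rho_linear[OF a]] _ u])
  show "component U C k (\<rho> a v) = \<rho> a (component U C k v)" if v: "v \<in> C l" for l v
    using U.pr_eq[OF v, of k] U.pr_eq[OF C_rho[OF a v], of k] a by simp
qed

text \<open>Every component is killed by \<open>sl2\<close> as well, so it is nonzero only in a
  trivial summand, which is a line.\<close>

lemma killed_components:
  assumes u: "u \<in> carrier U" "\<And>a. a \<in> carrier sl2 \<Longrightarrow> \<rho> a u = \<zero>\<^bsub>U\<^esub>" and w: "\<And>k. w k \<in> C k" "\<And>k. w k \<noteq> \<zero>\<^bsub>U\<^esub>"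
  shows "\<exists>c. component U C k u = c \<odot>\<^bsub>U\<^esub> w k"
proof -
  have "\<rho> a (component U C k u) = \<zero>\<^bsub>U\<^esub>" if "a \<in> carrier sl2" for a
    using component_rho[OF that u(1), of k] u(2)[OF that] by simp
  then show ?thesis by (intro killed_multiple[OF U.pr_in[OF u(1)] _ _ _ w]) simp_all
qed

text \<open>Bracketing with \<open>im w\<close> moves the question to \<open>sl2\<close>, where
  injectivity is known; so \<open>P u w\<close> vanishes for all \<open>w\<close>, and by
  nondegeneracy \<open>sl2\<close> kills \<open>u\<close>.\<close>

lemma \<phi>_i1:
  assumes u: "u \<in> carrier U" and 0: "\<phi> (i1 u) = \<zero>\<^bsub>L\<^sub>2\<^esub>"
  shows "u = \<zero>\<^bsub>U\<^esub>"
proof -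
  have "P u w = \<zero>\<^bsub>sl2\<^esub>" if w: "w \<in> carrier U" for w
    using \<phi>_bracket[of "i1 u" "im w"] P1.bracket_1m[OF u w] u w 0 by (intro \<phi>_i0 P1.P_in) simp_all
  then have "p (\<rho> a u) w = 0" if "a \<in> carrier sl2" "w \<in> carrier U" for a w
    using P1.P[OF that(1) u that(2)] that linear_maps_zero[OF sl2.complex_space_axioms complex_space_scalar killing_form_linear] by simp
  then have "\<rho> a u = \<zero>\<^bsub>U\<^esub>" if "a \<in> carrier sl2" for a
    using that u by (intro p_nondegenerate(2)) auto
  \<comment> \<open>Being killed by \<open>sl2\<close>, \<open>u\<close> is a combination of lowest
    weight vectors, and its image is \<open>j1 (0, f)\<close>.\<close>
  then obtain f where f: "f \<in> carrier formal_space" "u = E f"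
    using E(4)[OF u] killed_components[OF u _ low_top_C(1) low_top_nonzero(1)] by blast
  have f2: "(0, f) \<in> carrier V2" using f(1) by simp
  then have "f = (\<lambda>p. 0)" using P2.i_eq_zero(2)[OF f2] \<phi>_E(1)[OF f(1)] 0 f(2) by simp
  then show ?thesis using f(2) by simp
qed

text \<open>Mirror image of \<open>\<phi>_i1\<close>, with the action moved to \<open>w\<close> by
  invariance.\<close>

lemma \<phi>_im:
  assumes w: "w \<in> carrier U" and 0: "\<phi> (im w) = \<zero>\<^bsub>L\<^sub>2\<^esub>"
  shows "w = \<zero>\<^bsub>U\<^esub>"
proof -
  have "P u w = \<zero>\<^bsub>sl2\<^esub>" if u: "u \<in> carrier U" for u
    using \<phi>_bracket[of "i1 u" "im w"] P1.bracket_1m[OF u w] u w 0 by (intro \<phi>_i0 P1.P_in) simp_all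
  then have "p u (\<rho> a w) = 0" if "a \<in> carrier sl2" "u \<in> carrier U" for a u
    using P1.P[OF that w] that p_invariant[OF that w]
      linear_maps_zero[OF sl2.complex_space_axioms complex_space_scalar killing_form_linear] by simp
  then have "\<rho> a w = \<zero>\<^bsub>U\<^esub>" if "a \<in> carrier sl2" for a
    using that w by (intro p_nondegenerate(1)) auto
  then obtain f where f: "f \<in> carrier formal_space" "w = E' f"
    using E'(4)[OF w] killed_components[OF w _ low_top_C(2) low_top_nonzero(2)] by blast
  have f2: "(0, f) \<in> carrier W2" using f(1) by simp
  then have "f = (\<lambda>p. 0)" using P2.i_eq_zero(3)[OF f2] \<phi>_E(2)[OF f(1)] 0 f(2) by simp
  then show ?thesis using f(2) by simp
qed

text \<open>The components of a kernel element have images with distinct eigenvalues of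
  \<open>F'\<close> and sum zero, so they lie in the kernel; in the local degrees the three
  preceding injectivity results apply.\<close>

lemma \<phi>_kernel: "{a \<in> carrier L\<^sub>1. \<phi> a = \<zero>\<^bsub>L\<^sub>2\<^esub>} = {\<zero>\<^bsub>L\<^sub>1\<^esub>}" (is "?I = _")
proof (rule minimal_graded_ideal_trivial[OF P1.minimal])
  show "submodule ?I CC L\<^sub>1"
    using linear_mapsD[OF \<phi>_linear] \<phi>_zero by (intro P1.submodule_CI) auto
  show "bracket L\<^sub>1 a b \<in> ?I" if "a \<in> carrier L\<^sub>1" "b \<in> ?I" for a b
    using that by (simp add: \<phi>_bracket)
  show "component L\<^sub>1 G\<^sub>1 n b \<in> ?I" if "b \<in> ?I" for n b
  proof -
    let ?A = "{n. component L\<^sub>1 G\<^sub>1 n b \<noteq> \<zero>\<^bsub>L\<^sub>1\<^esub>}"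
    have b: "b \<in> carrier L\<^sub>1" "\<phi> b = \<zero>\<^bsub>L\<^sub>2\<^esub>" using that by auto
    have fin: "finite ?A" by (rule P1.pr_finite[OF b(1)])
    have "\<phi> (\<Oplus>\<^bsub>L\<^sub>1\<^esub>n\<in>?A. component L\<^sub>1 G\<^sub>1 n b) = (\<Oplus>\<^bsub>L\<^sub>2\<^esub>n\<in>?A. \<phi> (component L\<^sub>1 G\<^sub>1 n b))"
      by (rule linear_maps_finsum[OF P1.complex_space_axioms P2.complex_space_axioms \<phi>_linear fin]) (use b in auto)
    then have sum0: "(\<Oplus>\<^bsub>L\<^sub>2\<^esub>n\<in>?A. \<phi> (component L\<^sub>1 G\<^sub>1 n b)) = \<zero>\<^bsub>L\<^sub>2\<^esub>"
      using P1.finsum_pr[OF b(1) fin] b(2) by simp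
    have "\<phi> (component L\<^sub>1 G\<^sub>1 n b) = \<zero>\<^bsub>L\<^sub>2\<^esub>" if "n \<in> ?A" for n
      by (rule eigenvectors_independent[OF P2.complex_space_axioms F'_linear fin inj_on_subset[OF powi_inj subset_UNIV]
            \<phi>_in[OF P1.pr_carrier[OF b(1)]] \<phi>_eigen[OF P1.pr_in[OF b(1)]] sum0 that])
    then show ?thesis using b \<phi>_zero by (cases "n \<in> ?A") auto
  qed
  show "b = \<zero>\<^bsub>L\<^sub>1\<^esub>" if n: "n \<in> {-1, 0, 1}" and b: "b \<in> ?I" "b \<in> G\<^sub>1 n" for n b
  proof -
    consider "n = -1" | "n = 0" | "n = 1" using n by blast
    then show ?thesis
    proof cases
      case 1
      then obtain w where "b = im w" "w \<in> carrier U" using b(2) P1.G_images by auto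
      then show ?thesis using \<phi>_im[of w] b(1) P1.i_zero by simp
    next
      case 2
      then obtain z where "b = i0 z" "z \<in> carrier sl2" using b(2) P1.G_images by auto
      then show ?thesis using \<phi>_i0[of z] b(1) by simp
    next
      case 3
      then obtain u where "b = i1 u" "u \<in> carrier U" using b(2) P1.G_images by auto
      then show ?thesis using \<phi>_i1[of u] b(1) P1.i_zero by simp
    qed
  qed
qed

lemma isomorphic: "lie_isomorphic L\<^sub>1 L\<^sub>2"
proof -
  have "inj_on \<phi> (carrier L\<^sub>1)"
  proof (rule inj_onI)
    fix a b assume ab: "a \<in> carrier L\<^sub>1" "b \<in> carrier L\<^sub>1" "\<phi> a = \<phi> b"
    then have "\<phi> (a \<oplus>\<^bsub>L\<^sub>1\<^esub> (-1) \<odot>\<^bsub>L\<^sub>1\<^esub> b) = \<zero>\<^bsub>L\<^sub>2\<^esub>" using linear_mapsD(2,3)[OF \<phi>_linear] by simp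
    then have "a \<oplus>\<^bsub>L\<^sub>1\<^esub> (-1) \<odot>\<^bsub>L\<^sub>1\<^esub> b \<in> {\<zero>\<^bsub>L\<^sub>1\<^esub>}" unfolding \<phi>_kernel[symmetric] using ab by simp
    then show "a = b" using P1.eq_iff_diff_zero[OF ab(1,2)] by simp
  qed
  then show ?thesis unfolding lie_isomorphic_def using \<phi>_hom \<phi>_surj by (auto simp: bij_betw_def)
qed

end

theorem proposition3p12:
  fixes y h x :: "complex^2^2"
    and U :: "(complex, 'u) module"
    and \<rho> :: "complex^2^2 \<Rightarrow> 'u \<Rightarrow> 'u"
    and C :: "nat \<times> nat \<Rightarrow> 'u set"
    and p :: "'u \<Rightarrow> 'u \<Rightarrow> complex"
    and q :: "(complex^2^2) \<times> (nat \<times> nat \<Rightarrow> complex) \<Rightarrow>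
              (complex^2^2) \<times> (nat \<times> nat \<Rightarrow> complex) \<Rightarrow> complex"
    and L\<^sub>1 :: "'a lie" and G\<^sub>1 :: "int \<Rightarrow> 'a set"
    and L\<^sub>2 :: "'b lie" and G\<^sub>2 :: "int \<Rightarrow> 'b set"
  assumes basis: "is_basis sl2 3 (\<lambda>i. [y, h, x] ! i)"
    and hy: "bracket sl2 h y = (-2) \<odot>\<^bsub>sl2\<^esub> y"
    and hx: "bracket sl2 h x = 2 \<odot>\<^bsub>sl2\<^esub> x"
    and xy: "bracket sl2 x y = h"
    and U: "fd_sum U \<rho> C"
    and p: "fd_pairing U \<rho> C p"
    and L1: "associated_lie_algebra sl2 \<rho> U (dual_image U U p) (killing_form sl2) L\<^sub>1 G\<^sub>1"
    and q: "q \<in> bilinear_maps (line_formal_space x) (line_formal_space y) scalar_space"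
    and q_x_e: "\<And>i j. q (x, \<zero>\<^bsub>formal_space\<^esub>) (\<zero>\<^bsub>sl2\<^esub>, formal_vec i j) = 0"
    and q_e_y: "\<And>i j. q (\<zero>\<^bsub>sl2\<^esub>, formal_vec i j) (y, \<zero>\<^bsub>formal_space\<^esub>) = 0"
    and q_x_y: "q (x, \<zero>\<^bsub>formal_space\<^esub>) (y, \<zero>\<^bsub>formal_space\<^esub>) = 4"
    and q_e_e: "\<And>i j k l. q (\<zero>\<^bsub>sl2\<^esub>, formal_vec i j) (\<zero>\<^bsub>sl2\<^esub>, formal_vec k l) =
      (if (i, j) = (k, l) then 4 else 0)"
    and L2: "associated_lie_algebra (sl2_line h) (direct_sum_action (bracket sl2) (rho_minus h))
      (line_formal_space x) (dual_image (line_formal_space x) (line_formal_space y) q)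
      (killing_form sl2) L\<^sub>2 G\<^sub>2"
  shows "lie_isomorphic L\<^sub>1 L\<^sub>2"
proof -
  have sl: "sl2_basis y h x"
    by (rule sl2_basis.intro[OF basis hy hx xy])
  interpret fd_module y h x U \<rho> C p
    by (rule fd_module.intro[OF sl fd_module_axioms.intro[OF U p]])
  interpret formal_pairing y h x q
    by (rule formal_pairing.intro[OF sl formal_pairing_axioms.intro[OF q q_x_e q_e_y q_x_y q_e_e]])
  obtain P i0 i1 im where P1: "pairing_algebra sl2 U U L\<^sub>1 G\<^sub>1 \<rho> \<rho> (killing_form sl2) p P i0 i1 im"
  proof (rule pairing_algebraI[where \<rho>' = \<rho>, OF L1 sl2.lie_algebra_axioms U.complex_space_axioms U.complex_space_axioms])
    show "b = \<zero>\<^bsub>sl2\<^esub>" if "b \<in> carrier sl2" "\<And>a. a \<in> carrier sl2 \<Longrightarrow> killing_form sl2 a b = 0" for b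
      by (rule killing_form_nondegenerate) fact+
    show "w = \<zero>\<^bsub>U\<^esub>" if "w \<in> carrier U" "\<And>v. v \<in> carrier U \<Longrightarrow> p v w = 0" for w
      by (rule p_nondegenerate(1)) fact+
  qed ((rule rho_in killing_form_linear p_bilinear p_invariant that; assumption)+)
  interpret P1: pairing_algebra sl2 U U L\<^sub>1 G\<^sub>1 \<rho> \<rho> "killing_form sl2" p P i0 i1 im by (rule P1)
  obtain Q j0 j1 jm where P2: "pairing_algebra (sl2_line h) V2 W2 L\<^sub>2 G\<^sub>2 \<rho>2 \<rho>2' (killing_form sl2) q Q j0 j1 jm"
  proof (rule pairing_algebraI[where \<rho>' = \<rho>2', OF L2 lie_algebra_line V2_space W2_space])
    show "b = \<zero>\<^bsub>sl2_line h\<^esub>"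
      if "b \<in> carrier (sl2_line h)" "\<And>a. a \<in> carrier (sl2_line h) \<Longrightarrow> killing_form sl2 a b = 0" for b
      by (rule killing_form_line_nondegenerate) fact+
    show "w = \<zero>\<^bsub>W2\<^esub>" if "w \<in> carrier W2" "\<And>v. v \<in> carrier V2 \<Longrightarrow> q v w = 0" for w
      by (rule q_nondegenerate) fact+
  qed ((rule linear_mapsD(1)[OF rho2_linear(1)] linear_mapsD(1)[OF rho2_linear(2)] killing_form_line q q_invariant that;
      assumption)+)
  interpret P2: pairing_algebra "sl2_line h" V2 W2 L\<^sub>2 G\<^sub>2 \<rho>2 \<rho>2' "killing_form sl2" q Q j0 j1 jm by (rule P2)
  obtain E where E: "E \<in> linear_maps formal_space U" "\<And>i j. E (formal_vec i j) = low (i, j)"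
    "\<And>f. f \<in> carrier formal_space \<Longrightarrow> E f = \<zero>\<^bsub>U\<^esub> \<Longrightarrow> f = (\<lambda>k. 0)"
    "\<And>u. u \<in> carrier U \<Longrightarrow> (\<forall>k. \<exists>c. component U C k u = c \<odot>\<^bsub>U\<^esub> low k) \<Longrightarrow>
      \<exists>f\<in>carrier formal_space. u = E f"
    by (rule formal_embedding[of low, OF low_top_C(1) low_top_nonzero(1)]) (rule that)
  obtain E' where E': "E' \<in> linear_maps formal_space U" "\<And>i j. E' (formal_vec i j) = top (i, j)"
    "\<And>f. f \<in> carrier formal_space \<Longrightarrow> E' f = \<zero>\<^bsub>U\<^esub> \<Longrightarrow> f = (\<lambda>k. 0)"
    "\<And>u. u \<in> carrier U \<Longrightarrow> (\<forall>k. \<exists>c. component U C k u = c \<odot>\<^bsub>U\<^esub> top k) \<Longrightarrow>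
      \<exists>f\<in>carrier formal_space. u = E' f"
    by (rule formal_embedding[of top, OF low_top_C(2) low_top_nonzero(2)]) (rule that)
  obtain \<sigma> \<tau> where st: "\<sigma> \<in> linear_isos U U" "\<tau> \<in> linear_isos U U"
    "\<And>a u. a \<in> carrier sl2 \<Longrightarrow> u \<in> carrier U \<Longrightarrow> \<sigma> (\<rho> a u) = \<rho> (scale a) (\<sigma> u)"
    "\<And>u w. u \<in> carrier U \<Longrightarrow> w \<in> carrier U \<Longrightarrow> p (\<sigma> u) (\<tau> w) = p u w"
    "\<And>k. \<sigma> (low k) = 2 \<odot>\<^bsub>U\<^esub> low k" "\<And>k. \<tau> (top k) = (1 / 2) \<odot>\<^bsub>U\<^esub> top k"
    by (rule scaling_operators) (rule that)
  \<comment> \<open>The second grading as seen on the first pentad.\<close>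
  obtain F where F: "F \<in> lie_homs L\<^sub>1 L\<^sub>1" "\<And>a. a \<in> carrier sl2 \<Longrightarrow> F (i0 a) = i0 (scale a)"
    "\<And>v. v \<in> carrier U \<Longrightarrow> F (i1 v) = i1 (\<sigma> v)" "\<And>w. w \<in> carrier U \<Longrightarrow> F (im w) = im (\<tau> w)"
    by (rule P1.automorphism[OF scale_iso _ _ st(1) _ st(2)])
      ((rule scale_bracket scale_killing_form st(3) st(4) that; assumption)+)
  have id: "(\<lambda>a. a) \<in> linear_isos (sl2_line h) (sl2_line h)"
    by (auto simp: linear_isos_def linear_maps_def bij_betw_def inj_on_def simp del: sl2_line_simps(1))
  \<comment> \<open>The first grading as seen on the second pentad: \<open>h\<close>,
    \<open>x\<close>, \<open>y\<close> have degree 0 and stay fixed, and only the formal parts are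
    scaled.\<close>
  obtain F' where F': "F' \<in> lie_homs L\<^sub>2 L\<^sub>2" "\<And>a. a \<in> carrier (sl2_line h) \<Longrightarrow> F' (j0 a) = j0 a"
    "\<And>v. v \<in> carrier V2 \<Longrightarrow> F' (j1 v) = j1 (rescale 2 v)" "\<And>w. w \<in> carrier W2 \<Longrightarrow> F' (jm w) = jm (rescale (1 / 2) w)"
    by (rule P2.automorphism[OF id refl refl rescale_iso[OF yhx_in(3)] _ rescale_iso[OF yhx_in(1)], of 2 "1 / 2"])
      (simp_all add: rescale_rho2 q_rescale that)
  interpret comparison y h x U \<rho> C p q L\<^sub>1 G\<^sub>1 P i0 i1 im L\<^sub>2 G\<^sub>2 Q j0 j1 jm E E' F F'
  proof (intro comparison.intro comparison_axioms.intro fd_module_axioms formal_pairing_axioms P1 P2 E(1,2,4) E'(1,2,4) F(1,2) F'(1,2))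
    show "f = (\<lambda>k. 0)" if "f \<in> carrier formal_space" "E f = \<zero>\<^bsub>U\<^esub>" for f by (rule E(3)[OF that])
    show "f = (\<lambda>k. 0)" if "f \<in> carrier formal_space" "E' f = \<zero>\<^bsub>U\<^esub>" for f by (rule E'(3)[OF that])
    show "F (i1 (low k)) = 2 \<odot>\<^bsub>L\<^sub>1\<^esub> i1 (low k)" "F (im (top k)) = (1 / 2) \<odot>\<^bsub>L\<^sub>1\<^esub> im (top k)" for k
      using F(3,4) st(5,6) P1.i1_simps(3) P1.im_simps(3) by simp_all
    show "F' (j1 (x, \<lambda>p. 0)) = j1 (x, \<lambda>p. 0)" "F' (jm (y, \<lambda>p. 0)) = jm (y, \<lambda>p. 0)"
      using F'(3)[OF V2_basis_in(1)] F'(4)[OF W2_basis_in(1)] by (simp_all only: rescale_basis(1))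
    show "F' (j1 (0, formal_vec i j)) = 2 \<odot>\<^bsub>L\<^sub>2\<^esub> j1 (0, formal_vec i j)"
      "F' (jm (0, formal_vec i j)) = (1 / 2) \<odot>\<^bsub>L\<^sub>2\<^esub> jm (0, formal_vec i j)" for i j
      unfolding F'(3)[OF V2_basis_in(2)] F'(4)[OF W2_basis_in(2)] rescale_basis(2)[where z = x and c = 2]
        rescale_basis(2)[where z = y and c = "1 / 2"]
      by (rule P2.i1_simps(3)[OF V2_basis_in(2)] P2.im_simps(3)[OF W2_basis_in(2)])+
  qed
  show ?thesis by (rule isomorphic)
qed

end
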